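(* Let $\beta,\eta\ge0$. The min-plus product of an $n\times n^\beta$ matrix $A$ and an $n^\beta\times n$ monotone matrix $B$ with total range $O(n^{\beta+\eta})$ can be deterministically computed, for any $\theta\in[0,\eta]$, in time \[ \tilde{O}\bigl(n^{\max\{1+\beta+\eta-\theta,\ \frac12(2+\beta+g(1,\beta,1,\theta))\}}\bigr). \] In other words, \[ m(1,\beta,1,\eta)\le\min_{0\le\theta\le\eta}\max\{1+\beta+\eta-\theta,\ \tfrac12(2+\beta+g(1,\beta,1,\theta))\}. \]
   Context: The min-plus product is $(A\star B)_{i,j}=\min_k\{A_{i,k}+B_{k,j}\}$. An $n^\beta\times n^\gamma$ matrix $B$ is monotone if for every row $k$, $B_{k,j}$ is non-decreasing in $j$; its total range is $\sum_{k\in[n^\beta]}(\max_{j\in[n^\gamma],B_{k,j}\ne\infty}B_{k,j}-B_{k,1}+1)$. For non-negative reals $\alpha,\beta,\gamma,\theta$, $g(\alpha,\beta,\gamma,\theta)$ is the smallest number such that the min-plus product of an $n^\alpha\times n^\beta$ matrix with entries in $\{-n^\theta,\ldots,n^\theta\}\cup\{\infty\}$ by an arbitrary $n^\beta\times n^\gamma$ matrix can be computed in $\tilde{O}(n^{g(\alpha,\beta,\gamma,\theta)})$ time. For non-negative reals $\alpha,\beta,\gamma,\eta$, $m(\alpha,\beta,\gamma,\eta)$ is the smallest number such that the min-plus product of an arbitrary $n^\alpha\times n^\beta$ matrix $A$ and an $n^\beta\times n^\gamma$ monotone matrix $B$ with total range $O(n^{\beta+\eta})$ can be computed in $\tilde{O}(n^{m(\alpha,\beta,\gamma,\eta)})$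 time. $\tilde{O}$ hides subpolynomial factors; the model is the word RAM with $O(\log n)$-bit words and entries are $\mathrm{polylog}(n)$-bit integers or $\infty$. *)

theory Defs
  imports
    "HOL-Analysis.Analysis"
    "HOL-Library.Extended"
    "HOL-Library.Log_Nat"
    "Jordan_Normal_Form.Matrix"
begin

text \<open>
  Word RAM with word length \<open>w\<close>: registers and one memory, all holding words, i.e. numbers
  below \<open>2 ^ w\<close>; arithmetic is modulo \<open>2 ^ w\<close>. Programs are structured (a jump costs only a
  constant factor), every executed instruction and every evaluated test takes one time unit.
\<close>

datatype binop = Add | Sub | Mul | Div | Mod | And | Or | Xor | Shl | Shr | Less | Equal

type_synonym reg = nat

datatype prog =
    Const reg nat
  | Op binop reg reg reg
  | Load reg reg
  | Store reg reg
  | Seq prog prog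
  | IfNZ reg prog prog
  | WhileNZ reg prog

record ram =
  regs :: "reg \<Rightarrow> nat"
  mem :: "nat \<Rightarrow> nat"

context
  includes bit_operations_syntax
begin

fun binop_int :: "binop \<Rightarrow> nat \<Rightarrow> nat \<Rightarrow> int" where
  "binop_int Add x y = int x + int y"
| "binop_int Sub x y = int x - int y"
| "binop_int Mul x y = int x * int y"
| "binop_int Div x y = int (x div y)"
| "binop_int Mod x y = int (x mod y)"
| "binop_int And x y = int (x AND y)"
| "binop_int Or x y = int (x OR y)"
| "binop_int Xor x y = int (x XOR y)"
| "binop_int Shl x y = int (push_bit y x)"
| "binop_int Shr x y = int (drop_bit y x)"
| "binop_int Less x y = (if x < y then 1 else 0)"
| "binop_int Equal x y = (if x = y then 1 else 0)"

end

definition binop_word :: "nat \<Rightarrow> binop \<Rightarrow> nat \<Rightarrow> nat \<Rightarrow> nat" where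
  "binop_word w f x y = nat (binop_int f x y mod 2 ^ w)"

text \<open>\<open>exec w P s t s'\<close>: started in \<open>s\<close>, the program \<open>P\<close> halts in \<open>s'\<close> after exactly \<open>t\<close> steps.\<close>

inductive exec :: "nat \<Rightarrow> prog \<Rightarrow> ram \<Rightarrow> nat \<Rightarrow> ram \<Rightarrow> bool" for w :: nat where
  Const: "exec w (Const r k) s 1 (s\<lparr>regs := (regs s)(r := k mod 2 ^ w)\<rparr>)"
| Op: "exec w (Op f r a b) s 1 (s\<lparr>regs := (regs s)(r := binop_word w f (regs s a) (regs s b))\<rparr>)"
| Load: "exec w (Load r a) s 1 (s\<lparr>regs := (regs s)(r := mem s (regs s a))\<rparr>)"
| Store: "exec w (Store a r) s 1 (s\<lparr>mem := (mem s)(regs s a := regs s r)\<rparr>)"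
| Seq: "exec w P s t s' \<Longrightarrow> exec w Q s' u s'' \<Longrightarrow> exec w (Seq P Q) s (t + u) s''"
| IfTrue: "regs s r \<noteq> 0 \<Longrightarrow> exec w P s t s' \<Longrightarrow> exec w (IfNZ r P Q) s (1 + t) s'"
| IfFalse: "regs s r = 0 \<Longrightarrow> exec w Q s t s' \<Longrightarrow> exec w (IfNZ r P Q) s (1 + t) s'"
| WhileFalse: "regs s r = 0 \<Longrightarrow> exec w (WhileNZ r P) s 1 s"
| WhileTrue: "regs s r \<noteq> 0 \<Longrightarrow> exec w P s t s' \<Longrightarrow> exec w (WhileNZ r P) s' u s''
    \<Longrightarrow> exec w (WhileNZ r P) s (1 + t + u) s''"

inductive_cases exec_ConstE: "exec w (Const r k) s t s'"
inductive_cases exec_OpE: "exec w (Op f r a b) s t s'"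
inductive_cases exec_LoadE: "exec w (Load r a) s t s'"
inductive_cases exec_StoreE: "exec w (Store a r) s t s'"
inductive_cases exec_SeqE: "exec w (Seq P Q) s t s'"
inductive_cases exec_IfNZE: "exec w (IfNZ r P Q) s t s'"
inductive_cases exec_WhileNZE: "exec w (WhileNZ r P) s t s'"

lemma exec_deterministic:
  "exec w P s t s' \<Longrightarrow> exec w P s u s'' \<Longrightarrow> t = u \<and> s' = s''"
proof (induction arbitrary: u s'' rule: exec.induct)
  case (Const r k s)
  then show ?case by (rule exec_ConstE) simp
next
  case (Op f r a b s)
  then show ?case by (rule exec_OpE) simp
next
  case (Load r a s)
  then show ?case by (rule exec_LoadE) simp
next
  case (Store a r s)
  then show ?case by (rule exec_StoreE) simp
next
  case (Seq P s t s' Q v s3)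
  from Seq.prems show ?case by (rule exec_SeqE) (metis Seq.IH)
next
  case (IfTrue s r P t s' Q)
  from IfTrue.prems show ?case by (rule exec_IfNZE) (use IfTrue.hyps(1) in \<open>auto dest: IfTrue.IH\<close>)
next
  case (IfFalse s r Q t s' P)
  from IfFalse.prems show ?case by (rule exec_IfNZE) (use IfFalse.hyps(1) in \<open>auto dest: IfFalse.IH\<close>)
next
  case (WhileFalse s r P)
  from WhileFalse.prems show ?case by (rule exec_WhileNZE) (use WhileFalse.hyps in auto)
next
  case (WhileTrue s r P t s' v s3)
  from WhileTrue.prems show ?case
    by (rule exec_WhileNZE) (use WhileTrue.hyps(1) in \<open>auto dest!: WhileTrue.IH\<close>)
qed

text \<open>
  The input occupies the memory from address 0 on, and so does the output at the end. Nothing is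
  assumed about the initial contents of the registers and of the other memory cells. The first two
  conjuncts say that words are long enough to hold and to address the input.
\<close>

definition computes_within ::
  "nat \<Rightarrow> prog \<Rightarrow> nat list \<Rightarrow> nat list \<Rightarrow> real \<Rightarrow> bool" where
  "computes_within w P xs ys T \<longleftrightarrow>
     (\<forall>x\<in>set xs. x < 2 ^ w) \<and> length xs \<le> 2 ^ w \<and>
     (\<forall>s. (\<forall>r. regs s r < 2 ^ w) \<and> (\<forall>a. mem s a < 2 ^ w) \<and> (\<forall>i<length xs. mem s i = xs ! i) \<longrightarrow>
        (\<exists>t s'. exec w P s t s' \<and> real t \<le> T \<and> (\<forall>i<length ys. mem s' i = ys ! i)))"

text \<open>
  A problem gives for each \<open>n\<close> the set of pairs of an instance and its solution. Words have
  \<open>c * floorlog 2 n\<close> bits, where \<open>floorlog 2 n\<close> is the bit length of \<open>n\<close>. As usual for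
  exponents, time \<open>n ^ e\<close> up to subpolynomial factors means: for every \<open>\<epsilon> > 0\<close> there is an
  algorithm with running time \<open>O(n ^ (e + \<epsilon>))\<close>. With this reading the set of feasible
  exponents is closed, so that there is a smallest one.
\<close>

type_synonym problem = "nat \<Rightarrow> (nat list \<times> nat list) set"

definition soft_O_time :: "problem \<Rightarrow> real \<Rightarrow> bool" where
  "soft_O_time prob e \<longleftrightarrow>
     (\<forall>\<epsilon>>0. \<exists>P c K. \<forall>n\<ge>1. \<forall>(xs, ys)\<in>prob n.
        computes_within (c * floorlog 2 n) P xs ys (K * real n powr (e + \<epsilon>)))"

type_synonym matrix = "int extended mat"

definition min_plus :: "matrix \<Rightarrow> matrix \<Rightarrow> matrix" where
  "min_plus A B = mat (dim_row A) (dim_col B)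
     (\<lambda>(i, j). Min ((\<lambda>k. A $$ (i, k) + B $$ (k, j)) ` {..<dim_col A}))"

definition monotone_mat :: "matrix \<Rightarrow> bool" where
  "monotone_mat B \<longleftrightarrow>
     (\<forall>k<dim_row B. \<forall>j<dim_col B. \<forall>j'<dim_col B. j \<le> j' \<longrightarrow> B $$ (k, j) \<le> B $$ (k, j'))"

text \<open>A row of a monotone matrix that starts with \<open>Pinf\<close> has no finite entry; it counts 0.\<close>

definition total_range :: "matrix \<Rightarrow> int" where
  "total_range B = (\<Sum>k<dim_row B. case B $$ (k, 0) of
       Fin b \<Rightarrow> Max {z. \<exists>j<dim_col B. B $$ (k, j) = Fin z} - b + 1
     | _ \<Rightarrow> 0)"

text \<open>
  Every polylogarithmic bound on bit lengths is at most \<open>entry_bits d\<close> for some \<open>d\<close>. An entry is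
  stored as a tag followed by the digits of its absolute value in base \<open>2 ^ floorlog 2 n\<close>, least
  significant digit first, one digit per word. The number of digits leaves room for sums of two
  entries.
\<close>

definition entry_bits :: "nat \<Rightarrow> nat \<Rightarrow> nat" where
  "entry_bits d n = d * floorlog 2 n ^ d"

definition valid_entries :: "nat \<Rightarrow> nat \<Rightarrow> matrix \<Rightarrow> bool" where
  "valid_entries d n A \<longleftrightarrow>
     (\<forall>x\<in>elements_mat A. x = Pinf \<or> (\<exists>z. x = Fin z \<and> \<bar>z\<bar> < 2 ^ entry_bits d n))"

definition encode_entry :: "nat \<Rightarrow> nat \<Rightarrow> int extended \<Rightarrow> nat list" where
  "encode_entry d n x = (let b = floorlog 2 n; l = entry_bits d n + 1 in case x of
       Fin z \<Rightarrow> (if z < 0 then 1 else 0) #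
                map (\<lambda>i. nat \<bar>z\<bar> div 2 ^ (b * i) mod 2 ^ b) [0..<l]
     | _ \<Rightarrow> 2 # replicate l 0)"

definition encode_mat :: "nat \<Rightarrow> nat \<Rightarrow> matrix \<Rightarrow> nat list" where
  "encode_mat d n A =
     concat [encode_entry d n (A $$ (i, j)). i \<leftarrow> [0..<dim_row A], j \<leftarrow> [0..<dim_col A]]"

text \<open>
  The dimensions are part of the input since \<open>n powr \<beta>\<close> need not be computable from \<open>n\<close>.
\<close>

definition encode_instance :: "nat \<Rightarrow> nat \<Rightarrow> matrix \<Rightarrow> matrix \<Rightarrow> nat list" where
  "encode_instance d n A B =
     [n, dim_row A, dim_col A, dim_col B] @ encode_mat d n A @ encode_mat d n B"

definition min_plus_problem ::
  "real \<Rightarrow> real \<Rightarrow> real \<Rightarrow> (nat \<Rightarrow> matrix \<Rightarrow> matrix \<Rightarrow> bool) \<Rightarrow> nat \<Rightarrow> problem" where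
  "min_plus_problem \<alpha> \<beta> \<gamma> \<Phi> d n =
     {(encode_instance d n A B, encode_mat d n (min_plus A B)) | A B.
        A \<in> carrier_mat (nat \<lfloor>real n powr \<alpha>\<rfloor>) (nat \<lfloor>real n powr \<beta>\<rfloor>) \<and>
        B \<in> carrier_mat (nat \<lfloor>real n powr \<beta>\<rfloor>) (nat \<lfloor>real n powr \<gamma>\<rfloor>) \<and>
        valid_entries d n A \<and> valid_entries d n B \<and> \<Phi> n A B}"

definition bounded_product_in_time :: "real \<Rightarrow> real \<Rightarrow> real \<Rightarrow> real \<Rightarrow> real \<Rightarrow> bool" where
  "bounded_product_in_time \<alpha> \<beta> \<gamma> \<theta> e \<longleftrightarrow>
     (\<forall>d. soft_O_time (min_plus_problem \<alpha> \<beta> \<gamma>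
        (\<lambda>n A B. \<forall>x\<in>elements_mat A. x = Pinf \<or> (\<exists>z. x = Fin z \<and> \<bar>real_of_int z\<bar> \<le> real n powr \<theta>))
        d) e)"

definition monotone_product_in_time :: "real \<Rightarrow> real \<Rightarrow> real \<Rightarrow> real \<Rightarrow> real \<Rightarrow> bool" where
  "monotone_product_in_time \<alpha> \<beta> \<gamma> \<eta> e \<longleftrightarrow>
     (\<forall>d C. soft_O_time (min_plus_problem \<alpha> \<beta> \<gamma>
        (\<lambda>n A B. monotone_mat B \<and> real_of_int (total_range B) \<le> C * real n powr (\<beta> + \<eta>))
        d) e)"

definition g_exp :: "real \<Rightarrow> real \<Rightarrow> real \<Rightarrow> real \<Rightarrow> real" where
  "g_exp \<alpha> \<beta> \<gamma> \<theta> = Inf {e. bounded_product_in_time \<alpha> \<beta> \<gamma> \<theta> e}"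

definition m_exp :: "real \<Rightarrow> real \<Rightarrow> real \<Rightarrow> real \<Rightarrow> real" where
  "m_exp \<alpha> \<beta> \<gamma> \<eta> = Inf {e. monotone_product_in_time \<alpha> \<beta> \<gamma> \<eta> e}"

end

theory Submission
  imports Defs
begin

text \<open>
  Round every row of \<open>B\<close> down to a step function with jumps at least \<open>\<Delta> \<approx> n powr \<theta>\<close>; the bound on
  the total range leaves about \<open>n powr (\<beta> + \<eta> - \<theta>)\<close> pieces, so the rounded product \<open>C'\<close> is cheap
  and satisfies \<open>C' \<le> C < C' + \<Delta>\<close>. Only triples \<open>(i, k, j)\<close> whose rounded sum lies below
  \<open>C' + \<Delta>\<close> can be optimal. Call \<open>(i, k)\<close> alive at column \<open>j\<close> if it is such a triple. While some
  column has at least a \<open>1 / \<rho>\<close> fraction of all pairs alive and not yet covered, normalise \<open>A\<close> and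
  \<open>B\<close> at this column: the alive entries of \<open>A\<close> fall into \<open>{0..<\<Delta>}\<close>, so one product with small
  entries covers all these pairs for all columns. This happens at most \<open>\<rho>\<close> times, and the
  remaining alive triples number at most \<open>n powr (2 + \<beta>) / \<rho>\<close> and are enumerated. Choosing
  \<open>\<rho> \<approx> n powr ((2 + \<beta> - g) / 2)\<close> balances both costs; \<open>g \<le> 2 + \<beta>\<close> holds by brute force, and
  \<open>g \<ge> max (1 + \<beta>) 2\<close> because a correct program must read the input and write the output.

  The algorithm is a concrete word RAM program. Stores with variables, word arrays and arrays of
  long integers abstract from the memory layout, and \<open>runs\<close> is a weakest precondition for them
  with a ghost clock. The given program for small entries has its own word length and expects its
  input at address 0; it is emulated on every 24th memory cell, all its values being reduced to
  its word length.
\<close>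

section \<open>Programs as transformers of abstract stores\<close>

text \<open>Counting the alive uncovered pairs of a column must not cost time per triple. On one
  piece of row \<open>k\<close> the rounded sum is constant while C' is non-decreasing, so the alive
  columns form a final segment of the piece; binary search finds its start, and prefix sums over
  arrays of segment starts and ends give the counts. Pivoting only removes pairs, so a column once
  sparse stays sparse and one sweep over the columns suffices. Initial registers and memory are
  arbitrary. Every abstract read is reduced modulo \<open>N\<close>, and digits modulo
  \<open>2 ^ b\<close>, so that any content denotes a legal store. A program has no access to real
  exponents. With \<open>b\<close> the bit length of \<open>n\<close>,
  \<open>n powr \<theta>\<close> is replaced by \<open>2 ^ ((b - 1) * pp div qq)\<close> for a
  rational \<open>pp / qq\<close> just below \<open>\<theta>\<close>, which costs an arbitrarily
  small power of \<open>n\<close>. Infinity is coded by a finite number above every sum of two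
  finite codes, so the rounding works with natural numbers only and infinity costs at most one extra
  piece per row.\<close>

record store =
 vr :: "nat => nat"
 wa :: "nat => nat => nat"
 za :: "nat => nat => nat"
 tm :: nat

definition bounded_ram :: "nat => ram => bool" where
 "bounded_ram w s \<longleftrightarrow> (ALL r. regs s r < 2 ^ w) & (ALL a. mem s a < 2 ^ w)"

lemma binop_word_less: "binop_word w f x y < 2 ^ w"
proof -
 have "binop_int f x y mod 2 ^ w < 2 ^ w" "0 <= binop_int f x y mod 2 ^ w" by simp_all
 then show ?thesis unfolding binop_word_def
  by (metis nat_less_numeral_power_cancel_iff)
qed

lemma exec_bounded_ram: "exec w P s t s' ==> bounded_ram w s ==> bounded_ram w s'"
 by (induction rule: exec.induct) (auto simp: bounded_ram_def binop_word_less)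

text \<open>The machine is deterministic, so this existential is the exact weakest precondition of a
  program, and for single instructions it becomes an equation usable for rewriting.\<close>

definition outcome :: "nat => prog => ram => (nat => ram => bool) => bool" where
 "outcome w P s Q \<longleftrightarrow> (\<exists>t s'. exec w P s t s' & Q t s')"

lemma outcome_Const [simp]: "outcome w (Const r k) s Q = Q 1 (s(|regs := (regs s)(r := k mod 2 ^ w)|))"
 unfolding outcome_def by (metis exec.Const exec_deterministic)

lemma outcome_Op [simp]: "outcome w (Op f r a b) s Q =
  Q 1 (s(|regs := (regs s)(r := binop_word w f (regs s a) (regs s b))|))"
 unfolding outcome_def by (metis exec.Op exec_deterministic)

lemma outcome_Load [simp]: "outcome w (Load r a) s Q = Q 1 (s(|regs := (regs s)(r := mem s (regs s a))|))"
 unfolding outcome_def by (metis exec.Load exec_deterministic)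

lemma outcome_Store [simp]: "outcome w (Store a r) s Q = Q 1 (s(|mem := (mem s)(regs s a := regs s r)|))"
 unfolding outcome_def by (metis exec.Store exec_deterministic)

lemma outcome_Seq: "outcome w (Seq P P') s Q = outcome w P s (%t s'. outcome w P' s' (%u. Q (t + u)))"
 by (auto simp: outcome_def elim!: exec_SeqE) (meson exec.Seq)

lemma outcome_mono: "outcome w P s Q ==> (!!t s'. exec w P s t s' ==> Q t s' ==> Q' t s') ==> outcome w P s Q'"
 by (auto simp: outcome_def)

text \<open>One abstract tick pays for at most \<open>U\<close> machine steps. The final store is
  existentially quantified, so a rule may choose any store that represents the final machine state,
  in particular the reading of its clock.\<close>

definition runs :: "nat => nat => (ram => store => bool) => prog => store => (store => bool) => bool" where
 "runs w U R P sg Q \<longleftrightarrow> (ALL s. R s sg -->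
   (\<exists>t s' sg'. exec w P s t s' & R s' sg' & t + U * tm sg <= U * tm sg' & Q sg'))"

lemma runsI:
 assumes "!!s. R s sg ==> \<exists>t s' sg'. exec w P s t s' & R s' sg' & t + U * tm sg <= U * tm sg' & Q sg'"
 shows "runs w U R P sg Q"
 using assms by (auto simp: runs_def)

lemma runs_seq:
 assumes "runs w U R P sg (%sg'. runs w U R P' sg' Q)"
 shows "runs w U R (Seq P P') sg Q"
proof (rule runsI)
 fix s assume "R s sg"
 then obtain t s' sg' where 1: "exec w P s t s'" "R s' sg'" "t + U * tm sg <= U * tm sg'" "runs w U R P' sg' Q"
  using assms by (auto simp: runs_def)
 then obtain u s'' sg'' where 2: "exec w P' s' u s''" "R s'' sg''" "u + U * tm sg' <= U * tm sg''" "Q sg''"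
  by (auto simp: runs_def)
 from 1 2 show "\<exists>t s' sg'. exec w (Seq P P') s t s' & R s' sg' & t + U * tm sg <= U * tm sg' & Q sg'"
  by (intro exI[of _ "t + u"] exI[of _ s''] exI[of _ sg'']) (auto intro: exec.Seq)
qed

lemma runs_conseq: "runs w U R P sg Q ==> (!!sg'. Q sg' ==> Q' sg') ==> runs w U R P sg Q'"
 unfolding runs_def by meson

lemma exec_exI: "exec w P s t s' ==> Q t s' ==> \<exists>t s'. exec w P s t s' & Q t s'"
 by blast

lemma exec_exI3: "exec w P s t s' ==> Q t s' sg ==> \<exists>t s' sg'. exec w P s t s' & Q t s' sg'"
 by blast

section \<open>Arithmetic expressions and their compilation to word operations\<close>

datatype aexp = Num nat | Var nat | Bin binop aexp aexp | Arr nat aexp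

fun evop :: "binop => nat => nat => nat" where
 "evop Add x y = x + y"
| "evop Sub x y = x - y"
| "evop Mul x y = x * y"
| "evop Div x y = x div y"
| "evop Mod x y = x mod y"
| "evop Less x y = (if x < y then 1 else 0)"
| "evop Equal x y = (if x = y then 1 else 0)"
| "evop _ x y = 0"

fun eval :: "store => aexp => nat" where
 "eval sg (Num k) = k"
| "eval sg (Var x) = vr sg x"
| "eval sg (Bin f a b) = evop f (eval sg a) (eval sg b)"
| "eval sg (Arr a e) = wa sg a (eval sg e)"

text \<open>If all variables and array cells are below \<open>N\<close>, then the value of \<open>e\<close> is below \<open>N ^ deg e\<close>.\<close>

fun deg :: "aexp => nat" where
 "deg (Num k) = 1"
| "deg (Var x) = 1"
| "deg (Bin f a b) = (case f of Add => max (deg a) (deg b) + 1 | Mul => deg a + deg b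
   | Less => 1 | Equal => 1 | _ => deg a)"
| "deg (Arr a e) = 1"

text \<open>Literals below 128 are below \<open>N\<close>. Degree at most 8 keeps intermediate
  values below \<open>N ^ 8\<close> and the address \<open>M * i + a\<close> below
  \<open>N ^ 9\<close>, so that word arithmetic never wraps when
  \<open>N ^ 10 <= 2 ^ w\<close>.\<close>

fun okx :: "nat => aexp => bool" where
 "okx M (Num k) \<longleftrightarrow> k < 128"
| "okx M (Var x) \<longleftrightarrow> True"
| "okx M (Bin f a b) \<longleftrightarrow> okx M a & okx M b & deg (Bin f a b) <= 8 &
   (f = Add \<or> f = Sub \<or> f = Mul \<or> f = Div \<or> f = Mod \<or> f = Less \<or> f = Equal)"
| "okx M (Arr a e) \<longleftrightarrow> okx M e & a < M"

fun esz :: "aexp => nat" where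
 "esz (Num k) = 1"
| "esz (Var x) = 1"
| "esz (Bin f a b) = esz a + esz b + 5"
| "esz (Arr a e) = esz e + 6"

text \<open>Registers are split by residue modulo 3: \<open>3 * x\<close> holds the variable
  \<open>x\<close>, \<open>3 * t + 4\<close> is the temporary \<open>t\<close>, and
  \<open>3 * r + 2\<close> is left to an emulated program. Register 1, the one remaining, is
  reserved for \<open>N\<close>.\<close>

definition tmp :: "nat => nat" where "tmp t = 3 * t + 4"

definition cadr :: "nat => nat => nat => nat => prog" where
 "cadr M a t u = Seq (Const (tmp u) M) (Seq (Op Mul (tmp t) (tmp t) (tmp u))
   (Seq (Const (tmp u) a) (Op Add (tmp t) (tmp t) (tmp u))))"

text \<open>Subtraction is compiled to truncated subtraction.\<close>

fun cexp :: "nat => aexp => nat => prog" where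
 "cexp M (Num k) t = Const (tmp t) k"
| "cexp M (Var x) t = Op Mod (tmp t) (3 * x) 1"
| "cexp M (Bin f a b) t = Seq (cexp M a t) (Seq (cexp M b (Suc t))
   (if f = Sub then
    Seq (Op Less (tmp (t + 2)) (tmp t) (tmp (Suc t))) (Seq (Const (tmp (t + 3)) 0)
    (Seq (Op Equal (tmp (t + 2)) (tmp (t + 2)) (tmp (t + 3)))
    (Seq (Op Sub (tmp t) (tmp t) (tmp (Suc t))) (Op Mul (tmp t) (tmp t) (tmp (t + 2))))))
   else Op f (tmp t) (tmp t) (tmp (Suc t))))"
| "cexp M (Arr a e) t = Seq (cexp M e t) (Seq (cadr M a t (Suc t))
   (Seq (Load (tmp t) (tmp t)) (Op Mod (tmp t) (tmp t) 1)))"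

lemma tmp_simps [simp]: "tmp t ~= 1" "tmp t ~= Suc 0" "tmp t ~= 3 * x" "3 * x ~= tmp t" "tmp t = tmp u \<longleftrightarrow> t = u" "tmp 0 = 4"
 unfolding tmp_def by presburger+

lemma binop_word_simps:
 "x + y < 2 ^ w ==> binop_word w Add x y = x + y"
 "y <= x ==> x < 2 ^ w ==> binop_word w Sub x y = x - y"
 "x * y < 2 ^ w ==> binop_word w Mul x y = x * y"
 "x < 2 ^ w ==> binop_word w Div x y = x div y"
 "x < 2 ^ w ==> binop_word w Mod x y = x mod y"
 "x < 2 ^ w ==> binop_word w Or x x = x"
 "w > 0 ==> binop_word w Less x y = (if x < y then 1 else 0)"
 "w > 0 ==> binop_word w Equal x y = (if x = y then 1 else 0)"
proof -
 have *: "nat (int z mod 2 ^ w) = z" if "z < 2 ^ w" for z :: nat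
  using that by (metis nat_int of_nat_numeral of_nat_power zmod_int mod_less)
 have 1: "(1::int) mod 2 ^ w = 1" if "w > 0" using that
  by (metis one_mod_2_pow_eq of_bool_eq(2))
 show "x + y < 2 ^ w ==> binop_word w Add x y = x + y" using *[of "x + y"] by (simp add: binop_word_def)
 show "y <= x ==> x < 2 ^ w ==> binop_word w Sub x y = x - y" using *[of "x - y"] by (simp add: binop_word_def of_nat_diff)
 show "x * y < 2 ^ w ==> binop_word w Mul x y = x * y" using *[of "x * y"] by (simp add: binop_word_def)
 show "x < 2 ^ w ==> binop_word w Div x y = x div y"
  using *[OF le_less_trans[OF div_le_dividend]] by (simp add: binop_word_def)
 show "x < 2 ^ w ==> binop_word w Mod x y = x mod y"
  using *[OF le_less_trans[OF mod_less_eq_dividend]] by (simp add: binop_word_def)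
 show "x < 2 ^ w ==> binop_word w Or x x = x" using *[of x] by (simp add: binop_word_def)
 show "w > 0 ==> binop_word w Less x y = (if x < y then 1 else 0)" by (simp add: binop_word_def 1)
 show "w > 0 ==> binop_word w Equal x y = (if x = y then 1 else 0)" by (simp add: binop_word_def 1)
qed

definition cnd :: "prog => prog => prog => prog" where
 "cnd C P Q = Seq C (IfNZ 4 P Q)"

definition whl :: "prog => prog => prog" where
 "whl C P = Seq C (WhileNZ 4 (Seq P C))"

definition tick :: "store => store" where
 "tick sg = sg(|tm := tm sg + 1|)"

lemma tick_simps [simp]: "vr (tick sg) = vr sg" "wa (tick sg) = wa sg" "za (tick sg) = za sg"
 "tm (tick sg) = Suc (tm sg)"
 by (simp_all add: tick_def)

lemma eval_cong: "vr sg = vr sg' ==> wa sg = wa sg' ==> eval sg e = eval sg' e"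
 by (induction e) auto

lemma eval_tick [simp]: "eval (tick sg) e = eval sg e"
 by (rule eval_cong) auto

text \<open>Proof rules for control flow, instantiated for words and again for long integers built
  on top of words. The strict bound \<open>t < U\<close> leaves room for the one step of the test
  that follows an evaluated condition, so that both together cost one tick.\<close>

locale lang =
 fixes w U N :: nat and R :: "ram => store => bool" and ev :: "aexp => prog"
  and asg :: "nat => aexp => prog" and ok :: "aexp => bool"
 assumes ev: "R s sg ==> ok e ==> \<exists>t s'. exec w (ev e) s t s' & t < U & R s' sg & regs s' 4 = eval sg e"
  and R_tm: "R s (sg(|tm := x|)) = R s sg"
  and asg: "R s sg ==> ok e ==> eval sg e < N ==>
    \<exists>t s'. exec w (asg x e) s t s' & t <= U & R s' (sg(|vr := (vr sg)(x := eval sg e)|))"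
begin

abbreviation "run \<equiv> runs w U R"

lemma R_tick: "R s (tick sg) = R s sg"
 by (simp add: tick_def R_tm)

lemma runs_asg:
 assumes "ok e" "eval sg e < N" "Q (sg(|vr := (vr sg)(x := eval sg e), tm := Suc (tm sg)|))"
 shows "run (asg x e) sg Q"
proof (rule runsI)
 fix s assume "R s sg"
 from asg[OF this assms(1,2), of x] obtain t s' where "exec w (asg x e) s t s'" "t <= U"
  "R s' (sg(|vr := (vr sg)(x := eval sg e)|))" by blast
 then show "\<exists>t s' sg'. exec w (asg x e) s t s' & R s' sg' & t + U * tm sg <= U * tm sg' & Q sg'"
  using assms(3) R_tm[where s = s' and x = "Suc (tm sg)" and sg = "sg(|vr := (vr sg)(x := eval sg e)|)"]
  by (intro exI[of _ t] exI[of _ s'] exI[of _ "sg(|vr := (vr sg)(x := eval sg e), tm := Suc (tm sg)|)"]) auto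
qed

lemma runs_cnd:
 assumes "ok e" "eval sg e ~= 0 ==> run P (tick sg) Q" "eval sg e = 0 ==> run P' (tick sg) Q"
 shows "run (cnd (ev e) P P') sg Q"
proof (rule runsI)
 fix s assume "R s sg"
 from ev[OF this assms(1)] obtain t s' where 1: "exec w (ev e) s t s'" "t < U" "R s' (tick sg)" "regs s' 4 = eval sg e"
  by (auto simp: R_tick)
 show "\<exists>t s' sg'. exec w (cnd (ev e) P P') s t s' & R s' sg' & t + U * tm sg <= U * tm sg' & Q sg'"
 proof (cases "eval sg e = 0")
  case True
  with assms(3) 1(3) obtain u s'' sg'' where 2: "exec w P' s' u s''" "R s'' sg''"
   "u + U * tm (tick sg) <= U * tm sg''" "Q sg''" by (auto simp: runs_def)
  have "exec w (IfNZ 4 P P') s' (1 + u) s''" using exec.IfFalse[OF _ 2(1), of 4 P] True 1 by simp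
  then have "exec w (cnd (ev e) P P') s (t + (1 + u)) s''" unfolding cnd_def by (rule exec.Seq[OF 1(1)])
  with 1 2 show ?thesis
   by (intro exI[of _ "t + (1 + u)"] exI[of _ s''] exI[of _ sg'']) auto
 next
  case False
  with assms(2) 1(3) obtain u s'' sg'' where 2: "exec w P s' u s''" "R s'' sg''"
   "u + U * tm (tick sg) <= U * tm sg''" "Q sg''" by (auto simp: runs_def)
  have "exec w (IfNZ 4 P P') s' (1 + u) s''" using exec.IfTrue[OF _ 2(1), of 4 P'] False 1 by simp
  then have "exec w (cnd (ev e) P P') s (t + (1 + u)) s''" unfolding cnd_def by (rule exec.Seq[OF 1(1)])
  with 1 2 show ?thesis
   by (intro exI[of _ "t + (1 + u)"] exI[of _ s''] exI[of _ sg'']) auto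
 qed
qed

text \<open>Total correctness: \<open>\<mu>\<close> decreases in every round. The body starts from
  \<open>tick sg\<close> because the test has been charged already.\<close>

lemma runs_whl:
 fixes \<mu> :: "store => nat"
 assumes ok: "ok e" and init: "I sg"
  and step: "!!sg. I sg ==> eval sg e ~= 0 ==> run P (tick sg) (%sg'. I sg' & \<mu> sg' < \<mu> sg)"
  and exit: "!!sg. I sg ==> eval sg e = 0 ==> Q (tick sg)"
 shows "run (whl (ev e) P) sg Q"
proof (rule runsI)
 \<comment> \<open>The extra \<open>U - 1\<close> is the evaluation of \<open>e\<close> that
   precedes the test. It was spent before the state considered here and is charged to the tick of
   that test.\<close>
 have loop: "I sg ==> R s sg ==> regs s 4 = eval sg e ==>
   \<exists>t s' sg'. exec w (WhileNZ 4 (Seq P (ev e))) s t s' & R s' sg' & t + (U - 1) + U * tm sg <= U * tm sg' & Q sg'"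
  for s sg
 proof (induction "\<mu> sg" arbitrary: sg s rule: less_induct)
  case less
  have U: "U > 0" using ev[OF less.prems(2) ok] by auto
  show ?case
  proof (cases "eval sg e = 0")
   case True
   then have "exec w (WhileNZ 4 (Seq P (ev e))) s 1 s" using less.prems by (intro exec.WhileFalse) simp
   then show ?thesis using U less.prems exit[OF less.prems(1) True]
    by (intro exI[of _ 1] exI[of _ s] exI[of _ "tick sg"]) (auto simp: R_tick)
  next
   case False
   have "R s (tick sg)" using less.prems by (simp add: R_tick)
   with step[OF less.prems(1) False] obtain t1 s1 sg1 where 1: "exec w P s t1 s1" "R s1 sg1"
    "t1 + U * tm (tick sg) <= U * tm sg1" "I sg1" "\<mu> sg1 < \<mu> sg" by (auto simp: runs_def)
   from ev[OF 1(2) ok] obtain t2 s2 where 2: "exec w (ev e) s1 t2 s2" "t2 < U" "R s2 sg1"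
    "regs s2 4 = eval sg1 e" by blast
   from less.hyps[OF 1(5,4) 2(3,4)] obtain t3 s3 sg3 where 3:
    "exec w (WhileNZ 4 (Seq P (ev e))) s2 t3 s3" "R s3 sg3" "t3 + (U - 1) + U * tm sg1 <= U * tm sg3" "Q sg3"
    by blast
   have "exec w (WhileNZ 4 (Seq P (ev e))) s (1 + (t1 + t2) + t3) s3"
    using False less.prems by (intro exec.WhileTrue[OF _ exec.Seq[OF 1(1) 2(1)] 3(1)]) simp
   then show ?thesis using 1 2 3 U
    by (intro exI[of _ "1 + (t1 + t2) + t3"] exI[of _ s3] exI[of _ sg3]) (auto simp: algebra_simps)
  qed
 qed
 fix s assume "R s sg"
 from ev[OF this ok] obtain t s' where 1: "exec w (ev e) s t s'" "t < U" "R s' sg" "regs s' 4 = eval sg e" by blast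
 from loop[OF init 1(3,4)] obtain u s'' sg'' where 2: "exec w (WhileNZ 4 (Seq P (ev e))) s' u s''"
  "R s'' sg''" "u + (U - 1) + U * tm sg <= U * tm sg''" "Q sg''" by blast
 from 1 2 show "\<exists>t s' sg'. exec w (whl (ev e) P) s t s' & R s' sg' & t + U * tm sg <= U * tm sg' & Q sg'"
  unfolding whl_def by (intro exI[of _ "t + u"] exI[of _ s''] exI[of _ sg'']) (auto intro: exec.Seq)
qed

definition frl :: "nat => aexp => prog => prog" where
 "frl x e P = Seq (asg x (Num 0))
   (whl (ev (Bin Less (Var x) e)) (Seq P (asg x (Bin Add (Var x) (Num 1)))))"

text \<open>The limit is an expression evaluated anew in every round, so the invariant has to fix
  both the loop variable and the value of \<open>e\<close>.\<close>

lemma runs_frl: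
 assumes ok: "ok (Num 0)" "ok (Bin Less (Var x) e)" "ok (Bin Add (Var x) (Num 1))" and n: "n < N"
  and init: "I 0 (sg(|vr := (vr sg)(x := 0), tm := Suc (tm sg)|))"
  and inv: "!!k sg. k <= n ==> I k sg ==> vr sg x = k & eval sg e = n"
  and step: "!!k sg. k < n ==> I k sg ==> run P (tick sg)
   (%sg'. vr sg' x = k & I (Suc k) (sg'(|vr := (vr sg')(x := Suc k), tm := Suc (tm sg')|)))"
  and exit: "!!sg. I n sg ==> Q (tick sg)"
 shows "run (frl x e P) sg Q"
 unfolding frl_def
proof (rule runs_seq, rule runs_asg, goal_cases)
 case 3
 show ?case
 proof (rule runs_whl[where I = "%sg. vr sg x <= n & I (vr sg x) sg" and \<mu> = "%sg. n - vr sg x"], goal_cases)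
  case (3 sg)
  then have I: "I (vr sg x) sg" and le: "vr sg x <= n" and lt: "vr sg x < n" using inv[of "vr sg x" sg]
   by (auto split: if_splits)
  show ?case
   by (rule runs_seq, rule runs_conseq[OF step[OF lt I]], rule runs_asg) (use ok lt n in auto)
 next
  case (4 sg)
  then have "vr sg x = n" using inv[of "vr sg x" sg] by (auto split: if_splits)
  then show ?case using 4 exit by auto
 qed (use ok init in auto)
qed (use ok n in auto)

end

lemma tmp_simps' [simp]: "Suc 0 ~= tmp t" "1 ~= tmp t"
 unfolding tmp_def by presburger+

definition sz1 :: nat where "sz1 = 200"

section \<open>Word variables and interleaved word arrays\<close>

locale mach =
 fixes w M N :: nat
 assumes N: "128 <= N" and M: "M < N" and M0: "0 < M" and NW: "N ^ 10 <= 2 ^ w"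
begin

text \<open>Cell \<open>M * i + a\<close> is element \<open>i\<close> of array \<open>a\<close>;
  interleaving lets all \<open>M\<close> arrays grow without fixed boundaries. Because reading is
  modulo \<open>N\<close>, every state with bounded words and \<open>N\<close> in register 1
  represents some store.\<close>

definition R1 :: "ram => store => bool" where
 "R1 s sg \<longleftrightarrow> bounded_ram w s & regs s 1 = N & vr sg = (%x. regs s (3 * x) mod N) &
   wa sg = (%a i. if a < M then mem s (M * i + a) mod N else 0)"

definition ok1 :: "aexp => bool" where
 "ok1 e \<longleftrightarrow> okx M e & deg e <= 8 & esz e < sz1 - 10"

lemma N_pow_le: "k <= 10 ==> N ^ k <= 2 ^ w"
 using N NW power_increasing[of k 10 N] by linarith

lemma w_pos: "w > 0"
 using NW N_pow_le[of 1] N by (cases "w = 0") auto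

lemma vr_less: "R1 s sg ==> vr sg x < N"
 using N by (simp add: R1_def)

lemma wa_less: "R1 s sg ==> wa sg a i < N"
 using N by (simp add: R1_def)

lemma eval_less: "R1 s sg ==> okx M e ==> eval sg e < N ^ deg e"
proof (induction e)
 case (Num k)
 then show ?case using N by simp
next
 case (Var x)
 then show ?case using vr_less by simp
next
 case (Bin f a b)
 then have IH: "eval sg a < N ^ deg a" "eval sg b < N ^ deg b" by auto
 consider "f = Add" | "f = Mul" | "f = Less \<or> f = Equal" | "f = Sub" | "f = Div" | "f = Mod"
  using Bin.prems by auto
 then show ?case
 proof cases
  case 1
  let ?m = "max (deg a) (deg b)"
  have "N ^ deg a <= N ^ ?m" "N ^ deg b <= N ^ ?m" using N by (auto intro: power_increasing)
  moreover have "2 * N ^ ?m <= N ^ Suc ?m" using N by simp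
  ultimately have "eval sg a + eval sg b < N ^ Suc ?m" using IH by linarith
  then show ?thesis using 1 by simp
 next
  case 2
  then show ?thesis using IH mult_strict_mono'[of "eval sg a" "N ^ deg a" "eval sg b" "N ^ deg b"] by (simp add: power_add)
 next
  case 3
  then show ?thesis using N by auto
 next
  case 4 then show ?thesis using IH by simp
 next
  case 5 then show ?thesis using IH le_less_trans[OF div_le_dividend] by simp
 next
  case 6 then show ?thesis using IH le_less_trans[OF mod_less_eq_dividend] by simp
 qed
next
 case (Arr a e)
 then show ?case using wa_less by simp
qed

lemma eval_less_word: "R1 s sg ==> okx M e ==> deg e <= 10 ==> eval sg e < 2 ^ w"
 using eval_less N_pow_le[of "deg e"] by fastforce

lemma addr_less: "i < N ^ 8 ==> a < M ==> M * i + a < 2 ^ w"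
proof -
 assume a: "i < N ^ 8" "a < M"
 then have "M * i + a < M * i + M" by simp
 also have "\<dots> <= M * N ^ 8" using a(1) by (metis Suc_leI mult_Suc_right add.commute mult_le_mono2)
 also have "\<dots> <= N * N ^ 8" using M by simp
 also have "\<dots> <= 2 ^ w" using N_pow_le[of 9] by (simp add: power_Suc[symmetric] del: power_Suc)
 finally show ?thesis .
qed

lemma okx_deg: "okx M e ==> deg e <= 8"
 by (cases e) auto

lemma small_less: "x < N ==> x < 2 ^ w"
 using N_pow_le[of 1] by simp

lemma regs_bound: "R1 s sg ==> regs s r < 2 ^ w" "R1 s sg ==> mem s a < 2 ^ w"
 by (simp_all add: R1_def bounded_ram_def)

lemma cadr_outcome:
 assumes "regs s (tmp t) = i" "i < N ^ 8" "a < M" "t ~= u"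
 shows "outcome w (cadr M a t u) s Q = Q 4 (s(|regs := (regs s)(tmp u := a, tmp t := M * i + a)|))"
proof -
 have "M * i + a < 2 ^ w" using assms addr_less by blast
 then have 1: "M * i < 2 ^ w" "M * i + a < 2 ^ w" by auto
 have 2: "M < 2 ^ w" "a < 2 ^ w" using small_less M assms by auto
 show ?thesis using assms 1 2
  by (simp add: cadr_def outcome_Seq binop_word_simps fun_upd_twist mult.commute numeral_eq_Suc)
qed

text \<open>Evaluation at position \<open>t\<close> works with the temporaries from \<open>t\<close>
  on. This is what lets a binary operation keep its left operand while the right one is
  computed.\<close>

lemma cexp_exec:
 assumes "R1 s sg" "okx M e"
 shows "\<exists>u s'. exec w (cexp M e t) s u s' & u <= esz e & regs s' (tmp t) = eval sg e & mem s' = mem s &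
   (ALL r. r mod 3 ~= 1 --> regs s' r = regs s r) & (ALL v<t. regs s' (tmp v) = regs s (tmp v)) & R1 s' sg"
 using assms
proof (induction e arbitrary: s t)
 have upd: "R1 (s(|regs := (regs s)(tmp t := v)|)) sg" if "R1 s sg" "v < 2 ^ w" for s t v
  using that by (auto simp: R1_def bounded_ram_def fun_eq_iff)
 have t3: "r mod 3 ~= 1 ==> r ~= tmp t" for r t unfolding tmp_def by presburger
 {
  case (Num k)
  then have "k < 2 ^ w" using N small_less by simp
  then have "exec w (cexp M (Num k) t) s 1 (s(|regs := (regs s)(tmp t := k)|))"
   using exec.Const[of w "tmp t" k s] by simp
  then show ?case by (rule exec_exI) (use \<open>k < 2 ^ w\<close> upd[OF Num(1)] in \<open>auto simp: t3\<close>)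
 next
  case (Var x)
  have "exec w (cexp M (Var x) t) s 1 (s(|regs := (regs s)(tmp t := vr sg x)|))"
   using exec.Op[of w Mod "tmp t" "3 * x" 1 s] Var regs_bound(1)[OF Var(1)] binop_word_simps(5) by (simp add: R1_def)
  then show ?case by (rule exec_exI) (use upd[OF Var(1)] vr_less[OF Var(1), of x] small_less in \<open>auto simp: t3\<close>)
 next
  case (Bin f a b)
  have ok: "okx M a" "okx M b" using Bin.prems by auto
  from Bin.IH(1)[OF Bin.prems(1) ok(1), of t] obtain u1 s1 where 1: "exec w (cexp M a t) s u1 s1" "u1 <= esz a"
   "regs s1 (tmp t) = eval sg a" "mem s1 = mem s" "ALL r. r mod 3 ~= 1 --> regs s1 r = regs s r"
   "ALL v<t. regs s1 (tmp v) = regs s (tmp v)" "R1 s1 sg" by blast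
  from Bin.IH(2)[OF 1(7) ok(2), of "Suc t"] obtain u2 s2 where 2: "exec w (cexp M b (Suc t)) s1 u2 s2" "u2 <= esz b"
   "regs s2 (tmp (Suc t)) = eval sg b" "mem s2 = mem s1" "ALL r. r mod 3 ~= 1 --> regs s2 r = regs s1 r"
   "ALL v<Suc t. regs s2 (tmp v) = regs s1 (tmp v)" "R1 s2 sg" by blast
  have lt: "eval sg (Bin f a b) < 2 ^ w" using eval_less_word[OF Bin.prems(1,2)] okx_deg[OF Bin.prems(2)] by (simp del: eval.simps deg.simps)
  have lta: "eval sg a < 2 ^ w" using eval_less_word[OF Bin.prems(1) ok(1)] okx_deg[OF ok(1)] by simp
  have ltb: "eval sg b < 2 ^ w" using eval_less_word[OF Bin.prems(1) ok(2)] okx_deg[OF ok(2)] by simp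
  let ?P = "if f = Sub then
    Seq (Op Less (tmp (t + 2)) (tmp t) (tmp (Suc t))) (Seq (Const (tmp (t + 3)) 0)
    (Seq (Op Equal (tmp (t + 2)) (tmp (t + 2)) (tmp (t + 3)))
    (Seq (Op Sub (tmp t) (tmp t) (tmp (Suc t))) (Op Mul (tmp t) (tmp t) (tmp (t + 2))))))
   else Op f (tmp t) (tmp t) (tmp (Suc t))"
  have "outcome w ?P s2 (%u s'. u <= 5 & regs s' (tmp t) = eval sg (Bin f a b) & mem s' = mem s2 &
   (ALL r. r mod 3 ~= 1 --> regs s' r = regs s2 r) & (ALL v<t. regs s' (tmp v) = regs s2 (tmp v)) & R1 s' sg)"
  proof (cases "f = Sub")
   case True
   have "outcome w ?P s2 (%u s'. u <= 5 & regs s' (tmp t) = eval sg (Bin f a b) & mem s' = mem s2 &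
   (ALL r. r mod 3 ~= 1 --> regs s' r = regs s2 r) & (ALL v<t. regs s' (tmp v) = regs s2 (tmp v)))"
    using True 1(3) 2(3,6) w_pos lta ltb
    by (auto simp: outcome_Seq binop_word_simps t3)
   then obtain u s' where *: "exec w ?P s2 u s'" "u <= 5" "regs s' (tmp t) = eval sg (Bin f a b)" "mem s' = mem s2"
   "ALL r. r mod 3 ~= 1 --> regs s' r = regs s2 r" "ALL v<t. regs s' (tmp v) = regs s2 (tmp v)" by (auto simp: outcome_def)
   have "regs s' 1 = regs s2 1" using *(1) True by (auto elim!: exec_SeqE exec_OpE exec_ConstE)
   then have "R1 s' sg" using exec_bounded_ram[OF *(1)] 2(7) * by (auto simp: R1_def fun_eq_iff)
   with * show ?thesis unfolding outcome_def by blast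
  next
   case False
   then have "binop_word w f (eval sg a) (eval sg b) = eval sg (Bin f a b)"
    using Bin.prems lt lta w_pos by (auto simp: binop_word_simps)
   then show ?thesis using False 1(3) 2(3,6) upd[OF 2(7) lt, of t] by (auto simp: t3)
  qed
  then obtain u3 s3 where 3: "exec w ?P s2 u3 s3" "u3 <= 5" "regs s3 (tmp t) = eval sg (Bin f a b)" "mem s3 = mem s2"
   "ALL r. r mod 3 ~= 1 --> regs s3 r = regs s2 r" "ALL v<t. regs s3 (tmp v) = regs s2 (tmp v)" "R1 s3 sg"
   by (auto simp: outcome_def)
  have "exec w (cexp M (Bin f a b) t) s (u1 + (u2 + u3)) s3"
   unfolding cexp.simps using 1(1) 2(1) 3(1) by (intro exec.Seq)
  then show ?case by (rule exec_exI) (use 1 2 3 in auto)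
 next
  case (Arr a e)
  have ok: "okx M e" "a < M" using Arr.prems by auto
  from Arr.IH[OF Arr.prems(1) ok(1), of t] obtain u1 s1 where 1: "exec w (cexp M e t) s u1 s1" "u1 <= esz e"
   "regs s1 (tmp t) = eval sg e" "mem s1 = mem s" "ALL r. r mod 3 ~= 1 --> regs s1 r = regs s r"
   "ALL v<t. regs s1 (tmp v) = regs s (tmp v)" "R1 s1 sg" by blast
  have "N ^ deg e <= N ^ 8" using okx_deg[OF ok(1)] N by (intro power_increasing) auto
  then have lt: "eval sg e < N ^ 8" using eval_less[OF Arr.prems(1) ok(1)] by linarith
  have mm: "mem s1 (M * eval sg e + a) < 2 ^ w" using 1(7) regs_bound by blast
  have wa: "mem s1 (M * eval sg e + a) mod N = wa sg a (eval sg e)" using 1(7) ok by (simp add: R1_def)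
  have r1: "regs s1 (Suc 0) = N" using 1(7) by (simp add: R1_def)
  let ?P = "Seq (cadr M a t (Suc t)) (Seq (Load (tmp t) (tmp t)) (Op Mod (tmp t) (tmp t) 1))"
  have "outcome w ?P s1 (%u s'. u = 6 & s' = s1(|regs := (regs s1)(tmp (Suc t) := a, tmp t := wa sg a (eval sg e))|))"
   using 1(3) lt ok mm wa r1 by (simp add: outcome_Seq cadr_outcome binop_word_simps)
  then have 2: "exec w ?P s1 6 (s1(|regs := (regs s1)(tmp (Suc t) := a, tmp t := wa sg a (eval sg e))|))" (is "exec w ?P s1 6 ?s2")
   by (auto simp: outcome_def)
  have "?s2 = (s1(|regs := (regs s1)(tmp (Suc t) := a)|))(|regs := (regs (s1(|regs := (regs s1)(tmp (Suc t) := a)|)))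
    (tmp t := wa sg a (eval sg e))|)" by simp
  also have "R1 \<dots> sg" using 1(7) wa_less[OF 1(7)] small_less ok(2) M by (intro upd) auto
  finally have r2: "R1 ?s2 sg" .
  have "exec w (cexp M (Arr a e) t) s (u1 + 6) ?s2" unfolding cexp.simps using 1(1) 2 by (intro exec.Seq)
  then show ?case by (rule exec_exI) (use 1 r2 in \<open>auto simp: t3\<close>)
 }
qed

definition ev1 :: "aexp => prog" where "ev1 e = cexp M e 0"

text \<open>\<open>Or\<close> of register 4 with itself serves as a register move; register 4 is
  temporary 0, which holds the value of the expression.\<close>

definition asg1 :: "nat => aexp => prog" where
 "asg1 x e = Seq (cexp M e 0) (Op Or (3 * x) 4 4)"

definition sto1 :: "nat => aexp => aexp => prog" where
 "sto1 a ei e = Seq (cexp M ei 0) (Seq (cexp M e 1) (Seq (cadr M a 0 2) (Store 4 7)))"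

lemma R1_vr_upd:
 assumes "R1 s sg" "v < N"
 shows "R1 (s(|regs := (regs s)(3 * x := v)|)) (sg(|vr := (vr sg)(x := v)|))"
 using assms small_less[OF assms(2)] by (auto simp: R1_def bounded_ram_def fun_eq_iff)

lemma R1_wa_upd:
 assumes "R1 s sg" "v < N" "a < M"
 shows "R1 (s(|mem := (mem s)(M * i + a := v)|)) (sg(|wa := (wa sg)(a := (wa sg a)(i := v))|))"
proof -
 have d: "(M * i + a) div M = i" "(M * i + a) mod M = a" if "a < M" for i a using that by simp_all
 have "M * i' + a' = M * i + a \<longleftrightarrow> i' = i & a' = a" if "a' < M" for i' a'
  using d[OF that, of i'] d[OF assms(3), of i] by auto
 then show ?thesis using assms small_less[OF assms(2)]
  by (auto simp: R1_def bounded_ram_def fun_eq_iff)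
qed

sublocale L1: lang w sz1 N R1 ev1 asg1 ok1
proof
 fix s sg e assume a: "R1 s sg" "ok1 e"
 from cexp_exec[OF a(1), of e 0] a(2) obtain u s' where 1: "exec w (ev1 e) s u s'" "u <= esz e"
  "regs s' 4 = eval sg e" "R1 s' sg" by (auto simp: ok1_def ev1_def)
 from 1(1) show "\<exists>t s'. exec w (ev1 e) s t s' & t < sz1 & R1 s' sg & regs s' 4 = eval sg e"
  by (rule exec_exI) (use 1 a(2) in \<open>auto simp: ok1_def sz1_def\<close>)
next
 fix s sg x show "R1 s (sg(|tm := x|)) = R1 s sg" by (simp add: R1_def)
next
 fix s sg e x assume a: "R1 s sg" "ok1 e" "eval sg e < N"
 from cexp_exec[OF a(1), of e 0] a(2) obtain u s' where 1: "exec w (cexp M e 0) s u s'" "u <= esz e"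
  "regs s' 4 = eval sg e" "R1 s' sg" by (auto simp: ok1_def)
 have "exec w (Op Or (3 * x) 4 4) s' 1 (s'(|regs := (regs s')(3 * x := eval sg e)|))"
  using exec.Op[of w Or "3 * x" 4 4 s'] 1(3) small_less[OF a(3)] by (simp add: binop_word_simps)
 with 1 have "exec w (asg1 x e) s (u + 1) (s'(|regs := (regs s')(3 * x := eval sg e)|))"
  unfolding asg1_def by (blast intro: exec.Seq)
 then show "\<exists>t s'. exec w (asg1 x e) s t s' & t <= sz1 & R1 s' (sg(|vr := (vr sg)(x := eval sg e)|))"
  by (rule exec_exI) (use R1_vr_upd[OF 1(4) a(3), of x] 1(2) a(2) in \<open>auto simp: ok1_def sz1_def\<close>)
qed

lemma sto1_exec:
 assumes "R1 s sg" "okx M ei" "okx M e" "a < M" "eval sg e < N"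
 shows "\<exists>t s'. exec w (sto1 a ei e) s t s' & t <= esz ei + esz e + 5 &
  R1 s' (sg(|wa := (wa sg)(a := (wa sg a)(eval sg ei := eval sg e))|))"
proof -
 from cexp_exec[OF assms(1), of ei 0] assms(2) obtain u s1 where 1: "exec w (cexp M ei 0) s u s1" "u <= esz ei"
  "regs s1 (tmp 0) = eval sg ei" "R1 s1 sg" by auto
 from cexp_exec[OF 1(4), of e 1] assms(3) obtain u2 s2 where 2: "exec w (cexp M e 1) s1 u2 s2" "u2 <= esz e"
  "regs s2 (tmp 1) = eval sg e" "regs s2 (tmp 0) = eval sg ei" "R1 s2 sg" using 1(3) by auto
 have "N ^ deg ei <= N ^ 8" using okx_deg[OF assms(2)] N by (intro power_increasing) auto
 then have lt: "eval sg ei < N ^ 8" using eval_less[OF assms(1,2)] by linarith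
 let ?s3 = "s2(|regs := (regs s2)(tmp 2 := a, tmp 0 := M * eval sg ei + a)|)"
 let ?s4 = "?s3(|mem := (mem s2)(M * eval sg ei + a := eval sg e)|)"
 have n: "3 * x ~= 10" "3 * x ~= 4" for x :: nat by presburger+
 have t: "tmp 2 = 10" "tmp 1 = 7" "tmp 0 = 4" by (simp_all add: tmp_def)
 have "outcome w (Seq (cadr M a 0 2) (Store 4 7)) s2 (%t s'. t = 5 & s' = ?s4)"
  using 2(3,4) unfolding outcome_Seq cadr_outcome[OF 2(4) lt assms(4), of 2, simplified] by (simp add: t del: One_nat_def)
 then have 3: "exec w (Seq (cadr M a 0 2) (Store 4 7)) s2 5 ?s4" by (auto simp: outcome_def)
 have b: "bounded_ram w ?s4" using exec_bounded_ram[OF 3] 2(5) by (simp add: R1_def)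
 have r: "R1 ?s3 sg"
  using 2(5) exec_bounded_ram[OF 3] n unfolding R1_def t by (auto simp: bounded_ram_def fun_eq_iff)
 from R1_wa_upd[OF r assms(5,4), of "eval sg ei"] have "R1 ?s4 (sg(|wa := (wa sg)(a := (wa sg a)(eval sg ei := eval sg e))|))"
  by simp
 note r4 = this
 have "exec w (sto1 a ei e) s (u + (u2 + 5)) ?s4" unfolding sto1_def using 1(1) 2(1) 3 by (intro exec.Seq)
 then show ?thesis by (rule exec_exI) (use r4 1(2) 2(2) in auto)
qed

lemma runs_sto1:
 assumes "ok1 ei" "ok1 e" "esz ei + esz e + 5 <= sz1" "a < M" "eval sg e < N"
  "Q (sg(|wa := (wa sg)(a := (wa sg a)(eval sg ei := eval sg e)), tm := Suc (tm sg)|))"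
 shows "L1.run (sto1 a ei e) sg Q"
proof (rule runsI)
 fix s assume "R1 s sg"
 from sto1_exec[OF this _ _ assms(4,5), of ei] assms(1,2) obtain t s' where 1: "exec w (sto1 a ei e) s t s'"
  "t <= esz ei + esz e + 5" "R1 s' (sg(|wa := (wa sg)(a := (wa sg a)(eval sg ei := eval sg e))|))" by (auto simp: ok1_def)
 from 1(1) show "\<exists>t s' sg'. exec w (sto1 a ei e) s t s' & R1 s' sg' & t + sz1 * tm sg <= sz1 * tm sg' & Q sg'"
  by (rule exec_exI3[where sg = "sg(|wa := (wa sg)(a := (wa sg a)(eval sg ei := eval sg e)), tm := Suc (tm sg)|)"])
   (use 1 assms(3,6) in \<open>auto simp: R1_def\<close>)
qed

end

section \<open>Long integers as digit arrays: a second level of stores on top of the first\<close>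

fun sh :: "aexp => aexp" where
 "sh (Num k) = Num k"
| "sh (Var x) = Var (x + 10)"
| "sh (Bin f a b) = Bin f (sh a) (sh b)"
| "sh (Arr a e) = Arr (2 * a) (sh e)"

lemma deg_sh [simp]: "deg (sh e) = deg e"
 by (induction e) (auto split: binop.split)

lemma esz_sh [simp]: "esz (sh e) = esz e"
 by (induction e) auto

lemma okx_sh [simp]: "okx 24 (sh e) = okx 12 e"
 by (induction e) auto

lemma digits_less: "(\<Sum>l<k. (f l mod B) * B ^ l) < B ^ k" if "B > 0" for B :: nat
proof (induction k)
 case (Suc k)
 have "f k mod B + 1 <= B" using that by (simp add: Suc_leI)
 then have "(f k mod B + 1) * B ^ k <= B * B ^ k" by (rule mult_le_mono1)
 then show ?case using Suc by (simp add: algebra_simps)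
qed simp

lemma digits_div_mod:
 fixes B :: nat assumes "B > 0" "i < k"
 shows "(\<Sum>l<k. (f l mod B) * B ^ l) div B ^ i mod B = f i mod B"
 using assms(2)
proof (induction k)
 case (Suc k)
 show ?case
 proof (cases "i = k")
  case True
  then show ?thesis using digits_less[OF assms(1), of f k] assms(1) by simp
 next
  case False
  with Suc.prems have "i < k" by simp
  then obtain j where j: "k = i + Suc j" using less_imp_Suc_add by fastforce
  have "(\<Sum>l<Suc k. (f l mod B) * B ^ l) = (\<Sum>l<k. (f l mod B) * B ^ l) + B ^ i * (B * ((f k mod B) * B ^ j))"
   using j by (simp add: power_add algebra_simps)
  then have "(\<Sum>l<Suc k. (f l mod B) * B ^ l) div B ^ i = (\<Sum>l<k. (f l mod B) * B ^ l) div B ^ i + B * ((f k mod B) * B ^ j)"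
   by (simp only:) (use assms(1) in simp)
  then show ?thesis using Suc False by simp
 qed
qed simp

lemma digits_of_nat:
 fixes B :: nat assumes "B > 0" "x < B ^ k"
 shows "(\<Sum>l<k. (x div B ^ l mod B) * B ^ l) = x"
proof -
 have "(\<Sum>l<k. (x div B ^ l mod B) * B ^ l) = x mod B ^ k" for k
 proof (induction k)
  case (Suc k)
  have "x mod B ^ Suc k = B ^ k * (x div B ^ k mod B) + x mod B ^ k"
   by (metis mod_mult2_eq power_Suc2)
  then show ?case using Suc by (simp add: algebra_simps)
 qed simp
 then show ?thesis using assms by simp
qed

text \<open>\<open>2 * 2 ^ b < N\<close> lets the sum of two digits and a carry fit into a variable.
  The 24 interleaved arrays yield 12 arrays of words and 12 arrays of long integers with
  \<open>L\<close> digits each.\<close>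

locale bigm = mach w 24 N for w N :: nat +
 fixes b L :: nat
 assumes bN: "2 * 2 ^ b < N" and LN: "L < N" and L0: "0 < L"
begin

definition big :: "(nat => nat) => nat => nat" where
 "big f t = (\<Sum>l<L. (f (t * L + l) mod 2 ^ b) * (2 ^ b) ^ l)"

text \<open>The lower variables 0 to 9 belong to the digit routines, with the base in 0 and the
  number of digits in 1, hence the shift by 10. Even arrays carry words, odd ones the digits of long
  integers.\<close>

definition PR :: "store => store => bool" where
 "PR sg ts \<longleftrightarrow> vr sg 0 = 2 ^ b & vr sg 1 = L & vr ts = (%x. vr sg (x + 10)) &
   wa ts = (%a. wa sg (2 * a)) & za ts = (%a. big (wa sg (2 * a + 1)))"

definition R2 :: "ram => store => bool" where
 "R2 s ts \<longleftrightarrow> (EX sg. R1 s sg & PR sg ts)"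

definition ok2 :: "aexp => bool" where
 "ok2 e \<longleftrightarrow> okx 12 e & deg e <= 8 & esz e < 90"

text \<open>A digit routine needs at most \<open>12 * L + 12\<close> lower ticks of
  \<open>sz1\<close> steps each, so every operation on long integers counts as one upper
  tick.\<close>

definition U2 :: nat where "U2 = sz1 * (12 * L + 12)"

definition ev2 :: "aexp => prog" where "ev2 e = ev1 (sh e)"

definition asg2 :: "nat => aexp => prog" where "asg2 x e = asg1 (x + 10) (sh e)"

definition sto2 :: "nat => aexp => aexp => prog" where "sto2 a ei e = sto1 (2 * a) (sh ei) (sh e)"

lemma eval_sh: "PR sg ts ==> eval sg (sh e) = eval ts e"
 by (induction e) (auto simp: PR_def)

lemma ok2_ok1: "ok2 e ==> ok1 (sh e)"
 by (auto simp: ok1_def ok2_def sz1_def)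

lemma U2_ge: "sz1 <= U2" by (simp add: U2_def)

sublocale L2: lang w U2 N R2 ev2 asg2 ok2
proof
 fix s ts e assume a: "R2 s ts" "ok2 e"
 then obtain sg where 1: "R1 s sg" "PR sg ts" by (auto simp: R2_def)
 from L1.ev[OF 1(1) ok2_ok1[OF a(2)]] 1(2) U2_ge
 show "\<exists>t s'. exec w (ev2 e) s t s' & t < U2 & R2 s' ts & regs s' 4 = eval ts e"
  unfolding ev2_def R2_def using eval_sh[OF 1(2)] by (metis order_less_le_trans)
next
 fix s ts x show "R2 s (ts(|tm := x|)) = R2 s ts" by (simp add: R2_def PR_def)
next
 fix s ts e x assume a: "R2 s ts" "ok2 e" "eval ts e < N"
 then obtain sg where 1: "R1 s sg" "PR sg ts" by (auto simp: R2_def)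
 have lt: "eval sg (sh e) < N" using a(3) eval_sh[OF 1(2)] by simp
 from L1.asg[OF 1(1) ok2_ok1[OF a(2)] lt, of "x + 10"] obtain t s' where 2: "exec w (asg2 x e) s t s'" "t <= sz1"
  "R1 s' (sg(|vr := (vr sg)(x + 10 := eval sg (sh e))|))" unfolding asg2_def by blast
 have "PR (sg(|vr := (vr sg)(x + 10 := eval sg (sh e))|)) (ts(|vr := (vr ts)(x := eval ts e)|))"
  using 1(2) eval_sh[OF 1(2)] by (auto simp: PR_def fun_eq_iff)
 then show "\<exists>t s'. exec w (asg2 x e) s t s' & t <= U2 & R2 s' (ts(|vr := (vr ts)(x := eval ts e)|))"
  using 2 U2_ge unfolding R2_def by (meson le_trans)
qed

text \<open>Makes a lower-level program a primitive of the upper level: the lower clock is reset to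
  0, must stay within the ticks that \<open>U2\<close> allows, and is then replaced by one upper
  tick.\<close>

lemma lift:
 assumes "!!sg. PR sg ts ==> tm sg = 0 ==> (!!a i. wa sg a i < N) ==> L1.run P sg (%sg'. tm sg' <= 12 * L + 12 & (\<exists>ts'. PR sg' ts' & tm ts' = Suc (tm ts) & Q ts'))"
 shows "L2.run P ts Q"
proof (rule runsI)
 fix s assume "R2 s ts"
 then obtain sg where 1: "R1 s sg" "PR sg ts" by (auto simp: R2_def)
 have 2: "R1 s (sg(|tm := 0|))" "PR (sg(|tm := 0|)) ts" using 1 by (auto simp: PR_def L1.R_tm)
 have "L1.run P (sg(|tm := 0|)) (%sg'. tm sg' <= 12 * L + 12 & (\<exists>ts'. PR sg' ts' & tm ts' = Suc (tm ts) & Q ts'))"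
  using assms[OF 2(2)] wa_less[OF 2(1)] by simp
 with 2(1) obtain t s' sg' ts' where 3: "exec w P s t s'" "R1 s' sg'"
  "t <= sz1 * tm sg'" "tm sg' <= 12 * L + 12" "PR sg' ts'" "tm ts' = Suc (tm ts)" "Q ts'"
  by (auto simp: runs_def)
 have "sz1 * tm sg' <= U2" unfolding U2_def using 3(4) by (rule mult_le_mono2)
 with 3(3) have t: "t <= U2" by linarith
 from 3(1) show "\<exists>t s' sg'. exec w P s t s' & R2 s' sg' & t + U2 * tm ts <= U2 * tm sg' & Q sg'"
  by (rule exec_exI3[where sg = ts']) (use 3 t in \<open>auto simp: R2_def\<close>)
qed

lemma big_less: "big f t < (2 ^ b) ^ L"
 unfolding big_def by (rule digits_less) simp

text \<open>Bounds valid for every represented store may be assumed, since a store that no machine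
  state represents makes the claim vacuous.\<close>

lemma run_bounds:
 assumes "(!!x. vr ts x < N) ==> (!!a i. wa ts a i < N) ==> (!!a t. za ts a t < (2 ^ b) ^ L) ==> L2.run P ts Q"
 shows "L2.run P ts Q"
proof (rule runsI)
 fix s assume a: "R2 s ts"
 then obtain sg where 1: "R1 s sg" "PR sg ts" by (auto simp: R2_def)
 have "L2.run P ts Q" using 1 vr_less wa_less big_less by (intro assms) (auto simp: PR_def)
 with a show "\<exists>t s' sg'. exec w P s t s' & R2 s' sg' & t + U2 * tm ts <= U2 * tm sg' & Q sg'"
  by (simp add: runs_def)
qed

lemma runs_sto2:
 assumes "ok2 ei" "ok2 e" "a < 12" "eval ts e < N"
  "Q (ts(|wa := (wa ts)(a := (wa ts a)(eval ts ei := eval ts e)), tm := Suc (tm ts)|))"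
 shows "L2.run (sto2 a ei e) ts Q"
proof (rule lift)
 fix sg assume 1: "PR sg ts" "tm sg = 0"
 have odd: "2 * x = Suc (2 * y) \<longleftrightarrow> False" "Suc (2 * y) = 2 * x \<longleftrightarrow> False" for x y :: nat by presburger+
 show "L1.run (sto2 a ei e) sg (%sg'. tm sg' <= 12 * L + 12 & (\<exists>ts'. PR sg' ts' & tm ts' = Suc (tm ts) & Q ts'))"
  unfolding sto2_def
 proof (rule runs_sto1, goal_cases)
  case 6
  show ?case using 1 assms(5) eval_sh[OF 1(1)]
   by (auto intro!: exI[of _ "ts(|wa := (wa ts)(a := (wa ts a)(eval ts ei := eval ts e)), tm := Suc (tm ts)|)"]
    simp: PR_def fun_eq_iff odd)
 qed (use assms ok2_ok1 eval_sh[OF 1(1)] in \<open>auto simp: ok2_def sz1_def\<close>)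
qed

definition dg :: "nat => nat => aexp" where
 "dg a v = Bin Mod (Arr (2 * a + 1) (Bin Add (Bin Mul (Var v) (Var 1)) (Var 6))) (Var 0)"

text \<open>With \<open>neg\<close>, a digit is computed as \<open>2 ^ b + x - (y + c)\<close>,
  which is never negative; quotient 0 on division by \<open>2 ^ b\<close> then signals the next
  borrow.\<close>

definition bop :: "bool => nat => aexp => nat => aexp => nat => aexp => prog" where
 "bop neg a ea c ec d ed =
   Seq (asg1 2 (sh ea)) (Seq (asg1 3 (sh ec)) (Seq (asg1 4 (sh ed)) (Seq (asg1 5 (Num 0))
   (L1.frl 6 (Var 1)
    (Seq (asg1 7 (if neg then Bin Sub (Bin Add (Var 0) (dg c 3)) (Bin Add (dg d 4) (Var 5))
           else Bin Add (Bin Add (dg c 3) (dg d 4)) (Var 5)))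
    (Seq (sto1 (2 * a + 1) (Bin Add (Bin Mul (Var 2) (Var 1)) (Var 6)) (Bin Mod (Var 7) (Var 0)))
      (asg1 5 (if neg then Bin Sub (Num 1) (Bin Div (Var 7) (Var 0)) else Bin Div (Var 7) (Var 0)))))))))"

text \<open>School arithmetic after \<open>k\<close> digits: the partial result is right up to a
  pending carry, or debt, of weight \<open>(2 ^ b) ^ k\<close>.\<close>

definition carry_inv :: "bool => (nat => nat) => (nat => nat) => nat => nat => nat => bool" where
 "carry_inv neg x y k c S \<longleftrightarrow> c <= 1 &
   (let X = \<Sum>l<k. (x l mod 2 ^ b) * (2 ^ b) ^ l; Y = \<Sum>l<k. (y l mod 2 ^ b) * (2 ^ b) ^ l
   in if neg then S + Y = X + c * (2 ^ b) ^ k else S + c * (2 ^ b) ^ k = X + Y)"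

lemma carry_step:
 assumes "carry_inv neg x y k c S" and u: "u = x k mod 2 ^ b" "v = y k mod 2 ^ b"
  and z: "z = (if neg then 2 ^ b + u - (v + c) else u + v + c)"
 shows "carry_inv neg x y (Suc k) (if neg then 1 - z div 2 ^ b else z div 2 ^ b) (S + z mod 2 ^ b * (2 ^ b) ^ k)"
  and "z < 2 * 2 ^ b"
proof -
 let ?B = "2 ^ b :: nat"
 have uv: "u < ?B" "v < ?B" "c <= 1" using assms by (auto simp: carry_inv_def)
 then show z2: "z < 2 * 2 ^ b" using z by auto
 have d: "z div ?B <= 1" using z2 less_mult_imp_div_less[of z 2 ?B] by simp
 have zz: "z mod ?B * ?B ^ k + z div ?B * ?B ^ Suc k = z * ?B ^ k"
 proof -
  have "z mod ?B * ?B ^ k + z div ?B * ?B ^ Suc k = (z mod ?B + z div ?B * ?B) * ?B ^ k"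
   by (simp only: distrib_right power_Suc mult.assoc)
  then show ?thesis by (simp only: mod_div_mult_eq)
 qed
 show "carry_inv neg x y (Suc k) (if neg then 1 - z div 2 ^ b else z div 2 ^ b) (S + z mod 2 ^ b * (2 ^ b) ^ k)"
 proof (cases neg)
  case True
  then have "z + v + c = ?B + u" using z uv by simp
  then have "(z + v + c) * ?B ^ k = (?B + u) * ?B ^ k" by simp
  then have e: "z * ?B ^ k + v * ?B ^ k + c * ?B ^ k = ?B ^ Suc k + u * ?B ^ k" by (simp add: algebra_simps)
  have "(1 - z div ?B) * ?B ^ Suc k + z div ?B * ?B ^ Suc k = ?B ^ Suc k"
   using d by (metis add_mult_distrib le_add_diff_inverse2 mult_1)
  then show ?thesis using True assms(1) d zz e u unfolding carry_inv_def Let_def by simp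
 next
  case False
  then have "z * ?B ^ k = u * ?B ^ k + v * ?B ^ k + c * ?B ^ k" using z by (simp add: algebra_simps)
  then show ?thesis using False assms(1) d zz u unfolding carry_inv_def Let_def by simp
 qed
qed

lemma PR_big_upd:
 assumes "PR sg ts" "vr sg' 0 = 2 ^ b" "vr sg' 1 = L" "!!x. x \<ge> 10 ==> vr sg' x = vr sg x"
  "!!a'. a' ~= Suc (2 * a) ==> wa sg' a' = wa sg a'"
  "!!i. i \<notin> {t * L..<t * L + L} ==> wa sg' (Suc (2 * a)) i = wa sg (Suc (2 * a)) i"
  "(\<Sum>l<L. (wa sg' (Suc (2 * a)) (t * L + l) mod 2 ^ b) * (2 ^ b) ^ l) = S"
 shows "PR sg' (ts(|za := (za ts)(a := (za ts a)(t := S)), tm := x|))"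
proof -
 have "big (wa sg' (Suc (2 * a))) t' = big (wa sg (Suc (2 * a))) t'" if "t' ~= t" for t'
 proof -
  have "t' * L + l \<notin> {t * L..<t * L + L}" if "l < L" for l
  proof
   assume "t' * L + l \<in> {t * L..<t * L + L}"
   then have 1: "t * L < Suc t' * L" "t' * L < Suc t * L" using that by auto
   have "t < Suc t'" "t' < Suc t" using 1 by (auto simp only: mult_less_cancel2)
   with \<open>t' ~= t\<close> show False by simp
  qed
  then show ?thesis unfolding big_def using assms(6) by (intro sum.cong) auto
 qed
 note other = this
 have "big (wa sg' (Suc (2 * a))) t = S" using assms(7) by (simp add: big_def)
 with other have "(za ts)(a := (za ts a)(t := S)) = (%a. big (wa sg' (2 * a + 1)))"
  using assms(1,5) by (intro ext) (auto simp: PR_def)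
 moreover have "2 * x ~= Suc (2 * a)" for x by presburger
 ultimately show ?thesis using assms(1-5) by (auto simp: PR_def)
qed

lemma eval_sh_vr:
 assumes PR: "PR sg ts" and "!!x. x \<ge> 10 ==> v x = vr sg x"
 shows "eval (sg(|vr := v, tm := k|)) (sh e) = eval ts e"
proof -
 have "PR (sg(|vr := v(0 := 2 ^ b, 1 := L), tm := k|)) ts" using assms by (auto simp: PR_def)
 moreover have "eval (sg(|vr := v(0 := 2 ^ b, 1 := L), tm := k|)) (sh e) = eval (sg(|vr := v, tm := k|)) (sh e)"
  by (induction e) auto
 ultimately show ?thesis using eval_sh by metis
qed

lemma runs_bop:
 assumes ok: "ok2 ea" "ok2 ec" "ok2 ed" "a < 12" "c < 12" "d < 12"
  and lt: "eval ts ea < N" "eval ts ec < N" "eval ts ed < N"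
  and res: "if neg then za ts d (eval ts ed) <= za ts c (eval ts ec) & S = za ts c (eval ts ec) - za ts d (eval ts ed)
    else S = za ts c (eval ts ec) + za ts d (eval ts ed) & S < (2 ^ b) ^ L"
  and Q: "Q (ts(|za := (za ts)(a := (za ts a)(eval ts ea := S)), tm := Suc (tm ts)|))"
 shows "L2.run (bop neg a ea c ec d ed) ts Q"
proof (rule lift)
 fix sg assume PR: "PR sg ts" and tm0: "tm sg = 0" and wN: "!!a i. wa sg a i < N"
 note sh [simp] = eval_sh[OF PR]
 have ok1: "ok1 (sh ea)" "ok1 (sh ec)" "ok1 (sh ed)" using ok ok2_ok1 by auto
 have v01: "vr sg 0 = 2 ^ b" "vr sg (Suc 0) = L" using PR by (auto simp: PR_def)
 note ev = eval_sh_vr[OF PR]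
 define t u v where tuv: "t = eval ts ea" "u = eval ts ec" "v = eval ts ed"
 define x y where xy: "x = (%l. wa sg (Suc (2 * c)) (u * L + l))" "y = (%l. wa sg (Suc (2 * d)) (v * L + l))"
 let ?B = "2 ^ b :: nat"
 define I where "I k sg' \<longleftrightarrow> vr sg' 0 = ?B & vr sg' 1 = L & vr sg' 2 = t & vr sg' 3 = u & vr sg' 4 = v & vr sg' 6 = k &
   (\<forall>x\<ge>10. vr sg' x = vr sg x) & (\<forall>a'. a' ~= Suc (2 * a) --> wa sg' a' = wa sg a') &
   (ALL i. i \<notin> {t * L..<t * L + k} --> wa sg' (Suc (2 * a)) i = wa sg (Suc (2 * a)) i) &
   carry_inv neg x y k (vr sg' 5) (\<Sum>l<k. (wa sg' (Suc (2 * a)) (t * L + l) mod ?B) * ?B ^ l) & tm sg' <= 5 * k + 5" for k and sg' :: store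
 \<comment> \<open>Target and operands may share an array and even an index. An operand digit
   already overwritten would satisfy \<open>t * L <= u' * L + k < t * L + k\<close>, hence
   \<open>u' < t < u' + 1\<close>.\<close>
 have read: "wa sg' (Suc (2 * c')) (u' * L + k) = wa sg (Suc (2 * c')) (u' * L + k)" if "I k sg'" "k < L" for c' u' k sg'
 proof (cases "c' = a")
  case True
  have "u' * L + k \<notin> {t * L..<t * L + k}"
  proof
   assume a: "u' * L + k \<in> {t * L..<t * L + k}"
   then have 1: "t * L < Suc u' * L" "u' * L < t * L" using that by auto
   have "t < Suc u'" "u' < t" using 1 by (auto simp only: mult_less_cancel2)
   then show False by simp
  qed
  then show ?thesis using that True by (simp add: I_def)
 next
  case False
  then show ?thesis using that by (simp add: I_def)
 qed
 have N7: "7 < N" using N by simp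
 show "L1.run (bop neg a ea c ec d ed) sg (%sg'. tm sg' <= 12 * L + 12 & (\<exists>ts'. PR sg' ts' & tm ts' = Suc (tm ts) & Q ts'))"
  unfolding bop_def
 proof (rule runs_seq, rule L1.runs_asg, goal_cases)
  case 3
  show ?case
  proof (rule runs_seq, rule L1.runs_asg, goal_cases)
   case 3
   show ?case
   proof (rule runs_seq, rule L1.runs_asg, goal_cases)
    case 3
    show ?case
    proof (rule runs_seq, rule L1.runs_asg, goal_cases)
     case 3
     show ?case
     proof (rule L1.runs_frl[where n = L and I = I], goal_cases)
      case (5)
      show ?case using tm0 v01 ev by (auto simp: I_def tuv carry_inv_def)
     next
      case (7 k sg')
      let ?x = "wa sg (Suc (2 * c)) (u * L + k) mod ?B" and ?y = "wa sg (Suc (2 * d)) (v * L + k) mod ?B"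
      define z where "z = (if neg then ?B + ?x - (?y + vr sg' 5) else ?x + ?y + vr sg' 5)"
      let ?S = "\<Sum>l<k. (wa sg' (Suc (2 * a)) (t * L + l) mod ?B) * ?B ^ l"
      from 7 have ci: "carry_inv neg x y k (vr sg' 5) ?S" by (simp add: I_def)
      from carry_step[OF ci _ _ z_def] have cs: "carry_inv neg x y (Suc k) (if neg then 1 - z div ?B else z div ?B) (?S + z mod ?B * ?B ^ k)"
       "z < 2 * ?B" by (auto simp: xy)
      have zN: "z < N" using cs(2) bN by linarith
      have zN2: "z mod ?B < N" "z div ?B < N" using le_less_trans[OF mod_less_eq_dividend zN]
        le_less_trans[OF div_le_dividend zN] by auto
      have Ik: "vr sg' 0 = ?B" "vr sg' (Suc 0) = L" "vr sg' 2 = t" "vr sg' 3 = u" "vr sg' 4 = v" "vr sg' 6 = k" "tm sg' <= 5 * k + 5"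
       using 7 by (auto simp: I_def)
      note rd = read[OF 7(2,1)]
      have ee: "eval (tick sg') (if neg then Bin Sub (Bin Add (Var 0) (dg c 3)) (Bin Add (dg d 4) (Var 5))
           else Bin Add (Bin Add (dg c 3) (dg d 4)) (Var 5)) = z"
       by (simp add: Ik z_def rd dg_def)
      show ?case
       apply (rule runs_seq, rule L1.runs_asg)
        apply (use ok in \<open>auto simp: ok1_def sz1_def dg_def\<close>)[1]
        apply (simp only: ee zN)
       apply (simp only: ee)
       apply (rule runs_seq, rule runs_sto1)
          apply (simp add: ok1_def sz1_def)
         apply (simp add: ok1_def sz1_def)
         apply (simp add: sz1_def)
        apply (use ok in simp)
        apply (simp add: Ik zN2)
       apply (rule L1.runs_asg)
        apply (simp add: ok1_def sz1_def)
        apply (use zN2 N in \<open>simp add: Ik\<close>)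
       using 7(2) cs(1) Ik(7) by (auto simp: I_def)
     next
      case (8 sg')
      define S' where "S' = (\<Sum>l<L. (wa sg' (Suc (2 * a)) (t * L + l) mod ?B) * ?B ^ l)"
      have ci: "carry_inv neg x y L (vr sg' 5) S'" using 8 by (simp add: I_def S'_def)
      have zz: "za ts c u = (\<Sum>l<L. (x l mod ?B) * ?B ^ l)" "za ts d v = (\<Sum>l<L. (y l mod ?B) * ?B ^ l)"
       using PR by (auto simp: PR_def big_def xy)
      have lt: "S' < ?B ^ L" unfolding S'_def by (rule digits_less) simp
      \<comment> \<open>A pending carry would weigh \<open>(2 ^ b) ^ L\<close>, which is impossible
        as both the \<open>L\<close> digits and the true result lie below it.\<close>
      have "S' = S"
      proof (cases neg)
       case True
       then have 1: "S' + za ts d v = za ts c u + vr sg' 5 * ?B ^ L" "za ts d v <= za ts c u" "S = za ts c u - za ts d v"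
        using ci res by (auto simp: carry_inv_def Let_def zz[symmetric] tuv)
       have "vr sg' 5 * ?B ^ L < 1 * ?B ^ L" using 1(1,2) lt by linarith
       then have "vr sg' 5 = 0" by (simp only: mult_less_cancel2) simp
       then show ?thesis using 1 by simp
      next
       case False
       then have 1: "S' + vr sg' 5 * ?B ^ L = za ts c u + za ts d v" "S = za ts c u + za ts d v" "S < ?B ^ L"
        using ci res by (auto simp: carry_inv_def Let_def zz[symmetric] tuv)
       have "vr sg' 5 * ?B ^ L < 1 * ?B ^ L" using 1 by linarith
       then have "vr sg' 5 = 0" by (simp only: mult_less_cancel2) simp
       then show ?thesis using 1 by simp
      qed
      then have "PR (tick sg') (ts(|za := (za ts)(a := (za ts a)(t := S)), tm := Suc (tm ts)|))"
       using 8 by (intro PR_big_upd[OF PR]) (auto simp: I_def S'_def)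
      then show ?case using 8 Q by (auto simp: I_def tuv)
     qed (use LN in \<open>auto simp: ok1_def sz1_def I_def\<close>)
    qed (use N in \<open>auto simp: ok1_def sz1_def\<close>)
   qed (use ok1 lt ev in auto)
  qed (use ok1 lt ev in auto)
 qed (use ok1 lt in auto)
qed

text \<open>Comparison from the least significant digit upwards: the current digit decides unless
  both agree, and then the previous verdict stands.\<close>

definition bless :: "nat => nat => aexp => nat => aexp => prog" where
 "bless z c ec d ed =
   Seq (asg1 3 (sh ec)) (Seq (asg1 4 (sh ed)) (Seq (asg1 5 (Num 0))
   (Seq (L1.frl 6 (Var 1)
    (asg1 5 (Bin Add (Bin Less (dg c 3) (dg d 4)) (Bin Mul (Bin Equal (dg c 3) (dg d 4)) (Var 5)))))
   (asg1 (z + 10) (Var 5)))))"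

lemma digit_less_iff:
 fixes x y K X Y :: nat assumes "X < K" "Y < K"
 shows "X + x * K < Y + y * K \<longleftrightarrow> x < y \<or> (x = y & X < Y)"
proof (cases x y rule: linorder_cases)
 case less
 then have "x * K + K <= y * K" by (metis Suc_leI mult_Suc add.commute mult_le_mono1)
 then show ?thesis using assms less by linarith
next
 case greater
 then have "y * K + K <= x * K" by (metis Suc_leI mult_Suc add.commute mult_le_mono1)
 then show ?thesis using assms greater by linarith
qed simp

lemma runs_bless:
 assumes ok: "ok2 ec" "ok2 ed" "c < 12" "d < 12"
  and lt: "eval ts ec < N" "eval ts ed < N"
  and Q: "Q (ts(|vr := (vr ts)(z := (if za ts c (eval ts ec) < za ts d (eval ts ed) then 1 else 0)), tm := Suc (tm ts)|))"
 shows "L2.run (bless z c ec d ed) ts Q"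
proof (rule lift)
 fix sg assume PR: "PR sg ts" and tm0: "tm sg = 0" and wN: "!!a i. wa sg a i < N"
 note sh [simp] = eval_sh[OF PR]
 have ok1: "ok1 (sh ec)" "ok1 (sh ed)" using ok ok2_ok1 by auto
 have v01: "vr sg 0 = 2 ^ b" "vr sg (Suc 0) = L" using PR by (auto simp: PR_def)
 note ev = eval_sh_vr[OF PR]
 define u v where uv: "u = eval ts ec" "v = eval ts ed"
 define x y where xy: "x = (%l. wa sg (Suc (2 * c)) (u * L + l))" "y = (%l. wa sg (Suc (2 * d)) (v * L + l))"
 let ?B = "2 ^ b :: nat"
 define X Y where XY: "X = (%k. \<Sum>l<k. (x l mod ?B) * ?B ^ l)" "Y = (%k. \<Sum>l<k. (y l mod ?B) * ?B ^ l)"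
 define I where "I k sg' \<longleftrightarrow> vr sg' 0 = ?B & vr sg' 1 = L & vr sg' 3 = u & vr sg' 4 = v & vr sg' 6 = k &
   (\<forall>x\<ge>10. vr sg' x = vr sg x) & wa sg' = wa sg & vr sg' 5 = (if X k < Y k then 1 else 0) & tm sg' <= 5 * k + 5" for k and sg' :: store
 have zz: "za ts c u = X L" "za ts d v = Y L"
  using PR by (auto simp: PR_def big_def xy XY)
 have N7: "7 < N" using N by simp
 show "L1.run (bless z c ec d ed) sg (%sg'. tm sg' <= 12 * L + 12 & (\<exists>ts'. PR sg' ts' & tm ts' = Suc (tm ts) & Q ts'))"
  unfolding bless_def
 proof (rule runs_seq, rule L1.runs_asg, goal_cases)
  case 3
  show ?case
  proof (rule runs_seq, rule L1.runs_asg, goal_cases)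
   case 3
   show ?case
   proof (rule runs_seq, rule L1.runs_asg, goal_cases)
    case 3
    show ?case
    proof (rule runs_seq, rule L1.runs_frl[where n = L and I = I], goal_cases)
     case (5)
     show ?case using tm0 v01 ev by (auto simp: I_def uv XY)
    next
     case (7 k sg')
     have "X k < ?B ^ k" "Y k < ?B ^ k" unfolding XY by (rule digits_less, simp)+
     from digit_less_iff[OF this, of "x k mod ?B" "y k mod ?B"]
     have 1: "X (Suc k) < Y (Suc k) \<longleftrightarrow> x k mod ?B < y k mod ?B \<or> x k mod ?B = y k mod ?B & X k < Y k"
      by (simp add: XY)
     show ?case
      apply (rule L1.runs_asg)
       apply (use ok in \<open>auto simp: ok1_def sz1_def dg_def\<close>)[1]
       apply (use 7 N7 in \<open>auto simp: I_def dg_def\<close>)[1]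
      using 7 1 by (auto simp: I_def dg_def xy)
    next
     case (8 sg')
     show ?case
     proof (rule L1.runs_asg, goal_cases)
      case 3
      have "PR (sg'(|vr := (vr sg')(z + 10 := vr sg' 5), tm := t|))
        (ts(|vr := (vr ts)(z := (if za ts c (eval ts ec) < za ts d (eval ts ed) then 1 else 0)), tm := Suc (tm ts)|))" for t
       using 8 PR zz unfolding I_def PR_def uv by (auto intro!: ext)
      note pr = this[of "Suc (Suc (tm sg'))"]
      have "tm sg' <= 5 * L + 5" using 8 by (simp add: I_def)
      then show ?case
       by (intro conjI exI[of _ "ts(|vr := (vr ts)(z := (if za ts c (eval ts ec) < za ts d (eval ts ed) then 1 else 0)), tm := Suc (tm ts)|)"])
        (use pr Q in \<open>simp_all add: tick_def\<close>)
     qed (use 8 N7 in \<open>auto simp: ok1_def sz1_def I_def\<close>)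
    qed (use LN in \<open>auto simp: ok1_def sz1_def I_def\<close>)
   qed (use N in \<open>auto simp: ok1_def sz1_def\<close>)
  qed (use ok1 lt ev in auto)
 qed (use ok1 lt in auto)
qed

text \<open>Multiplying by the outcome of a comparison writes zeros from position \<open>el\<close>
  on, which pads shorter numbers to \<open>L\<close> digits.\<close>

definition bfrom :: "nat => aexp => nat => aexp => aexp => prog" where
 "bfrom a ea c ec el =
   Seq (asg1 2 (sh ea)) (Seq (asg1 3 (sh ec)) (Seq (asg1 4 (sh el))
   (L1.frl 6 (Var 1)
    (sto1 (2 * a + 1) (Bin Add (Bin Mul (Var 2) (Var 1)) (Var 6))
     (Bin Mul (Bin Less (Var 6) (Var 4)) (Bin Mod (Arr (2 * c) (Bin Add (Var 3) (Var 6))) (Var 0)))))))"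

lemma runs_bfrom:
 assumes ok: "ok2 ea" "ok2 ec" "ok2 el" "a < 12" "c < 12"
  and lt: "eval ts ea < N" "eval ts ec < N" "eval ts el <= L"
  and S: "S = (\<Sum>l<eval ts el. (wa ts c (eval ts ec + l) mod 2 ^ b) * (2 ^ b) ^ l)"
  and Q: "Q (ts(|za := (za ts)(a := (za ts a)(eval ts ea := S)), tm := Suc (tm ts)|))"
 shows "L2.run (bfrom a ea c ec el) ts Q"
proof (rule lift)
 fix sg assume PR: "PR sg ts" and tm0: "tm sg = 0" and wN: "!!a i. wa sg a i < N"
 note sh [simp] = eval_sh[OF PR]
 have ok1: "ok1 (sh ea)" "ok1 (sh ec)" "ok1 (sh el)" using ok ok2_ok1 by auto
 have v01: "vr sg 0 = 2 ^ b" "vr sg (Suc 0) = L" using PR by (auto simp: PR_def)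
 note ev = eval_sh_vr[OF PR]
 define t u v where tuv: "t = eval ts ea" "u = eval ts ec" "v = eval ts el"
 let ?B = "2 ^ b :: nat"
 define x where x: "x l = (if l < v then wa sg (2 * c) (u + l) mod ?B else 0)" for l
 define I where "I k sg' \<longleftrightarrow> vr sg' 0 = ?B & vr sg' 1 = L & vr sg' 2 = t & vr sg' 3 = u & vr sg' 4 = v & vr sg' 6 = k &
   (\<forall>x\<ge>10. vr sg' x = vr sg x) & (\<forall>a'. a' ~= Suc (2 * a) --> wa sg' a' = wa sg a') &
   (ALL i. i \<notin> {t * L..<t * L + k} --> wa sg' (Suc (2 * a)) i = wa sg (Suc (2 * a)) i) &
   (ALL l<k. wa sg' (Suc (2 * a)) (t * L + l) = x l) & tm sg' <= 5 * k + 5" for k and sg' :: store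
 have xB: "x l mod ?B = x l" for l by (simp add: x)
 have S': "(\<Sum>l<L. x l * ?B ^ l) = S"
 proof -
  have "(\<Sum>l<L. x l * ?B ^ l) = (\<Sum>l<v. x l * ?B ^ l)"
   by (rule sum.mono_neutral_right) (use lt(3) in \<open>auto simp: tuv x\<close>)
  also have "\<dots> = S" unfolding S tuv[symmetric] using PR by (intro sum.cong) (auto simp: x PR_def)
  finally show ?thesis .
 qed
 have N7: "7 < N" using N by simp
 have odd: "Suc (2 * y) ~= 2 * x" "2 * x ~= Suc (2 * y)" for x y :: nat by presburger+
 show "L1.run (bfrom a ea c ec el) sg (%sg'. tm sg' <= 12 * L + 12 & (\<exists>ts'. PR sg' ts' & tm ts' = Suc (tm ts) & Q ts'))"
  unfolding bfrom_def
 proof (rule runs_seq, rule L1.runs_asg, goal_cases)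
  case 3
  show ?case
  proof (rule runs_seq, rule L1.runs_asg, goal_cases)
   case 3
   show ?case
   proof (rule runs_seq, rule L1.runs_asg, goal_cases)
    case 3
    show ?case
    proof (rule L1.runs_frl[where n = L and I = I], goal_cases)
     case (5)
     show ?case using tm0 v01 ev by (auto simp: I_def tuv)
    next
     case (7 k sg')
     have xk: "x k < N" using wN[of "2 * c" "u + k"] N le_less_trans[OF mod_less_eq_dividend wN[of "2 * c" "u + k"]] by (simp add: x)
     have e: "eval (tick sg') (Bin Mul (Bin Less (Var 6) (Var 4)) (Bin Mod (Arr (2 * c) (Bin Add (Var 3) (Var 6))) (Var 0))) = x k"
      using 7(2) by (auto simp: I_def x odd)
     show ?case
      apply (rule runs_sto1)
         apply (simp add: ok1_def sz1_def)
        apply (use ok in \<open>simp add: ok1_def sz1_def\<close>)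
        apply (simp add: sz1_def)
       apply (use ok in simp)
       apply (simp only: e xk)
      apply (simp only: e)
      using 7 by (auto simp: I_def less_Suc_eq)
    next
     case (8 sg')
     have "(\<Sum>l<L. (wa sg' (Suc (2 * a)) (t * L + l) mod ?B) * ?B ^ l) = S"
      unfolding S'[symmetric] using 8 xB by (intro sum.cong) (auto simp: I_def)
     then have "PR (tick sg') (ts(|za := (za ts)(a := (za ts a)(t := S)), tm := Suc (tm ts)|))"
      using 8 by (intro PR_big_upd[OF PR]) (auto simp: I_def)
     then show ?case using 8 Q by (auto simp: I_def tuv)
    qed (use LN in \<open>auto simp: ok1_def sz1_def I_def\<close>)
   qed (use ok1 lt ev LN in auto)
  qed (use ok1 lt ev in auto)
 qed (use ok1 lt in auto)
qed

definition bto :: "nat => aexp => nat => aexp => aexp => prog" where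
 "bto c ec a ea el =
   Seq (asg1 2 (sh ea)) (Seq (asg1 3 (sh ec)) (Seq (asg1 4 (sh el))
   (L1.frl 6 (Var 4)
    (sto1 (2 * c) (Bin Add (Var 3) (Var 6)) (dg a 2)))))"

lemma runs_bto:
 assumes ok: "ok2 ea" "ok2 ec" "ok2 el" "a < 12" "c < 12"
  and lt: "eval ts ea < N" "eval ts ec < N" "eval ts el <= L"
  and Q: "Q (ts(|wa := (wa ts)(c := (%i. if eval ts ec <= i & i < eval ts ec + eval ts el
     then za ts a (eval ts ea) div (2 ^ b) ^ (i - eval ts ec) mod 2 ^ b else wa ts c i)), tm := Suc (tm ts)|))"
 shows "L2.run (bto c ec a ea el) ts Q"
proof (rule lift)
 fix sg assume PR: "PR sg ts" and tm0: "tm sg = 0" and wN: "!!a i. wa sg a i < N"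
 note sh [simp] = eval_sh[OF PR]
 have ok1: "ok1 (sh ea)" "ok1 (sh ec)" "ok1 (sh el)" using ok ok2_ok1 by auto
 have v01: "vr sg 0 = 2 ^ b" "vr sg (Suc 0) = L" using PR by (auto simp: PR_def)
 note ev = eval_sh_vr[OF PR]
 define t u v where tuv: "t = eval ts ea" "u = eval ts ec" "v = eval ts el"
 let ?B = "2 ^ b :: nat"
 define f where "f k i = (if u <= i & i < u + k then za ts a t div ?B ^ (i - u) mod ?B else wa sg (2 * c) i)" for k i
 define I where "I k sg' \<longleftrightarrow> vr sg' 0 = ?B & vr sg' 1 = L & vr sg' 2 = t & vr sg' 3 = u & vr sg' 4 = v & vr sg' 6 = k &
   (\<forall>x\<ge>10. vr sg' x = vr sg x) & wa sg' = (wa sg)(2 * c := f k) & tm sg' <= 5 * k + 5" for k and sg' :: store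
 have N7: "7 < N" using N by simp
 have odd: "Suc (2 * y) ~= 2 * x" "2 * x ~= Suc (2 * y)" for x y :: nat by presburger+
 show "L1.run (bto c ec a ea el) sg (%sg'. tm sg' <= 12 * L + 12 & (\<exists>ts'. PR sg' ts' & tm ts' = Suc (tm ts) & Q ts'))"
  unfolding bto_def
 proof (rule runs_seq, rule L1.runs_asg, goal_cases)
  case 3
  show ?case
  proof (rule runs_seq, rule L1.runs_asg, goal_cases)
   case 3
   show ?case
   proof (rule runs_seq, rule L1.runs_asg, goal_cases)
    case 3
    show ?case
    proof (rule L1.runs_frl[where n = v and I = I], goal_cases)
     case (5)
     have "f 0 = wa sg (2 * c)" by (auto simp: f_def)
     then show ?case using tm0 v01 ev by (auto simp: I_def tuv)
    next
     case (7 k sg')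
     then have k: "k < L" using lt(3) tuv by simp
     have dd: "za ts a t div ?B ^ k mod ?B = wa sg (Suc (2 * a)) (t * L + k) mod ?B"
      using PR digits_div_mod[OF _ k, of ?B "%l. wa sg (Suc (2 * a)) (t * L + l)"] by (simp add: PR_def big_def)
     have e: "eval (tick sg') (dg a 2) = za ts a t div ?B ^ k mod ?B"
      using 7(2) by (auto simp: I_def odd dg_def dd)
     have lt: "za ts a t div ?B ^ k mod ?B < N" unfolding dd
      using le_less_trans[OF mod_less_eq_dividend wN] by simp
     have f: "(f k)(u + k := za ts a t div ?B ^ k mod ?B) = f (Suc k)" by (auto simp: f_def fun_eq_iff)
     show ?case
      apply (rule runs_sto1)
         apply (simp add: ok1_def sz1_def)
        apply (use ok in \<open>simp add: ok1_def sz1_def dg_def\<close>)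
        apply (simp add: sz1_def dg_def)
       apply (use ok in simp)
       apply (simp only: e lt)
      apply (simp only: e)
      using 7 by (auto simp: I_def f)
    next
     case (8 sg')
     have "PR (tick sg') (ts(|wa := (wa ts)(c := f v), tm := Suc (tm ts)|))"
      using 8 PR odd by (auto simp: I_def PR_def intro!: ext)
     moreover have "f v = (%i. if eval ts ec <= i & i < eval ts ec + eval ts el
       then za ts a (eval ts ea) div (2 ^ b) ^ (i - eval ts ec) mod 2 ^ b else wa ts c i)"
      using PR by (auto simp: f_def tuv PR_def)
     ultimately show ?case using 8 Q lt(3) by (auto simp: I_def tuv)
    qed (use LN lt tuv in \<open>auto simp: ok1_def sz1_def I_def\<close>)
   qed (use ok1 lt ev LN in auto)
  qed (use ok1 lt ev in auto)
 qed (use ok1 lt in auto)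
qed

end

section \<open>Emulation of a program written for shorter words\<close>

fun emul :: "nat => prog => prog" where
 "emul M (Const r k) = Const (3 * r + 2) k"
| "emul M (Op f r a b) = Seq (Op Mod (tmp 1) (3 * a + 2) (tmp 0)) (Seq (Op Mod (tmp 2) (3 * b + 2) (tmp 0))
   (Op f (3 * r + 2) (tmp 1) (tmp 2)))"
| "emul M (Load r a) = Seq (Op Mod (tmp 1) (3 * a + 2) (tmp 0)) (Seq (Const (tmp 2) M)
   (Seq (Op Mul (tmp 1) (tmp 2) (tmp 1)) (Load (3 * r + 2) (tmp 1))))"
| "emul M (Store a r) = Seq (Op Mod (tmp 1) (3 * a + 2) (tmp 0)) (Seq (Const (tmp 2) M)
   (Seq (Op Mul (tmp 1) (tmp 2) (tmp 1)) (Store (tmp 1) (3 * r + 2))))"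
| "emul M (Seq P Q) = Seq (emul M P) (emul M Q)"
| "emul M (IfNZ r P Q) = Seq (Op Mod (tmp 1) (3 * r + 2) (tmp 0)) (IfNZ (tmp 1) (emul M P) (emul M Q))"
| "emul M (WhileNZ r P) = Seq (Op Mod (tmp 1) (3 * r + 2) (tmp 0))
   (WhileNZ (tmp 1) (Seq (emul M P) (Op Mod (tmp 1) (3 * r + 2) (tmp 0))))"

definition simrel :: "nat => nat => nat => ram => ram => bool" where
 "simrel M w w' s s0 \<longleftrightarrow> bounded_ram w s & regs s (tmp 0) = 2 ^ w' &
   (ALL r. regs s0 r = regs s (3 * r + 2) mod 2 ^ w') & (ALL i. mem s0 i = mem s (M * i) mod 2 ^ w')"

text \<open>What a caller relies on after an emulation: its variables, \<open>N\<close> in register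
  1, and all arrays except number 0, which is the emulated memory.\<close>

definition simframe :: "nat => ram => ram => bool" where
 "simframe M s s' \<longleftrightarrow> (ALL r. regs s' (3 * r) = regs s (3 * r)) & regs s' 1 = regs s 1 &
   (ALL a. a mod M ~= 0 --> mem s' a = mem s a)"

lemma simframe_trans: "simframe M s s' ==> simframe M s' s'' ==> simframe M s s''"
 by (simp add: simframe_def)

lemma tmp_2 [simp]: "tmp t ~= 3 * r + 2" "3 * r + 2 ~= tmp t" "tmp t ~= Suc (Suc (3 * r))" "Suc (Suc (3 * r)) ~= tmp t"
 "3 * x ~= Suc (Suc (3 * r))" "Suc (Suc (3 * r)) ~= 3 * x"
 "tmp t = 4 \<longleftrightarrow> t = 0" "4 = tmp t \<longleftrightarrow> t = 0" "3 * r ~= 4" "3 * r ~= 2" "3 * r + 2 ~= 4" "4 ~= 3 * r" "2 ~= 3 * r"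
 unfolding tmp_def by presburger+

lemma emul_test:
 assumes "simrel M w w' s s0"
 shows "\<exists>s'. exec w (Op Mod (tmp 1) (3 * r + 2) (tmp 0)) s 1 s' & simrel M w w' s' s0 & simframe M s s' &
  regs s' (tmp 1) = regs s0 r"
proof -
 have b: "regs s (3 * r + 2) < 2 ^ w" using assms by (simp add: simrel_def bounded_ram_def)
 let ?s = "s(|regs := (regs s)(tmp 1 := binop_word w Mod (regs s (3 * r + 2)) (regs s (tmp 0)))|)"
 have e: "exec w (Op Mod (tmp 1) (3 * r + 2) (tmp 0)) s 1 ?s" by (rule exec.Op)
 have "bounded_ram w ?s" using exec_bounded_ram[OF e] assms by (simp add: simrel_def)
 then show ?thesis using e assms binop_word_simps(5)[OF b]
  by (intro exI[of _ ?s]) (auto simp: simrel_def simframe_def)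
qed

text \<open>Values are stored unreduced and reduced modulo \<open>2 ^ w'\<close>, kept in temporary
  0, when an operation, a test or an address uses them. With reduced operands both machines compute
  the same integer before their final reduction, and \<open>2 ^ w'\<close> divides
  \<open>2 ^ w\<close>, so the results agree modulo \<open>2 ^ w'\<close>.\<close>

lemma emul_exec:
 assumes "exec w' P s0 t s0'" "simrel M w w' s s0" and w: "M * 2 ^ w' < 2 ^ w" "0 < M"
 shows "\<exists>t' s'. exec w (emul M P) s t' s' & t' <= 5 * t & simrel M w w' s' s0' & simframe M s s'"
 using assms(1,2)
proof (induction arbitrary: s rule: exec.induct)
 have "2 ^ w' <= M * 2 ^ w'" using w(2) by simp
 then have lt: "(2::nat) ^ w' < 2 ^ w" using w(1) by linarith
 then have ww: "w' < w" by simp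
 then have dv: "(2::nat) ^ w' dvd 2 ^ w" by (simp add: le_imp_power_dvd)
 have "M * 1 <= M * 2 ^ w'" by (rule mult_le_mono2) simp
 then have M: "M < 2 ^ w" using w(1) by linarith
 have rb: "regs s r < 2 ^ w" "mem s a < 2 ^ w" if "simrel M w w' s s0" for s s0 r a
  using that by (auto simp: simrel_def bounded_ram_def)
 have ad: "M * (x mod 2 ^ w') < 2 ^ w" for x
 proof -
  have "M * (x mod 2 ^ w') <= M * 2 ^ w'" by (intro mult_le_mono2 less_imp_le) simp
  then show ?thesis using w(1) by linarith
 qed
 have ad': "(x mod 2 ^ w') * M < 2 ^ w" for x using ad by (simp add: mult.commute)
 {
  case (Const r k s0)
  have e: "exec w (emul M (Const r k)) s 1 (s(|regs := (regs s)(3 * r + 2 := k mod 2 ^ w)|))" (is "exec _ _ _ _ ?s")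
   by (simp only: emul.simps) (rule exec.Const)
  have "bounded_ram w ?s" using exec_bounded_ram[OF e] Const by (simp add: simrel_def)
  then show ?case using Const dv
   by (intro exec_exI[OF e]) (auto simp: simrel_def simframe_def mod_mod_cancel)
 next
  case (Op f r a b s0)
  let ?x = "regs s0 a" and ?y = "regs s0 b"
  have bw: "binop_word w f ?x ?y mod 2 ^ w' = binop_word w' f ?x ?y"
  proof -
   have "int (binop_word w f ?x ?y mod 2 ^ w') = binop_int f ?x ?y mod 2 ^ w mod 2 ^ w'"
    by (simp add: binop_word_def zmod_int)
   also have "\<dots> = binop_int f ?x ?y mod 2 ^ w'" using ww by (simp add: mod_mod_cancel le_imp_power_dvd)
   also have "\<dots> = int (binop_word w' f ?x ?y)" by (simp add: binop_word_def)
   finally show ?thesis by simp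
  qed
  let ?s = "s(|regs := (regs s)(tmp 1 := ?x, tmp 2 := ?y, 3 * r + 2 := binop_word w f ?x ?y)|)"
  have "outcome w (emul M (Op f r a b)) s (%t s'. t = 3 & s' = ?s)"
   using Op rb(1)[OF Op] by (simp add: outcome_Seq binop_word_simps simrel_def)
  then have e: "exec w (emul M (Op f r a b)) s 3 ?s" by (auto simp: outcome_def)
  have "bounded_ram w ?s" using exec_bounded_ram[OF e] Op by (simp add: simrel_def)
  then show ?case using Op bw
   by (intro exec_exI[OF e]) (auto simp: simrel_def simframe_def)
 next
  case (Load r a s0)
  let ?x = "regs s0 a"
  let ?s = "s(|regs := (regs s)(tmp 2 := M, tmp 1 := M * ?x, 3 * r + 2 := mem s (M * ?x))|)"
  have "outcome w (emul M (Load r a)) s (%t s'. t = 4 & s' = ?s)"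
   using Load rb(1)[OF Load] M ad ad' by (simp add: outcome_Seq binop_word_simps simrel_def fun_upd_twist)
  then have e: "exec w (emul M (Load r a)) s 4 ?s" by (auto simp: outcome_def)
  have "bounded_ram w ?s" using exec_bounded_ram[OF e] Load by (simp add: simrel_def)
  then show ?case using Load
   by (intro exec_exI[OF e]) (auto simp: simrel_def simframe_def)
 next
  case (Store a r s0)
  let ?x = "regs s0 a"
  let ?s = "s(|regs := (regs s)(tmp 2 := M, tmp 1 := M * ?x), mem := (mem s)(M * ?x := regs s (3 * r + 2))|)"
  have "outcome w (emul M (Store a r)) s (%t s'. t = 4 & s' = ?s)"
   using Store rb(1)[OF Store] M ad ad' by (simp add: outcome_Seq binop_word_simps simrel_def fun_upd_twist)
  then have e: "exec w (emul M (Store a r)) s 4 ?s" by (auto simp: outcome_def)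
  have "bounded_ram w ?s" using exec_bounded_ram[OF e] Store by (simp add: simrel_def)
  then show ?case using Store w(2)
   by (intro exec_exI[OF e]) (auto simp: simrel_def simframe_def)
 next
  case (Seq P s0 t s0' Q u s0'')
  from Seq.IH(1)[OF Seq.prems] obtain t1 s1 where 1: "exec w (emul M P) s t1 s1" "t1 <= 5 * t"
   "simrel M w w' s1 s0'" "simframe M s s1" by blast
  from Seq.IH(2)[OF 1(3)] obtain t2 s2 where 2: "exec w (emul M Q) s1 t2 s2" "t2 <= 5 * u"
   "simrel M w w' s2 s0''" "simframe M s1 s2" by blast
  have "exec w (emul M (Seq P Q)) s (t1 + t2) s2" using 1 2 by (auto intro: exec.Seq)
  then show ?case by (rule exec_exI) (use 1(2) 2(2,3) simframe_trans[OF 1(4) 2(4)] in auto)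
 next
  case (IfTrue s0 r P t s0' Q)
  from emul_test[OF IfTrue.prems, of r] obtain s1 where 1: "exec w (Op Mod (tmp 1) (3 * r + 2) (tmp 0)) s 1 s1"
   "simrel M w w' s1 s0" "simframe M s s1" "regs s1 (tmp 1) = regs s0 r" by blast
  from IfTrue.IH[OF 1(2)] obtain t2 s2 where 2: "exec w (emul M P) s1 t2 s2" "t2 <= 5 * t"
   "simrel M w w' s2 s0'" "simframe M s1 s2" by blast
  have "exec w (emul M (IfNZ r P Q)) s (1 + (1 + t2)) s2" unfolding emul.simps
   by (rule exec.Seq[OF 1(1)], rule exec.IfTrue[OF _ 2(1)]) (use 1 IfTrue in simp)
  then show ?case by (rule exec_exI) (use 2(2,3) simframe_trans[OF 1(3) 2(4)] in auto)
 next
  case (IfFalse s0 r Q t s0' P)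
  from emul_test[OF IfFalse.prems, of r] obtain s1 where 1: "exec w (Op Mod (tmp 1) (3 * r + 2) (tmp 0)) s 1 s1"
   "simrel M w w' s1 s0" "simframe M s s1" "regs s1 (tmp 1) = regs s0 r" by blast
  from IfFalse.IH[OF 1(2)] obtain t2 s2 where 2: "exec w (emul M Q) s1 t2 s2" "t2 <= 5 * t"
   "simrel M w w' s2 s0'" "simframe M s1 s2" by blast
  have "exec w (emul M (IfNZ r P Q)) s (1 + (1 + t2)) s2" unfolding emul.simps
   by (rule exec.Seq[OF 1(1)], rule exec.IfFalse[OF _ 2(1)]) (use 1 IfFalse in simp)
  then show ?case by (rule exec_exI) (use 2(2,3) simframe_trans[OF 1(3) 2(4)] in auto)
 next
  case (WhileFalse s0 r P)
  from emul_test[OF WhileFalse.prems, of r] obtain s1 where 1: "exec w (Op Mod (tmp 1) (3 * r + 2) (tmp 0)) s 1 s1"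
   "simrel M w w' s1 s0" "simframe M s s1" "regs s1 (tmp 1) = regs s0 r" by blast
  have "exec w (emul M (WhileNZ r P)) s (1 + 1) s1" unfolding emul.simps
   by (rule exec.Seq[OF 1(1)], rule exec.WhileFalse) (use 1 WhileFalse in simp)
  then show ?case by (rule exec_exI) (use 1 in auto)
 next
  case (WhileTrue s0 r P t s0' u s0'')
  from emul_test[OF WhileTrue.prems, of r] obtain s1 where 1: "exec w (Op Mod (tmp 1) (3 * r + 2) (tmp 0)) s 1 s1"
   "simrel M w w' s1 s0" "simframe M s s1" "regs s1 (tmp 1) = regs s0 r" by blast
  from WhileTrue.IH(1)[OF 1(2)] obtain t2 s2 where 2: "exec w (emul M P) s1 t2 s2" "t2 <= 5 * t"
   "simrel M w w' s2 s0'" "simframe M s1 s2" by blast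
  from WhileTrue.IH(2)[OF 2(3)] obtain t3 s3 where 3: "exec w (emul M (WhileNZ r P)) s2 t3 s3" "t3 <= 5 * u"
   "simrel M w w' s3 s0''" "simframe M s2 s3" by blast
  \<comment> \<open>The test that opens the emulation of the remaining rounds doubles as the test at
    the end of the current body; the run is regrouped around it.\<close>
  from 3(1) obtain t4 s4 t5 where 4: "exec w (Op Mod (tmp 1) (3 * r + 2) (tmp 0)) s2 t4 s4" "t3 = t4 + t5"
   "exec w (WhileNZ (tmp 1) (Seq (emul M P) (Op Mod (tmp 1) (3 * r + 2) (tmp 0)))) s4 t5 s3"
   unfolding emul.simps by (auto elim!: exec_SeqE)
  have "exec w (emul M (WhileNZ r P)) s (1 + (1 + (t2 + t4) + t5)) s3" unfolding emul.simps
   by (rule exec.Seq[OF 1(1)], rule exec.WhileTrue[OF _ exec.Seq[OF 2(1) 4(1)] 4(3)]) (use 1 WhileTrue in simp)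
  then show ?case by (rule exec_exI) (use 2(2) 3(2,3) 4(2) simframe_trans[OF simframe_trans[OF 1(3) 2(4)] 3(4)] in auto)
 }
qed

context mach
begin

lemma runs_setc:
 assumes "k < N" "Q (sg(|vr := (vr sg)(x := k), tm := Suc (tm sg)|))"
 shows "L1.run (Const (3 * x) k) sg Q"
proof (rule runsI)
 fix s assume a: "R1 s sg"
 have "R1 (s(|regs := (regs s)(3 * x := k)|)) (sg(|vr := (vr sg)(x := k), tm := Suc (tm sg)|))"
  using R1_vr_upd[OF a assms(1), of x] L1.R_tm[where x = "Suc (tm sg)" and sg = "sg(|vr := (vr sg)(x := k)|)"] by simp
 then show "\<exists>t s' sg'. exec w (Const (3 * x) k) s t s' & R1 s' sg' & t + sz1 * tm sg <= sz1 * tm sg' & Q sg'"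
  using exec.Const[of w "3 * x" k s] small_less[OF assms(1)] assms(2)
  by (intro exec_exI3) (auto simp: sz1_def)
qed

end

context bigm
begin

definition setc2 :: "nat => nat => prog" where "setc2 x k = Const (3 * (x + 10)) k"

lemma runs_setc2:
 assumes "k < N" "Q (ts(|vr := (vr ts)(x := k), tm := Suc (tm ts)|))"
 shows "L2.run (setc2 x k) ts Q"
proof (rule lift)
 fix sg assume 1: "PR sg ts" "tm sg = 0"
 show "L1.run (setc2 x k) sg (%sg'. tm sg' <= 12 * L + 12 & (\<exists>ts'. PR sg' ts' & tm ts' = Suc (tm ts) & Q ts'))"
  unfolding setc2_def
 proof (rule runs_setc, goal_cases)
  case 2
  show ?case using 1 assms(2)
   by (auto intro!: exI[of _ "ts(|vr := (vr ts)(x := k), tm := Suc (tm ts)|)"] ext simp: PR_def)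
 qed (use assms in auto)
qed

definition callp :: "nat => prog => prog" where
 "callp x P = Seq (Op Mod 4 (3 * (x + 10)) 1) (emul 24 P)"

text \<open>Since \<open>2 ^ w'\<close> divides \<open>N\<close>, reading a cell modulo
  \<open>N\<close> preserves its residue modulo \<open>2 ^ w'\<close>. The guarantee for the given
  program covers arbitrary contents of registers and of cells beyond the input, so leftovers of
  earlier calls are harmless. The output is known only modulo \<open>2 ^ w'\<close>.\<close>

lemma runs_callp:
 assumes P: "computes_within w' P xs ys T" and vx: "vr ts x = 2 ^ w'"
  and w: "24 * 2 ^ w' < (2::nat) ^ w" "2 ^ w' dvd N"
  and inp: "!!i. i < length xs ==> wa ts 0 i = xs ! i"
  and Q: "!!ts'. vr ts' = vr ts ==> (!!a. a ~= 0 ==> wa ts' a = wa ts a) ==> za ts' = za ts ==>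
   (!!i. i < length ys ==> wa ts' 0 i mod 2 ^ w' = ys ! i) ==> tm ts' = tm ts + (5 * nat \<lceil>T\<rceil> + 1) ==> Q ts'"
 shows "L2.run (callp x P) ts Q"
proof (rule runsI)
 fix s assume "R2 s ts"
 then obtain sg where 1: "R1 s sg" "PR sg ts" by (auto simp: R2_def)
 have vx': "regs s (3 * (x + 10)) mod N = 2 ^ w'" using 1 vx unfolding R1_def PR_def by metis
 let ?s = "s(|regs := (regs s)(4 := 2 ^ w')|)"
 have r1: "regs s 1 = N" using 1 by (simp add: R1_def)
 have e1: "exec w (Op Mod 4 (3 * (x + 10)) 1) s 1 ?s"
  using exec.Op[of w Mod 4 "3 * (x + 10)" 1 s] regs_bound(1)[OF 1(1), of "3 * (x + 10)"] vx' r1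
  by (simp only: binop_word_simps)
 define s0 where "s0 = (|regs = (%r. regs s (3 * r + 2) mod 2 ^ w'), mem = (%i. mem s (24 * i) mod 2 ^ w')|)"
 have b: "bounded_ram w s" using 1 by (simp add: R1_def)
 have b': "bounded_ram w ?s" using exec_bounded_ram[OF e1 b] .
 have n: "3 * r + 2 ~= 4" "3 * r ~= 4" for r :: nat by presburger+
 have er: "simrel 24 w w' ?s s0" using b' n by (simp add: simrel_def s0_def)
 have mm: "mem s (24 * i) mod 2 ^ w' = wa ts 0 i mod 2 ^ w'" for i
  using 1 w(2) by (simp add: R1_def PR_def mod_mod_cancel)
 have "mem s0 i = xs ! i" if "i < length xs" for i
  using that inp P by (simp add: s0_def mm computes_within_def)
 moreover have "regs s0 r < 2 ^ w'" "mem s0 a < 2 ^ w'" for r a by (simp_all add: s0_def)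
 ultimately obtain t0 s0' where 2: "exec w' P s0 t0 s0'" "real t0 <= T" "ALL i<length ys. mem s0' i = ys ! i"
  using P unfolding computes_within_def by blast
 from emul_exec[OF 2(1) er w(1)] obtain t' s' where 3: "exec w (emul 24 P) ?s t' s'" "t' <= 5 * t0"
  "simrel 24 w w' s' s0'" "simframe 24 ?s s'" by auto
 have t0: "t0 <= nat \<lceil>T\<rceil>" using 2(2) by linarith
 define sg' where "sg' = sg(|wa := (wa sg)(0 := (%i. mem s' (24 * i) mod N))|)"
 have fr: "!!r. regs s' (3 * r) = regs s (3 * r)" "regs s' 1 = N" "!!a. a mod 24 ~= 0 ==> mem s' a = mem s a"
  using 3(4) n r1 by (auto simp: simframe_def)
 have "wa sg' a i = (if a < 24 then mem s' (24 * i + a) mod N else 0)" for a i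
  using 1(1) fr(3)[of "24 * i + a"] by (cases "a = 0") (auto simp: sg'_def R1_def)
 then have "wa sg' = (%a i. if a < 24 then mem s' (24 * i + a) mod N else 0)" by (intro ext)
 moreover have "vr sg' = vr sg" by (simp add: sg'_def)
 ultimately have R1': "R1 s' sg'" using 1(1) fr(1,2) exec_bounded_ram[OF 3(1) b'] by (simp add: R1_def)
 define ts' where "ts' = ts(|wa := (wa ts)(0 := (%i. mem s' (24 * i) mod N)), tm := tm ts + (5 * nat \<lceil>T\<rceil> + 1)|)"
 have PR': "PR sg' ts'" using 1(2) by (auto simp: PR_def ts'_def sg'_def intro!: ext)
 have "Q ts'"
 proof (rule Q)
  fix i assume "i < length ys"
  then show "wa ts' 0 i mod 2 ^ w' = ys ! i"
   using 2(3) 3(3) w(2) by (simp add: ts'_def mod_mod_cancel simrel_def)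
 qed (auto simp: ts'_def)
 moreover have "1 + t' + U2 * tm ts <= U2 * tm ts'"
 proof -
  have "1 + t' <= 1 * (5 * nat \<lceil>T\<rceil> + 1)" using order_trans[OF 3(2) mult_le_mono2[OF t0]] by simp
  also have "\<dots> <= U2 * (5 * nat \<lceil>T\<rceil> + 1)" by (rule mult_le_mono1) (simp add: U2_def sz1_def)
  finally show ?thesis by (simp add: ts'_def algebra_simps)
 qed
 moreover have "exec w (callp x P) s (1 + t') s'" unfolding callp_def by (rule exec.Seq[OF e1 3(1)])
 ultimately show "\<exists>t s' sg'. exec w (callp x P) s t s' & R2 s' sg' & t + U2 * tm ts <= U2 * tm sg' & Q sg'"
  using R1' PR' unfolding R2_def by blast
qed

end

section \<open>Rounding a monotone matrix to piecewise constant rows\<close>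

text \<open>The combinatorial core, free of machine details. Entries are natural numbers: later,
  codes in which infinity is an ordinary large value.\<close>

locale pieces =
 fixes A B :: "nat => nat => nat" and p q r \<Delta> :: nat
 assumes D0: "0 < \<Delta>" and q0: "0 < q" and r0: "0 < r"
  and mono: "!!k j j'. k < q ==> j <= j' ==> j' < r ==> B k j <= B k j'"
begin

text \<open>The start of the piece that contains column \<open>j\<close>. Opening pieces greedily
  keeps the values at distinct starts of a row at least \<open>\<Delta>\<close> apart, which is what
  limits their number.\<close>

fun stt :: "nat => nat => nat" where
 "stt k 0 = 0"
| "stt k (Suc j) = (if B k (stt k j) + \<Delta> <= B k (Suc j) then Suc j else stt k j)"

lemma stt_le: "stt k j <= j"
 by (induction j) auto

lemma stt_idem: "stt k (stt k j) = stt k j"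
 by (induction j) auto

lemma stt_mono: "j <= j' ==> stt k j <= stt k j'"
proof (induction j' rule: dec_induct)
 case (step n)
 then show ?case using stt_le[of k n] by auto
qed simp

lemma stt_between: "stt k j <= j' ==> j' <= j ==> stt k j' = stt k j"
 using stt_mono[of "stt k j" j' k] stt_mono[of j' j k] stt_idem by simp

definition bp :: "nat => nat => nat" where "bp k j = B k (stt k j)"

lemma bp_le: "k < q ==> j < r ==> bp k j <= B k j"
 unfolding bp_def using stt_le mono by blast

lemma bp_gt: "B k j < bp k j + \<Delta>"
 unfolding bp_def using D0 by (cases j) auto

lemma bp_mono: "k < q ==> j <= j' ==> j' < r ==> bp k j <= bp k j'"
 unfolding bp_def using stt_mono stt_le mono by (meson le_less_trans)

definition starts :: "nat => nat set" where "starts k = {j. j < r & stt k j = j}"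

definition en :: "nat => nat => nat" where "en k s = Suc (Max {j. j < r & stt k j = s})"

lemma finite_starts [simp]: "finite (starts k)" by (simp add: starts_def)

lemma zero_start: "0 \<in> starts k" using r0 by (simp add: starts_def)

text \<open>The fibres of \<open>stt k\<close> are intervals because the function is monotone and
  idempotent. The last two claims allow a loop to go from one start to the next by jumping to
  \<open>en k s\<close>.\<close>

lemma piece: assumes "s \<in> starts k"
 shows "{j. j < r & stt k j = s} = {s..<en k s}" "s < en k s" "en k s <= r" "en k s < r ==> en k s \<in> starts k"
  "{s' \<in> starts k. s' < en k s} = insert s {s' \<in> starts k. s' < s}"
proof -
 let ?J = "{j. j < r & stt k j = s}"
 have s: "s < r" "stt k s = s" using assms by (auto simp: starts_def)
 have fin: "finite ?J" "s \<in> ?J" using s by auto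
 have mx: "Max ?J \<in> ?J" using fin by (intro Max_in) auto
 have sM: "s <= Max ?J" using fin by simp
 have iff: "j \<in> ?J \<longleftrightarrow> s <= j & j <= Max ?J" for j
 proof
  assume "j \<in> ?J"
  then show "s <= j & j <= Max ?J" using stt_le[of k j] Max_ge[OF fin(1)] by blast
 next
  assume "s <= j & j <= Max ?J"
  then show "j \<in> ?J" using mx stt_between[of k "Max ?J" j] by (metis (mono_tags, lifting) le_less_trans mem_Collect_eq)
 qed
 show eq: "?J = {s..<en k s}" by (rule Set.set_eqI) (simp only: iff en_def atLeastLessThan_iff less_Suc_eq_le)
 show "s < en k s" using sM by (simp add: en_def)
 show "en k s <= r" using mx by (simp add: en_def Suc_leI)
 show st: "en k s \<in> starts k" if "en k s < r"
 proof -
  have 1: "stt k (Max ?J) = s" using mx by simp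
  have "en k s \<notin> ?J" unfolding eq by simp
  then have "stt k (Suc (Max ?J)) ~= s" using that by (simp add: en_def)
  then have "stt k (Suc (Max ?J)) = Suc (Max ?J)" using 1 by (auto split: if_splits)
  then show ?thesis using that by (simp add: en_def starts_def)
 qed
 show "{s' \<in> starts k. s' < en k s} = insert s {s' \<in> starts k. s' < s}"
 proof -
  have "s' = s" if "s' \<in> starts k" "s' < en k s" "\<not> s' < s" for s'
  proof -
   have "s' \<in> ?J" unfolding eq using that by simp
   then show ?thesis using that by (auto simp: starts_def)
  qed
  then show ?thesis using assms \<open>s < en k s\<close> by force
 qed
qed

lemma stt_start: "j < r ==> stt k j \<in> starts k & stt k j <= j & j < en k (stt k j)"
proof -
 assume j: "j < r"
 have 1: "stt k j \<in> starts k" using j stt_le[of k j] stt_idem by (auto simp: starts_def)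
 have "j \<in> {stt k j..<en k (stt k j)}" unfolding piece(1)[OF 1, symmetric] using j by simp
 then show ?thesis using 1 by auto
qed

text \<open>The min-plus product with the rounded second factor; \<open>cc\<close> is the exact
  one.\<close>

definition cp :: "nat => nat => nat" where "cp i j = Min ((%k. A i k + bp k j) ` {..<q})"

definition cc :: "nat => nat => nat" where "cc i j = Min ((%k. A i k + B k j) ` {..<q})"

lemma cp_le: "k < q ==> cp i j <= A i k + bp k j"
 unfolding cp_def by (intro Min_le) auto

lemma cp_ex: "EX k<q. cp i j = A i k + bp k j"
proof -
 have "cp i j \<in> (%k. A i k + bp k j) ` {..<q}" unfolding cp_def by (rule Min_in) (use q0 in auto)
 then show ?thesis by (rule imageE) auto
qed

lemma cc_le: "k < q ==> cc i j <= A i k + B k j"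
 unfolding cc_def by (intro Min_le) auto

lemma cc_ex: "EX k<q. cc i j = A i k + B k j"
proof -
 have "cc i j \<in> (%k. A i k + B k j) ` {..<q}" unfolding cc_def by (rule Min_in) (use q0 in auto)
 then show ?thesis by (rule imageE) auto
qed

lemma cp_mono: "j <= j' ==> j' < r ==> cp i j <= cp i j'"
 using cp_ex[of i j'] cp_le bp_mono by (metis add_left_mono le_trans)

definition S :: "nat => nat => nat set" where "S i k = {j. j < r & A i k + bp k j < cp i j + \<Delta>}"

text \<open>Rounding down gives \<open>A i k + bp k j <= cc i j\<close>. The minimiser of the
  rounded sum loses less than \<open>\<Delta>\<close> when the true entry is used, so
  \<open>cc i j < cp i j + \<Delta>\<close>.\<close>

lemma cc_S: "k < q ==> j < r ==> cc i j = A i k + B k j ==> j \<in> S i k"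
proof -
 assume a: "k < q" "j < r" "cc i j = A i k + B k j"
 obtain k' where k': "k' < q" "cp i j = A i k' + bp k' j" using cp_ex by blast
 have "A i k + bp k j <= cc i j" using a bp_le[of k j] by simp
 also have "\<dots> <= A i k' + B k' j" using k' cc_le by simp
 also have "\<dots> < cp i j + \<Delta>" using k' bp_gt[of k' j] by simp
 finally show ?thesis using a by (simp add: S_def)
qed

text \<open>On a piece the rounded sum is constant and \<open>cp i\<close> is non-decreasing, so the
  alive columns are a final segment. This is its first column; inserting \<open>en k s\<close>
  covers the empty segment.\<close>

definition xx :: "nat => nat => nat => nat" where
 "xx i k s = Min (insert (en k s) {j \<in> {s..<en k s}. A i k + B k s < cp i j + \<Delta>})"

lemma xx_eqI:
 assumes "s <= x" "x <= en k s" "!!j. s <= j ==> j < x ==> \<not> A i k + B k s < cp i j + \<Delta>"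
  "x < en k s ==> A i k + B k s < cp i x + \<Delta>"
 shows "xx i k s = x"
 unfolding xx_def
proof (rule Min_eqI)
 show "x \<in> insert (en k s) {j \<in> {s..<en k s}. A i k + B k s < cp i j + \<Delta>}"
  using assms by (cases "x = en k s") auto
 fix y assume "y \<in> insert (en k s) {j \<in> {s..<en k s}. A i k + B k s < cp i j + \<Delta>}"
 then show "x <= y" using assms by (metis (no_types, lifting) atLeastLessThan_iff insertE leI mem_Collect_eq)
qed auto

lemma xx_le: "s \<in> starts k ==> s <= xx i k s & xx i k s <= en k s"
 unfolding xx_def using piece(2)[of s k] by (auto intro!: Min_le)

lemma xx_iff: assumes "s \<in> starts k" "s <= j" "j < en k s" shows "j \<in> S i k \<longleftrightarrow> xx i k s <= j"
proof -
 have "j \<in> {j. j < r & stt k j = s}" unfolding piece(1)[OF assms(1)] using assms by simp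
 then have j: "j < r" "stt k j = s" by auto
 have eq: "j \<in> S i k \<longleftrightarrow> A i k + B k s < cp i j + \<Delta>" using j by (auto simp: S_def bp_def)
 let ?X = "insert (en k s) {j \<in> {s..<en k s}. A i k + B k s < cp i j + \<Delta>}"
 show ?thesis
 proof
  assume "j \<in> S i k"
  then show "xx i k s <= j" unfolding xx_def using assms eq by (intro Min_le) auto
 next
  assume le: "xx i k s <= j"
  have "xx i k s \<in> ?X" unfolding xx_def by (intro Min_in) auto
  then have "A i k + B k s < cp i (xx i k s) + \<Delta>" using le assms(3) by auto
  also have "cp i (xx i k s) <= cp i j" using cp_mono le j by blast
  finally show "j \<in> S i k" using eq by simp
 qed
qed

text \<open>Difference arrays of a pair: \<open>dp\<close> counts the alive segments that open at a
  column, \<open>dm\<close> those that close there. An empty segment opens and closes at the same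
  column and cancels.\<close>

definition dp :: "nat => nat => nat => nat" where "dp i k x = card {s \<in> starts k. xx i k s = x}"
definition dm :: "nat => nat => nat" where "dm k x = card {s \<in> starts k. en k s = x}"

lemma sum_card_eq: "finite T ==> (\<Sum>x\<le>j. card {s \<in> T. f s = x}) = card {s \<in> T. f s <= (j::nat)}"
proof -
 assume T: "finite T"
 have "card (\<Union>x\<in>{..j}. {s \<in> T. f s = x}) = (\<Sum>x\<le>j. card {s \<in> T. f s = x})"
  using T by (intro card_UN_disjoint) auto
 moreover have "(\<Union>x\<in>{..j}. {s \<in> T. f s = x}) = {s \<in> T. f s <= j}" by auto
 ultimately show ?thesis by simp
qed

text \<open>Only the segment in the piece of \<open>j\<close> can be open at column
  \<open>j\<close>; all others that have opened by then have also closed.\<close>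

lemma count_S:
 assumes "j < r"
 shows "(\<Sum>x\<le>j. dp i k x) = (\<Sum>x\<le>j. dm k x) + (if j \<in> S i k then 1 else 0)"
proof -
 let ?X = "{s \<in> starts k. xx i k s <= j}" and ?E = "{s \<in> starts k. en k s <= j}"
 have sub: "?E \<subseteq> ?X" using xx_le by (auto intro: le_trans)
 have "?X - ?E = (if j \<in> S i k then {stt k j} else {})"
 proof -
  have "s = stt k j & j \<in> S i k" if "s \<in> ?X - ?E" for s
  proof -
   have s: "s \<in> starts k" "xx i k s <= j" "j < en k s" using that by auto
   then have "s <= j" using xx_le[of s k i] by simp
   then have "j \<in> {j. j < r & stt k j = s}" unfolding piece(1)[OF s(1)] using s by simp
   then show ?thesis using xx_iff[OF s(1) \<open>s <= j\<close> s(3), of i] s by auto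
  qed
  moreover have "stt k j \<in> ?X - ?E" if "j \<in> S i k"
   using stt_start[OF assms, of k] that xx_iff[of "stt k j" k j i] by auto
  ultimately show ?thesis by auto
 qed
 moreover have "card ?X = card ?E + card (?X - ?E)"
  using card_Diff_subset[OF _ sub] card_mono[OF _ sub] by simp
 ultimately have "card ?X = card ?E + (if j \<in> S i k then 1 else 0)" by auto
 then show ?thesis unfolding dp_def dm_def by (simp add: sum_card_eq)
qed

lemma S_partition:
 shows "S i k = (\<Union>s\<in>starts k. {xx i k s..<en k s})"
proof -
 have "j \<in> S i k \<longleftrightarrow> (\<exists>s\<in>starts k. xx i k s <= j & j < en k s)" for j
 proof
  assume "j \<in> S i k"
  moreover from this have "j < r" by (simp add: S_def)
  ultimately show "\<exists>s\<in>starts k. xx i k s <= j & j < en k s" using stt_start[of j k] xx_iff[of "stt k j" k j i] by auto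
 next
  assume "\<exists>s\<in>starts k. xx i k s <= j & j < en k s"
  then obtain s where s: "s \<in> starts k" "xx i k s <= j" "j < en k s" by auto
  then have "s <= j" using xx_le[of s k i] by simp
  then show "j \<in> S i k" using xx_iff[OF s(1) _ s(3), of i] s by auto
 qed
 then show ?thesis by auto
qed

text \<open>Used to charge the walk through the segments of a pair to the alive triples of that
  pair.\<close>

lemma card_S: "(\<Sum>s\<in>starts k. en k s - xx i k s) = card (S i k)"
proof -
 have "{xx i k s..<en k s} \<inter> {xx i k s'..<en k s'} = {}" if "s \<in> starts k" "s' \<in> starts k" "s ~= s'" for s s'
 proof -
  have "{s..<en k s} \<inter> {s'..<en k s'} = {}"
   unfolding piece(1)[OF that(1), symmetric] piece(1)[OF that(2), symmetric] using that(3) by auto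
  moreover have "{xx i k s..<en k s} \<subseteq> {s..<en k s}" "{xx i k s'..<en k s'} \<subseteq> {s'..<en k s'}"
   using xx_le[OF that(1), of i] xx_le[OF that(2), of i] by auto
  ultimately show ?thesis by blast
 qed
 then have "card (\<Union>s\<in>starts k. {xx i k s..<en k s}) = (\<Sum>s\<in>starts k. card {xx i k s..<en k s})"
  by (intro card_UN_disjoint) auto
 then show ?thesis by (simp add: S_partition)
qed

lemma starts_gap: assumes "s \<in> starts k" "s' \<in> starts k" "s < s'" "k < q" shows "B k s + \<Delta> <= B k s'"
proof -
 obtain j where j: "s' = Suc j" using assms(3) by (cases s') auto
 have "stt k (Suc j) = Suc j" using assms j by (simp add: starts_def)
 then have 1: "B k (stt k j) + \<Delta> <= B k s'" using stt_le[of k j] j by (auto split: if_splits)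
 have "s <= stt k j" using stt_mono[of s j k] assms j by (simp add: starts_def)
 then have "B k s <= B k (stt k j)" using assms stt_le[of k j] j by (intro mono) (auto simp: starts_def)
 with 1 show ?thesis by simp
qed

text \<open>Starts with values up to \<open>R\<close> above the first entry fall into distinct
  blocks of length \<open>\<Delta>\<close>, which gives \<open>R div \<Delta> + 1\<close>. One more
  piece is due to the value \<open>c\<close>, later the code of infinity, which may lie far above
  the finite entries.\<close>

lemma card_starts:
 assumes "k < q" "!!j. j < r ==> B k j <= B k 0 + R \<or> B k j = c"
 shows "card (starts k) <= R div \<Delta> + 2"
proof -
 let ?F = "{s \<in> starts k. B k s <= B k 0 + R}" and ?G = "{s \<in> starts k. B k s = c}"
 have inj: "inj_on (%s. (B k s - B k 0) div \<Delta>) ?F"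
 proof (rule linorder_inj_onI')
  fix s s' assume s: "s \<in> ?F" "s' \<in> ?F" "s < s'"
  then have "B k s + \<Delta> <= B k s'" using starts_gap assms(1) by auto
  moreover have "B k 0 <= B k s" using s assms(1) mono[of k 0 s] by (auto simp: starts_def)
  ultimately have "(B k s - B k 0) + \<Delta> <= B k s' - B k 0" by simp
  then have "((B k s - B k 0) + \<Delta>) div \<Delta> <= (B k s' - B k 0) div \<Delta>" by (rule div_le_mono)
  then show "(B k s - B k 0) div \<Delta> ~= (B k s' - B k 0) div \<Delta>" using D0 by simp
 qed
 have "(%s. (B k s - B k 0) div \<Delta>) ` ?F \<subseteq> {..R div \<Delta>}" by (auto intro: div_le_mono)
 then have F: "card ?F <= R div \<Delta> + 1"
  using card_mono[of "{..R div \<Delta>}" "(%s. (B k s - B k 0) div \<Delta>) ` ?F"] card_image[OF inj] by simp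
 have "s = s'" if "s \<in> ?G" "s' \<in> ?G" for s s'
  using that starts_gap[of s k s'] starts_gap[of s' k s] assms(1) D0 by (cases s s' rule: linorder_cases) auto
 then have G: "card ?G <= 1" by (auto simp: card_le_Suc0_iff_eq)
 have "starts k \<subseteq> ?F \<union> ?G" using assms(2) by (auto simp: starts_def)
 then have "card (starts k) <= card (?F \<union> ?G)" by (intro card_mono) auto
 also have "\<dots> <= card ?F + card ?G" by (rule card_Un_le)
 finally show ?thesis using F G by simp
qed

end

section \<open>Encoded matrices\<close>

definition tag :: "int extended => nat" where
 "tag x = (case x of Fin z => if z < 0 then 1 else 0 | _ => 2)"

definition mag :: "int extended => nat" where
 "mag x = (case x of Fin z => nat \<bar>z\<bar> | _ => 0)"

lemma tag_mag_simps [simp]: "tag Pinf = 2" "mag Pinf = 0" "tag (Fin z) = (if z < 0 then 1 else 0)" "mag (Fin z) = nat \<bar>z\<bar>"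
 by (simp_all add: tag_def mag_def)

lemma encode_entry_eq:
 "encode_entry d n x = tag x # map (%i. mag x div (2 ^ floorlog 2 n) ^ i mod 2 ^ floorlog 2 n) [0..<entry_bits d n + 1]"
 unfolding encode_entry_def Let_def
 by (cases x) (simp_all add: tag_def mag_def power_mult map_replicate_const del: upt_Suc)

text \<open>Contents are given by a function and not a list, so that the predicate applies alike to
  machine memory, to an abstract array and to values reduced modulo a word length.\<close>

definition entry_at :: "nat => nat => (nat => nat) => nat => int extended => bool" where
 "entry_at b L f pos x \<longleftrightarrow> f pos = tag x & (ALL l<L. f (pos + 1 + l) = mag x div (2 ^ b) ^ l mod 2 ^ b)"

lemma entry_at_encode:
 "entry_at (floorlog 2 n) (entry_bits d n + 1) f pos x \<longleftrightarrow>
  (ALL l<entry_bits d n + 2. f (pos + l) = encode_entry d n x ! l)"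
proof -
 have "(ALL l<entry_bits d n + 2. f (pos + l) = encode_entry d n x ! l) \<longleftrightarrow>
   f pos = encode_entry d n x ! 0 & (ALL l<entry_bits d n + 1. f (pos + Suc l) = encode_entry d n x ! Suc l)"
  using All_less_Suc2[of "entry_bits d n + 1" "%l. f (pos + l) = encode_entry d n x ! l"] by simp
 then show ?thesis unfolding entry_at_def encode_entry_eq by (simp del: upt_Suc)
qed

lemma all_nth_append:
 "(ALL i<length (xs @ ys). f i = (xs @ ys) ! i) \<longleftrightarrow>
  (ALL i<length xs. f i = xs ! i) & (ALL i<length ys. f (length xs + i) = ys ! i)"
proof -
 have "f i = (xs @ ys) ! i" if "ALL i<length xs. f i = xs ! i" "ALL i<length ys. f (length xs + i) = ys ! i" "i < length (xs @ ys)" for i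
  using that(1,3) that(2)[rule_format, of "i - length xs"] by (cases "i < length xs") (auto simp: nth_append)
 moreover have "f (length xs + i) = ys ! i" if "ALL i<length (xs @ ys). f i = (xs @ ys) ! i" "i < length ys" for i
  using that(1)[rule_format, of "length xs + i"] that(2) by simp
 moreover have "f i = xs ! i" if "ALL i<length (xs @ ys). f i = (xs @ ys) ! i" "i < length xs" for i
  using that(1)[rule_format, of i] that(2) by (simp add: nth_append)
 ultimately show ?thesis by blast
qed

lemma concat_nth:
 assumes "!!ys. ys \<in> set xss ==> length ys = c"
 shows "(ALL i<length (concat xss). f i = concat xss ! i) \<longleftrightarrow> (ALL t<length xss. ALL l<c. f (t * c + l) = xss ! t ! l)"
 using assms
proof (induction xss arbitrary: f)
 case (Cons ys xss)
 have "(ALL i<length (concat (ys # xss)). f i = concat (ys # xss) ! i) \<longleftrightarrow>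
  (ALL i<c. f i = ys ! i) & (ALL i<length (concat xss). f (c + i) = concat xss ! i)"
  using all_nth_append[of ys "concat xss" f] Cons.prems[of ys] by simp
 also have "\<dots> \<longleftrightarrow> (ALL i<c. f i = ys ! i) & (ALL t<length xss. ALL l<c. f (c + (t * c + l)) = xss ! t ! l)"
  using Cons.IH[of "%i. f (c + i)"] Cons.prems by simp
 also have "\<dots> \<longleftrightarrow> (ALL t<Suc (length xss). ALL l<c. f (t * c + l) = (ys # xss) ! t ! l)"
  by (simp only: All_less_Suc2) (simp add: add.assoc)
 finally show ?case by simp
qed simp

lemma length_concat_uniform: "(!!ys. ys \<in> set xss ==> length ys = c) ==> length (concat xss) = length xss * c"
 by (induction xss) auto

lemma concat_map_upt:
 "concat (map (%i. map (g i) [0..<c]) [0..<r]) = map (%t. g (t div c) (t mod c)) [0..<r * c]" (is "?l = ?r")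
proof (rule nth_equalityI)
 show len: "length ?l = length ?r" by (subst length_concat_uniform[where c = c]) auto
 fix i assume "i < length ?l"
 then have i: "i < r * c" using len by simp
 then have c: "c > 0" by (cases c) auto
 have "(ALL i<length ?l. ?l ! i = ?l ! i) \<longleftrightarrow> (ALL t<length (map (%i. map (g i) [0..<c]) [0..<r]). ALL l<c. ?l ! (t * c + l) = map (%i. map (g i) [0..<c]) [0..<r] ! t ! l)"
  by (rule concat_nth) auto
 then have *: "ALL t<r. ALL l<c. ?l ! (t * c + l) = map (%i. map (g i) [0..<c]) [0..<r] ! t ! l" by simp
 have "i div c < r" using i by (simp add: less_mult_imp_div_less)
 moreover have "i mod c < c" using c by simp
 ultimately show "?l ! i = ?r ! i" using *[rule_format, of "i div c" "i mod c"] i by simp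
qed

lemma encode_mat_eq:
 "encode_mat d n A = concat (map (%t. encode_entry d n (A $$ (t div dim_col A, t mod dim_col A))) [0..<dim_row A * dim_col A])"
 unfolding encode_mat_def by (simp only: concat_map_upt[where g = "%i j. encode_entry d n (A $$ (i, j))"])

lemma length_encode_entry: "length (encode_entry d n x) = entry_bits d n + 2"
 by (simp add: encode_entry_eq del: upt_Suc)

lemma length_encode_mat: "length (encode_mat d n A) = dim_row A * dim_col A * (entry_bits d n + 2)"
 unfolding encode_mat_eq by (subst length_concat_uniform[where c = "entry_bits d n + 2"]) (auto simp: length_encode_entry)

lemma encode_mat_at:
 "(ALL i<length (encode_mat d n A). f (off + i) = encode_mat d n A ! i) \<longleftrightarrow>
  (ALL t<dim_row A * dim_col A. entry_at (floorlog 2 n) (entry_bits d n + 1) f (off + t * (entry_bits d n + 2))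
   (A $$ (t div dim_col A, t mod dim_col A)))"
 unfolding encode_mat_eq entry_at_encode
 by (subst concat_nth[where c = "entry_bits d n + 2" and f = "%i. f (off + i)"])
  (auto simp: length_encode_entry add.assoc)

text \<open>Translates the list format into address arithmetic: a header of four words, then equal
  blocks in row-major order whose numbering runs on from the first matrix to the second.\<close>

lemma encode_instance_at:
 "(ALL i<length (encode_instance d n A B). f i = encode_instance d n A B ! i) \<longleftrightarrow>
  f 0 = n & f 1 = dim_row A & f 2 = dim_col A & f 3 = dim_col B &
  (ALL t<dim_row A * dim_col A. entry_at (floorlog 2 n) (entry_bits d n + 1) f (4 + t * (entry_bits d n + 2))
   (A $$ (t div dim_col A, t mod dim_col A))) &
  (ALL t<dim_row B * dim_col B. entry_at (floorlog 2 n) (entry_bits d n + 1) f (4 + (dim_row A * dim_col A + t) * (entry_bits d n + 2))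
   (B $$ (t div dim_col B, t mod dim_col B)))"
proof -
 have 4: "(ALL i<length [a, b, c, e]. f i = [a, b, c, e] ! i) \<longleftrightarrow> f 0 = a & f 1 = b & f 2 = c & f 3 = e" for a b c e :: nat
  by (auto simp: All_less_Suc2 numeral_eq_Suc)
 have "(ALL i<length (encode_instance d n A B). f i = encode_instance d n A B ! i) \<longleftrightarrow>
   (f 0 = n & f 1 = dim_row A & f 2 = dim_col A & f 3 = dim_col B) &
   (ALL i<length (encode_mat d n A). f (4 + i) = encode_mat d n A ! i) &
   (ALL i<length (encode_mat d n B). f (4 + length (encode_mat d n A) + i) = encode_mat d n B ! i)"
  unfolding encode_instance_def
  by (subst all_nth_append, subst 4, subst all_nth_append[where f = "%i. f (length [n, dim_row A, dim_col A, dim_col B] + i)"])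
   (simp add: add.assoc numeral_eq_Suc)
 then show ?thesis unfolding encode_mat_at by (simp only: length_encode_mat add.assoc conj_assoc distrib_right)
qed

lemma length_encode_instance:
 "length (encode_instance d n A B) = 4 + (dim_row A * dim_col A + dim_row B * dim_col B) * (entry_bits d n + 2)"
 by (simp add: encode_instance_def length_encode_mat algebra_simps)

section \<open>Lower bounds\<close>

lemma ram_upd_swap: "s(|mem := m, regs := r|) = s(|regs := r, mem := m|)" for s :: ram
 by (cases s) simp

text \<open>A run of \<open>t\<close> steps accesses at most \<open>t\<close> cells; a change
  elsewhere is invisible to it and survives it. This is the adversary principle for both lower
  bounds.\<close>

lemma exec_touched:
 "exec w P s t s' ==> EX T. finite T & card T <= t & (ALL a. a \<notin> T --> mem s' a = mem s a) &
   (\<forall>a v. a \<notin> T --> exec w P (s(|mem := (mem s)(a := v)|)) t (s'(|mem := (mem s')(a := v)|)))"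
proof (induction rule: exec.induct)
 case (Const r k s)
 have "exec w (Const r k) (s(|mem := (mem s)(a := v)|)) 1 (s(|regs := (regs s)(r := k mod 2 ^ w), mem := (mem s)(a := v)|))" for a v
  using exec.Const[of w r k "s(|mem := (mem s)(a := v)|)"] by (simp add: ram_upd_swap)
 then show ?case by (intro exI[of _ "{}"] conjI allI impI) (simp_all add: fun_upd_other del: fun_upd_apply)
next
 case (Op f r x y s)
 have "exec w (Op f r x y) (s(|mem := (mem s)(a := v)|)) 1
   (s(|regs := (regs s)(r := binop_word w f (regs s x) (regs s y)), mem := (mem s)(a := v)|))" for a v
  using exec.Op[of w f r x y "s(|mem := (mem s)(a := v)|)"] by (simp add: ram_upd_swap)
 then show ?case by (intro exI[of _ "{}"] conjI allI impI) (simp_all add: fun_upd_other del: fun_upd_apply)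
next
 case (Load r x s)
 have "exec w (Load r x) (s(|mem := (mem s)(a := v)|)) 1
   (s(|regs := (regs s)(r := mem s (regs s x)), mem := (mem s)(a := v)|))" if "a ~= regs s x" for a v
  using exec.Load[of w r x "s(|mem := (mem s)(a := v)|)"] that by (simp add: ram_upd_swap)
 then show ?case by (intro exI[of _ "{regs s x}"] conjI allI impI) (simp_all add: fun_upd_other del: fun_upd_apply)
next
 case (Store x r s)
 have "exec w (Store x r) (s(|mem := (mem s)(a := v)|)) 1
   (s(|mem := (mem s)(regs s x := regs s r, a := v)|))" if "a ~= regs s x" for a v
  using exec.Store[of w x r "s(|mem := (mem s)(a := v)|)"] that by (simp add: fun_upd_twist)
 then show ?case by (intro exI[of _ "{regs s x}"] conjI allI impI) (simp_all add: fun_upd_other del: fun_upd_apply)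
next
 case (Seq P s t s' Q u s'')
 from Seq.IH(1) obtain T where T: "finite T" "card T <= t" "ALL a. a \<notin> T --> mem s' a = mem s a"
   "!!a v. a \<notin> T ==> exec w P (s(|mem := (mem s)(a := v)|)) t (s'(|mem := (mem s')(a := v)|))" by blast
 from Seq.IH(2) obtain T' where T': "finite T'" "card T' <= u" "ALL a. a \<notin> T' --> mem s'' a = mem s' a"
   "!!a v. a \<notin> T' ==> exec w Q (s'(|mem := (mem s')(a := v)|)) u (s''(|mem := (mem s'')(a := v)|))" by blast
 have "card (T \<union> T') <= t + u" using card_Un_le[of T T'] T(2) T'(2) by linarith
 moreover have "exec w (Seq P Q) (s(|mem := (mem s)(a := v)|)) (t + u) (s''(|mem := (mem s'')(a := v)|))" if "a \<notin> T \<union> T'" for a v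
  by (rule exec.Seq[OF T(4) T'(4)]) (use that in auto)
 ultimately show ?case using T T' by (intro exI[of _ "T \<union> T'"]) (auto simp del: fun_upd_apply)
next
 case (IfTrue s r P t s' Q)
 from IfTrue.IH obtain T where T: "finite T" "card T <= t" "ALL a. a \<notin> T --> mem s' a = mem s a"
   "!!a v. a \<notin> T ==> exec w P (s(|mem := (mem s)(a := v)|)) t (s'(|mem := (mem s')(a := v)|))" by blast
 have "exec w (IfNZ r P Q) (s(|mem := (mem s)(a := v)|)) (1 + t) (s'(|mem := (mem s')(a := v)|))" if "a \<notin> T" for a v
  by (rule exec.IfTrue[OF _ T(4)[OF that]]) (use IfTrue in simp)
 then show ?case using T by (intro exI[of _ T]) (auto simp del: fun_upd_apply)
next
 case (IfFalse s r Q t s' P)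
 from IfFalse.IH obtain T where T: "finite T" "card T <= t" "ALL a. a \<notin> T --> mem s' a = mem s a"
   "!!a v. a \<notin> T ==> exec w Q (s(|mem := (mem s)(a := v)|)) t (s'(|mem := (mem s')(a := v)|))" by blast
 have "exec w (IfNZ r P Q) (s(|mem := (mem s)(a := v)|)) (1 + t) (s'(|mem := (mem s')(a := v)|))" if "a \<notin> T" for a v
  by (rule exec.IfFalse[OF _ T(4)[OF that]]) (use IfFalse in simp)
 then show ?case using T by (intro exI[of _ T]) (auto simp del: fun_upd_apply)
next
 case (WhileFalse s r P)
 have "exec w (WhileNZ r P) (s(|mem := (mem s)(a := v)|)) 1 (s(|mem := (mem s)(a := v)|))" for a v
  by (rule exec.WhileFalse) (use WhileFalse in simp)
 then show ?case by (intro exI[of _ "{}"] conjI allI impI) (simp_all add: fun_upd_other del: fun_upd_apply)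
next
 case (WhileTrue s r P t s' u s'')
 from WhileTrue.IH(1) obtain T where T: "finite T" "card T <= t" "ALL a. a \<notin> T --> mem s' a = mem s a"
   "!!a v. a \<notin> T ==> exec w P (s(|mem := (mem s)(a := v)|)) t (s'(|mem := (mem s')(a := v)|))" by blast
 from WhileTrue.IH(2) obtain T' where T': "finite T'" "card T' <= u" "ALL a. a \<notin> T' --> mem s'' a = mem s' a"
   "!!a v. a \<notin> T' ==> exec w (WhileNZ r P) (s'(|mem := (mem s')(a := v)|)) u (s''(|mem := (mem s'')(a := v)|))" by blast
 have "card (T \<union> T') <= 1 + t + u" using card_Un_le[of T T'] T(2) T'(2) by linarith
 moreover have "exec w (WhileNZ r P) (s(|mem := (mem s)(a := v)|)) (1 + t + u) (s''(|mem := (mem s'')(a := v)|))" if "a \<notin> T \<union> T'" for a v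
  by (rule exec.WhileTrue[OF _ T(4) T'(4)]) (use WhileTrue that in auto)
 ultimately show ?case using T T' by (intro exI[of _ "T \<union> T'"]) (auto simp del: fun_upd_apply)
qed

lemma powr_le_imp_exponent_le:
 assumes "!!n. n \<ge> 2 ==> real n powr a <= K * real n powr b"
 shows "a <= b"
proof (rule ccontr)
 assume "\<not> a <= b"
 then have ab: "a - b > 0" by simp
 define C where "C = max K 1 + 1"
 \<comment> \<open>Large enough that \<open>n powr (a - b)\<close> exceeds \<open>K\<close>; the
   added 2 meets the hypothesis on \<open>n\<close>.\<close>
 define n where "n = nat \<lceil>C powr (1 / (a - b))\<rceil> + 2"
 have C: "C > K" "C > 0" by (auto simp: C_def)
 have n2: "n \<ge> 2" by (simp add: n_def)
 have "real n \<ge> C powr (1 / (a - b))" unfolding n_def by linarith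
 then have "real n powr (a - b) \<ge> (C powr (1 / (a - b))) powr (a - b)" using ab by (intro powr_mono2) auto
 also have "(C powr (1 / (a - b))) powr (a - b) = C" using C ab by (simp add: powr_powr)
 finally have "real n powr (a - b) > K" using C by simp
 then have "real n powr (a - b) * real n powr b > K * real n powr b" using n2 by simp
 then have "real n powr a > K * real n powr b" by (simp add: powr_add[symmetric])
 then show False using assms[OF n2] by simp
qed

lemma floor_powr_bounds:
 assumes "n \<ge> 1" "\<beta> \<ge> 0"
 shows "1 <= nat \<lfloor>real n powr \<beta>\<rfloor>" "real (nat \<lfloor>real n powr \<beta>\<rfloor>) <= real n powr \<beta>" "real n powr \<beta> <= 2 * real (nat \<lfloor>real n powr \<beta>\<rfloor>)"
proof -
 have 1: "1 <= real n powr \<beta>" using assms by (simp add: ge_one_powr_ge_zero)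
 then have "1 <= \<lfloor>real n powr \<beta>\<rfloor>" by simp
 then show "1 <= nat \<lfloor>real n powr \<beta>\<rfloor>" by linarith
 show "real (nat \<lfloor>real n powr \<beta>\<rfloor>) <= real n powr \<beta>" using 1 by linarith
 show "real n powr \<beta> <= 2 * real (nat \<lfloor>real n powr \<beta>\<rfloor>)" using 1 \<open>1 <= \<lfloor>real n powr \<beta>\<rfloor>\<close> by linarith
qed

text \<open>Adversary argument on an infinite first factor and a zero second one. Turning one entry
  of the first factor into 0 changes a whole output row, so every input tag of that factor must be
  accessed. Every output tag except the one in cell 0 differs from the initial content of its cell,
  so that cell must be accessed too; the exception explains \<open>T + 1\<close>.\<close>

lemma product_time_lower:
 fixes n :: nat
 assumes n: "n \<ge> 2" and q: "q \<ge> 1"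
  and prob: "!!f. (!!x. f x \<in> {Pinf, Fin 0}) ==> computes_within w P (encode_instance 3 n (mat n q f) (mat q n (%_. Fin 0)))
    (encode_mat 3 n (min_plus (mat n q f) (mat q n (%_. Fin 0)))) T"
 shows "real (n * q) <= T" "real (n * n) <= T + 1"
proof -
 define l b where lb: "l = entry_bits 3 n + 2" "b = floorlog 2 n"
 have "b \<ge> 1" using n by (simp add: lb floorlog_def)
 then have "b ^ 3 \<ge> 1" by simp
 \<comment> \<open>The parameter 3 makes blocks at least 5 words long. Hence \<open>l\<close> does
   not divide the header length 4, and output tags never lie on input tags.\<close>
 then have l5: "l \<ge> 5" unfolding lb(1) entry_bits_def lb(2)[symmetric] by linarith
 have l1: "entry_bits 3 n + 1 = l - 1" "entry_bits 3 n + 2 = l" by (auto simp: lb)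
 let ?A = "%f. mat n q f :: matrix" and ?B = "mat q n (%_. Fin 0) :: matrix"
 have mp: "min_plus (?A f) ?B $$ (i, j) = Min ((%k. f (i, k) + Fin 0) ` {..<q})" if "i < n" "j < n" for f i j
 proof -
  have "(%k. ?A f $$ (i, k) + ?B $$ (k, j)) ` {..<q} = (%k. f (i, k) + Fin 0) ` {..<q}"
   using that by (intro image_cong) auto
  then show ?thesis using that by (simp add: min_plus_def)
 qed
 have mp0: "min_plus (?A (%_. Pinf)) ?B $$ (i, j) = Pinf" if "i < n" "j < n" for i j
 proof -
  have "{..<q} ~= {}" using q by (simp add: lessThan_empty_iff)
  then show ?thesis unfolding mp[OF that] by (simp add: image_constant_conv)
 qed
 define xs ys where xy: "xs = encode_instance 3 n (?A (%_. Pinf)) ?B" "ys = encode_mat 3 n (min_plus (?A (%_. Pinf)) ?B)"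
 have cw: "computes_within w P xs ys T" unfolding xy by (rule prob) simp
 define m0 where "m0 i = (if i < length xs then xs ! i else 0)" for i
 define s0 where "s0 = (|regs = (%_. 0), mem = m0|)"
 have "regs s0 r < 2 ^ w" "mem s0 a < 2 ^ w" for r a
  using cw by (auto simp: s0_def m0_def computes_within_def)
 moreover have "mem s0 i = xs ! i" if "i < length xs" for i using that by (simp add: s0_def m0_def)
 ultimately obtain tt s' where ex: "exec w P s0 tt s'" "real tt <= T" "ALL i<length ys. mem s' i = ys ! i"
  using cw unfolding computes_within_def by blast
 from exec_touched[OF ex(1)] obtain Tc where Tc: "finite Tc" "card Tc <= tt" "!!a. a \<notin> Tc ==> mem s' a = mem s0 a"
  "!!a v. a \<notin> Tc ==> exec w P (s0(|mem := (mem s0)(a := v)|)) tt (s'(|mem := (mem s')(a := v)|))" by blast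
 have dims: "dim_row (min_plus (?A f) ?B) = n" "dim_col (min_plus (?A f) ?B) = n" for f by (auto simp: min_plus_def)
 have nn: "0 < n" using n by simp
 have out: "mem s' (y * l) = 2" if "y < n * n" for y
 proof -
  have "entry_at b (l - 1) (mem s') (0 + y * l) (min_plus (?A (%_. Pinf)) ?B $$ (y div n, y mod n))"
  proof -
   have "ALL i<length ys. mem s' (0 + i) = ys ! i" using ex(3) by simp
   then show ?thesis unfolding xy(2) encode_mat_at dims l1 lb(2)[symmetric] using that by blast
  qed
  then show ?thesis using mp0[of "y div n" "y mod n"] nn that by (simp add: entry_at_def less_mult_imp_div_less)
 qed
 have "(ALL i<length xs. m0 i = xs ! i)" by (simp add: m0_def)
 then have inst0: "m0 0 = n" "m0 1 = n" "m0 2 = q" "m0 3 = n"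
  "!!t. t < n * q ==> entry_at b (l - 1) m0 (4 + t * l) Pinf"
  "!!t. t < q * n ==> entry_at b (l - 1) m0 (4 + (n * q + t) * l) (Fin 0)"
  unfolding xy(1) encode_instance_at l1 lb(2)[symmetric] using nn q
  by (auto simp: less_mult_imp_div_less)
 have lpos: "l > 0" using l5 by simp
 have tags: "4 + t * l \<in> Tc" if t: "t < n * q" for t
 proof (rule ccontr)
  let ?a = "4 + t * l"
  assume na: "?a \<notin> Tc"
  define f where "f = (%(i, k). if i * q + k = t then Fin 0 else Pinf :: int extended)"
  define xs1 ys1 where xy1: "xs1 = encode_instance 3 n (?A f) ?B" "ys1 = encode_mat 3 n (min_plus (?A f) ?B)"
  have cw1: "computes_within w P xs1 ys1 T" unfolding xy1 by (rule prob) (auto simp: f_def split: prod.split)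
  \<comment> \<open>Tag 0 with zero digits encodes 0, so overwriting this single cell turns one
    infinite entry into 0.\<close>
  define m1 where "m1 = m0(?a := 0)"
  have other: "m1 (4 + t' * l + l') = m0 (4 + t' * l + l')" if "l' < l" "t' ~= t \<or> l' ~= 0" for t' l'
  proof -
   have "t' * l + l' ~= t * l"
   proof
    assume e: "t' * l + l' = t * l"
    then have "(t' * l + l') div l = t" "(t' * l + l') mod l = 0" using lpos by simp_all
    then show False using that lpos by simp
   qed
   then show ?thesis by (simp add: m1_def)
  qed
  have e: "entry_at b (l - 1) m1 (4 + t' * l) x \<longleftrightarrow> entry_at b (l - 1) m0 (4 + t' * l) x" if "t' ~= t" for t' x
  proof -
   have "m1 (4 + t' * l + 1 + l') = m0 (4 + t' * l + 1 + l')" if "l' < l - 1" for l'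
    using other[of "Suc l'" t'] that by (simp add: add.assoc)
   then show ?thesis using other[of 0 t'] that lpos unfolding entry_at_def by simp
  qed
  have ft: "?A f $$ (t' div q, t' mod q) = (if t' = t then Fin 0 else Pinf)" if "t' < n * q" for t'
   using that q by (auto simp: f_def less_mult_imp_div_less)
  have et: "entry_at b (l - 1) m1 (4 + t * l) (Fin 0)"
  proof -
   have "m1 (4 + t * l + 1 + l') = m0 (4 + t * l + 1 + l')" if "l' < l - 1" for l'
    using other[of "Suc l'" t] that by (simp add: add.assoc)
   moreover have "m1 (4 + t * l) = 0" by (simp add: m1_def)
   ultimately show ?thesis using inst0(5)[OF t] unfolding entry_at_def by simp
  qed
  have "ALL i<length xs1. m1 i = xs1 ! i"
   unfolding xy1(1) encode_instance_at l1 lb(2)[symmetric]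
  proof (intro conjI allI impI)
   fix t' assume "t' < dim_row (?A f) * dim_col (?A f)"
   then have t': "t' < n * q" by simp
   then show "entry_at b (l - 1) m1 (4 + t' * l) (?A f $$ (t' div dim_col (?A f), t' mod dim_col (?A f)))"
    using ft[OF t'] et e[of t'] inst0(5)[OF t'] by (cases "t' = t") auto
  next
   fix t' assume "t' < dim_row ?B * dim_col ?B"
   then show "entry_at b (l - 1) m1 (4 + (dim_row (?A f) * dim_col (?A f) + t') * l) (?B $$ (t' div dim_col ?B, t' mod dim_col ?B))"
    using inst0(6)[of t'] e[of "n * q + t'"] t nn by (auto simp: less_mult_imp_div_less)
  qed (use inst0 in \<open>auto simp: m1_def\<close>)
  then have "mem (s0(|mem := m1|)) i = xs1 ! i" if "i < length xs1" for i using that by simp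
  moreover have "regs (s0(|mem := m1|)) a < 2 ^ w" "mem (s0(|mem := m1|)) a < 2 ^ w" for a
   using cw by (auto simp: s0_def m1_def m0_def computes_within_def)
  ultimately obtain t1 s1 where ex1: "exec w P (s0(|mem := m1|)) t1 s1" "ALL i<length ys1. mem s1 i = ys1 ! i"
   using cw1 unfolding computes_within_def by blast
  have "exec w P (s0(|mem := m1|)) tt (s'(|mem := (mem s')(?a := 0)|))"
   using Tc(4)[OF na, of 0] by (simp add: m1_def s0_def)
  from exec_deterministic[OF this ex1(1)] have s1: "mem s1 = (mem s')(?a := 0)" by auto
  have iq: "t div q < n" "t mod q < q" using t q by (auto simp: less_mult_imp_div_less)
  have zero: "mem s1 ((t div q * n + j) * l) = 0" if "j < n" for j
  proof -
   let ?y = "t div q * n + j"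
   have "?y < Suc (t div q) * n" using that by simp
   also have "\<dots> <= n * n" using iq by (intro mult_le_mono1) simp
   finally have y: "?y < n * n" .
   have "Fin 0 \<in> (%k. f (t div q, k) + Fin 0) ` {..<q}"
    using iq by (intro image_eqI[of _ _ "t mod q"]) (auto simp: f_def zero_extended_def[symmetric])
   moreover have "Fin 0 <= x" if "x \<in> (%k. f (t div q, k) + Fin 0) ` {..<q}" for x
    using that by (auto simp: f_def)
   ultimately have "Min ((%k. f (t div q, k) + Fin 0) ` {..<q}) = Fin 0" by (intro Min_eqI) auto
   then have "min_plus (?A f) ?B $$ (?y div n, ?y mod n) = Fin 0" using mp[OF iq(1) that, of f] that by simp
   moreover have "entry_at b (l - 1) (mem s1) (0 + ?y * l) (min_plus (?A f) ?B $$ (?y div n, ?y mod n))"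
   proof -
    have "ALL i<length ys1. mem s1 (0 + i) = ys1 ! i" using ex1(2) by simp
    then show ?thesis unfolding xy1(2) encode_mat_at dims l1 lb(2)[symmetric] using y by blast
   qed
   ultimately show ?thesis by (simp add: entry_at_def)
  qed
  have "mem s' ((t div q * n + j) * l) = 2" if "j < n" for j
  proof -
   have "t div q * n + j < Suc (t div q) * n" using that by simp
   also have "\<dots> <= n * n" using iq by (intro mult_le_mono1) simp
   finally show ?thesis by (rule out)
  qed
  \<comment> \<open>The two final memories differ at most in cell \<open>?a\<close>, but the tags of
    all \<open>n\<close> entries in this output row differ. As \<open>n >= 2\<close>, two distinct
    cells would have to coincide.\<close>
  then have "(t div q * n + j) * l = ?a" if "j < n" for j
   using zero[OF that] that unfolding s1 by (auto split: if_splits)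
  from this[of 0] this[of 1] show False using n lpos by simp
 qed
 have outs: "y * l \<in> Tc" if y: "1 <= y" "y < n * n" for y
 proof (rule ccontr)
  assume "y * l \<notin> Tc"
  then have m2: "m0 (y * l) = 2" using Tc(3)[of "y * l"] out[OF y(2)] by (simp add: s0_def)
  then have lt: "y * l < length xs" by (auto simp: m0_def split: if_splits)
  have len: "length xs = 4 + (n * q + q * n) * l"
   unfolding xy(1) length_encode_instance l1(2) by simp
  have "l <= y * l" using y by simp
  then have ge: "y * l \<ge> 5" using l5 by linarith
  define z where "z = y * l - 4"
  have z: "y * l = 4 + z" using ge by (simp add: z_def)
  have "z < (n * q + q * n) * l" using lt len z by simp
  then have zt: "z div l < n * q + q * n" by (simp add: less_mult_imp_div_less)
  \<comment> \<open>The cell lies in the input but does not open a block, so it holds a digit, and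
    all digits of this input are zero; the tag 2 cannot have been there from the start.\<close>
  have "z mod l ~= 0"
  proof
   assume "z mod l = 0"
   then have "l dvd z" by auto
   moreover have "l dvd 4 + z" unfolding z[symmetric] by simp
   ultimately have "l dvd 4" by (metis dvd_add_left_iff)
   then show False using l5 by (auto dest: dvd_imp_le)
  qed
  then obtain l' where l': "z mod l = Suc l'" by (cases "z mod l") auto
  have l'l: "l' < l - 1" using l' lpos mod_less_divisor[OF lpos, of z] by simp
  have zz: "y * l = 4 + z div l * l + 1 + l'" using z l' div_mult_mod_eq[of z l] by simp
  have "m0 (4 + z div l * l + 1 + l') = 0"
  proof (cases "z div l < n * q")
   case True
   then show ?thesis using inst0(5)[OF True] l'l by (simp add: entry_at_def)
  next
   case False
   then have e: "n * q + (z div l - n * q) = z div l" and lt: "z div l - n * q < q * n" using zt by auto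
   show ?thesis using inst0(6)[OF lt] l'l unfolding e by (simp add: entry_at_def)
  qed
  then show False using m2 zz by simp
 qed
 have "inj_on (%t. 4 + t * l) {..<n * q}" using lpos by (auto simp: inj_on_def)
 then have "n * q = card ((%t. 4 + t * l) ` {..<n * q})" by (simp add: card_image)
 also have "\<dots> <= card Tc" using tags Tc(1) by (intro card_mono) auto
 finally show "real (n * q) <= T" using Tc(2) ex(2) by linarith
 have "inj_on (%y. y * l) {1..<n * n}" using lpos by (auto simp: inj_on_def)
 then have "n * n - 1 = card ((%y. y * l) ` {1..<n * n})" by (simp add: card_image)
 also have "\<dots> <= card Tc" using outs Tc(1) by (intro card_mono) auto
 finally have "n * n <= tt + 1" using Tc(2) by linarith
 then have "real (n * n) <= real (tt + 1)" by (simp only: of_nat_le_iff)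
 then show "real (n * n) <= T + 1" using ex(2) by simp
qed

text \<open>With these bounds, writing the arguments of a call and reading its result never cost
  more than the time allowed for the call itself.\<close>

lemma bounded_product_exponent_lower:
 assumes "bounded_product_in_time 1 \<beta> 1 \<theta> e" and b: "\<beta> \<ge> 0"
 shows "1 + \<beta> <= e" "2 <= e"
proof -
 have main: "1 + \<beta> <= e + \<epsilon> & 2 <= e + \<epsilon>" if eps: "\<epsilon> > 0" for \<epsilon>
 proof -
  from assms(1) eps obtain P c K where K: "!!n xs ys. n \<ge> 1 ==> (xs, ys) \<in> min_plus_problem 1 \<beta> 1
    (%n A B. \<forall>x\<in>elements_mat A. x = Pinf \<or> (EX z. x = Fin z & \<bar>real_of_int z\<bar> <= real n powr \<theta>)) 3 n ==>
    computes_within (c * floorlog 2 n) P xs ys (K * real n powr (e + \<epsilon>))"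
   unfolding bounded_product_in_time_def soft_O_time_def by blast
  have low: "real (n * nat \<lfloor>real n powr \<beta>\<rfloor>) <= K * real n powr (e + \<epsilon>)" "real (n * n) <= K * real n powr (e + \<epsilon>) + 1" if n: "n \<ge> 2" for n
  proof -
   let ?q = "nat \<lfloor>real n powr \<beta>\<rfloor>"
   have q: "?q \<ge> 1" using floor_powr_bounds(1)[of n \<beta>] n b by simp
   have cw: "computes_within (c * floorlog 2 n) P (encode_instance 3 n (mat n ?q f) (mat ?q n (%_. Fin 0)))
     (encode_mat 3 n (min_plus (mat n ?q f) (mat ?q n (%_. Fin 0)))) (K * real n powr (e + \<epsilon>))"
    if f: "!!x. f x \<in> {Pinf, Fin 0}" for f
   proof (rule K)
    have fA: "x = Pinf \<or> x = Fin 0" if "x \<in> elements_mat (mat n ?q f)" for x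
     using that f by (auto simp: elements_mat_def)
    show "(encode_instance 3 n (mat n ?q f) (mat ?q n (%_. Fin 0)), encode_mat 3 n (min_plus (mat n ?q f) (mat ?q n (%_. Fin 0))))
     \<in> min_plus_problem 1 \<beta> 1 (%n A B. \<forall>x\<in>elements_mat A. x = Pinf \<or> (EX z. x = Fin z & \<bar>real_of_int z\<bar> <= real n powr \<theta>)) 3 n"
     unfolding min_plus_problem_def
    proof (rule CollectI, rule exI[of _ "mat n ?q f"], rule exI[of _ "mat ?q n (%_. Fin 0)"], intro conjI)
     show "valid_entries 3 n (mat n ?q f)" unfolding valid_entries_def using fA by fastforce
     show "valid_entries 3 n (mat ?q n (%_. Fin 0))" by (auto simp: valid_entries_def elements_mat_def)
     show "\<forall>x\<in>elements_mat (mat n ?q f). x = Pinf \<or> (EX z. x = Fin z & \<bar>real_of_int z\<bar> <= real n powr \<theta>)"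
      using fA by fastforce
    qed (use n in auto)
   qed (use n in simp)
   show "real (n * ?q) <= K * real n powr (e + \<epsilon>)" "real (n * n) <= K * real n powr (e + \<epsilon>) + 1"
    using product_time_lower[OF n q cw] by blast+
  qed
  have "1 + \<beta> <= e + \<epsilon>"
  proof (rule powr_le_imp_exponent_le[where K = "2 * K"])
   fix n :: nat assume n: "2 <= n"
   have "real n powr (1 + \<beta>) = real n * real n powr \<beta>" using n by (simp add: powr_add)
   also have "\<dots> <= real n * (2 * real (nat \<lfloor>real n powr \<beta>\<rfloor>))" using floor_powr_bounds(3)[of n \<beta>] n b by (intro mult_left_mono) auto
   also have "\<dots> <= 2 * (K * real n powr (e + \<epsilon>))" using low(1)[OF n] by simp
   finally show "real n powr (1 + \<beta>) <= 2 * K * real n powr (e + \<epsilon>)" by simp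
  qed
  moreover have "2 <= e + \<epsilon>"
  proof (rule powr_le_imp_exponent_le[where K = "2 * K"])
   fix n :: nat assume n: "2 <= n"
   have "2 * 2 <= n * n" using n by (intro mult_le_mono) auto
   then have "real (2 * 2) <= real (n * n)" by (simp only: of_nat_le_iff)
   then have "real (n * n) \<ge> 4" by simp
   then have "real (n * n) <= 2 * (K * real n powr (e + \<epsilon>))" using low(2)[OF n] by linarith
   then show "real n powr 2 <= 2 * K * real n powr (e + \<epsilon>)" using n by (simp add: power2_eq_square)
  qed
  ultimately show ?thesis by simp
 qed
 show "1 + \<beta> <= e" by (rule field_le_epsilon) (use main in blast)
 show "2 <= e" by (rule field_le_epsilon) (use main in blast)
qed

section \<open>Building blocks of the algorithms\<close>

notation Seq (infixr ";;" 55)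
abbreviation add_e (infixl "+!" 65) where "a +! b \<equiv> Bin Add a b"
abbreviation sub_e (infixl "-!" 65) where "a -! b \<equiv> Bin Sub a b"
abbreviation mul_e (infixl "*!" 70) where "a *! b \<equiv> Bin Mul a b"
abbreviation div_e (infixl "idiv" 70) where "a idiv b \<equiv> Bin Div a b"
abbreviation mod_e (infixl "imod" 70) where "a imod b \<equiv> Bin Mod a b"
abbreviation less_e (infix "<!" 50) where "a <! b \<equiv> Bin Less a b"
abbreviation eq_e (infix "=!" 50) where "a =! b \<equiv> Bin Equal a b"

text \<open>Register 7 is a temporary, so no abstract store notices the assignment.\<close>

definition skp :: prog where "skp = Const 7 0"

text \<open>The clock is left out, since every statement advances it.\<close>

definition frm :: "nat set => nat set => nat set => store => store => bool" where
 "frm X Y Zs ts ts' \<longleftrightarrow> (ALL x. x \<notin> X --> vr ts' x = vr ts x) & (ALL a. a \<notin> Y --> wa ts' a = wa ts a) &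
   (ALL a. a \<notin> Zs --> za ts' a = za ts a)"

lemma frm_refl [simp]: "frm X Y Zs ts ts"
 by (simp add: frm_def)

lemma frm_trans: "frm X Y Zs ts ts' ==> frm X' Y' Z' ts' ts'' ==> X' \<subseteq> X ==> Y' \<subseteq> Y ==> Z' \<subseteq> Zs ==> frm X Y Zs ts ts''"
 unfolding frm_def by (metis subsetD)

lemma frm_mono: "frm X Y Zs ts ts' ==> X \<subseteq> X' ==> Y \<subseteq> Y' ==> Zs \<subseteq> Z' ==> frm X' Y' Z' ts ts'"
 unfolding frm_def by (metis subsetD)

lemma frm_upd:
 "x \<in> X ==> frm X Y Zs ts (ts'(|vr := (vr ts')(x := v)|)) = frm X Y Zs ts ts'"
 "a \<in> Y ==> frm X Y Zs ts (ts'(|wa := (wa ts')(a := f)|)) = frm X Y Zs ts ts'"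
 "a \<in> Zs ==> frm X Y Zs ts (ts'(|za := (za ts')(a := g)|)) = frm X Y Zs ts ts'"
 "frm X Y Zs ts (ts'(|tm := t|)) = frm X Y Zs ts ts'"
 "frm X Y Zs ts (tick ts') = frm X Y Zs ts ts'"
 by (auto simp: frm_def tick_def)

context bigm
begin

definition BL :: nat where "BL = (2 ^ b) ^ L"

lemma runs_skp: assumes "Q (tick ts)" shows "L2.run skp ts Q"
proof (rule lift)
 fix sg assume 1: "PR sg ts" "tm sg = 0"
 show "L1.run skp sg (%sg'. tm sg' <= 12 * L + 12 & (\<exists>ts'. PR sg' ts' & tm ts' = Suc (tm ts) & Q ts'))"
 proof (rule runsI)
  fix s assume R: "R1 s sg"
  have n: "3 * x ~= 7" for x :: nat by presburger
  have e: "exec w skp s 1 (s(|regs := (regs s)(7 := 0)|))" using exec.Const[of w 7 0 s] by (simp add: skp_def)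
  have R': "R1 (s(|regs := (regs s)(7 := 0)|)) (tick sg)" using R n by (auto simp: R1_def bounded_ram_def intro!: ext)
  have "PR (tick sg) (tick ts)" using 1 by (simp add: PR_def)
  then show "\<exists>t s' sg'. exec w skp s t s' & R1 s' sg' & t + sz1 * tm sg <= sz1 * tm sg' &
    tm sg' <= 12 * L + 12 & (\<exists>ts'. PR sg' ts' & tm ts' = Suc (tm ts) & Q ts')"
   using R' 1 assms by (intro exec_exI3[OF e, where sg = "tick sg"]) (auto simp: sz1_def)
 qed
qed

definition badd :: "nat => aexp => nat => aexp => nat => aexp => prog" where "badd = bop False"
definition bsub :: "nat => aexp => nat => aexp => nat => aexp => prog" where "bsub = bop True"

lemma runs_badd:
 assumes "ok2 ea" "ok2 ec" "ok2 ed" "a < 12" "c < 12" "d < 12"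
  "eval ts ea < N" "eval ts ec < N" "eval ts ed < N"
  "za ts c (eval ts ec) + za ts d (eval ts ed) < BL"
  "Q (ts(|za := (za ts)(a := (za ts a)(eval ts ea := za ts c (eval ts ec) + za ts d (eval ts ed))), tm := Suc (tm ts)|))"
 shows "L2.run (badd a ea c ec d ed) ts Q"
 unfolding badd_def by (rule runs_bop) (use assms in \<open>auto simp: BL_def\<close>)

lemma runs_bsub:
 assumes "ok2 ea" "ok2 ec" "ok2 ed" "a < 12" "c < 12" "d < 12"
  "eval ts ea < N" "eval ts ec < N" "eval ts ed < N"
  "za ts d (eval ts ed) <= za ts c (eval ts ec)"
  "Q (ts(|za := (za ts)(a := (za ts a)(eval ts ea := za ts c (eval ts ec) - za ts d (eval ts ed))), tm := Suc (tm ts)|))"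
 shows "L2.run (bsub a ea c ec d ed) ts Q"
 unfolding bsub_def by (rule runs_bop) (use assms in auto)

lemma runs_bfrom':
 assumes "ok2 ea" "ok2 ec" "ok2 el" "a < 12" "c < 12" "eval ts ea < N" "eval ts ec < N" "eval ts el <= L"
  "Q (ts(|za := (za ts)(a := (za ts a)(eval ts ea := (\<Sum>l<eval ts el. (wa ts c (eval ts ec + l) mod 2 ^ b) * (2 ^ b) ^ l))), tm := Suc (tm ts)|))"
 shows "L2.run (bfrom a ea c ec el) ts Q"
 by (rule runs_bfrom) (use assms in auto)

text \<open>\<open>chmin a e\<close> replaces entry \<open>e\<close> of the array \<open>a\<close> by its minimum with the temporary \<open>za 5 0\<close>.\<close>

definition chmin :: "nat => aexp => prog" where
 "chmin a e = bless 17 5 (Num 0) a e ;; cnd (ev2 (Var 17)) (badd a e 5 (Num 0) 4 (Num 0)) skp"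

text \<open>Long integers are copied by adding zero, which is kept in \<open>za 4 0\<close>
  throughout. The expression \<open>e\<close> is evaluated again after variable 17 has been set, so
  its value must not depend on that variable.\<close>

lemma runs_chmin:
 assumes ok: "ok2 e" "a < 12" "a ~= 4" "a ~= 5" and i: "i < N" "eval ts e = i" "!!v t. eval (ts(|vr := (vr ts)(17 := v), tm := t|)) e = i"
  and z: "za ts 4 0 = 0"
  and Q: "!!v t. t <= tm ts + 3 ==> Q (ts(|vr := (vr ts)(17 := v), za := (za ts)(a := (za ts a)(i := min (za ts a i) (za ts 5 0))), tm := t|))"
 shows "L2.run (chmin a e) ts Q"
proof (rule run_bounds)
 assume bd: "!!a t. za ts a t < (2 ^ b) ^ L"
 let ?c = "za ts 5 0 < za ts a i"
 show ?thesis unfolding chmin_def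
 proof (rule runs_seq, rule runs_bless, goal_cases)
  case 7
  let ?ts = "ts(|vr := (vr ts)(17 := if za ts 5 (eval ts (Num 0)) < za ts a (eval ts e) then 1 else 0), tm := Suc (tm ts)|)"
  have e: "eval ?ts e = i" "eval (tick ?ts) e = i" using i by auto
  show ?case
  proof (rule L2.runs_cnd, goal_cases)
   case 2
   then have c: ?c using i by (auto split: if_splits)
   show ?case
    by (rule runs_badd)
     (use ok i e c z bd[of 5 0] Q[of "Suc (Suc (Suc (tm ts)))" 1] N in \<open>simp_all add: ok2_def BL_def tick_def min_def\<close>)
  next
   case 3
   then have c: "\<not> ?c" using i by (auto split: if_splits)
   have "ts(|vr := (vr ts)(17 := 0), za := (za ts)(a := (za ts a)(i := min (za ts a i) (za ts 5 0))), tm := t|) =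
     ts(|vr := (vr ts)(17 := 0), tm := t|)" for t using c by (cases ts) (simp add: min_def)
   then show ?case using c i Q[of "Suc (Suc (Suc (tm ts)))" 0] by (intro runs_skp) (simp add: tick_def)
  qed (simp add: ok2_def)
 qed (use ok i N in \<open>auto simp: ok2_def\<close>)
qed

text \<open>All variables are handled by the frame, so that the loop invariant \<open>J\<close> has
  to speak only of the arrays and the clock.\<close>

lemma runs_for:
 assumes x: "x \<in> X" and ok: "ok2 (Var x <! e)" and n: "n < N"
  and e: "!!ts'. frm X Y Zs ts ts' ==> eval ts' e = n"
  and init: "J 0 (wa ts) (za ts) (Suc (tm ts))"
  and step: "!!k ts' t. k < n ==> frm X Y Zs ts ts' ==> vr ts' x = k ==> tm ts' = Suc t ==> J k (wa ts') (za ts') t ==>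
   L2.run P ts' (%ts''. vr ts'' x = k & frm X Y Zs ts ts'' & J (Suc k) (wa ts'') (za ts'') (Suc (tm ts'')))"
  and exit: "!!ts' t. frm X Y Zs ts ts' ==> tm ts' = Suc t ==> J n (wa ts') (za ts') t ==> Q ts'"
 shows "L2.run (L2.frl x e P) ts Q"
proof (rule L2.runs_frl[where n = n and I = "%k ts'. vr ts' x = k & frm X Y Zs ts ts' & J k (wa ts') (za ts') (tm ts')"], goal_cases)
 case (7 k ts')
 show ?case
  by (rule runs_conseq[OF step[of k "tick ts'" "tm ts'"]]) (use 7 x in \<open>auto simp: frm_upd\<close>)
next
 case (8 ts')
 then show ?case using exit[of "tick ts'" "tm ts'"] by (simp add: frm_upd)
qed (use ok n e init x in \<open>auto simp: ok2_def frm_upd\<close>)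

text \<open>A loop over the pieces of row \<open>vr 11\<close>: variable 12 runs through the starts of the pieces,
 and array 2 holds the ends.\<close>

definition pl :: "prog => prog" where
 "pl P = asg2 12 (Num 0) ;; whl (ev2 (Var 12 <! Var 3)) (P ;; asg2 12 (Arr 2 (Var 11 *! Var 3 +! Var 12)))"

end

locale algo = bigm w N b L + pieces A B p q r \<Delta> for w N b L A B p q r \<Delta>
begin

text \<open>The invariant is indexed by the set of starts already visited, so its users need not
  know the order of the pieces.\<close>

lemma runs_pl:
 assumes x: "12 \<in> X" "11 \<notin> X" "3 \<notin> X" "2 \<notin> Y" and r: "r < N" "vr ts 3 = r" "vr ts 11 = k"
  and en: "!!s. s \<in> starts k ==> wa ts 2 (k * r + s) = en k s"
  and init: "J {} (wa ts) (za ts) (Suc (tm ts))"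
  and step: "!!D s ts' t. s \<in> starts k ==> D \<subseteq> starts k ==> s \<notin> D ==> finite D ==> frm X Y Zs ts ts' ==> vr ts' 12 = s ==>
   tm ts' = Suc t ==> J D (wa ts') (za ts') t ==>
   L2.run P ts' (%ts''. vr ts'' 12 = s & frm X Y Zs ts ts'' & J (insert s D) (wa ts'') (za ts'') (Suc (tm ts'')))"
  and exit: "!!ts' t. frm X Y Zs ts ts' ==> tm ts' = Suc t ==> J (starts k) (wa ts') (za ts') t ==> Q ts'"
 shows "L2.run (pl P) ts Q"
 unfolding pl_def
proof (rule runs_seq, rule L2.runs_asg, goal_cases)
 case 3
 define D where "D s = {s' \<in> starts k. s' < s}" for s
 have D0: "D 0 = {}" and Dr: "D r = starts k" by (auto simp: D_def starts_def)
 show ?case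
 proof (rule L2.runs_whl[where \<mu> = "%ts'. r - vr ts' 12" and
   I = "%ts'. frm X Y Zs ts ts' & (vr ts' 12 = r \<or> vr ts' 12 \<in> starts k) & J (D (vr ts' 12)) (wa ts') (za ts') (tm ts')"], goal_cases)
  case 2
  show ?case using x init zero_start D0 by (auto simp: frm_upd)
 next
  case (3 ts')
  then have f: "frm X Y Zs ts (tick ts')" by (simp add: frm_upd)
  have v: "vr ts' 3 = r" "vr ts' 11 = k" "wa ts' 2 = wa ts 2" using 3 x r by (auto simp: frm_def)
  then have s: "vr ts' 12 \<in> starts k" using 3 by (auto split: if_splits)
  let ?s = "vr ts' 12"
  have D: "D (en k ?s) = insert ?s (D ?s)" unfolding D_def by (rule piece(5)[OF s])
  have run: "L2.run P (tick ts') (%ts''. vr ts'' 12 = ?s & frm X Y Zs ts ts'' & J (insert ?s (D ?s)) (wa ts'') (za ts'') (Suc (tm ts'')))"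
   by (rule step[of ?s "D ?s" "tick ts'" "tm ts'"]) (use 3 s f in \<open>auto simp: D_def\<close>)
  show ?case
  proof (rule runs_seq, rule runs_conseq[OF run], rule L2.runs_asg, goal_cases)
   case (2 ts'')
   have "vr ts'' 3 = r" "vr ts'' 11 = k" "wa ts'' 2 = wa ts 2" using 2 x r by (auto simp: frm_def)
   then show ?case using 2 en[OF s] piece(3)[OF s] r(1) by simp
  next
   case (3 ts'')
   have v: "vr ts'' 3 = r" "vr ts'' 11 = k" "wa ts'' 2 = wa ts 2" using 3 x r by (auto simp: frm_def)
   have sr: "?s < r" using s by (simp add: starts_def)
   have "en k ?s = r \<or> en k ?s \<in> starts k" using piece(3,4)[OF s] by linarith
   then show ?case using 3 v en[OF s] x(1) D piece(2)[OF s] sr by (auto simp: frm_upd)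
  qed (simp add: ok2_def)
 next
  case (4 ts')
  have "vr ts' 3 = r" using 4 x r by (auto simp: frm_def)
  then have "vr ts' 12 = r" using 4 by (auto simp: starts_def split: if_splits)
  then show ?case using 4 exit[of "tick ts'" "tm ts'"] Dr by (simp add: frm_upd)
 qed (simp add: ok2_def)
qed (use N in \<open>auto simp: ok2_def\<close>)

end

section \<open>Coding of entries; input, output and the brute force product\<close>

definition enc :: "nat => int extended => nat" where
 "enc h x = (case x of Fin z => nat (2 ^ h + z) | _ => 2 ^ (h + 2))"

text \<open>Inverts sums of two codes, not single ones: two finite codes carry the offset
  \<open>2 ^ (h + 1)\<close> and add up to less than \<open>2 ^ (h + 2)\<close>, while any sum
  involving infinity reaches \<open>2 ^ (h + 2)\<close>.\<close>

definition dec :: "nat => nat => int extended" where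
 "dec h v = (if v < 2 ^ (h + 2) then Fin (int v - 2 ^ (h + 1)) else Pinf)"

lemma entry_at_cong:
 assumes "!!i. pos <= i ==> i <= pos + L ==> f i = g i"
 shows "entry_at b L f pos x = entry_at b L g pos x"
 unfolding entry_at_def using assms by (auto simp: Suc_le_eq)

lemma entry_at_sum:
 assumes "entry_at b L f pos x" "mag x < (2 ^ b) ^ L"
 shows "(\<Sum>l<L. (f (Suc pos + l) mod 2 ^ b) * (2 ^ b) ^ l) = mag x"
proof -
 have "(\<Sum>l<L. (f (Suc pos + l) mod 2 ^ b) * (2 ^ b) ^ l) = (\<Sum>l<L. (mag x div (2 ^ b) ^ l mod 2 ^ b) * (2 ^ b) ^ l)"
  using assms(1) by (intro sum.cong) (auto simp: entry_at_def)
 then show ?thesis using digits_of_nat[OF _ assms(2)] by simp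
qed

lemma Min_insert_lessThan_Suc:
 "Min (insert X (f ` {..<Suc k})) = min (Min (insert X (f ` {..<k}))) (f k :: nat)"
proof -
 have "insert X (f ` {..<Suc k}) = insert (f k) (insert X (f ` {..<k}))" by (auto simp: lessThan_Suc)
 then show ?thesis by (simp add: min.commute del: Min_insert) (simp add: Min_insert min.commute)
qed

text \<open>Running minima start at an upper bound of all candidates, which drops out once the set
  of candidates is non-empty.\<close>

lemma Min_insert_big:
 assumes "finite F" "F ~= {}" "!!x. x \<in> F ==> x <= X"
 shows "Min (insert X F) = Min (F :: nat set)"
proof -
 have "Min F <= X" using assms Min_in[of F] by blast
 then show ?thesis using assms by (simp add: min_absorb2)
qed

text \<open>Gives the first two statements of a right-nested sequence a joint postcondition.\<close>

lemma runs_assoc: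
 assumes "runs w U R (P ;; P1) sg (%sg'. runs w U R P2 sg' Q)"
 shows "runs w U R (P ;; P1 ;; P2) sg Q"
proof (rule runsI)
 fix s assume "R s sg"
 with assms obtain t s' sg' where 1: "exec w (P ;; P1) s t s'" "R s' sg'" "t + U * tm sg <= U * tm sg'" "runs w U R P2 sg' Q"
  by (auto simp: runs_def)
 from 1(4,2) obtain t2 s2 sg2 where 2: "exec w P2 s' t2 s2" "R s2 sg2" "t2 + U * tm sg' <= U * tm sg2" "Q sg2"
  by (auto simp: runs_def)
 from 1(1) obtain t3 t4 s3 where 3: "exec w P s t3 s3" "exec w P1 s3 t4 s'" "t = t3 + t4" by (auto elim!: exec_SeqE)
 have "exec w (P ;; P1 ;; P2) s (t3 + (t4 + t2)) s2" using 3 2 by (blast intro: exec.Seq)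
 then show "\<exists>t s' sg'. exec w (P ;; P1 ;; P2) s t s' & R s' sg' & t + U * tm sg <= U * tm sg' & Q sg'"
  by (rule exec_exI3[where sg = sg2]) (use 1 2 3 in auto)
qed

context bigm
begin

lemmas intros = runs_seq L2.runs_asg runs_sto2 L2.runs_cnd runs_badd runs_bsub runs_bless runs_bfrom' runs_bto runs_skp

lemma runs_asg':
 assumes "ok2 e" "eval ts e = v" "v < N" "Q (ts(|vr := (vr ts)(x := v), tm := Suc (tm ts)|))"
 shows "L2.run (asg2 x e) ts Q"
 by (rule L2.runs_asg) (use assms in auto)

lemma runs_sto':
 assumes "ok2 ei" "ok2 e" "a < 12" "eval ts ei = i" "eval ts e = v" "v < N"
  "Q (ts(|wa := (wa ts)(a := (wa ts a)(i := v)), tm := Suc (tm ts)|))"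
 shows "L2.run (sto2 a ei e) ts Q"
 by (rule runs_sto2) (use assms in auto)

lemma runs_cnd':
 assumes "ok2 e" "eval ts e = v" "v ~= 0 ==> L2.run P (tick ts) Q" "v = 0 ==> L2.run P' (tick ts) Q"
 shows "L2.run (cnd (ev2 e) P P') ts Q"
 by (rule L2.runs_cnd) (use assms in auto)

lemma runs_badd':
 assumes "ok2 ea" "ok2 ec" "ok2 ed" "a < 12" "c < 12" "d < 12"
  "eval ts ea = i" "eval ts ec = j" "eval ts ed = k" "i < N" "j < N" "k < N"
  "za ts c j = x" "za ts d k = y" "x + y < BL"
  "Q (ts(|za := (za ts)(a := (za ts a)(i := x + y)), tm := Suc (tm ts)|))"
 shows "L2.run (badd a ea c ec d ed) ts Q"
 by (rule runs_badd) (use assms in auto)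

lemma runs_bsub':
 assumes "ok2 ea" "ok2 ec" "ok2 ed" "a < 12" "c < 12" "d < 12"
  "eval ts ea = i" "eval ts ec = j" "eval ts ed = k" "i < N" "j < N" "k < N"
  "za ts c j = x" "za ts d k = y" "y <= x"
  "Q (ts(|za := (za ts)(a := (za ts a)(i := x - y)), tm := Suc (tm ts)|))"
 shows "L2.run (bsub a ea c ec d ed) ts Q"
 by (rule runs_bsub) (use assms in auto)

lemma runs_bless':
 assumes "ok2 ec" "ok2 ed" "c < 12" "d < 12" "eval ts ec = j" "eval ts ed = k" "j < N" "k < N"
  "za ts c j = x" "za ts d k = y"
  "Q (ts(|vr := (vr ts)(z := (if x < y then 1 else 0)), tm := Suc (tm ts)|))"
 shows "L2.run (bless z c ec d ed) ts Q"
 by (rule runs_bless) (use assms in auto)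

lemma runs_bfrom'':
 assumes "ok2 ea" "ok2 ec" "ok2 el" "a < 12" "c < 12" "eval ts ea = i" "eval ts ec = j" "eval ts el = l" "i < N" "j < N" "l <= L"
  "(\<Sum>k<l. (wa ts c (j + k) mod 2 ^ b) * (2 ^ b) ^ k) = S"
  "Q (ts(|za := (za ts)(a := (za ts a)(i := S)), tm := Suc (tm ts)|))"
 shows "L2.run (bfrom a ea c ec el) ts Q"
 by (rule runs_bfrom) (use assms in auto)

lemma runs_bto':
 assumes "ok2 ea" "ok2 ec" "ok2 el" "a < 12" "c < 12"
  "eval ts ea = i" "eval ts ec = j" "eval ts el = l" "i < N" "j < N" "l <= L" "za ts a i = x"
  "Q (ts(|wa := (wa ts)(c := (%n. if j <= n & n < j + l
     then x div (2 ^ b) ^ (n - j) mod 2 ^ b else wa ts c n)), tm := Suc (tm ts)|))"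
 shows "L2.run (bto c ec a ea el) ts Q"
 by (rule runs_bto) (use assms in auto)

lemma runs_chmin':
 assumes "ok2 e" "a < 12" "a ~= 4" "a ~= 5" "eval ts e = i" "i < N" "!!v t. eval (ts(|vr := (vr ts)(17 := v), tm := t|)) e = i"
  "za ts 4 0 = 0" "za ts a i = x" "za ts 5 0 = y"
  "!!v t. t <= tm ts + 3 ==> Q (ts(|vr := (vr ts)(17 := v), za := (za ts)(a := (za ts a)(i := min x y)), tm := t|))"
 shows "L2.run (chmin a e) ts Q"
 by (rule runs_chmin[where i = i]) (use assms in auto)

definition bpow :: "nat => aexp => prog" where
 "bpow c e = sto2 7 (Num 0) (Num 1) ;; bfrom 4 (Num c) 7 (Num 0) (Num 1) ;; L2.frl 20 e (badd 4 (Num c) 4 (Num c) 4 (Num c))"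

lemma runs_bpow:
 assumes b: "0 < b" and ok: "ok2 (Var 20 <! e)" "c < 100" and m: "m < N" "2 ^ m < BL"
  and e: "!!ts'. frm {20} {7} {4} ts ts' ==> eval ts' e = m"
  and Q: "!!ts'. frm {20} {7} {4} ts ts' ==> za ts' 4 = (za ts 4)(c := 2 ^ m) ==> tm ts' <= tm ts + 3 * m + 10 ==> Q ts'"
 shows "L2.run (bpow c e) ts Q"
proof -
 have N100: "c < N" using ok N by simp
 have one: "(1::nat) mod 2 ^ b = 1" using b by simp
 show ?thesis unfolding bpow_def
 proof (intro intros, goal_cases)
  case 13
  let ?ts = "ts(|wa := (wa ts)(7 := (wa ts 7)(eval ts (Num 0) := eval ts (Num 1))), tm := Suc (tm ts)|)"
  show ?case
  proof (rule runs_for[where X = "{20}" and Y = "{7}" and Zs = "{4}" and n = m and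
    J = "%k W Z t. Z 4 = (za ts 4)(c := 2 ^ k) & t <= tm ts + 3 * k + 5"], goal_cases)
   case (4 ts')
   have "frm {20} {7} {4} ts ts'" using 4 by (auto simp: frm_def)
   then show ?case by (rule e)
  next
   case (6 k ts' t)
   have "2 ^ Suc k <= (2::nat) ^ m" using 6 by (intro power_increasing) auto
   then have lt: "2 ^ k + 2 ^ k < BL" using m(2) by simp
   show ?case
    by (rule runs_badd) (use 6 N100 lt ok in \<open>auto simp: ok2_def frm_def\<close>)
  next
   case (7 ts' t)
   then show ?case by (intro Q) (auto simp: frm_def)
  qed (use m ok one in auto)
 qed (use N N100 L0 ok in \<open>auto simp: ok2_def\<close>)
qed

definition wpow :: "nat => aexp => prog" where
 "wpow x e = asg2 x (Num 1) ;; L2.frl 20 e (asg2 x (Var x +! Var x))"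

lemma runs_wpow:
 assumes ok: "ok2 (Var 20 <! e)" "x ~= 20" and m: "m < N" "2 ^ m < N"
  and e: "!!ts'. frm {20, x} {} {} ts ts' ==> eval ts' e = m"
  and Q: "!!ts'. frm {20, x} {} {} ts ts' ==> vr ts' x = 2 ^ m ==> tm ts' <= tm ts + 3 * m + 10 ==> Q ts'"
 shows "L2.run (wpow x e) ts Q"
 unfolding wpow_def
proof (intro intros, goal_cases)
 case 3
 show ?case
 proof (rule L2.runs_frl[where n = m and I = "%k ts'. frm {20, x} {} {} ts ts' & vr ts' 20 = k & vr ts' x = 2 ^ k & tm ts' <= tm ts + 3 * k + 5"], goal_cases)
  case (7 k ts')
  have "2 ^ Suc k <= (2::nat) ^ m" using 7 by (intro power_increasing) auto
  then have lt: "2 ^ k + 2 ^ k < N" using m(2) by simp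
  show ?case by (rule L2.runs_asg) (use 7 lt ok in \<open>auto simp: ok2_def frm_def\<close>)
 next
  case (8 ts')
  then show ?case by (intro Q) (auto simp: frm_def)
 qed (use m ok e in \<open>auto simp: ok2_def frm_def\<close>)
qed (use N in \<open>auto simp: ok2_def\<close>)

text \<open>Array 4 holds constants: 0, made by converting no digits at all; at index 2 the shift
  \<open>2 ^ h\<close>, at 3 the code of infinity, at 4 an upper bound of all sums from which minima
  start, at 5 the offset of a sum of two codes. Index 1 is left for \<open>\<Delta>\<close>.\<close>

definition cst :: prog where
 "cst = bfrom 4 (Num 0) 7 (Num 0) (Num 0) ;; bpow 2 (Var 4 *! Var 5) ;; bpow 3 (Var 4 *! Var 5 +! Num 2) ;;
   bpow 4 (Var 4 *! Var 5 +! Num 4) ;; badd 4 (Num 5) 4 (Num 2) 4 (Num 2)"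

lemma runs_cst:
 assumes b: "0 < b" and v: "vr ts 4 * vr ts 5 = h" "h + 4 < N" "2 ^ (h + 4) < BL"
  and Q: "!!ts'. frm {20} {7} {4} ts ts' ==> za ts' 4 0 = 0 ==> za ts' 4 2 = 2 ^ h ==> za ts' 4 3 = 2 ^ (h + 2) ==> za ts' 4 4 = 2 ^ (h + 4) ==>
   za ts' 4 5 = 2 ^ (h + 1) ==> tm ts' <= tm ts + 9 * h + 60 ==> Q ts'"
 shows "L2.run cst ts Q"
proof -
 have p: "(2::nat) ^ k < BL" if "k <= h + 4" for k
  using power_increasing[OF that, of "2::nat"] v(3) by linarith
 have ev: "vr ts' 4 * vr ts' 5 = h" if "frm {20} {7} {4} ts1 ts'" "frm {20} {7} {4} ts ts1" for ts' ts1
  using that v by (auto simp: frm_def)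
 have tr: "frm {20} {7} {4} ts ts'" if "frm {20} {7} {4} ts1 ts'" "frm {20} {7} {4} ts ts1" for ts' ts1
  using frm_trans[OF that(2,1)] by simp
 show ?thesis unfolding cst_def
 proof (rule runs_seq, rule runs_bfrom', goal_cases)
  case 9
  define ts0 where "ts0 = ts(|za := (za ts)(4 := (za ts 4)(eval ts (Num 0) := \<Sum>l<eval ts (Num 0). wa ts 7 (eval ts (Num 0) + l) mod 2 ^ b * (2 ^ b) ^ l)), tm := Suc (tm ts)|)"
  have f0: "frm {20} {7} {4} ts ts0" "za ts0 4 0 = 0" "tm ts0 = tm ts + 1" by (auto simp: ts0_def frm_def)
  show ?case unfolding ts0_def[symmetric]
  proof (rule runs_seq, rule runs_bpow[where m = h], goal_cases)
   case (7 ts1)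
   have f1: "frm {20} {7} {4} ts ts1" "za ts1 4 = (za ts0 4)(2 := 2 ^ h)" "tm ts1 <= tm ts0 + 3 * h + 10" using 7(2,3) tr[OF 7(1) f0(1)] by auto
   show ?case
   proof (rule runs_seq, rule runs_bpow[where m = "h + 2"], goal_cases)
    case (7 ts2)
    have f2: "frm {20} {7} {4} ts ts2" "za ts2 4 = (za ts1 4)(3 := 2 ^ (h + 2))" "tm ts2 <= tm ts1 + 3 * (h + 2) + 10" using 7(2,3) tr[OF 7(1) f1(1)] by auto
    show ?case
    proof (rule runs_seq, rule runs_bpow[where m = "h + 4"], goal_cases)
     case (7 ts3)
     have f3: "frm {20} {7} {4} ts ts3" "za ts3 4 = (za ts2 4)(4 := 2 ^ (h + 4))" "tm ts3 <= tm ts2 + 3 * (h + 4) + 10" using 7(2,3) tr[OF 7(1) f2(1)] by auto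
     show ?case
      by (rule runs_badd, goal_cases)
       (use N f0 f1 f2 f3 p[of "h + 1"] in \<open>auto simp: ok2_def frm_def intro!: Q\<close>)
    next
     case (6 ts')
     then show ?case using ev[OF 6 f2(1)] by simp
    qed (use b v p[of h] p[of "h + 2"] p[of "h + 4"] in \<open>auto simp: ok2_def\<close>)
   next
    case (6 ts')
    then show ?case using ev[OF 6 f1(1)] by simp
   qed (use b v p[of h] p[of "h + 2"] p[of "h + 4"] in \<open>auto simp: ok2_def\<close>)
  next
   case (6 ts')
   then show ?case using ev[OF 6 f0(1)] by simp
  qed (use b v p[of h] p[of "h + 2"] p[of "h + 4"] in \<open>auto simp: ok2_def\<close>)
 qed (use N in \<open>auto simp: ok2_def\<close>)
qed

text \<open>\<open>off\<close> counts entries and the 4 skips the header. The tags 2, 1 and 0 lead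
  to the code of infinity, to \<open>2 ^ h\<close> minus the magnitude and to \<open>2 ^ h\<close>
  plus the magnitude.\<close>

definition rdm :: "nat => aexp => aexp => prog" where
 "rdm a off cnt = L2.frl 19 cnt (asg2 20 (Num 4 +! (off +! Var 19) *! (Var 5 +! Num 1)) ;;
   bfrom 5 (Num 0) 0 (Var 20 +! Num 1) (Var 5) ;;
   cnd (ev2 (Arr 0 (Var 20) =! Num 2)) (badd a (Var 19) 4 (Num 3) 4 (Num 0))
    (cnd (ev2 (Arr 0 (Var 20) =! Num 1)) (bsub a (Var 19) 4 (Num 2) 5 (Num 0)) (badd a (Var 19) 4 (Num 2) 5 (Num 0))))"

lemma runs_rdm:
 assumes a: "a < 12" "a ~= 4" "a ~= 5" and ok: "ok2 (Var 19 <! cnt)" "ok2 (Num 4 +! (off +! Var 19) *! (Var 5 +! Num 1))"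
  and v: "vr ts 5 = L1" "L1 <= L" "n < N" "5 + (m + n) * (L1 + 1) < N"
  and cnt: "!!ts'. frm {19, 20} {} {a, 5} ts ts' ==> eval ts' cnt = n"
  and off: "!!ts'. frm {19, 20} {} {a, 5} ts ts' ==> eval ts' off = m"
  and at: "!!t. t < n ==> entry_at b L1 (wa ts 0) (4 + (m + t) * (L1 + 1)) (x t)"
  and x: "!!t. t < n ==> x t = Pinf \<or> (EX z. x t = Fin z & \<bar>z\<bar> < 2 ^ h)" and h: "h = b * L1" "2 ^ (h + 4) < BL"
  and c: "za ts 4 0 = 0" "za ts 4 2 = 2 ^ h" "za ts 4 3 = 2 ^ (h + 2)"
  and Q: "!!ts'. frm {19, 20} {} {a, 5} ts ts' ==> (!!t. t < n ==> za ts' a t = enc h (x t)) ==> tm ts' <= tm ts + 8 * n + 3 ==> Q ts'"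
 shows "L2.run (rdm a off cnt) ts Q"
 unfolding rdm_def
proof (rule runs_for[where X = "{19, 20}" and Y = "{}" and Zs = "{a, 5}" and n = n and
  J = "%k W Z t. (\<forall>t'<k. Z a t' = enc h (x t')) & t <= tm ts + 8 * k + 1"], goal_cases)
 case (6 k ts' t)
 have "(m + k) * (L1 + 1) <= (m + n) * (L1 + 1)" using 6 by (intro mult_le_mono1) simp
 then have pos: "5 + (m + k) * (L1 + 1) < N" using v(4) by linarith
 have f: "vr ts' 5 = L1" "wa ts' = wa ts" "za ts' 4 = za ts 4" using 6 v a by (auto simp: frm_def)
 note at' = at[OF 6(1)]
 have hL: "(2 ^ b) ^ L1 = (2::nat) ^ h" by (simp add: h power_mult)
 have mg: "mag (x k) < 2 ^ h" using x[OF 6(1)] by (auto simp: nat_less_iff)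
 define P where "P = 4 + (m + k) * (L1 + 1)"
 have sm: "(\<Sum>l<L1. wa ts 0 (Suc P + l) mod 2 ^ b * (2 ^ b) ^ l) = mag (x k)"
  by (rule entry_at_sum[OF at'[folded P_def]]) (use mg hL in simp)
 have tg: "wa ts 0 P = tag (x k)" using at' by (simp add: entry_at_def P_def)
 have sm': "(\<Sum>l<L1. wa ts 0 (Suc (P + l)) mod 2 ^ b * (2 ^ b) ^ l) = mag (x k)" using sm by simp
 have PN: "Suc P < N" using pos by (simp add: P_def)
 have ev: "eval ts' (Num 4 +! (off +! Var 19) *! (Var 5 +! Num 1)) = P" using off[OF 6(2)] 6(3) f by (simp add: P_def)
 have h2: "2 ^ (h + 2) < BL" "2 ^ h + 2 ^ h < BL" using h(2) power_increasing[of "h + 2" "h + 4" "2::nat"] power_increasing[of "h + 1" "h + 4" "2::nat"] by auto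
 have e1: "x k = Pinf ==> enc h (x k) = 2 ^ (h + 2)" by (simp add: enc_def)
 have e2: "tag (x k) = 1 ==> enc h (x k) = 2 ^ h - mag (x k)"
 proof -
  assume "tag (x k) = 1"
  then obtain z where z: "x k = Fin z" "z < 0" "\<bar>z\<bar> < 2 ^ h" using x[OF 6(1)] by (auto split: if_splits)
  have "nat (2 ^ h - (- z)) = nat (2 ^ h) - nat (- z)" using z by (intro nat_diff_distrib) auto
  then show ?thesis using z by (simp add: enc_def nat_power_eq)
 qed
 have e3: "tag (x k) ~= 1 ==> tag (x k) ~= 2 ==> enc h (x k) = 2 ^ h + mag (x k)" using x[OF 6(1)]
  by (auto simp: enc_def nat_add_distrib nat_power_eq split: if_splits)
 have t2: "tag (x k) = 2 \<longleftrightarrow> x k = Pinf" using x[OF 6(1)] by (auto split: if_splits)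
 have kN: "k < N" using 6 v by simp
 show ?case
 proof (rule runs_seq, rule L2.runs_asg, goal_cases)
  case 3
  have NN: "0 < N" "2 < N" "3 < N" "P < N" using N PN by auto
  have h3: "4 * 2 ^ h < BL" "2 ^ h + mag (x k) < BL" "mag (x k) <= 2 ^ h" using h2 mg by auto
  have lN: "L1 < N" using v LN by simp
  have fin: "vr ts'' 19 = k & frm {19, 20} {} {a, 5} ts ts'' & (\<forall>t'<Suc k. za ts'' a t' = enc h (x t')) & Suc (tm ts'') <= tm ts + 8 * Suc k + 1"
   if "vr ts'' = (vr ts')(20 := P)" "wa ts'' = wa ts'" "za ts'' = (za ts')(5 := (za ts' 5)(0 := mag (x k)), a := (za ts' a)(k := enc h (x k)))"
    "tm ts'' <= tm ts' + 5" for ts''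
   using that 6 by (auto simp: frm_def less_Suc_eq)
  show ?case unfolding ev
   supply [simp] = ok2_def f tg sm' kN PN NN lN v a c h2 h3 6(3)
   apply (rule runs_seq, rule runs_bfrom'', (simp; fail)+)
   apply (rule runs_cnd', (simp; fail)+)
    apply (rule runs_badd', (simp; fail)+)
    apply (rule fin, simp, simp, simp add: t2 enc_def split: if_splits)
    apply simp
   apply (rule runs_cnd', (simp; fail)+)
    apply (rule runs_bsub', (use mg in \<open>simp; fail\<close>)+)
    apply (rule fin, simp, simp, simp add: e2 split: if_splits)
    apply simp
   apply (rule runs_badd', (use mg h2 in \<open>simp; fail\<close>)+)
   apply (rule fin, simp, simp, simp add: e3 split: if_splits)
   apply simp
   done
 qed (use ok ev PN in auto)
next
 case (7 ts' t)
 then show ?case by (intro Q) auto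
qed (use ok v cnt in auto)

text \<open>The output overwrites the input in array 0, which by then has been converted to long
  integers.\<close>

definition wrm :: "aexp => prog" where
 "wrm cnt = L2.frl 19 cnt (asg2 20 (Var 19 *! (Var 5 +! Num 1)) ;; bless 17 3 (Var 19) 4 (Num 3) ;;
   cnd (ev2 (Var 17))
    (bless 17 3 (Var 19) 4 (Num 5) ;; cnd (ev2 (Var 17))
     (sto2 0 (Var 20) (Num 1) ;; bsub 5 (Num 0) 4 (Num 5) 3 (Var 19))
     (sto2 0 (Var 20) (Num 0) ;; bsub 5 (Num 0) 3 (Var 19) 4 (Num 5)))
    (sto2 0 (Var 20) (Num 2) ;; badd 5 (Num 0) 4 (Num 0) 4 (Num 0)) ;;
   bto 0 (Var 20 +! Num 1) 5 (Num 0) (Var 5))"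

lemma runs_wrm:
 assumes ok: "ok2 (Var 19 <! cnt)"
  and v: "vr ts 5 = L1" "L1 <= L" "n < N" "1 + n * (L1 + 1) < N"
  and cnt: "!!ts'. frm {17, 19, 20} {0} {5} ts ts' ==> eval ts' cnt = n"
  and c: "za ts 4 0 = 0" "za ts 4 3 = 2 ^ (h + 2)" "za ts 4 5 = 2 ^ (h + 1)"
  and Q: "!!ts'. frm {17, 19, 20} {0} {5} ts ts' ==> (!!t. t < n ==> entry_at b L1 (wa ts' 0) (t * (L1 + 1)) (dec h (za ts 3 t))) ==>
   tm ts' <= tm ts + 11 * n + 3 ==> Q ts'"
 shows "L2.run (wrm cnt) ts Q"
 unfolding wrm_def
proof (rule runs_for[where X = "{17, 19, 20}" and Y = "{0}" and Zs = "{5}" and n = n and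
  J = "%k W Z t. (\<forall>t'<k. entry_at b L1 (W 0) (t' * (L1 + 1)) (dec h (za ts 3 t'))) & t <= tm ts + 11 * k + 1"], goal_cases)
 case (6 k ts' t)
 have "Suc k * (L1 + 1) <= n * (L1 + 1)" using 6 by (intro mult_le_mono1) simp
 then have pos: "Suc (k * (L1 + 1)) < N" using v(4) by simp
 have f: "vr ts' 5 = L1" "za ts' 4 = za ts 4" "za ts' 3 = za ts 3" using 6 v by (auto simp: frm_def)
 define P where "P = k * (L1 + 1)"
 have PN: "Suc P < N" using pos by (simp add: P_def)
 have ev: "eval ts' (Var 19 *! (Var 5 +! Num 1)) = P" using 6(3) f by (simp add: P_def)
 have kN: "k < N" using 6 v by simp
 let ?y = "za ts 3 k"
 have new: "entry_at b L1 W (t' * (L1 + 1)) (dec h (za ts 3 t'))"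
  if t': "t' < Suc k" and W: "!!i. i < P ==> W i = wa ts' 0 i" "W P = tag (dec h ?y)" "!!l. l < L1 ==> W (Suc (P + l)) = mag (dec h ?y) div (2 ^ b) ^ l mod 2 ^ b" for W t'
 proof (cases "t' = k")
  case True
  then show ?thesis using W(2,3) by (simp add: entry_at_def P_def)
 next
  case False
  then have "t' < k" using t' by simp
  then have "Suc t' * (L1 + 1) <= P" unfolding P_def by (intro mult_le_mono1) simp
  then have "entry_at b L1 W (t' * (L1 + 1)) (dec h (za ts 3 t')) = entry_at b L1 (wa ts' 0) (t' * (L1 + 1)) (dec h (za ts 3 t'))"
   using W(1) by (intro entry_at_cong) auto
  then show ?thesis using 6(5) \<open>t' < k\<close> by simp
 qed
 have d1: "?y < 2 ^ (h + 2) ==> ?y < 2 ^ (h + 1) ==> tag (dec h ?y) = 1 & mag (dec h ?y) = 2 ^ (h + 1) - ?y"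
 proof -
  assume "?y < 2 ^ (h + 2)" and l: "?y < 2 ^ (h + 1)"
  moreover have "int ?y < 2 ^ (h + 1)" using l by (metis of_nat_less_iff of_nat_numeral of_nat_power)
  moreover have "nat \<bar>int ?y - 2 ^ (h + 1)\<bar> = 2 ^ (h + 1) - ?y" using calculation(3)
   by (metis abs_minus_commute abs_of_nonneg diff_ge_0_iff_ge less_imp_le nat_diff_distrib nat_int nat_power_eq nat_numeral of_nat_0_le_iff zero_le_numeral)
  ultimately show ?thesis unfolding dec_def by simp
 qed
 have d2: "?y < 2 ^ (h + 2) ==> \<not> ?y < 2 ^ (h + 1) ==> tag (dec h ?y) = 0 & mag (dec h ?y) = ?y - 2 ^ (h + 1)"
 proof -
  assume "?y < 2 ^ (h + 2)" and l: "\<not> ?y < 2 ^ (h + 1)"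
  moreover have "int ?y \<ge> 2 ^ (h + 1)" using l by (metis not_less of_nat_le_iff of_nat_numeral of_nat_power)
  moreover have "nat \<bar>int ?y - 2 ^ (h + 1)\<bar> = ?y - 2 ^ (h + 1)" using calculation(3)
   by (metis abs_of_nonneg diff_ge_0_iff_ge nat_diff_distrib nat_int nat_power_eq nat_numeral zero_le_numeral zero_le_power)
  ultimately show ?thesis unfolding dec_def by simp
 qed
 have d3: "\<not> ?y < 2 ^ (h + 2) ==> tag (dec h ?y) = 2 & mag (dec h ?y) = 0" by (simp add: dec_def)
 have w2: "2 < N" "L1 < N" using N v LN by auto
 define K where "K ts'' \<longleftrightarrow> vr ts'' 20 = P & vr ts'' 19 = k & vr ts'' 5 = L1 & (ALL i. i ~= P --> wa ts'' 0 i = wa ts' 0 i) & wa ts'' 0 P = tag (dec h ?y) &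
   za ts'' 5 0 = mag (dec h ?y) & frm {17, 20} {0} {5} ts' ts'' & tm ts'' <= tm ts' + 7" for ts'' :: store
 have z0: "0 < BL" by (simp add: BL_def)
 define HH II :: nat where HI: "HH = 2 ^ (h + 1)" "II = 2 ^ (h + 2)"
 note c' = c(1) c(2)[folded HI] c(3)[folded HI]
 have g: "vr ts' 19 = k" using 6 by simp
 have N6: "0 < N" "Suc 0 < N" "2 < N" "3 < N" "5 < N" using N by simp_all
 have P0: "P < N" using PN by simp
 have fin: "L2.run (bto 0 (Var 20 +! Num 1) 5 (Num 0) (Var 5)) ts'' (%ts''. vr ts'' 19 = k & frm {17, 19, 20} {0} {5} ts ts'' &
   (\<forall>t'<Suc k. entry_at b L1 (wa ts'' 0) (t' * (L1 + 1)) (dec h (za ts 3 t'))) & Suc (tm ts'') <= tm ts + 11 * Suc k + 1)" if K: "K ts''" for ts''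
 proof (rule runs_bto, goal_cases)
  case 9
  show ?case
   apply (intro conjI allI impI)
     apply (use K in \<open>simp add: K_def\<close>)
    apply (rule frm_trans[OF 6(2), where X' = "{17, 20}" and Y' = "{0}" and Z' = "{5}"])
      apply (use K in \<open>simp add: K_def frm_def\<close>)
     apply simp
     apply simp
    apply simp
    apply (rule new, assumption)
   using K 6(4,5) by (simp_all add: K_def)
 qed (use K PN w2 N v in \<open>auto simp: ok2_def K_def\<close>)
 let ?s = "ts'(|vr := (vr ts')(20 := P), tm := Suc (tm ts')|)"
 let ?C = "bless 17 3 (Var 19) 4 (Num 3) ;;
   cnd (ev2 (Var 17))
    (bless 17 3 (Var 19) 4 (Num 5) ;; cnd (ev2 (Var 17))
     (sto2 0 (Var 20) (Num 1) ;; bsub 5 (Num 0) 4 (Num 5) 3 (Var 19))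
     (sto2 0 (Var 20) (Num 0) ;; bsub 5 (Num 0) 3 (Var 19) 4 (Num 5)))
    (sto2 0 (Var 20) (Num 2) ;; badd 5 (Num 0) 4 (Num 0) 4 (Num 0))"
 consider (a) "?y < II" "?y < HH" "tag (dec h ?y) = 1" "mag (dec h ?y) = HH - ?y"
  | (b) "?y < II" "\<not> ?y < HH" "tag (dec h ?y) = 0" "mag (dec h ?y) = ?y - HH"
  | (c) "\<not> ?y < II" "tag (dec h ?y) = 2" "mag (dec h ?y) = 0"
  using d1[folded HI] d2[folded HI] d3[folded HI] by metis
 then have br: "L2.run ?C ?s K"
 proof cases
  case a
  show ?thesis
   supply [simp] = ok2_def f g c' kN PN N6 P0 a less_imp_le[OF a(2)]
   apply (rule runs_seq, rule runs_bless', (simp; fail)+)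
   apply (rule runs_cnd', (simp; fail)+)
    apply (rule runs_seq, rule runs_bless', (simp; fail)+)
    apply (rule runs_cnd', (simp; fail)+)
    apply (rule runs_seq, rule runs_sto', (simp; fail)+)
    apply (rule runs_bsub', (simp; fail)+)
    apply (simp add: K_def frm_def)
    apply simp
   apply simp
   done
 next
  case b
  show ?thesis
   supply [simp] = ok2_def f g c' kN PN N6 P0 b b(2)[unfolded not_less]
   apply (rule runs_seq, rule runs_bless', (simp; fail)+)
   apply (rule runs_cnd', (simp; fail)+)
    apply (rule runs_seq, rule runs_bless', (simp; fail)+)
    apply (rule runs_cnd', (simp; fail)+)
    apply simp
    apply (rule runs_seq, rule runs_sto', (simp; fail)+)
    apply (rule runs_bsub', (simp; fail)+)
    apply (simp add: K_def frm_def)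
   apply simp
   done
 next
  case c'': c
  show ?thesis
   supply [simp] = ok2_def f g c' kN PN N6 P0 z0 c''
   apply (rule runs_seq, rule runs_bless', (simp; fail)+)
   apply (rule runs_cnd', (simp; fail)+)
    apply simp
   apply (rule runs_seq, rule runs_sto', (simp; fail)+)
   apply (rule runs_badd', (simp; fail)+)
   apply (simp add: K_def frm_def)
   done
 qed
 have assoc: "L2.run (bless 17 3 (Var 19) 4 (Num 3) ;; P1 ;; P2) ts1 Q'" if "L2.run (bless 17 3 (Var 19) 4 (Num 3) ;; P1) ts1 (%ts'. L2.run P2 ts' Q')" for P1 P2 ts1 Q'
  using runs_assoc[OF that] .
 show ?case
 proof (rule runs_seq, rule L2.runs_asg, goal_cases)
  case 3
  show ?case unfolding ev by (rule assoc, rule runs_conseq[OF br fin])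
 qed (use ev PN in \<open>auto simp: ok2_def\<close>)
next
 case (7 ts' t)
 then show ?case by (intro Q) auto
qed (use ok v cnt in auto)

text \<open>The cubic method, used for the upper bound \<open>2 + \<beta>\<close> on the exponent of
  products with small entries.\<close>

definition brt :: prog where
 "brt = L2.frl 19 (Var 1 *! Var 3) (asg2 10 (Var 19 idiv Var 3) ;; asg2 12 (Var 19 imod Var 3) ;;
   badd 3 (Var 19) 4 (Num 4) 4 (Num 0) ;;
   L2.frl 11 (Var 2) (badd 5 (Num 0) 0 (Var 10 *! Var 2 +! Var 11) 1 (Var 11 *! Var 3 +! Var 12) ;; chmin 3 (Var 19)))"

lemma runs_brt:
 assumes v: "vr ts 1 = p" "vr ts 2 = q" "vr ts 3 = r" "0 < q" "p * r < N" "p * q < N" "q * r < N" "q < N" "r < N"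
  and A: "!!t. t < p * q ==> za ts 0 t = A (t div q) (t mod q)" and B: "!!t. t < q * r ==> za ts 1 t = B (t div r) (t mod r)"
  and c: "za ts 4 0 = 0" "za ts 4 4 = X" "X < BL" and lt: "!!i k j. i < p ==> k < q ==> j < r ==> A i k + B k j <= X"
  and Q: "!!ts'. frm {10, 11, 12, 17, 19} {} {3, 5} ts ts' ==>
   (!!t. t < p * r ==> za ts' 3 t = Min ((%k. A (t div r) k + B k (t mod r)) ` {..<q})) ==>
   tm ts' <= tm ts + (p * r) * (7 * q + 10) + 3 ==> Q ts'"
 shows "L2.run brt ts Q"
 unfolding brt_def
proof (rule runs_for[where X = "{10, 11, 12, 17, 19}" and Y = "{}" and Zs = "{3, 5}" and n = "p * r" and
  J = "%m W Z t. (\<forall>t'<m. Z 3 t' = Min ((%k. A (t' div r) k + B k (t' mod r)) ` {..<q})) & t <= tm ts + m * (7 * q + 10) + 1"], goal_cases)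
 case (6 m ts' t)
 have f: "vr ts' 1 = p" "vr ts' 2 = q" "vr ts' 3 = r" "za ts' 4 = za ts 4" "za ts' 0 = za ts 0" "za ts' 1 = za ts 1"
  using 6(2) v by (auto simp: frm_def)
 have r0: "r > 0" using 6(1) by (cases r) auto
 define i j where ij: "i = m div r" "j = m mod r"
 have i: "i < p" "j < r" "m < N" using 6(1) v r0 by (auto simp: ij less_mult_imp_div_less)
 have iN: "i < N" "j < N" using i(3) div_le_dividend[of m r] mod_less_eq_dividend[of m r] unfolding ij by linarith+
 let ?f = "%k. A i k + B k j"
 let ?s = "ts'(|vr := (vr ts')(10 := i, 12 := j), za := (za ts')(3 := (za ts' 3)(m := X)), tm := Suc (Suc (Suc (tm ts')))|)"
 have inner: "L2.run (L2.frl 11 (Var 2) (badd 5 (Num 0) 0 (Var 10 *! Var 2 +! Var 11) 1 (Var 11 *! Var 3 +! Var 12) ;; chmin 3 (Var 19))) ?s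
   (%ts''. vr ts'' 19 = m & frm {10, 11, 12, 17, 19} {} {3, 5} ts ts'' & (\<forall>t'<Suc m. za ts'' 3 t' = Min ((%k. A (t' div r) k + B k (t' mod r)) ` {..<q})) &
    Suc (tm ts'') <= tm ts + Suc m * (7 * q + 10) + 1)"
 proof (rule runs_for[where X = "{11, 17}" and Y = "{}" and Zs = "{3, 5}" and n = q and
   J = "%k W Z t. Z 3 = (za ts' 3)(m := Min (insert X (?f ` {..<k}))) & t <= tm ts' + 4 + 7 * k"], goal_cases)
  case (6 k ts1 t1)
  have g: "vr ts1 10 = i" "vr ts1 12 = j" "vr ts1 2 = q" "vr ts1 3 = r" "vr ts1 19 = m" "za ts1 4 = za ts 4" "za ts1 0 = za ts 0" "za ts1 1 = za ts 1"
   using 6(2) f \<open>vr ts' 19 = m\<close> by (auto simp: frm_def)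
  have "i * q + k < Suc i * q" using 6(1) by simp
  also have "\<dots> <= p * q" using i by (intro mult_le_mono1) simp
  finally have ik: "i * q + k < p * q" .
  have "k * r + j < Suc k * r" using i by simp
  also have "\<dots> <= q * r" using 6(1) by (intro mult_le_mono1) simp
  finally have kj: "k * r + j < q * r" .
  have AB: "za ts 0 (i * q + k) = A i k" "za ts 1 (k * r + j) = B k j" using A[OF ik] B[OF kj] 6(1) i by auto
  have lX: "A i k + B k j < BL" using lt[of i k j] i 6(1) c(3) by simp
  show ?case
  proof (rule runs_seq, rule runs_badd, goal_cases)
   case 11
   show ?case
    by (rule runs_chmin[where i = m])
     (use 6 g c AB i in \<open>auto simp: ok2_def frm_def Min_insert_lessThan_Suc simp del: Min_insert\<close>)
  qed (use ik kj v(5-9) lX N g 6(3) AB in \<open>simp_all add: ok2_def\<close>)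
 next
  case (7 ts1 t1)
  have "Min (insert X (?f ` {..<q})) = Min (?f ` {..<q})"
   using v(4) lt i by (intro Min_insert_big) auto
  then have new: "za ts1 3 t' = Min ((%k. A (t' div r) k + B k (t' mod r)) ` {..<q})" if "t' < Suc m" for t'
   using that 7(3) \<open>_ & t <= _\<close> ij by (auto simp: less_Suc_eq simp del: Min_insert)
  have "frm {10, 11, 12, 17, 19} {} {3, 5} ts ts1" using \<open>frm _ _ _ ts ts'\<close> 7(1) by (auto simp: frm_def)
  moreover have "vr ts1 19 = m" using 7(1) \<open>vr ts' 19 = m\<close> by (auto simp: frm_def)
  ultimately show ?case using 7(2,3) \<open>_ & t <= _\<close> \<open>tm ts' = Suc t\<close> new by auto
 qed (use v f in \<open>auto simp: ok2_def frm_def\<close>)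
 show ?case
  apply (intro intros)
  using f 6(3) i iN N c inner by (simp_all add: ok2_def ij frm_def add.commute[of _ "tm ts'"])
next
 case (7 ts' t)
 then show ?case by (intro Q) auto
qed (use v in \<open>auto simp: ok2_def frm_def\<close>)

end

lemma index_div_mod: "j < r ==> (k * r + j) div r = k" "j < r ==> (k * r + j) mod r = (j::nat)"
 by auto

lemma index_less: "k < q ==> j < r ==> k * r + j < q * (r::nat)"
proof -
 assume a: "k < q" "j < r"
 then have "k * r + j < Suc k * r" by simp
 also have "\<dots> <= q * r" using a by (intro mult_le_mono1) simp
 finally show ?thesis .
qed

lemma index_eq: "j < r ==> j' < r ==> k * r + j = k' * r + j' \<longleftrightarrow> k = k' & j = (j'::nat)"
 by (metis index_div_mod)

section \<open>Piece tables and the rounded product\<close>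

locale algo2 = algo w N b L A B p q r \<Delta> for w N b L A B p q r \<Delta> +
 fixes X :: nat
 assumes sizes: "p * q < N" "q * r < N" "p * r < N" "p < N" "q < N" "Suc r < N" "p * q * r < N" and p0: "0 < p"
  and AX: "!!i k j. i < p ==> k < q ==> j < r ==> A i k + B k j <= X" and XB: "X + \<Delta> < BL"
begin

text \<open>Arrays of long integers: 0 and 1 are the factors, 2 will hold C', 3 the result, 4
  constants, 5 temporaries. Word arrays: 0 is shared with the emulated program, 1 holds piece
  starts, 2 piece ends, 3 marks covered pairs, 4 and 5 are the summed difference arrays, 6 holds
  starts of alive segments.\<close>

definition env :: "store => bool" where
 "env ts \<longleftrightarrow> vr ts 1 = p & vr ts 2 = q & vr ts 3 = r & za ts 4 0 = 0 & za ts 4 1 = \<Delta> & za ts 4 4 = X &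
   (ALL i<p. ALL k<q. za ts 0 (i * q + k) = A i k) & (ALL k<q. ALL j<r. za ts 1 (k * r + j) = B k j)"

lemma env_frm: "env ts ==> frm Xs Y Zs ts ts' ==> 1 \<notin> Xs ==> 2 \<notin> Xs ==> 3 \<notin> Xs ==> 0 \<notin> Zs ==> 1 \<notin> Zs ==> 4 \<notin> Zs ==> env ts'"
 unfolding env_def frm_def by simp

lemma envD: "env ts ==> vr ts 1 = p" "env ts ==> vr ts (Suc 0) = p" "env ts ==> vr ts 2 = q" "env ts ==> vr ts 3 = r"
 "env ts ==> za ts 4 0 = 0" "env ts ==> za ts 4 1 = \<Delta>" "env ts ==> za ts 4 (Suc 0) = \<Delta>" "env ts ==> za ts 4 4 = X"
 "env ts ==> i < p ==> k < q ==> za ts 0 (i * q + k) = A i k" "env ts ==> k < q ==> j < r ==> za ts 1 (k * r + j) = B k j"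
 "env ts ==> k < q ==> j < r ==> za ts (Suc 0) (k * r + j) = B k j"
 by (auto simp: env_def)

lemma BX: "k < q ==> j < r ==> B k j <= X"
 using AX[OF p0, of k j] by simp

lemma XBL: "X < BL" using XB by simp

lemma NN: "0 < N" "Suc 0 < N" "2 < N" "3 < N" "4 < N" "5 < N" "r < N"
 using N sizes by auto

text \<open>Each column overwrites the end recorded at the start of its piece, so the last column of
  the piece leaves the right value. Array 2 is meaningful only at starts.\<close>

definition scan :: prog where
 "scan = L2.frl 19 (Var 2 *! Var 3) (asg2 11 (Var 19 idiv Var 3) ;; asg2 12 (Var 19 imod Var 3) ;;
   cnd (ev2 (Var 12))
    (badd 5 (Num 0) 1 (Var 11 *! Var 3 +! Arr 1 (Var 19 -! Num 1)) 4 (Num 1) ;; bless 17 1 (Var 19) 5 (Num 0) ;;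
    cnd (ev2 (Var 17)) (sto2 1 (Var 19) (Arr 1 (Var 19 -! Num 1))) (sto2 1 (Var 19) (Var 12)))
    (sto2 1 (Var 19) (Num 0)) ;;
   sto2 2 (Var 11 *! Var 3 +! Arr 1 (Var 19)) (Var 12 +! Num 1))"

definition stab :: "(nat => nat => nat) => bool" where
 "stab W \<longleftrightarrow> (ALL k<q. ALL j<r. W 1 (k * r + j) = stt k j) & (ALL k<q. \<forall>s\<in>starts k. W 2 (k * r + s) = en k s)"

lemma runs_scan:
 assumes env: "env ts"
  and Q: "!!ts'. frm {11, 12, 17, 19} {1, 2} {5} ts ts' ==> stab (wa ts') ==> tm ts' <= tm ts + 12 * (q * r) + 3 ==> Q ts'"
 shows "L2.run scan ts Q"
 unfolding scan_def
proof (rule runs_for[where X = "{11, 12, 17, 19}" and Y = "{1, 2}" and Zs = "{5}" and n = "q * r" and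
  J = "%m W Z t. (ALL k<q. ALL j<r. k * r + j < m --> W 1 (k * r + j) = stt k j) &
   (ALL k<q. \<forall>s\<in>starts k. k * r + s < m --> W 2 (k * r + s) = Suc (Max {j. j < r & k * r + j < m & stt k j = s})) & t <= tm ts + 12 * m + 1"], goal_cases)
 case (6 m ts' t)
 have env': "env ts'" using env_frm[OF env 6(2)] by simp
 define k j where kj: "k = m div r" "j = m mod r"
 have m: "m = k * r + j" "k < q" "j < r" using 6(1) r0 by (auto simp: kj less_mult_imp_div_less)
 have mN: "m < N" "k < N" "j < N" "Suc j < N" using 6(1) sizes m by auto
 let ?st = "stt k j"
 have stj: "?st <= j" "?st < r" using stt_le[of k j] m by auto
 define K where "K ts'' \<longleftrightarrow> vr ts'' 11 = k & vr ts'' 12 = j & vr ts'' 19 = m & vr ts'' 3 = r & wa ts'' = (wa ts')(1 := (wa ts' 1)(m := ?st)) &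
   frm {11, 12, 17} {1} {5} ts' ts'' & tm ts'' <= tm ts' + 8" for ts'' :: store
 let ?C = "cnd (ev2 (Var 12))
    (badd 5 (Num 0) 1 (Var 11 *! Var 3 +! Arr 1 (Var 19 -! Num 1)) 4 (Num 1) ;; bless 17 1 (Var 19) 5 (Num 0) ;;
    cnd (ev2 (Var 17)) (sto2 1 (Var 19) (Arr 1 (Var 19 -! Num 1))) (sto2 1 (Var 19) (Var 12)))
    (sto2 1 (Var 19) (Num 0))"
 let ?s = "ts'(|vr := (vr ts')(11 := k, 12 := j), tm := Suc (Suc (tm ts'))|)"
 have br: "L2.run ?C ?s K"
 proof (cases j)
  case 0
  have st0: "?st = 0" using 0 by simp
  show ?thesis
   supply [simp] = ok2_def envD[OF env'] mN NN 6(3) 0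
   apply (rule runs_cnd', (simp; fail)+)
    apply simp
   apply (rule runs_sto', (simp; fail)+)
   apply (simp add: K_def frm_def)
   done
 next
  case (Suc j')
  have st': "wa ts' 1 (m - Suc 0) = stt k j'" using 6(5) m Suc by auto
  have j'r: "j' < r" "stt k j' < r" using m Suc stt_le[of k j'] by auto
  have iN: "k * r + stt k j' < N" using index_less[OF m(2) j'r(2)] sizes by simp
  have lt: "B k (stt k j') + \<Delta> < BL" using BX[OF m(2) j'r(2)] XB by simp
  have sN: "stt k j' < N" using j'r NN by simp
  have zB: "za ts' (Suc 0) m = B k j" "za ts' 1 m = B k j" using envD(10)[OF env' m(2,3)] m by auto
  have ss: "?st = (if B k j < B k (stt k j') + \<Delta> then stt k j' else j)" using Suc by auto
  show ?thesis
   supply [simp] = ok2_def envD[OF env'] mN NN 6(3) st' st'[simplified] iN lt sN zB m(2) j'r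
   apply (rule runs_cnd', (simp; fail)+)
    apply (rule runs_seq, rule runs_badd', (simp; fail)+)
    apply (rule runs_seq, rule runs_bless', (simp; fail)+)
    apply (rule runs_cnd', (simp; fail)+)
    apply (rule runs_sto', (simp; fail)+)
    apply (simp add: K_def frm_def ss split: if_splits)
    apply (rule runs_sto', (simp; fail)+)
    apply (simp add: K_def frm_def ss split: if_splits)
   using Suc by simp
 qed
 have fin: "L2.run (sto2 2 (Var 11 *! Var 3 +! Arr 1 (Var 19)) (Var 12 +! Num 1)) ts''
   (%ts''. vr ts'' 19 = m & frm {11, 12, 17, 19} {1, 2} {5} ts ts'' &
    ((ALL k<q. ALL j<r. k * r + j < Suc m --> wa ts'' 1 (k * r + j) = stt k j) &
   (ALL k<q. \<forall>s\<in>starts k. k * r + s < Suc m --> wa ts'' 2 (k * r + s) = Suc (Max {j. j < r & k * r + j < Suc m & stt k j = s})) & Suc (tm ts'') <= tm ts + 12 * Suc m + 1))"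
  if K: "K ts''" for ts''
 proof (rule runs_sto'[where i = "k * r + ?st" and v = "Suc j"], goal_cases)
  case 7
  have fr: "frm {11, 12, 17, 19} {1, 2} {5} ts ts''"
   using K by (intro frm_trans[OF 6(2), of "{11, 12, 17}" "{1}" "{5}"]) (auto simp: K_def)
  have W1: "wa ts'' 1 = (wa ts' 1)(m := ?st)" "wa ts'' 2 = wa ts' 2" using K by (auto simp: K_def)
  have 1: "wa ts'' 1 (k' * r + j') = stt k' j'" if "k' < q" "j' < r" "k' * r + j' < Suc m" for k' j'
  proof (cases "k' * r + j' = m")
   case True
   then have "k' = k" "j' = j" using index_eq[OF that(2) m(3)] m(1) by auto
   then show ?thesis using True W1 by simp
  next
   case False
   then show ?thesis using 6(5) that W1 by auto
  qed
  have 2: "((wa ts'' 2)(k * r + ?st := Suc j)) (k' * r + s) = Suc (Max {j. j < r & k' * r + j < Suc m & stt k' j = s})"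
   if "k' < q" "s \<in> starts k'" "k' * r + s < Suc m" for k' s
  proof (cases "k' = k & s = ?st")
   case True
   have "Max {j'. j' < r & k * r + j' < Suc m & stt k j' = ?st} = j"
    using m by (intro Max_eqI) auto
   then show ?thesis using True by simp
  next
   case False
   have sr: "s < r" using that by (simp add: starts_def)
   have ne: "k' * r + s ~= k * r + ?st" using index_eq[OF sr stj(2)] False by auto
   have "{j. j < r & k' * r + j < Suc m & stt k' j = s} = {j. j < r & k' * r + j < m & stt k' j = s}"
   proof -
    have "\<not> (j' < r & k' * r + j' = m & stt k' j' = s)" for j'
     using index_eq[of j' r j k' k] m False by auto
    then show ?thesis by (auto simp: less_Suc_eq)
   qed
   moreover have "k' * r + s < m"
   proof (rule ccontr)
    assume "\<not> k' * r + s < m"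
    then have "k' * r + s = k * r + j" using that m by simp
    then have "k' = k" "s = j" using index_eq[OF sr m(3)] by auto
    moreover have "stt k s = s" using that \<open>k' = k\<close> by (simp add: starts_def)
    ultimately show False using False by simp
   qed
   ultimately show ?thesis using 6(5) that ne W1 by simp
  qed
  show ?case using K fr 1 2 6(4,5) by (auto simp: K_def frm_def)
 qed (use K mN in \<open>auto simp: ok2_def K_def\<close>)
 show ?case
  supply [simp] = ok2_def envD[OF env'] mN NN 6(3) kj[symmetric]
  apply (rule runs_seq, rule runs_asg', (simp; fail)+)
  apply (rule runs_seq, rule runs_asg', (simp; fail)+)
  apply (rule runs_seq, rule runs_conseq[OF _ fin])
  using br by simp
next
 case (7 ts' t)
 have "stab (wa ts')" unfolding stab_def
 proof (intro conjI allI impI ballI)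
  fix k s assume k: "k < q" and s: "s \<in> starts k"
  have sr: "s < r" using s by (simp add: starts_def)
  have "{j. j < r & k * r + j < q * r & stt k j = s} = {j. j < r & stt k j = s}" using index_less[OF k] by auto
  then show "wa ts' 2 (k * r + s) = en k s" using 7(3) k s index_less[OF k sr] by (simp add: en_def)
 qed (use 7(3) index_less in auto)
 then show ?case using 7 by (intro Q) auto
qed (use env sizes in \<open>auto simp: ok2_def frm_def env_def\<close>)

text \<open>A piece enters only at its last column, and suffix minima spread it to the left.
  Spreading beyond its start is harmless because \<open>cp i\<close> is non-decreasing. A row costs
  \<open>r\<close> plus the number of all pieces, instead of \<open>q * r\<close>.\<close>

definition cpr :: prog where
 "cpr = L2.frl 10 (Var 1) (
   L2.frl 12 (Var 3) (badd 2 (Var 10 *! Var 3 +! Var 12) 4 (Num 4) 4 (Num 0)) ;;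
   L2.frl 11 (Var 2) (pl (badd 5 (Num 0) 0 (Var 10 *! Var 2 +! Var 11) 1 (Var 11 *! Var 3 +! Var 12) ;;
    chmin 2 (Var 10 *! Var 3 +! (Arr 2 (Var 11 *! Var 3 +! Var 12) -! Num 1)))) ;;
   L2.frl 13 (Var 3 -! Num 1) (asg2 12 (Var 3 -! (Num 2 +! Var 13)) ;;
    badd 5 (Num 0) 2 (Var 10 *! Var 3 +! (Var 12 +! Num 1)) 4 (Num 0) ;; chmin 2 (Var 10 *! Var 3 +! Var 12)))"

definition PC :: nat where "PC = (\<Sum>k<q. card (starts k))"

text \<open>Every row has a piece, so constant overhead per pair can be charged to pieces.\<close>

lemma card_starts_pos: "1 <= card (starts k)"
 using zero_start[of k] finite_starts[of k] by (metis One_nat_def Suc_leI card_gt_0_iff empty_iff)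

lemma cp_le_X: "i < p ==> j < r ==> cp i j <= X"
 using cp_le[OF q0, of i j] bp_le[OF q0, of j] AX[of i 0 j] q0 by simp

lemma runs_cpr_init:
 assumes env: "env ts" and i: "vr ts 10 = i" "i < p"
  and Q: "!!ts'. frm {12} {} {2} ts ts' ==> (!!t. t < i * r ==> za ts' 2 t = za ts 2 t) ==> (!!j. j < r ==> za ts' 2 (i * r + j) = X) ==>
   tm ts' <= tm ts + 3 * r + 3 ==> Q ts'"
 shows "L2.run (L2.frl 12 (Var 3) (badd 2 (Var 10 *! Var 3 +! Var 12) 4 (Num 4) 4 (Num 0))) ts Q"
proof (rule runs_for[where X = "{12}" and Y = "{}" and Zs = "{2}" and n = r and
  J = "%m W Z t. (ALL t<i * r. Z 2 t = za ts 2 t) & (ALL j<m. Z 2 (i * r + j) = X) & t <= tm ts + 3 * m + 1"], goal_cases)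
 case (6 j ts' t)
 have env': "env ts'" using env_frm[OF env 6(2)] by simp
 have ij: "i * r + j < N" using index_less[OF i(2) 6(1)] sizes by simp
 have v: "vr ts' 10 = i" using 6(2) i by (simp add: frm_def)
 show ?case
  supply [simp] = ok2_def envD[OF env'] NN 6(3) ij v XBL
  apply (rule runs_badd', (simp; fail)+)
  using 6 by (auto simp: frm_def less_Suc_eq)
next
 case (7 ts' t)
 then show ?case by (intro Q) auto
qed (use env NN in \<open>auto simp: ok2_def frm_def env_def\<close>)

text \<open>Before the suffix pass only bounds hold: no cell is below \<open>cp\<close>, and the
  cell at the last column of a piece is at most the value of that piece.\<close>

lemma runs_cpr_pieces:
 assumes env: "env ts" and st: "stab (wa ts)" and i: "vr ts 10 = i" "i < p" and init: "!!j. j < r ==> za ts 2 (i * r + j) = X"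
  and Q: "!!ts'. frm {11, 12, 17} {} {2, 5} ts ts' ==> (!!t. t < i * r ==> za ts' 2 t = za ts 2 t) ==>
   (!!j. j < r ==> cp i j <= za ts' 2 (i * r + j)) ==>
   (!!k s. k < q ==> s \<in> starts k ==> za ts' 2 (i * r + (en k s - 1)) <= A i k + B k s) ==>
   tm ts' <= tm ts + 14 * PC + 3 ==> Q ts'"
 shows "L2.run (L2.frl 11 (Var 2) (pl (badd 5 (Num 0) 0 (Var 10 *! Var 2 +! Var 11) 1 (Var 11 *! Var 3 +! Var 12) ;;
    chmin 2 (Var 10 *! Var 3 +! (Arr 2 (Var 11 *! Var 3 +! Var 12) -! Num 1))))) ts Q"
proof (rule runs_for[where X = "{11, 12, 17}" and Y = "{}" and Zs = "{2, 5}" and n = q and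
  J = "%m W Z t. (ALL t<i * r. Z 2 t = za ts 2 t) & (ALL j<r. cp i j <= Z 2 (i * r + j)) &
   (ALL k<m. \<forall>s\<in>starts k. Z 2 (i * r + (en k s - 1)) <= A i k + B k s) & t <= tm ts + 14 * (\<Sum>k<m. card (starts k)) + 1"], goal_cases)
 case (6 k ts' t)
 show ?case
 proof (rule runs_pl[where X = "{12, 17}" and Y = "{}" and Zs = "{2, 5}" and k = k and
   J = "%D W Z t. (ALL t<i * r. Z 2 t = za ts 2 t) & (ALL j<r. cp i j <= Z 2 (i * r + j)) &
   (\<forall>k'<k. \<forall>s\<in>starts k'. Z 2 (i * r + (en k' s - 1)) <= A i k' + B k' s) & (\<forall>s\<in>D. Z 2 (i * r + (en k s - 1)) <= A i k + B k s) &
   t <= tm ts + 14 * (\<Sum>k<k. card (starts k)) + 4 + 8 * card D"], goal_cases)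
  case (10 D s ts1 t1)
  have fr: "frm {11, 12, 17} {} {2, 5} ts ts1" using frm_trans[OF 6(2) 10(5)] by simp
  have env1: "env ts1" using env_frm[OF env fr] by simp
  have v: "vr ts1 10 = i" "vr ts1 11 = k" using fr i 10(5) 6(3) by (auto simp: frm_def)
  have st1: "wa ts1 2 (k * r + s) = en k s" using st 10(1) 6(1) fr by (auto simp: stab_def frm_def)
  have sr: "s < r" using 10(1) by (simp add: starts_def)
  have ik: "i * q + k < N" "k * r + s < N" using index_less[OF i(2) 6(1)] index_less[OF 6(1) sr] sizes by auto
  have lt: "A i k + B k s < BL" using AX[OF i(2) 6(1) sr] XBL by simp
  note pc = piece[OF 10(1)]
  define e where "e = en k s - 1"
  have e: "e < r" "en k s - Suc 0 = e" "s <= e" using pc(2,3) by (auto simp: e_def)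
  have ie: "i * r + e < N" using index_less[OF i(2) e(1)] sizes by simp
  have "e < en k s" using pc(2) by (simp add: e_def)
  then have "e \<in> {j. j < r & stt k j = s}" unfolding pc(1) using e(3) by simp
  then have cple: "cp i e <= A i k + B k s" using cp_le[OF 6(1), of i e] by (simp add: bp_def)
  let ?y = "A i k + B k s"
  let ?z = "%t. if t = i * r + e then min (za ts1 2 (i * r + e)) ?y else za ts1 2 t"
  have zle: "?z t <= za ts1 2 t" for t by simp
  have j8: "ALL t<i * r. za ts1 2 t = za ts 2 t" "ALL j<r. cp i j <= za ts1 2 (i * r + j)"
   "\<forall>k'<k. \<forall>s\<in>starts k'. za ts1 2 (i * r + (en k' s - 1)) <= A i k' + B k' s" "\<forall>s\<in>D. za ts1 2 (i * r + (en k s - 1)) <= A i k + B k s"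
   "t1 <= tm ts + 14 * (\<Sum>k<k. card (starts k)) + 4 + 8 * card D" using 10(8) by auto
  have z1: "ALL t<i * r. ?z t = za ts 2 t" using j8(1) by simp
  have z2: "ALL j<r. cp i j <= ?z (i * r + j)" using j8(2) cple by simp
  have z3: "\<forall>k'<k. \<forall>s\<in>starts k'. ?z (i * r + (en k' s - 1)) <= A i k' + B k' s" using j8(3) zle le_trans by blast
  have z4: "\<forall>s'\<in>insert s D. ?z (i * r + (en k s' - 1)) <= A i k + B k s'"
  proof
   fix s' assume "s' \<in> insert s D"
   then consider "s' = s" | "s' \<in> D" by auto
   then show "?z (i * r + (en k s' - 1)) <= A i k + B k s'"
   proof cases
    case 1 then show ?thesis by (simp add: e_def)
   next
    case 2 then show ?thesis using j8(4) zle le_trans by blast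
   qed
  qed
  have cd: "card (insert s D) = Suc (card D)" using 10(3,4) by simp
  have fin: "vr ts'' 12 = s & frm {12, 17} {} {2, 5} ts' ts'' & (ALL t<i * r. za ts'' 2 t = za ts 2 t) & (ALL j<r. cp i j <= za ts'' 2 (i * r + j)) &
   (\<forall>k'<k. \<forall>s\<in>starts k'. za ts'' 2 (i * r + (en k' s - 1)) <= A i k' + B k' s) & (\<forall>s\<in>insert s D. za ts'' 2 (i * r + (en k s - 1)) <= A i k + B k s) &
   Suc (tm ts'') <= tm ts + 14 * (\<Sum>k<k. card (starts k)) + 4 + 8 * card (insert s D)"
   if "za ts'' 2 = ?z" "frm {17} {} {2, 5} ts1 ts''" "tm ts'' <= tm ts1 + 4" for ts''
  proof (intro conjI)
   show "frm {12, 17} {} {2, 5} ts' ts''" using frm_trans[OF 10(5) that(2)] by simp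
   show "vr ts'' 12 = s" using that(2) 10(6) by (simp add: frm_def)
  qed (unfold that(1), fact z1, fact z2, fact z3, fact z4, use that(3) j8(5) 10(7) cd in simp)
  show ?case
   supply [simp] = ok2_def envD[OF env1] NN 10(6) v st1 ik lt e(2) ie i(2) 6(1) sr
   apply (rule runs_seq, rule runs_badd', (simp; fail)+)
   apply (rule runs_chmin'[where i = "i * r + e"], (simp; fail)+)
   apply (rule fin)
    apply (simp add: fun_eq_iff)
    apply (simp add: frm_def)
   apply simp
   done
 next
  case (11 ts1 t1)
  have fr: "frm {11, 12, 17} {} {2, 5} ts ts1" using frm_trans[OF 6(2) 11(1)] by simp
  have v: "vr ts1 11 = k" using 11(1) 6(3) by (auto simp: frm_def)
  show ?case using fr v 11(2,3) card_starts_pos[of k] by (auto simp: less_Suc_eq)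
 qed (use 6 env st NN in \<open>auto simp: env_def stab_def frm_def\<close>)
next
 case (7 ts' t)
 then show ?case by (intro Q) (auto simp: PC_def)
qed (use env NN sizes init cp_le_X i in \<open>auto simp: ok2_def frm_def env_def\<close>)

text \<open>The piece of a minimiser at column \<open>j\<close> either ends there, and then the cell
  is small enough, or goes on to \<open>j + 1\<close> with the same value, and then
  \<open>cp i (Suc j) <= cp i j\<close>.\<close>

lemma runs_cpr_suffix:
 assumes env: "env ts" and i: "vr ts 10 = i" "i < p" and lo: "!!j. j < r ==> cp i j <= za ts 2 (i * r + j)"
  and up: "!!k s. k < q ==> s \<in> starts k ==> za ts 2 (i * r + (en k s - 1)) <= A i k + B k s"
  and Q: "!!ts'. frm {12, 13, 17} {} {2, 5} ts ts' ==> (!!t. t < i * r ==> za ts' 2 t = za ts 2 t) ==>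
   (!!j. j < r ==> za ts' 2 (i * r + j) = cp i j) ==> tm ts' <= tm ts + 8 * r + 3 ==> Q ts'"
 shows "L2.run (L2.frl 13 (Var 3 -! Num 1) (asg2 12 (Var 3 -! (Num 2 +! Var 13)) ;;
    badd 5 (Num 0) 2 (Var 10 *! Var 3 +! (Var 12 +! Num 1)) 4 (Num 0) ;; chmin 2 (Var 10 *! Var 3 +! Var 12))) ts Q"
proof -
 \<comment> \<open>The piece that contains the last column ends with it, so its value is already
   entered there.\<close>
 have last: "za ts 2 (i * r + (r - Suc 0)) = cp i (r - Suc 0)"
 proof -
  obtain k where k: "k < q" "cp i (r - 1) = A i k + bp k (r - 1)" using cp_ex by blast
  have s: "stt k (r - 1) \<in> starts k" "r - 1 < en k (stt k (r - 1))" using stt_start[of "r - 1" k] r0 by auto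
  then have "en k (stt k (r - 1)) = r" using piece(3)[OF s(1)] by simp
  then have "za ts 2 (i * r + (r - 1)) <= cp i (r - 1)" using up[OF k(1) s(1)] k(2) by (simp add: bp_def)
  then show ?thesis using lo[of "r - 1"] r0 by simp
 qed
 show ?thesis
 proof (rule runs_for[where X = "{12, 13, 17}" and Y = "{}" and Zs = "{2, 5}" and n = "r - 1" and
   J = "%m W Z t. (ALL t<i * r. Z 2 t = za ts 2 t) & (ALL j<r. Z 2 (i * r + j) = (if r - Suc m <= j then cp i j else za ts 2 (i * r + j))) & t <= tm ts + 8 * m + 1"], goal_cases)
  case (6 m ts' t)
  have env': "env ts'" using env_frm[OF env 6(2)] by simp
  define j where "j = r - (2 + m)"
  have j: "Suc j < r" "r - Suc m = Suc j" "r - Suc (Suc m) = j" "r - (2 + m) = j" using 6(1) by (auto simp: j_def)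
  have ij: "i * r + j < N" "i * r + Suc j < N" "j < N" using index_less[OF i(2), of j r] index_less[OF i(2) j(1)] j sizes by auto
  have v: "vr ts' 10 = i" using 6(2) i by (simp add: frm_def)
  have z: "za ts' 2 (i * r + Suc j) = cp i (Suc j)" "za ts' 2 (i * r + j) = za ts 2 (i * r + j)" using 6(5) j by auto
  have lt: "cp i (Suc j) < BL" using cp_le_X[OF i(2) j(1)] XBL by simp
  have mn: "min (za ts 2 (i * r + j)) (cp i (Suc j)) = cp i j"
  proof (rule antisym)
   obtain k where k: "k < q" "cp i j = A i k + bp k j" using cp_ex by blast
   have s: "stt k j \<in> starts k" "stt k j <= j" "j < en k (stt k j)" using stt_start[of j k] j by auto
   show "min (za ts 2 (i * r + j)) (cp i (Suc j)) <= cp i j"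
   proof (cases "en k (stt k j) - 1 = j")
    case True
    then show ?thesis using up[OF k(1) s(1)] k(2) by (simp add: bp_def)
   next
    case False
    then have "Suc j \<in> {stt k j..<en k (stt k j)}" using s by auto
    then have "stt k (Suc j) = stt k j" unfolding piece(1)[OF s(1), symmetric] by simp
    then have "cp i (Suc j) <= cp i j" using cp_le[OF k(1), of i "Suc j"] k(2) by (simp add: bp_def)
    then show ?thesis by simp
   qed
   show "cp i j <= min (za ts 2 (i * r + j)) (cp i (Suc j))" using lo[of j] cp_mono[of j "Suc j" i] j by simp
  qed
  have jj: "r - Suc (Suc m) <= j' \<longleftrightarrow> j' = j \<or> r - Suc m <= j'" for j' using j by auto
  show ?case
   supply [simp] = ok2_def envD[OF env'] NN 6(3) v ij ij[simplified] j z z[simplified] lt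
   apply (rule runs_seq, rule runs_asg', (simp; fail)+)
   apply (rule runs_seq, rule runs_badd', (simp; fail)+)
   apply (rule runs_chmin', (simp; fail)+)
   subgoal for v' t'
    using 6 mn by (auto simp: frm_def jj)
   done
 next
  case (7 ts' t)
  have "r - Suc (r - 1) = 0" using r0 by simp
  then show ?case using 7 by (intro Q) auto
 next
  case 5
  have "za ts 2 (i * r + j) = (if r - Suc 0 <= j then cp i j else za ts 2 (i * r + j))" if "j < r" for j
  proof (cases "j = r - Suc 0")
   case True
   then show ?thesis using last by simp
  next
   case False
   then have "\<not> r - Suc 0 <= j" using that by simp
   then show ?thesis by simp
  qed
  then show ?case by simp
 qed (use env NN in \<open>auto simp: ok2_def frm_def env_def\<close>)
qed

lemma runs_cpr:
 assumes env: "env ts" and st: "stab (wa ts)"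
  and Q: "!!ts'. frm {10, 11, 12, 13, 17} {} {2, 5} ts ts' ==> (!!i j. i < p ==> j < r ==> za ts' 2 (i * r + j) = cp i j) ==>
   tm ts' <= tm ts + p * (11 * r + 14 * PC + 12) + 3 ==> Q ts'"
 shows "L2.run cpr ts Q"
 unfolding cpr_def
proof (rule runs_for[where X = "{10, 11, 12, 13, 17}" and Y = "{}" and Zs = "{2, 5}" and n = p and
  J = "%m W Z t. (ALL i<m. ALL j<r. Z 2 (i * r + j) = cp i j) & t <= tm ts + m * (11 * r + 14 * PC + 12) + 1"], goal_cases)
 case (6 i ts0 t)
 have env0: "env ts0" using env_frm[OF env 6(2)] by simp
 show ?case
 proof (rule runs_seq, rule runs_cpr_init[OF env0 6(3,1)])
  fix ts1 assume 1: "frm {12} {} {2} ts0 ts1" "!!t. t < i * r ==> za ts1 2 t = za ts0 2 t" "!!j. j < r ==> za ts1 2 (i * r + j) = X"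
   "tm ts1 <= tm ts0 + 3 * r + 3"
  have f1: "frm {10, 11, 12, 13, 17} {} {2, 5} ts ts1" using frm_trans[OF 6(2) 1(1)] by simp
  have env1: "env ts1" using env_frm[OF env f1] by simp
  have st1: "stab (wa ts1)" "vr ts1 10 = i" using st f1 1(1) 6(3) by (auto simp: stab_def frm_def)
  show "L2.run (L2.frl 11 (Var 2) (pl (badd 5 (Num 0) 0 (Var 10 *! Var 2 +! Var 11) 1 (Var 11 *! Var 3 +! Var 12) ;;
    chmin 2 (Var 10 *! Var 3 +! (Arr 2 (Var 11 *! Var 3 +! Var 12) -! Num 1)))) ;;
   L2.frl 13 (Var 3 -! Num 1) (asg2 12 (Var 3 -! (Num 2 +! Var 13)) ;;
    badd 5 (Num 0) 2 (Var 10 *! Var 3 +! (Var 12 +! Num 1)) 4 (Num 0) ;; chmin 2 (Var 10 *! Var 3 +! Var 12))) ts1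
   (%ts''. vr ts'' 10 = i & frm {10, 11, 12, 13, 17} {} {2, 5} ts ts'' &
    (\<forall>i'<Suc i. ALL j<r. za ts'' 2 (i' * r + j) = cp i' j) & Suc (tm ts'') <= tm ts + Suc i * (11 * r + 14 * PC + 12) + 1)"
  proof (rule runs_seq, rule runs_cpr_pieces[OF env1 st1(1,2) 6(1) 1(3)])
   fix ts2 assume 2: "frm {11, 12, 17} {} {2, 5} ts1 ts2" "!!t. t < i * r ==> za ts2 2 t = za ts1 2 t"
    "!!j. j < r ==> cp i j <= za ts2 2 (i * r + j)"
    "!!k s. k < q ==> s \<in> starts k ==> za ts2 2 (i * r + (en k s - 1)) <= A i k + B k s" "tm ts2 <= tm ts1 + 14 * PC + 3"
   have f2: "frm {10, 11, 12, 13, 17} {} {2, 5} ts ts2" using frm_trans[OF f1 2(1)] by simp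
   have env2: "env ts2" using env_frm[OF env f2] by simp
   have v2: "vr ts2 10 = i" using 2(1) st1 by (auto simp: frm_def)
   show "L2.run (L2.frl 13 (Var 3 -! Num 1) (asg2 12 (Var 3 -! (Num 2 +! Var 13)) ;;
     badd 5 (Num 0) 2 (Var 10 *! Var 3 +! (Var 12 +! Num 1)) 4 (Num 0) ;; chmin 2 (Var 10 *! Var 3 +! Var 12))) ts2
    (%ts''. vr ts'' 10 = i & frm {10, 11, 12, 13, 17} {} {2, 5} ts ts'' &
    (\<forall>i'<Suc i. ALL j<r. za ts'' 2 (i' * r + j) = cp i' j) & Suc (tm ts'') <= tm ts + Suc i * (11 * r + 14 * PC + 12) + 1)"
   proof (rule runs_cpr_suffix[OF env2 v2 6(1) 2(3,4)])
    fix ts3 assume 3: "frm {12, 13, 17} {} {2, 5} ts2 ts3" "!!t. t < i * r ==> za ts3 2 t = za ts2 2 t"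
     "!!j. j < r ==> za ts3 2 (i * r + j) = cp i j" "tm ts3 <= tm ts2 + 8 * r + 3"
    have f3: "frm {10, 11, 12, 13, 17} {} {2, 5} ts ts3" using frm_trans[OF f2 3(1)] by simp
    have old: "za ts3 2 (i' * r + j) = cp i' j" if "i' < i" "j < r" for i' j
     using 3(2) 2(2) 1(2) 6(5) that index_less[OF that] by simp
    have new: "\<forall>i'<Suc i. ALL j<r. za ts3 2 (i' * r + j) = cp i' j" using old 3(3) by (auto simp: less_Suc_eq)
    have v3: "vr ts3 10 = i" using 3(1) v2 by (auto simp: frm_def)
    have "Suc (tm ts3) <= tm ts + Suc i * (11 * r + 14 * PC + 12) + 1"
     using 1(4) 2(5) 3(4) 6(4,5) by (simp add: algebra_simps)
    then show "vr ts3 10 = i & frm {10, 11, 12, 13, 17} {} {2, 5} ts ts3 &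
     (\<forall>i'<Suc i. ALL j<r. za ts3 2 (i' * r + j) = cp i' j) & Suc (tm ts3) <= tm ts + Suc i * (11 * r + 14 * PC + 12) + 1"
     using f3 new v3 by simp
   qed
  qed
 qed
next
 case (7 ts' t)
 then show ?case by (intro Q) auto
qed (use env NN sizes in \<open>auto simp: ok2_def frm_def env_def\<close>)

end

lemma sum_lessThan_add: "(\<Sum>t<m + n. f t) = (\<Sum>t<m. f t) + (\<Sum>t<n. f (m + t :: nat))" for f :: "nat => nat"
 by (induction n) auto

lemma sum_mod: "(\<Sum>t<p * q. f (t mod q)) = p * (\<Sum>k<q. f k)" for f :: "nat => nat"
proof (induction p)
 case (Suc p)
 have "(\<Sum>t<Suc p * q. f (t mod q)) = (\<Sum>t<p * q + q. f (t mod q))" by (simp add: add.commute)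
 also have "\<dots> = p * (\<Sum>k<q. f k) + (\<Sum>t<q. f ((p * q + t) mod q))" by (simp add: sum_lessThan_add Suc)
 also have "(\<Sum>t<q. f ((p * q + t) mod q)) = (\<Sum>k<q. f k)" by (intro sum.cong) auto
 finally show ?case by simp
qed simp

lemma floorlog_half: "0 < d ==> floorlog 2 d = Suc (floorlog 2 (d div 2))"
 by (subst compute_floorlog) auto

section \<open>Alive segments and their difference arrays\<close>

context algo2
begin

definition ini :: prog where
 "ini = L2.frl 19 (Var 1 *! Var 2) (sto2 3 (Var 19) (Num 0)) ;;
   L2.frl 19 (Var 3 +! Num 1) (sto2 4 (Var 19) (Num 0) ;; sto2 5 (Var 19) (Num 0)) ;;
   L2.frl 19 (Var 1 *! Var 3) (badd 3 (Var 19) 4 (Num 4) 4 (Num 0))"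

lemma runs_ini:
 assumes env: "env ts"
  and Q: "!!ts'. frm {19} {3, 4, 5} {3} ts ts' ==> (!!t. t < p * q ==> wa ts' 3 t = 0) ==> (!!x. x <= r ==> wa ts' 4 x = 0 & wa ts' 5 x = 0) ==>
   (!!t. t < p * r ==> za ts' 3 t = X) ==> tm ts' <= tm ts + 3 * (p * q) + 4 * r + 3 * (p * r) + 15 ==> Q ts'"
 shows "L2.run ini ts Q"
 unfolding ini_def
proof (rule runs_seq, rule runs_for[where X = "{19}" and Y = "{3}" and Zs = "{}" and n = "p * q" and
  J = "%m W Z t. (ALL t<m. W 3 t = 0) & t <= tm ts + 3 * m + 1"], goal_cases)
 case (6 m ts' t)
 show ?case
  apply (rule runs_sto', (use NN 6 in \<open>simp add: ok2_def; fail\<close>)+)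
  using 6 by (auto simp: frm_def less_Suc_eq)
next
 case (7 ts1 t)
 have env1: "env ts1" using env_frm[OF env 7(1)] by simp
 show ?case
 proof (rule runs_seq, rule runs_for[where X = "{19}" and Y = "{4, 5}" and Zs = "{}" and n = "Suc r" and
   J = "%m W Z t. (ALL x<m. W 4 x = 0 & W 5 x = 0) & t <= tm ts1 + 4 * m + 1"], goal_cases)
  case (6 m ts' t)
  show ?case
   apply (rule runs_seq, rule runs_sto', (use NN 6 in \<open>simp add: ok2_def; fail\<close>)+)
   apply (rule runs_sto', (use NN 6 in \<open>simp add: ok2_def; fail\<close>)+)
   using 6 by (auto simp: frm_def less_Suc_eq)
 next
  case (7 ts2 t2)
  have env2: "env ts2" using env_frm[OF env1 7(1)] by simp
  have f12: "frm {19} {3, 4, 5} {} ts ts2" using frm_trans[OF frm_mono[OF \<open>frm _ _ _ ts ts1\<close>] 7(1), of "{19}" "{3, 4, 5}" "{}"] by simp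
  have w3: "wa ts2 3 = wa ts1 3" using 7(1) by (simp add: frm_def)
  have t12: "tm ts2 <= tm ts + 3 * (p * q) + 4 * r + 9" using 7(2,3) \<open>tm ts1 = _\<close> \<open>_ & t <= _\<close> by simp
  show ?case
  proof (rule runs_for[where X = "{19}" and Y = "{}" and Zs = "{3}" and n = "p * r" and
    J = "%m W Z t. (ALL t<m. Z 3 t = X) & t <= tm ts2 + 3 * m + 1"], goal_cases)
   case (6 m ts' t)
   have env': "env ts'" using env_frm[OF env2 6(2)] by simp
   show ?case
    apply (rule runs_badd', (use NN 6(1,3) sizes XBL envD[OF env'] in \<open>simp add: ok2_def; fail\<close>)+)
    using 6 by (auto simp: frm_def less_Suc_eq)
  next
   case (7 ts3 t3)
   have "frm {19} {3, 4, 5} {3} ts ts3" using frm_trans[OF frm_mono[OF f12] 7(1), of "{19}" "{3, 4, 5}" "{3}"] by simp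
   moreover have "wa ts3 = wa ts2" using 7(1) by (auto simp: frm_def)
   ultimately show ?case using 7(2,3) t12 w3 \<open>(ALL t<p * q. wa ts1 3 t = 0) & _\<close> \<open>(ALL x<Suc r. _ x) & _\<close> by (intro Q) auto
  qed (use sizes env2 in \<open>auto simp: ok2_def frm_def env_def\<close>)
 qed (use sizes env1 in \<open>auto simp: ok2_def frm_def env_def\<close>)
qed (use sizes env in \<open>auto simp: ok2_def frm_def env_def\<close>)

definition bs :: prog where
 "bs = whl (ev2 (Var 14 <! Var 15)) (asg2 16 ((Var 14 +! Var 15) idiv Num 2) ;;
   badd 5 (Num 1) 2 (Var 10 *! Var 3 +! Var 16) 4 (Num 1) ;; bless 17 5 (Num 0) 5 (Num 1) ;;
   cnd (ev2 (Var 17)) (asg2 15 (Var 16)) (asg2 14 (Var 16 +! Num 1)))"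

definition cpt :: "(nat => nat => nat) => bool" where
 "cpt Z \<longleftrightarrow> (ALL i<p. ALL j<r. Z 2 (i * r + j) = cp i j)"

text \<open>The test \<open>x < cp i j + \<Delta>\<close> flips at most once because
  \<open>cp i\<close> is non-decreasing. A round costs at most six ticks and shortens the bit length
  of the interval by at least one.\<close>

lemma runs_bs:
 assumes env: "env ts" and cpt: "cpt (za ts)" and v: "vr ts 10 = i" "i < p" "vr ts 14 = lo" "vr ts 15 = hi" "lo <= hi" "hi <= r" "za ts 5 0 = x"
  and Q: "!!ts'. frm {14, 15, 16, 17} {} {5} ts ts' ==> lo <= vr ts' 14 ==> vr ts' 14 <= hi ==>
   (!!j. lo <= j ==> j < vr ts' 14 ==> \<not> x < cp i j + \<Delta>) ==> (vr ts' 14 < hi ==> x < cp i (vr ts' 14) + \<Delta>) ==>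
   tm ts' <= tm ts + 6 * floorlog 2 (hi - lo) + 1 ==> Q ts'"
 shows "L2.run bs ts Q"
 unfolding bs_def
proof (rule L2.runs_whl[where \<mu> = "%ts'. vr ts' 15 - vr ts' 14" and I = "%ts'. frm {14, 15, 16, 17} {} {5} ts ts' & za ts' 5 0 = x &
  lo <= vr ts' 14 & vr ts' 14 <= vr ts' 15 & vr ts' 15 <= hi & (ALL j. lo <= j --> j < vr ts' 14 --> \<not> x < cp i j + \<Delta>) &
  (vr ts' 15 < hi --> x < cp i (vr ts' 15) + \<Delta>) & tm ts' + 6 * floorlog 2 (vr ts' 15 - vr ts' 14) <= tm ts + 6 * floorlog 2 (hi - lo)"], goal_cases)
 case (3 ts')
 have env': "env ts'" using env_frm[OF env 3(1)[THEN conjunct1]] by simp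
 define l h m where lhm: "l = vr ts' 14" "h = vr ts' 15" "m = (l + h) div 2"
 have lt: "l < h" using 3(2) by (auto simp: lhm split: if_splits)
 have m: "l <= m" "m < h" "h <= r" "m < r" using lt 3(1) v by (auto simp: lhm)
 have v10: "vr ts' 10 = i" "za ts' 2 = za ts 2" using 3(1) v by (auto simp: frm_def)
 have z: "za ts' 2 (i * r + m) = cp i m" using cpt m v v10 by (simp add: cpt_def)
 have im: "i * r + m < N" "m < N" "Suc m < N" using index_less[OF v(2) m(4)] sizes m by auto
 have bl: "cp i m + \<Delta> < BL" using cp_le_X[OF v(2) m(4)] XB by simp
 have fl: "floorlog 2 (h - l) = Suc (floorlog 2 ((h - l) div 2))" using lt by (intro floorlog_half) simp
 have f1: "floorlog 2 (m - l) <= floorlog 2 ((h - l) div 2)" using lt by (intro floorlog_mono) (auto simp: lhm)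
 have f2: "floorlog 2 (h - Suc m) <= floorlog 2 ((h - l) div 2)" using lt by (intro floorlog_mono) (auto simp: lhm)
 have I: "frm {14, 15, 16, 17} {} {5} ts ts'" "za ts' 5 0 = x" "lo <= l" "h <= hi" "ALL j. lo <= j --> j < l --> \<not> x < cp i j + \<Delta>"
  "h < hi --> x < cp i h + \<Delta>" "tm ts' + 6 * floorlog 2 (h - l) <= tm ts + 6 * floorlog 2 (hi - lo)" using 3(1) by (auto simp: lhm)
 have mono: "\<not> x < cp i j + \<Delta>" if "\<not> x < cp i m + \<Delta>" "j <= m" for j using cp_mono[OF that(2) m(4), of i] that by simp
 have fin: "frm {14, 15, 16, 17} {} {5} ts ts''" if "frm {14, 15, 16, 17} {} {5} ts' ts''" for ts''
  using frm_trans[OF I(1) that] by simp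
 show ?case
  supply [simp] = ok2_def envD[OF env'] NN v10(1) z im bl lhm(1,2)[symmetric] lhm(3)[symmetric] I(2)
  apply (rule runs_seq, rule runs_asg', (simp; fail)+)
  apply (rule runs_seq, rule runs_badd', (simp; fail)+)
  apply (rule runs_seq, rule runs_bless', (simp; fail)+)
  apply (rule runs_cnd', (simp; fail)+)
   apply (rule runs_asg', (simp; fail)+)
   apply (intro conjI)
       apply (rule fin, simp add: frm_def)
      apply simp
      apply (use I m in simp)
     apply (use I m in simp)
     apply (use I m in simp)
    apply (use I m in simp)
    apply (simp split: if_splits)
   apply (use I(7) fl f1 in simp)
   apply (use m in simp)
  apply (rule runs_asg', (simp; fail)+)
  apply (intro conjI)
      apply (rule fin, simp add: frm_def)
      apply simp
     apply (use I m in simp)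
     apply (use I m in simp)
    apply (use I m in simp)
    apply (use I m mono in \<open>simp add: less_Suc_eq_le split: if_splits\<close>)
   apply (use I m in simp)
   apply (use I(7) fl f2 in simp)
  apply (use m in simp)
  done
next
 case (4 ts')
 then have "vr ts' 14 = vr ts' 15" by (auto split: if_splits)
 then show ?case using 4(1) by (intro Q) (auto simp: frm_def)
qed (use v in \<open>auto simp: ok2_def\<close>)

text \<open>Handles one piece of one pair. The segment start is also stored in array 6, so that
  later passes need no search.\<close>

definition xbody :: prog where
 "xbody = asg2 13 (Arr 2 (Var 11 *! Var 3 +! Var 12)) ;; badd 5 (Num 0) 0 (Var 19) 1 (Var 11 *! Var 3 +! Var 12) ;;
   asg2 14 (Var 12) ;; asg2 15 (Var 13) ;; bs ;; sto2 6 (Var 19 *! Var 3 +! Var 12) (Var 14) ;;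
   sto2 4 (Var 14) (Arr 4 (Var 14) +! Num 1) ;; sto2 5 (Var 13) (Arr 5 (Var 13) +! Num 1)"

lemma runs_xbody:
 assumes env: "env ts" and cpt: "cpt (za ts)" and st: "stab (wa ts)" and v: "vr ts 10 = i" "vr ts 11 = k" "i < p" "k < q" "vr ts 12 = s" "vr ts 19 = i * q + k"
  and s: "s \<in> starts k" and lt: "wa ts 4 (xx i k s) + 1 < N" "wa ts 5 (en k s) + 1 < N"
  and Q: "!!ts'. frm {13, 14, 15, 16, 17} {4, 5, 6} {5} ts ts' ==> wa ts' 6 = (wa ts 6)((i * q + k) * r + s := xx i k s) ==>
   wa ts' 4 = (wa ts 4)(xx i k s := wa ts 4 (xx i k s) + 1) ==> wa ts' 5 = (wa ts 5)(en k s := wa ts 5 (en k s) + 1) ==>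
   tm ts' <= tm ts + 6 * floorlog 2 r + 8 ==> Q ts'"
 shows "L2.run xbody ts Q"
proof -
 have sr: "s < r" using s by (simp add: starts_def)
 have e2: "wa ts 2 (k * r + s) = en k s" using st s v by (simp add: stab_def)
 note pc = piece[OF s]
 have ik: "i * q + k < N" "k * r + s < N" "s < N" "en k s < N" using index_less[OF v(3,4)] index_less[OF v(4) sr] sizes sr pc(3) by auto
 have bl: "A i k + B k s < BL" using AX[OF v(3,4) sr] XBL by simp
 define ts1 where "ts1 = ts(|za := (za ts)(5 := (za ts 5)(0 := A i k + B k s)), vr := (vr ts)(13 := en k s, 14 := s, 15 := en k s), tm := Suc (Suc (Suc (Suc (tm ts))))|)"
 have f1: "frm {13, 14, 15, 16, 17} {4, 5, 6} {5} ts ts1" by (simp add: ts1_def frm_def)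
 have env1: "env ts1" using env_frm[OF env f1] by simp
 have cpt1: "cpt (za ts1)" using cpt by (simp add: cpt_def ts1_def)
 have v1: "vr ts1 10 = i" "vr ts1 14 = s" "vr ts1 15 = en k s" "za ts1 5 0 = A i k + B k s" using v by (auto simp: ts1_def)
 have main: "L2.run (bs ;; sto2 6 (Var 19 *! Var 3 +! Var 12) (Var 14) ;;
   sto2 4 (Var 14) (Arr 4 (Var 14) +! Num 1) ;; sto2 5 (Var 13) (Arr 5 (Var 13) +! Num 1)) ts1 Q"
 proof (rule runs_seq, rule runs_bs[OF env1 cpt1 v1(1) v(3) v1(2,3) _ pc(3) v1(4)])
  fix ts2 assume 2: "frm {14, 15, 16, 17} {} {5} ts1 ts2" "s <= vr ts2 14" "vr ts2 14 <= en k s"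
   "!!j. s <= j ==> j < vr ts2 14 ==> \<not> A i k + B k s < cp i j + \<Delta>" "vr ts2 14 < en k s ==> A i k + B k s < cp i (vr ts2 14) + \<Delta>"
   "tm ts2 <= tm ts1 + 6 * floorlog 2 (en k s - s) + 1"
  have x: "vr ts2 14 = xx i k s" using xx_eqI[OF 2(2,3,4,5)] by simp
  have f2: "frm {13, 14, 15, 16, 17} {4, 5, 6} {5} ts ts2" using frm_trans[OF f1 2(1)] by simp
  have env2: "env ts2" using env_frm[OF env f2] by simp
  have w: "wa ts2 = wa ts" "vr ts2 12 = s" "vr ts2 13 = en k s" "vr ts2 19 = i * q + k" using 2(1) v by (auto simp: frm_def ts1_def)
  have xN: "xx i k s < N" using 2(3) x ik by simp
  have tm2: "tm ts2 <= tm ts + 6 * floorlog 2 r + 5"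
  proof -
   have "en k s - s <= r" using pc(3) by simp
   from floorlog_mono[OF this, of 2] show ?thesis using 2(6) by (simp add: ts1_def)
  qed
  show "L2.run (sto2 6 (Var 19 *! Var 3 +! Var 12) (Var 14) ;;
   sto2 4 (Var 14) (Arr 4 (Var 14) +! Num 1) ;; sto2 5 (Var 13) (Arr 5 (Var 13) +! Num 1)) ts2 Q"
   supply [simp] = ok2_def envD[OF env2] NN x w xN lt lt[simplified]
   apply (rule runs_seq, rule runs_sto', (simp; fail)+)
   apply (rule runs_seq, rule runs_sto', (simp; fail)+)
   apply (rule runs_sto', (simp; fail)+)
   apply (rule Q)
     apply (use f2 in \<open>simp add: frm_def\<close>)
     apply simp
    apply simp
    apply simp
   using tm2 by simp
 qed (use pc in auto)
 show ?thesis unfolding xbody_def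
  supply [simp] = ok2_def envD[OF env] NN v e2 ik bl sr
  apply (rule runs_seq, rule runs_asg', (simp; fail)+)
  apply (rule runs_seq, rule runs_badd', (simp; fail)+)
  apply (rule runs_seq, rule runs_asg', (simp; fail)+)
  apply (rule runs_seq, rule runs_asg', (simp; fail)+)
  using main by (simp add: ts1_def fun_upd_twist)
qed

definition xxp :: prog where
 "xxp = L2.frl 19 (Var 1 *! Var 2) (asg2 10 (Var 19 idiv Var 2) ;; asg2 11 (Var 19 imod Var 2) ;; pl xbody)"

definition dpt :: "nat => nat => nat" where "dpt t = dp (t div q) (t mod q)"
definition dmt :: "nat => nat => nat" where "dmt t = dm (t mod q)"
definition xtab :: "(nat => nat => nat) => nat => bool" where
 "xtab W m \<longleftrightarrow> (ALL t<m. \<forall>s\<in>starts (t mod q). W 6 (t * r + s) = xx (t div q) (t mod q) s)"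

lemma starts_le: "D \<subseteq> starts k ==> card D <= r"
proof -
 assume "D \<subseteq> starts k"
 then have "D \<subseteq> {..<r}" by (auto simp: starts_def)
 then show ?thesis using card_mono[of "{..<r}" D] by simp
qed

lemma dpt_le: "dpt t x <= r" "dmt t x <= r"
 unfolding dpt_def dmt_def dp_def dm_def by (auto intro!: starts_le)

lemma runs_xxp:
 assumes env: "env ts" and cpt: "cpt (za ts)" and st: "stab (wa ts)"
  and z: "!!x. x <= r ==> wa ts 4 x = 0 & wa ts 5 x = 0"
  and Q: "!!ts'. frm {10, 11, 12, 13, 14, 15, 16, 17, 19} {4, 5, 6} {5} ts ts' ==> xtab (wa ts') (p * q) ==>
   (!!x. x <= r ==> wa ts' 4 x = (\<Sum>t<p * q. dpt t x)) ==> (!!x. x <= r ==> wa ts' 5 x = (\<Sum>t<p * q. dmt t x)) ==>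
   tm ts' <= tm ts + (6 * floorlog 2 r + 20) * (p * PC) + 3 ==> Q ts'"
 shows "L2.run xxp ts Q"
 unfolding xxp_def
proof (rule runs_for[where X = "{10, 11, 12, 13, 14, 15, 16, 17, 19}" and Y = "{4, 5, 6}" and Zs = "{5}" and n = "p * q" and
  J = "%m W Z t. xtab W m & (\<forall>x\<le>r. W 4 x = (\<Sum>t<m. dpt t x)) & (\<forall>x\<le>r. W 5 x = (\<Sum>t<m. dmt t x)) &
   t <= tm ts + (6 * floorlog 2 r + 20) * (\<Sum>t<m. card (starts (t mod q))) + 1"], goal_cases)
 case (6 m ts' t)
 define i k where ik: "i = m div q" "k = m mod q"
 have m: "m = i * q + k" "i < p" "k < q" using 6(1) q0 by (auto simp: ik less_mult_imp_div_less)
 have mN: "m < N" "i < N" "k < N" using 6(1) sizes m by auto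
 have env': "env ts'" using env_frm[OF env 6(2)] by simp
 let ?s = "ts'(|vr := (vr ts')(10 := i, 11 := k), tm := Suc (Suc (tm ts'))|)"
 let ?X = "{10, 11, 12, 13, 14, 15, 16, 17, 19}"
 have fs: "frm ?X {4, 5, 6} {5} ts ?s" using 6(2) by (auto simp: frm_def)
 have envs: "env ?s" using env_frm[OF env fs] by simp
 have mr: "m * r + r <= p * q * r" using 6(1) by (metis Suc_leI add.commute mult_Suc mult_le_mono1)
 \<comment> \<open>A pair has at most \<open>r\<close> pieces, so these counters never exceed
   \<open>p * q * r\<close> and remain words.\<close>
 have s4: "(\<Sum>t<m. dpt t x) <= m * r" "(\<Sum>t<m. dmt t x) <= m * r" for x
  using sum_bounded_above[of "{..<m}" "%t. dpt t x" r] sum_bounded_above[of "{..<m}" "%t. dmt t x" r] dpt_le by auto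
 have pl: "L2.run (pl xbody) ?s (%ts''. vr ts'' 19 = m & frm ?X {4, 5, 6} {5} ts ts'' & xtab (wa ts'') (Suc m) &
   (\<forall>x\<le>r. wa ts'' 4 x = (\<Sum>t<Suc m. dpt t x)) & (\<forall>x\<le>r. wa ts'' 5 x = (\<Sum>t<Suc m. dmt t x)) &
   Suc (tm ts'') <= tm ts + (6 * floorlog 2 r + 20) * (\<Sum>t<Suc m. card (starts (t mod q))) + 1)"
 proof (rule runs_pl[where X = "{12, 13, 14, 15, 16, 17}" and Y = "{4, 5, 6}" and Zs = "{5}" and k = k and
   J = "%D W Z t. xtab W m & (\<forall>s\<in>D. W 6 (m * r + s) = xx i k s) & (\<forall>x\<le>r. W 4 x = (\<Sum>t<m. dpt t x) + card {s \<in> D. xx i k s = x}) &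
    (\<forall>x\<le>r. W 5 x = (\<Sum>t<m. dmt t x) + card {s \<in> D. en k s = x}) &
    t <= tm ts + (6 * floorlog 2 r + 20) * (\<Sum>t<m. card (starts (t mod q))) + 6 + (6 * floorlog 2 r + 10) * card D"], goal_cases)
  case (10 D s ts1 t1)
  have f1: "frm ?X {4, 5, 6} {5} ts ts1" using frm_trans[OF fs 10(5)] by simp
  have env1: "env ts1" using env_frm[OF env f1] by simp
  have cpt1: "cpt (za ts1)" "stab (wa ts1)" using cpt st f1 by (auto simp: cpt_def stab_def frm_def)
  have v1: "vr ts1 10 = i" "vr ts1 11 = k" "vr ts1 19 = i * q + k" using 10(5) 6(3) m by (auto simp: frm_def)
  note pc = piece[OF 10(1)]
  have xr: "xx i k s <= r" using xx_le[OF 10(1), of i] pc(3) by simp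
  have cD: "card {s \<in> D. P s} + 1 <= r" for P
  proof -
   have "card {s \<in> D. P s} <= card D" using 10(4) by (intro card_mono) auto
   moreover have "card (insert s D) <= r" using 10(1,2) by (intro starts_le) auto
   ultimately show ?thesis using 10(3,4) by simp
  qed
  have lt: "wa ts1 4 (xx i k s) + 1 < N" "wa ts1 5 (en k s) + 1 < N"
   using 10(8) xr pc(3) s4[of "xx i k s"] s4[of "en k s"] cD[of "%s'. xx i k s' = xx i k s"] cD[of "%s'. en k s' = en k s"] mr sizes(7) by auto
  have ins: "card {s' \<in> insert s D. f s' = x} = card {s' \<in> D. f s' = x} + (if f s = x then 1 else 0)" for f and x :: nat
  proof -
   have "{s' \<in> insert s D. f s' = x} = (if f s = x then insert s {s' \<in> D. f s' = x} else {s' \<in> D. f s' = x})" by auto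
   then show ?thesis using 10(3,4) by simp
  qed
  show ?case
  proof (rule runs_xbody[OF env1 cpt1 v1(1,2) m(2,3) 10(6) v1(3) 10(1) lt])
   fix ts2 assume 2: "frm {13, 14, 15, 16, 17} {4, 5, 6} {5} ts1 ts2" "wa ts2 6 = (wa ts1 6)((i * q + k) * r + s := xx i k s)"
    "wa ts2 4 = (wa ts1 4)(xx i k s := wa ts1 4 (xx i k s) + 1)" "wa ts2 5 = (wa ts1 5)(en k s := wa ts1 5 (en k s) + 1)"
    "tm ts2 <= tm ts1 + 6 * floorlog 2 r + 8"
   have j8: "xtab (wa ts1) m" "\<forall>s\<in>D. wa ts1 6 (m * r + s) = xx i k s" "\<forall>x\<le>r. wa ts1 4 x = (\<Sum>t<m. dpt t x) + card {s \<in> D. xx i k s = x}"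
    "\<forall>x\<le>r. wa ts1 5 x = (\<Sum>t<m. dmt t x) + card {s \<in> D. en k s = x}"
    "t1 <= tm ts + (6 * floorlog 2 r + 20) * (\<Sum>t<m. card (starts (t mod q))) + 6 + (6 * floorlog 2 r + 10) * card D" using 10(8) by auto
   have sr: "s < r" using 10(1) by (simp add: starts_def)
   show "vr ts2 12 = s & frm {12, 13, 14, 15, 16, 17} {4, 5, 6} {5} ?s ts2 & xtab (wa ts2) m & (\<forall>s\<in>insert s D. wa ts2 6 (m * r + s) = xx i k s) &
    (\<forall>x\<le>r. wa ts2 4 x = (\<Sum>t<m. dpt t x) + card {s' \<in> insert s D. xx i k s' = x}) &
    (\<forall>x\<le>r. wa ts2 5 x = (\<Sum>t<m. dmt t x) + card {s' \<in> insert s D. en k s' = x}) &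
    Suc (tm ts2) <= tm ts + (6 * floorlog 2 r + 20) * (\<Sum>t<m. card (starts (t mod q))) + 6 + (6 * floorlog 2 r + 10) * card (insert s D)"
   proof (intro conjI)
    show "vr ts2 12 = s" using 2(1) 10(6) by (simp add: frm_def)
    show "frm {12, 13, 14, 15, 16, 17} {4, 5, 6} {5} ?s ts2" using frm_trans[OF 10(5) 2(1)] by simp
    show "xtab (wa ts2) m" unfolding xtab_def
    proof (intro allI impI ballI)
     fix t' s' assume a: "t' < m" "s' \<in> starts (t' mod q)"
     have "s' < r" using a by (simp add: starts_def)
     then have "t' * r + s' ~= m * r + s" using index_eq[OF _ sr, of s' t' m] a by auto
     then show "wa ts2 6 (t' * r + s') = xx (t' div q) (t' mod q) s'" using 2(2) j8(1) a m(1) by (simp add: xtab_def)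
    qed
    show "\<forall>s\<in>insert s D. wa ts2 6 (m * r + s) = xx i k s" using 2(2) j8(2) m(1) by auto
    show "\<forall>x\<le>r. wa ts2 4 x = (\<Sum>t<m. dpt t x) + card {s' \<in> insert s D. xx i k s' = x}" unfolding ins using 2(3) j8(3) by auto
    show "\<forall>x\<le>r. wa ts2 5 x = (\<Sum>t<m. dmt t x) + card {s' \<in> insert s D. en k s' = x}" unfolding ins using 2(4) j8(4) by auto
    show "Suc (tm ts2) <= tm ts + (6 * floorlog 2 r + 20) * (\<Sum>t<m. card (starts (t mod q))) + 6 + (6 * floorlog 2 r + 10) * card (insert s D)"
     using 2(5) j8(5) 10(3,4,7) by simp
   qed
  qed
 next
  case (11 ts1 t1)
  have f1: "frm ?X {4, 5, 6} {5} ts ts1" using frm_trans[OF fs 11(1)] by simp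
  have v: "vr ts1 19 = m" using 11(1) 6(3) by (auto simp: frm_def)
  have "xtab (wa ts1) (Suc m)" using 11(3) by (auto simp: xtab_def less_Suc_eq ik)
  moreover have "dpt m x = card {s \<in> starts k. xx i k s = x}" "dmt m x = card {s \<in> starts k. en k s = x}" for x
   by (auto simp: dpt_def dmt_def dp_def dm_def ik)
  moreover have "Suc (tm ts1) <= tm ts + (6 * floorlog 2 r + 20) * (\<Sum>t<Suc m. card (starts (t mod q))) + 1"
  proof -
   have "10 <= 10 * card (starts k)" using card_starts_pos[of k] by simp
   then show ?thesis using 11(2,3) by (simp add: algebra_simps ik[symmetric])
  qed
  ultimately show ?case using f1 v 11(3) by simp
 qed (use 6(3,4,5) env' st NN sizes 6(2) m(3) in \<open>auto simp: env_def stab_def frm_def\<close>)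
 show ?case
  supply [simp] = ok2_def envD[OF env'] mN NN 6(3) ik[symmetric]
  apply (rule runs_seq, rule runs_asg', (simp; fail)+)
  apply (rule runs_seq, rule runs_asg', (simp; fail)+)
  using pl by simp
next
 case (7 ts' t)
 have "(\<Sum>t<p * q. card (starts (t mod q))) = p * PC" unfolding PC_def by (rule sum_mod)
 then show ?case using 7 by (intro Q) auto
qed (use env NN sizes z in \<open>auto simp: ok2_def frm_def env_def xtab_def\<close>)

end

section \<open>Enumeration of alive triples and removal of covered pairs\<close>

context algo2
begin

text \<open>One half of correctness, kept by every update: only genuine sums
  \<open>A i k + B k j\<close> are merged, so the result never falls below the exact
  product.\<close>

definition lowC :: "(nat => nat => nat) => bool" where
 "lowC Z \<longleftrightarrow> (ALL i<p. ALL j<r. cc i j <= Z 3 (i * r + j))"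

definition St :: "nat => nat set" where "St t = S (t div q) (t mod q)"

definition ebody :: prog where
 "ebody = asg2 14 (Arr 6 (Var 19 *! Var 3 +! Var 12)) ;; asg2 13 (Arr 2 (Var 11 *! Var 3 +! Var 12)) ;;
   whl (ev2 (Var 14 <! Var 13)) (badd 5 (Num 0) 0 (Var 19) 1 (Var 11 *! Var 3 +! Var 14) ;;
    chmin 3 (Var 10 *! Var 3 +! Var 14) ;; asg2 14 (Var 14 +! Num 1))"

lemma runs_ebody:
 assumes env: "env ts" and st: "stab (wa ts)" and v: "vr ts 10 = i" "vr ts 11 = k" "i < p" "k < q" "vr ts 12 = s" "vr ts 19 = i * q + k"
  and s: "s \<in> starts k" and x: "wa ts 6 ((i * q + k) * r + s) = xx i k s" and low: "lowC (za ts)"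
  and Q: "!!ts'. frm {13, 14, 17} {} {3, 5} ts ts' ==> (!!t. za ts' 3 t <= za ts 3 t) ==> lowC (za ts') ==>
   (!!j. xx i k s <= j ==> j < en k s ==> za ts' 3 (i * r + j) <= A i k + B k j) ==>
   tm ts' <= tm ts + 6 * (en k s - xx i k s) + 3 ==> Q ts'"
 shows "L2.run ebody ts Q"
proof -
 have sr: "s < r" using s by (simp add: starts_def)
 have e2: "wa ts 2 (k * r + s) = en k s" using st s v by (simp add: stab_def)
 note pc = piece[OF s]
 have xe: "xx i k s <= en k s" "xx i k s < N" "en k s < N" using xx_le[OF s, of i] pc(3) NN by auto
 define ts1 where "ts1 = ts(|vr := (vr ts)(14 := xx i k s, 13 := en k s), tm := Suc (Suc (tm ts))|)"
 have main: "L2.run (whl (ev2 (Var 14 <! Var 13)) (badd 5 (Num 0) 0 (Var 19) 1 (Var 11 *! Var 3 +! Var 14) ;;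
    chmin 3 (Var 10 *! Var 3 +! Var 14) ;; asg2 14 (Var 14 +! Num 1))) ts1 Q"
 proof (rule L2.runs_whl[where \<mu> = "%ts'. en k s - vr ts' 14" and I = "%ts'. frm {13, 14, 17} {} {3, 5} ts ts' & vr ts' 13 = en k s &
   xx i k s <= vr ts' 14 & vr ts' 14 <= en k s & (ALL t. za ts' 3 t <= za ts 3 t) & lowC (za ts') &
   (ALL j. xx i k s <= j --> j < vr ts' 14 --> za ts' 3 (i * r + j) <= A i k + B k j) & tm ts' <= tm ts + 6 * (vr ts' 14 - xx i k s) + 2"], goal_cases)
  case 2
  show ?case using xe low by (auto simp: ts1_def frm_def)
 next
  case (3 ts')
  have fr: "frm {13, 14, 17} {} {3, 5} ts ts'" using 3(1) by simp
  have env': "env ts'" using env_frm[OF env fr] by simp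
  define l where "l = vr ts' 14"
  have l: "xx i k s <= l" "l < en k s" "vr ts' 13 = en k s" using 3 by (auto simp: l_def split: if_splits)
  have lr: "l < r" using l pc(3) by simp
  have v': "vr ts' 10 = i" "vr ts' 11 = k" "vr ts' 19 = i * q + k" using fr v by (auto simp: frm_def)
  have idx: "i * q + k < N" "k * r + l < N" "i * r + l < N" "Suc l < N" "l < N"
   using index_less[OF v(3,4)] index_less[OF v(4) lr] index_less[OF v(3) lr] sizes lr by auto
  have bl: "A i k + B k l < BL" using AX[OF v(3,4) lr] XBL by simp
  let ?y = "A i k + B k l"
  let ?z = "%t. if t = i * r + l then min (za ts' 3 (i * r + l)) ?y else za ts' 3 t"
  have zle: "?z t <= za ts' 3 t" for t by simp
  have z1: "ALL t. ?z t <= za ts 3 t" using 3(1) zle le_trans by blast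
  have z2: "\<forall>i'<p. ALL j<r. cc i' j <= ?z (i' * r + j)"
  proof (intro allI impI)
   fix i' j assume a: "i' < p" "j < r"
   have lc: "cc i' j <= za ts' 3 (i' * r + j)" using 3(1) a by (simp add: lowC_def)
   show "cc i' j <= ?z (i' * r + j)"
    using lc cc_le[OF v(4), of i l] index_eq[OF a(2) lr, of i' i] by auto
  qed
  have z3: "ALL j. xx i k s <= j --> j < Suc l --> ?z (i * r + j) <= A i k + B k j"
  proof (intro allI impI)
   fix j assume a: "xx i k s <= j" "j < Suc l"
   show "?z (i * r + j) <= A i k + B k j"
   proof (cases "j = l")
    case False
    then have "za ts' 3 (i * r + j) <= A i k + B k j" using 3(1) a by (simp add: l_def)
    then show ?thesis using zle[of "i * r + j"] by linarith
   qed simp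
  qed
  have tm': "tm ts' <= tm ts + 6 * (l - xx i k s) + 2" using 3(1) by (simp add: l_def)
  have sl: "Suc l - xx i k s = Suc (l - xx i k s)" using l by simp
  have fin: "(frm {13, 14, 17} {} {3, 5} ts ts'' & vr ts'' 13 = en k s &
   xx i k s <= vr ts'' 14 & vr ts'' 14 <= en k s & (ALL t. za ts'' 3 t <= za ts 3 t) & lowC (za ts'') &
   (ALL j. xx i k s <= j --> j < vr ts'' 14 --> za ts'' 3 (i * r + j) <= A i k + B k j) & tm ts'' <= tm ts + 6 * (vr ts'' 14 - xx i k s) + 2) &
   en k s - vr ts'' 14 < en k s - vr ts' 14"
   if "za ts'' 3 = ?z" "frm {14, 17} {} {3, 5} ts' ts''" "vr ts'' 14 = Suc l" "tm ts'' <= tm ts' + 6" for ts''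
  proof (intro conjI)
   show "frm {13, 14, 17} {} {3, 5} ts ts''" using frm_trans[OF fr that(2)] by simp
   show "vr ts'' 13 = en k s" using that(2) l by (simp add: frm_def)
   show "lowC (za ts'')" unfolding lowC_def that(1) by (fact z2)
   show "tm ts'' <= tm ts + 6 * (vr ts'' 14 - xx i k s) + 2" using that(4) tm' unfolding that(3) sl by simp
  qed (unfold that(1) that(3), use l z1 z3 in \<open>auto simp: l_def\<close>)
  show ?case
   supply [simp] = ok2_def envD[OF env'] NN v' l_def[symmetric] idx bl v(3,4) lr
   apply (rule runs_seq, rule runs_badd', (simp; fail)+)
   apply (rule runs_seq, rule runs_chmin'[where i = "i * r + l"], (simp; fail)+)
   apply (rule runs_asg', (simp; fail)+)
   apply (rule fin)
     apply (simp add: fun_eq_iff)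
    apply (simp add: frm_def)
    apply simp
   apply simp
   done
 next
  case (4 ts')
  then have "vr ts' 14 = en k s" by (auto split: if_splits)
  then show ?case using 4(1) by (intro Q) (auto simp: frm_def)
 qed (simp add: ok2_def)
 show ?thesis unfolding ebody_def
  supply [simp] = ok2_def envD[OF env] NN v e2 x xe
  apply (rule runs_seq, rule runs_asg', (simp; fail)+)
  apply (rule runs_seq, rule runs_asg', (simp; fail)+)
  using main by (simp add: ts1_def)
qed

definition enm :: prog where
 "enm = L2.frl 19 (Var 1 *! Var 2) (cnd (ev2 (Arr 3 (Var 19))) skp
   (asg2 10 (Var 19 idiv Var 2) ;; asg2 11 (Var 19 imod Var 2) ;; pl ebody))"

text \<open>Covered pairs are skipped. For the others the cost is the number of their alive columns;
  all overhead is charged to pieces.\<close>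

lemma runs_enm:
 assumes env: "env ts" and st: "stab (wa ts)" and xt: "xtab (wa ts) (p * q)" and low: "lowC (za ts)"
  and Q: "!!ts'. frm {10, 11, 12, 13, 14, 17, 19} {} {3, 5} ts ts' ==> (!!t. za ts' 3 t <= za ts 3 t) ==> lowC (za ts') ==>
   (!!i k j. i < p ==> k < q ==> wa ts 3 (i * q + k) = 0 ==> j \<in> S i k ==> za ts' 3 (i * r + j) <= A i k + B k j) ==>
   tm ts' <= tm ts + 15 * (p * PC) + 6 * (\<Sum>t\<in>{t \<in> {..<p * q}. wa ts 3 t = 0}. card (St t)) + 3 ==> Q ts'"
 shows "L2.run enm ts Q"
 unfolding enm_def
proof (rule runs_for[where X = "{10, 11, 12, 13, 14, 17, 19}" and Y = "{}" and Zs = "{3, 5}" and n = "p * q" and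
  J = "%m W Z t. (ALL t. Z 3 t <= za ts 3 t) & lowC Z &
   (ALL i<p. ALL k<q. i * q + k < m --> wa ts 3 (i * q + k) = 0 --> (\<forall>j\<in>S i k. Z 3 (i * r + j) <= A i k + B k j)) &
   t <= tm ts + 15 * (\<Sum>t<m. card (starts (t mod q))) + 6 * (\<Sum>t<m. if wa ts 3 t = 0 then card (St t) else 0) + 1"], goal_cases)
 case (6 m ts' t)
 define i k where ik: "i = m div q" "k = m mod q"
 have m: "m = i * q + k" "i < p" "k < q" using 6(1) q0 by (auto simp: ik less_mult_imp_div_less)
 have mN: "m < N" "i < N" "k < N" using 6(1) sizes m by auto
 have env': "env ts'" using env_frm[OF env 6(2)] by simp
 have w: "wa ts' = wa ts" using 6(2) by (auto simp: frm_def)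
 have cs: "1 <= card (starts k)" by (rule card_starts_pos)
 let ?X = "{10, 11, 12, 13, 14, 17, 19}"
 let ?post = "%ts''. vr ts'' 19 = m & frm ?X {} {3, 5} ts ts'' & (ALL t. za ts'' 3 t <= za ts 3 t) & lowC (za ts'') &
   (ALL i<p. ALL k<q. i * q + k < Suc m --> wa ts 3 (i * q + k) = 0 --> (\<forall>j\<in>S i k. za ts'' 3 (i * r + j) <= A i k + B k j)) &
   Suc (tm ts'') <= tm ts + 15 * (\<Sum>t<Suc m. card (starts (t mod q))) + 6 * (\<Sum>t<Suc m. if wa ts 3 t = 0 then card (St t) else 0) + 1"
 have dist: "i' = i & k' = k" if "k' < q" "i' * q + k' = m" for i' k' using index_eq[OF that(1) m(3), of i' i] that m(1) by simp
 have J: "ALL t. za ts' 3 t <= za ts 3 t" "lowC (za ts')"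
  "ALL i<p. ALL k<q. i * q + k < m --> wa ts 3 (i * q + k) = 0 --> (\<forall>j\<in>S i k. za ts' 3 (i * r + j) <= A i k + B k j)"
  "t <= tm ts + 15 * (\<Sum>t<m. card (starts (t mod q))) + 6 * (\<Sum>t<m. if wa ts 3 t = 0 then card (St t) else 0) + 1" using 6(5) by auto
 show ?case
 proof (cases "wa ts 3 m = 0")
  case False
  have new: "ALL i<p. ALL k<q. i * q + k < Suc m --> wa ts 3 (i * q + k) = 0 --> (\<forall>j\<in>S i k. za ts' 3 (i * r + j) <= A i k + B k j)"
   using J(3) False by (metis less_Suc_eq)
  show ?thesis
   supply [simp] = ok2_def envD[OF env'] mN NN 6(3) w False
   apply (rule runs_cnd', (simp; fail)+)
    apply (rule runs_skp)
    apply (use J new 6(2,4) cs False in \<open>simp add: frm_upd ik(2)[symmetric]\<close>)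
   using False by simp
 next
  case True
  let ?s = "ts'(|vr := (vr ts')(10 := i, 11 := k), tm := Suc (Suc (Suc (tm ts')))|)"
  have fs: "frm ?X {} {3, 5} ts ?s" using 6(2) by (auto simp: frm_def)
  have pl: "L2.run (pl ebody) ?s ?post"
  proof (rule runs_pl[where X = "{12, 13, 14, 17}" and Y = "{}" and Zs = "{3, 5}" and k = k and
    J = "%D W Z t. (ALL t. Z 3 t <= za ts' 3 t) & lowC Z & (\<forall>s\<in>D. ALL j. xx i k s <= j --> j < en k s --> Z 3 (i * r + j) <= A i k + B k j) &
     t <= tm ts' + 4 + 5 * card D + 6 * (\<Sum>s\<in>D. en k s - xx i k s)"], goal_cases)
   case (10 D s ts1 t1)
   have f1: "frm ?X {} {3, 5} ts ts1" using frm_trans[OF fs 10(5)] by simp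
   have env1: "env ts1" using env_frm[OF env f1] by simp
   have w1: "wa ts1 = wa ts" using f1 by (auto simp: frm_def)
   have st1: "stab (wa ts1)" "wa ts1 6 ((i * q + k) * r + s) = xx i k s" using st xt 10(1) 6(1) unfolding w1 by (auto simp: xtab_def ik m(1)[symmetric])
   have v1: "vr ts1 10 = i" "vr ts1 11 = k" "vr ts1 19 = i * q + k" using 10(5) 6(3) m by (auto simp: frm_def)
   have low1: "lowC (za ts1)" using 10(8) by simp
   show ?case
   proof (rule runs_ebody[OF env1 st1(1) v1(1,2) m(2,3) 10(6) v1(3) 10(1) st1(2) low1])
    fix ts2 assume 2: "frm {13, 14, 17} {} {3, 5} ts1 ts2" "!!t. za ts2 3 t <= za ts1 3 t" "lowC (za ts2)"
     "!!j. xx i k s <= j ==> j < en k s ==> za ts2 3 (i * r + j) <= A i k + B k j" "tm ts2 <= tm ts1 + 6 * (en k s - xx i k s) + 3"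
    have "za ts2 3 t <= za ts' 3 t" for t using 2(2)[of t] 10(8) le_trans by blast
    moreover have "za ts2 3 (i * r + j) <= A i k + B k j" if "s' \<in> insert s D" "xx i k s' <= j" "j < en k s'" for s' j
    proof (cases "s' = s")
     case True then show ?thesis using 2(4) that by simp
    next
     case False
     then have "za ts1 3 (i * r + j) <= A i k + B k j" using 10(8) that by simp
     then show ?thesis using 2(2)[of "i * r + j"] by linarith
    qed
    moreover have "frm {12, 13, 14, 17} {} {3, 5} ?s ts2" using frm_trans[OF 10(5) 2(1)] by simp
    moreover have "vr ts2 12 = s" using 2(1) 10(6) by (simp add: frm_def)
    moreover have "Suc (tm ts2) <= tm ts' + 4 + 5 * card (insert s D) + 6 * (\<Sum>s\<in>insert s D. en k s - xx i k s)"
     using 2(5) 10(3,4,7,8) by simp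
    ultimately show "vr ts2 12 = s & frm {12, 13, 14, 17} {} {3, 5} ?s ts2 & (ALL t. za ts2 3 t <= za ts' 3 t) & lowC (za ts2) &
     (\<forall>s\<in>insert s D. ALL j. xx i k s <= j --> j < en k s --> za ts2 3 (i * r + j) <= A i k + B k j) &
     Suc (tm ts2) <= tm ts' + 4 + 5 * card (insert s D) + 6 * (\<Sum>s\<in>insert s D. en k s - xx i k s)" using 2(3) by blast
   qed
  next
   case (11 ts1 t1)
   have f1: "frm ?X {} {3, 5} ts ts1" using frm_trans[OF fs 11(1)] by simp
   have v: "vr ts1 19 = m" using 11(1) 6(3) by (auto simp: frm_def)
   have dec: "ALL t. za ts1 3 t <= za ts 3 t" using 11(3) J(1) le_trans by blast
   have new: "za ts1 3 (i' * r + j) <= A i' k' + B k' j" if "i' < p" "k' < q" "i' * q + k' < Suc m" "wa ts 3 (i' * q + k') = 0" "j \<in> S i' k'" for i' k' j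
   proof (cases "i' * q + k' = m")
    case True
    then have e: "i' = i" "k' = k" using dist that by auto
    have "j \<in> (\<Union>s\<in>starts k. {xx i k s..<en k s})" using that(5) unfolding e S_partition .
    then show ?thesis using 11(3) unfolding e by auto
   next
    case False
    then have "za ts' 3 (i' * r + j) <= A i' k' + B k' j" using J(3) that by simp
    moreover have "za ts1 3 (i' * r + j) <= za ts' 3 (i' * r + j)" using 11(3) by blast
    ultimately show ?thesis by linarith
   qed
   have cS: "(\<Sum>s\<in>starts k. en k s - xx i k s) = card (St m)" unfolding card_S by (simp add: St_def ik)
   have "Suc (tm ts1) <= tm ts + 15 * (\<Sum>t<Suc m. card (starts (t mod q))) + 6 * (\<Sum>t<Suc m. if wa ts 3 t = 0 then card (St t) else 0) + 1"
    using 11(2,3) J(4) 6(4) cs True unfolding cS by (simp add: ik(2)[symmetric])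
   then show ?case using f1 v dec new 11(3) by auto
  qed (use 6(3) env' st w J NN m(3) in \<open>auto simp: env_def stab_def\<close>)
  show ?thesis
   supply [simp] = ok2_def envD[OF env'] mN NN 6(3) w True ik[symmetric]
   apply (rule runs_cnd', (simp; fail)+)
    apply simp
   apply (rule runs_seq, rule runs_asg', (simp; fail)+)
   apply (rule runs_seq, rule runs_asg', (simp; fail)+)
   using pl by (simp add: tick_def)
 qed
next
 case (7 ts' t)
 have "(\<Sum>t<p * q. card (starts (t mod q))) = p * PC" unfolding PC_def by (rule sum_mod)
 moreover have "(\<Sum>t<p * q. if wa ts 3 t = 0 then card (St t) else 0) = (\<Sum>t\<in>{t \<in> {..<p * q}. wa ts 3 t = 0}. card (St t))"
  by (rule sum.inter_filter[symmetric]) simp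
 ultimately show ?case using 7 index_less by (intro Q) auto
qed (use env NN sizes low in \<open>auto simp: ok2_def frm_def env_def\<close>)

text \<open>Takes the segments of a newly covered pair out of the summed difference arrays, with the
  starts read off from array 6.\<close>

definition rmv :: prog where
 "rmv = pl (asg2 14 (Arr 6 (Var 19 *! Var 3 +! Var 12)) ;; sto2 4 (Var 14) (Arr 4 (Var 14) -! Num 1) ;;
   asg2 13 (Arr 2 (Var 11 *! Var 3 +! Var 12)) ;; sto2 5 (Var 13) (Arr 5 (Var 13) -! Num 1))"

lemma runs_rmv:
 assumes env: "env ts" and st: "stab (wa ts)" and xt: "xtab (wa ts) (p * q)" and v: "vr ts 11 = k" "i < p" "k < q" "vr ts 19 = i * q + k"
  and Q: "!!ts'. frm {12, 13, 14} {4, 5} {} ts ts' ==> (!!x. x <= r ==> wa ts' 4 x = wa ts 4 x - dpt (i * q + k) x) ==>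
   (!!x. x <= r ==> wa ts' 5 x = wa ts 5 x - dmt (i * q + k) x) ==> tm ts' <= tm ts + 6 * card (starts k) + 3 ==> Q ts'"
 shows "L2.run rmv ts Q"
proof (rule run_bounds)
 assume bd: "!!a i. wa ts a i < N"
 have dd: "dpt (i * q + k) x = card {s \<in> starts k. xx i k s = x}" "dmt (i * q + k) x = card {s \<in> starts k. en k s = x}" for x
  using index_div_mod[OF v(3)] by (auto simp: dpt_def dmt_def dp_def dm_def)
 show ?thesis unfolding rmv_def
 proof (rule runs_pl[where X = "{12, 13, 14}" and Y = "{4, 5}" and Zs = "{}" and k = k and
   J = "%D W Z t. (\<forall>x\<le>r. W 4 x = wa ts 4 x - card {s \<in> D. xx i k s = x}) & (\<forall>x\<le>r. W 5 x = wa ts 5 x - card {s \<in> D. en k s = x}) &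
    t <= tm ts + 1 + 6 * card D"], goal_cases)
  case (10 D s ts1 t1)
  have env1: "env ts1" using env_frm[OF env 10(5)] by simp
  have v1: "vr ts1 11 = k" "vr ts1 19 = i * q + k" using 10(5) v by (auto simp: frm_def)
  have ikt: "i * q + k < p * q" using index_less[OF v(2,3)] .
  have x6: "wa ts1 6 ((i * q + k) * r + s) = xx i k s" using xt 10(1,5) ikt index_div_mod[OF v(3), of i] by (auto simp: xtab_def frm_def)
  have e2: "wa ts1 2 (k * r + s) = en k s" using st 10(1,5) v by (auto simp: stab_def frm_def)
  have xr: "xx i k s <= r" "en k s <= r" using xx_le[OF 10(1), of i] piece(3)[OF 10(1)] by auto
  have xN: "xx i k s < N" "en k s < N" using xr NN by auto
  have ins: "card {s' \<in> insert s D. f s' = x} = card {s' \<in> D. f s' = x} + (if f s = x then 1 else 0)" for f and x :: nat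
  proof -
   have "{s' \<in> insert s D. f s' = x} = (if f s = x then insert s {s' \<in> D. f s' = x} else {s' \<in> D. f s' = x})" by auto
   then show ?thesis using 10(3,4) by simp
  qed
  have j: "\<forall>x\<le>r. wa ts1 4 x = wa ts 4 x - card {s \<in> D. xx i k s = x}" "\<forall>x\<le>r. wa ts1 5 x = wa ts 5 x - card {s \<in> D. en k s = x}"
   "t1 <= tm ts + 1 + 6 * card D" using 10(8) by auto
  have lN: "wa ts1 4 (xx i k s) - Suc 0 < N" "wa ts1 5 (en k s) - Suc 0 < N"
   using j(1,2) xr bd[of 4 "xx i k s"] bd[of 5 "en k s"] by auto
  have fin: "vr ts'' 12 = s & frm {12, 13, 14} {4, 5} {} ts ts'' & (\<forall>x\<le>r. wa ts'' 4 x = wa ts 4 x - card {s' \<in> insert s D. xx i k s' = x}) &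
   (\<forall>x\<le>r. wa ts'' 5 x = wa ts 5 x - card {s' \<in> insert s D. en k s' = x}) & Suc (tm ts'') <= tm ts + 1 + 6 * card (insert s D)"
   if "frm {13, 14} {4, 5} {} ts1 ts''" "wa ts'' 4 = (wa ts1 4)(xx i k s := wa ts1 4 (xx i k s) - Suc 0)"
    "wa ts'' 5 = (wa ts1 5)(en k s := wa ts1 5 (en k s) - Suc 0)" "tm ts'' <= tm ts1 + 4" for ts''
  proof (intro conjI)
   show "frm {12, 13, 14} {4, 5} {} ts ts''" using frm_trans[OF 10(5) that(1)] by simp
   show "vr ts'' 12 = s" using that(1) 10(6) by (simp add: frm_def)
   show "\<forall>x\<le>r. wa ts'' 4 x = wa ts 4 x - card {s' \<in> insert s D. xx i k s' = x}" unfolding ins that(2) using j(1) by auto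
   show "\<forall>x\<le>r. wa ts'' 5 x = wa ts 5 x - card {s' \<in> insert s D. en k s' = x}" unfolding ins that(3) using j(2) by auto
   show "Suc (tm ts'') <= tm ts + 1 + 6 * card (insert s D)" using that(4) j(3) 10(3,4,7) by simp
  qed
  show ?case
   supply [simp] = ok2_def envD[OF env1] NN v1 10(6) x6 e2 xN lN
   apply (rule runs_seq, rule runs_asg', (simp; fail)+)
   apply (rule runs_seq, rule runs_sto', (simp; fail)+)
   apply (rule runs_seq, rule runs_asg', (simp; fail)+)
   apply (rule runs_sto', (simp; fail)+)
   apply (rule fin)
     apply (simp add: frm_def)
    apply simp
    apply simp
   apply simp
   done
 next
  case (11 ts1 t1)
  then show ?case by (intro Q) (auto simp: dd)
 qed (use env v st NN in \<open>auto simp: env_def stab_def\<close>)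
qed

end

lemma entry_at_upd:
 assumes "f P = tag x" "!!l. l < L ==> f (Suc (P + l)) = mag x div (2 ^ b) ^ l mod 2 ^ b"
 shows "entry_at b L f P x"
 using assms by (simp add: entry_at_def)

text \<open>Commuting record updates give equal but differently written stores; comparing the fields
  bridges this.\<close>

lemma (in bigm) run_eqI:
 assumes "L2.run P ts Q" "vr ts' = vr ts" "wa ts' = wa ts" "za ts' = za ts" "tm ts' = tm ts"
 shows "L2.run P ts' Q"
proof -
 have "ts' = ts" using assms(2-5) by simp
 then show ?thesis using assms(1) by simp
qed

section \<open>A product with small entries at a pivot column\<close>

context algo2
begin

text \<open>An alive entry becomes the excess of its rounded sum over \<open>cp\<close> at the
  pivot, a number in \<open>{0..<\<Delta>}\<close>; all other entries become infinite. On adding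
  \<open>Bent\<close> the term \<open>bp k jj\<close> cancels, and
  \<open>A i k + B k j - cp i jj\<close> remains for every column \<open>j\<close>, not just the
  pivot.\<close>

definition Aent :: "nat => nat => int extended" where
 "Aent jj t = (if jj \<in> St t then Fin (int (A (t div q) (t mod q) + bp (t mod q) jj - cp (t div q) jj)) else Pinf)"

definition Bent :: "nat => nat => int extended" where
 "Bent jj t = Fin (int (B (t div r) (t mod r)) - int (bp (t div r) jj))"

definition MA :: "nat => matrix" where "MA jj = mat p q (%(i, k). Aent jj (i * q + k))"
definition MB :: "nat => matrix" where "MB jj = mat q r (%(k, j). Bent jj (k * r + j))"

text \<open>Writing the entry and marking an alive pair as covered happen in the same pass; the mark
  in array 3 ensures that the segments of a pair are removed only once. The digits of an infinite
  entry are taken from the constant zero.\<close>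

definition abody :: prog where
 "abody = asg2 10 (Var 19 idiv Var 2) ;; asg2 11 (Var 19 imod Var 2) ;;
   badd 5 (Num 0) 0 (Var 19) 1 (Var 11 *! Var 3 +! Arr 1 (Var 11 *! Var 3 +! Var 21)) ;;
   badd 5 (Num 1) 2 (Var 10 *! Var 3 +! Var 21) 4 (Num 1) ;; bless 17 5 (Num 0) 5 (Num 1) ;;
   asg2 20 (Num 4 +! Var 19 *! (Var 8 +! Num 1)) ;;
   cnd (ev2 (Var 17))
    (sto2 0 (Var 20) (Num 0) ;; bsub 5 (Num 0) 5 (Num 0) 2 (Var 10 *! Var 3 +! Var 21) ;;
    bto 0 (Var 20 +! Num 1) 5 (Num 0) (Var 8) ;;
    cnd (ev2 (Arr 3 (Var 19))) skp (sto2 3 (Var 19) (Num 1) ;; rmv))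
    (sto2 0 (Var 20) (Num 2) ;; bto 0 (Var 20 +! Num 1) 4 (Num 0) (Var 8))"

lemma runs_abody:
 assumes env: "env ts" and cpt: "cpt (za ts)" and st: "stab (wa ts)" and xt: "xtab (wa ts) (p * q)"
  and v: "vr ts 19 = t" "t < p * q" "vr ts 21 = jj" "jj < r" "vr ts 8 = L" and PN: "5 + t * (L + 1) < N" "P = 4 + t * (L + 1)"
  and Q: "!!ts'. frm {10, 11, 12, 13, 14, 17, 20} {0, 3, 4, 5} {5} ts ts' ==> entry_at b L (wa ts' 0) P (Aent jj t) ==>
   (!!n. n < P ==> wa ts' 0 n = wa ts 0 n) ==>
   (if jj \<in> St t & wa ts 3 t = 0 then wa ts' 3 = (wa ts 3)(t := 1) & (\<forall>x\<le>r. wa ts' 4 x = wa ts 4 x - dpt t x) &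
     (\<forall>x\<le>r. wa ts' 5 x = wa ts 5 x - dmt t x) & tm ts' <= tm ts + 17 + 6 * card (starts (t mod q))
    else wa ts' 3 = wa ts 3 & wa ts' 4 = wa ts 4 & wa ts' 5 = wa ts 5 & tm ts' <= tm ts + 12) ==> Q ts'"
 shows "L2.run abody ts Q"
proof -
 define i k where ik: "i = t div q" "k = t mod q"
 have t: "t = i * q + k" "i < p" "k < q" using v(2) q0 by (auto simp: ik less_mult_imp_div_less)
 have tN: "t < N" "i < N" "k < N" using v(2) sizes t by auto
 have s1: "wa ts 1 (k * r + jj) = stt k jj" "wa ts (Suc 0) (k * r + jj) = stt k jj" using st t v by (simp_all add: stab_def)
 have sr: "stt k jj < r" using stt_le[of k jj] v by simp
 have idx: "k * r + stt k jj < N" "i * r + jj < N" "Suc P < N" "P < N"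
  using index_less[OF t(3) sr] index_less[OF t(2) v(4)] sizes PN by auto
 have zA: "za ts 0 t = A i k" using env t by (simp add: env_def)
 have zB: "za ts 1 (k * r + stt k jj) = bp k jj" "za ts (Suc 0) (k * r + stt k jj) = bp k jj" using env t sr by (auto simp: env_def bp_def)
 have zC: "za ts 2 (i * r + jj) = cp i jj" using cpt t v by (simp add: cpt_def)
 have bl: "A i k + bp k jj < BL" "cp i jj + \<Delta> < BL"
  using bp_le[OF t(3) v(4)] AX[OF t(2,3) v(4)] XBL cp_le_X[OF t(2) v(4)] XB by auto
 have cple: "cp i jj <= A i k + bp k jj" by (rule cp_le[OF t(3)])
 have inS: "jj \<in> St t \<longleftrightarrow> A i k + bp k jj < cp i jj + \<Delta>" using v by (auto simp: St_def S_def ik)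
 let ?v = "A i k + bp k jj - cp i jj"
 have ent: "tag (Aent jj t) = (if jj \<in> St t then 0 else 2)" "mag (Aent jj t) = (if jj \<in> St t then ?v else 0)"
  by (auto simp: Aent_def ik)
 define ts1 where "ts1 = ts(|vr := (vr ts)(10 := i, 11 := k, 17 := (if jj \<in> St t then 1 else 0), 20 := P),
   za := (za ts)(5 := (za ts 5)(0 := A i k + bp k jj, 1 := cp i jj + \<Delta>)), tm := Suc (Suc (Suc (Suc (Suc (Suc (tm ts))))))|)"
 have f1: "frm {10, 11, 12, 13, 14, 17, 20} {0, 3, 4, 5} {5} ts ts1" by (auto simp: ts1_def frm_def)
 have env1: "env ts1" using env_frm[OF env f1] by simp
 have c1: "vr ts1 10 = i" "vr ts1 11 = k" "vr ts1 20 = P" "vr ts1 19 = t" "vr ts1 21 = jj" "vr ts1 8 = L" "wa ts1 = wa ts" "tm ts1 = tm ts + 6"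
  "za ts1 5 0 = A i k + bp k jj" "za ts1 2 (i * r + jj) = cp i jj" using v zC by (auto simp: ts1_def)
 let ?C = "cnd (ev2 (Var 17))
    (sto2 0 (Var 20) (Num 0) ;; bsub 5 (Num 0) 5 (Num 0) 2 (Var 10 *! Var 3 +! Var 21) ;;
    bto 0 (Var 20 +! Num 1) 5 (Num 0) (Var 8) ;;
    cnd (ev2 (Arr 3 (Var 19))) skp (sto2 3 (Var 19) (Num 1) ;; rmv))
    (sto2 0 (Var 20) (Num 2) ;; bto 0 (Var 20 +! Num 1) 4 (Num 0) (Var 8))"
 have main: "L2.run ?C ts1 Q"
 proof (cases "jj \<in> St t")
  case False
  have 17: "vr ts1 17 = 0" using False by (simp add: ts1_def)
  show ?thesis
   supply [simp] = ok2_def envD[OF env1] NN c1 17 idx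
   apply (rule runs_cnd', (simp; fail)+)
    apply simp
   apply (rule runs_seq, rule runs_sto', (simp; fail)+)
   apply (rule runs_bto', (simp; fail)+)
   apply (rule Q)
     apply (use f1 in \<open>simp add: frm_def\<close>)
    apply (rule entry_at_upd)
     apply (simp add: ent False)
    apply (simp add: ent False)
    apply simp
   using False by simp
 next
  case True
  have 17: "vr ts1 17 = 1" using True by (simp add: ts1_def)
  define W where "W = (%n. if Suc P <= n & n < Suc P + L then ?v div (2 ^ b) ^ (n - Suc P) mod 2 ^ b else ((wa ts 0)(P := 0)) n)"
  have WP: "entry_at b L W P (Aent jj t)" by (rule entry_at_upd) (auto simp: W_def ent True)
  have Wlt: "W n = wa ts 0 n" if "n < P" for n using that by (simp add: W_def)
  let ?s = "ts1(|wa := (wa ts)(0 := W), za := (za ts1)(5 := (za ts1 5)(0 := ?v)), tm := 10 + tm ts|)"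
  have fs: "frm {10, 11, 12, 13, 14, 17, 20} {0, 3, 4, 5} {5} ts ?s" using f1 by (auto simp: frm_def)
  have C2: "L2.run (cnd (ev2 (Arr 3 (Var 19))) skp (sto2 3 (Var 19) (Num 1) ;; rmv)) ?s Q"
  proof (cases "wa ts 3 t = 0")
   case False
   show ?thesis
    supply [simp] = ok2_def NN c1 False
    apply (rule runs_cnd', (simp; fail)+)
     apply (rule runs_skp)
     apply (rule Q)
      apply (use fs in \<open>simp add: frm_upd\<close>)
      apply (simp add: WP)
     apply (simp add: Wlt)
     apply simp
    using False by simp
  next
   case new: True
   let ?s2 = "ts1(|za := (za ts1)(5 := (za ts1 5)(0 := ?v)), wa := (wa ts)(0 := W, 3 := (wa ts 3)(t := 1)), tm := 12 + tm ts|)"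
   have fs2: "frm {10, 11, 12, 13, 14, 17, 20} {0, 3, 4, 5} {5} ts ?s2" using f1 by (auto simp: frm_def)
   have env2: "env ?s2" using env_frm[OF env fs2] by simp
   have st2: "stab (wa ?s2)" "xtab (wa ?s2) (p * q)" using st xt by (auto simp: stab_def xtab_def)
   have v2: "vr ?s2 11 = k" "vr ?s2 19 = i * q + k" using c1 t by auto
   have r: "L2.run rmv ?s2 Q"
   proof (rule runs_rmv[OF env2 st2 v2(1) t(2,3) v2(2)])
    fix ts3 assume 3: "frm {12, 13, 14} {4, 5} {} ?s2 ts3" "!!x. x <= r ==> wa ts3 4 x = wa ?s2 4 x - dpt (i * q + k) x"
     "!!x. x <= r ==> wa ts3 5 x = wa ?s2 5 x - dmt (i * q + k) x" "tm ts3 <= tm ?s2 + 6 * card (starts k) + 3"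
    show "Q ts3"
    proof (rule Q)
     show "frm {10, 11, 12, 13, 14, 17, 20} {0, 3, 4, 5} {5} ts ts3" using frm_trans[OF fs2 3(1)] by simp
     have w: "wa ts3 0 = W" "wa ts3 3 = (wa ts 3)(t := 1)" using 3(1) by (auto simp: frm_def)
     show "entry_at b L (wa ts3 0) P (Aent jj t)" unfolding w by (rule WP)
     show "n < P ==> wa ts3 0 n = wa ts 0 n" for n unfolding w by (rule Wlt)
     show "if jj \<in> St t & wa ts 3 t = 0 then wa ts3 3 = (wa ts 3)(t := 1) & (\<forall>x\<le>r. wa ts3 4 x = wa ts 4 x - dpt t x) &
      (\<forall>x\<le>r. wa ts3 5 x = wa ts 5 x - dmt t x) & tm ts3 <= tm ts + 17 + 6 * card (starts (t mod q))
      else wa ts3 3 = wa ts 3 & wa ts3 4 = wa ts 4 & wa ts3 5 = wa ts 5 & tm ts3 <= tm ts + 12"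
      using w(2) 3(2,3)[folded t(1)] 3(4) True new by (simp add: ik(2)[symmetric])
    qed
   qed
   show ?thesis
    supply [simp] = ok2_def NN c1 new
    apply (rule runs_cnd', (simp; fail)+)
     apply simp
    apply (rule runs_seq, rule runs_sto', (simp; fail)+)
    using r by (simp add: tick_def)
  qed
  show ?thesis
   supply [simp] = ok2_def envD[OF env1] NN c1 17 idx cple
   apply (rule runs_cnd', (simp; fail)+)
    apply (rule runs_seq, rule runs_sto', (simp; fail)+)
    apply (rule runs_seq, rule runs_bsub', (simp; fail)+)
    apply (rule runs_seq, rule runs_bto', (simp; fail)+)
    apply (rule run_eqI[OF C2])
     apply simp
     apply (simp add: fun_eq_iff W_def)
    apply simp
    apply simp
   apply simp
   done
 qed
 show ?thesis unfolding abody_def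
  supply [simp] = ok2_def envD[OF env] NN v tN ik[symmetric] s1 idx zA zB zC bl PN(2)[symmetric] PN(2)[symmetric, simplified]
  apply (rule runs_seq, rule runs_asg', (simp; fail)+)
  apply (rule runs_seq, rule runs_asg', (simp; fail)+)
  apply (rule runs_seq, rule runs_badd', (simp; fail)+)
  apply (rule runs_seq, rule runs_badd', (simp; fail)+)
  apply (rule runs_seq, rule runs_bless', (simp; fail)+)
  apply (rule runs_seq, rule runs_asg', (simp; fail)+)
  apply (rule run_eqI[OF main]; simp add: ts1_def inS)
  done
qed

definition Uof :: "(nat => nat => nat) => nat set" where "Uof W = {t \<in> {..<p * q}. W 3 t = 0}"

text \<open>The link between the counters and the marks: only pairs not yet covered
  contribute.\<close>

definition cnts :: "(nat => nat => nat) => bool" where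
 "cnts W \<longleftrightarrow> (\<forall>x\<le>r. W 4 x = (\<Sum>t\<in>Uof W. dpt t x)) & (\<forall>x\<le>r. W 5 x = (\<Sum>t\<in>Uof W. dmt t x))"

lemma finite_Uof [simp]: "finite (Uof W)" by (simp add: Uof_def)

definition bldA :: prog where "bldA = L2.frl 19 (Var 9) abody"

lemma runs_bldA:
 assumes env: "env ts" and cpt: "cpt (za ts)" and st: "stab (wa ts)" and xt: "xtab (wa ts) (p * q)" and cn: "cnts (wa ts)"
  and v: "vr ts 21 = jj" "jj < r" "vr ts 8 = L" "vr ts 9 = p * q" and PN: "5 + p * q * (L + 1) < N"
  and Q: "!!ts'. frm {10, 11, 12, 13, 14, 17, 19, 20} {0, 3, 4, 5} {5} ts ts' ==> (!!n. n < 4 ==> wa ts' 0 n = wa ts 0 n) ==>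
   (!!t. t < p * q ==> entry_at b L (wa ts' 0) (4 + t * (L + 1)) (Aent jj t)) ==> Uof (wa ts') = Uof (wa ts) - {t. jj \<in> St t} ==>
   cnts (wa ts') ==> tm ts' <= tm ts + 14 * (p * q) + 12 * (\<Sum>t\<in>{t \<in> Uof (wa ts). jj \<in> St t}. card (starts (t mod q))) + 3 ==> Q ts'"
 shows "L2.run bldA ts Q"
 unfolding bldA_def
proof (rule runs_for[where X = "{10, 11, 12, 13, 14, 17, 19, 20}" and Y = "{0, 3, 4, 5}" and Zs = "{5}" and n = "p * q" and
  J = "%m W Z t. (ALL n<4. W 0 n = wa ts 0 n) & (ALL t<m. entry_at b L (W 0) (4 + t * (L + 1)) (Aent jj t)) &
   (\<forall>t\<ge>m. W 3 t = wa ts 3 t) & Uof W = Uof (wa ts) - {t. t < m & jj \<in> St t} & cnts W &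
   t <= tm ts + 14 * m + 12 * (\<Sum>t\<in>{t \<in> Uof (wa ts). t < m & jj \<in> St t}. card (starts (t mod q))) + 1"], goal_cases)
 case (6 m ts' t)
 have env': "env ts'" using env_frm[OF env 6(2)] by simp
 have i': "cpt (za ts')" "stab (wa ts')" "xtab (wa ts') (p * q)" "vr ts' 21 = jj" "vr ts' 8 = L"
  using 6(2) cpt st xt v by (auto simp: cpt_def stab_def xtab_def frm_def)
 have "m * (L + 1) <= p * q * (L + 1)" using 6(1) by (intro mult_le_mono1) simp
 then have PN': "5 + m * (L + 1) < N" using PN by linarith
 have J: "ALL n<4. wa ts' 0 n = wa ts 0 n" "ALL t<m. entry_at b L (wa ts' 0) (4 + t * (L + 1)) (Aent jj t)" "\<forall>t\<ge>m. wa ts' 3 t = wa ts 3 t"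
  "Uof (wa ts') = Uof (wa ts) - {t. t < m & jj \<in> St t}" "cnts (wa ts')"
  "t <= tm ts + 14 * m + 12 * (\<Sum>t\<in>{t \<in> Uof (wa ts). t < m & jj \<in> St t}. card (starts (t mod q))) + 1" using 6(5) by auto
 have w3: "wa ts' 3 m = wa ts 3 m" using J(3) by simp
 show ?case
 proof (rule runs_abody[OF env' i'(1-3) 6(3,1) i'(4) v(2) i'(5) PN' refl])
  fix ts1 assume 1: "frm {10, 11, 12, 13, 14, 17, 20} {0, 3, 4, 5} {5} ts' ts1" "entry_at b L (wa ts1 0) (4 + m * (L + 1)) (Aent jj m)"
   "!!n. n < 4 + m * (L + 1) ==> wa ts1 0 n = wa ts' 0 n"
   "if jj \<in> St m & wa ts' 3 m = 0 then wa ts1 3 = (wa ts' 3)(m := 1) & (\<forall>x\<le>r. wa ts1 4 x = wa ts' 4 x - dpt m x) &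
     (\<forall>x\<le>r. wa ts1 5 x = wa ts' 5 x - dmt m x) & tm ts1 <= tm ts' + 17 + 6 * card (starts (m mod q))
    else wa ts1 3 = wa ts' 3 & wa ts1 4 = wa ts' 4 & wa ts1 5 = wa ts' 5 & tm ts1 <= tm ts' + 12"
  have A: "vr ts1 19 = m" "frm {10, 11, 12, 13, 14, 17, 19, 20} {0, 3, 4, 5} {5} ts ts1"
   using 1(1) 6(3) frm_trans[OF 6(2) 1(1)] by (auto simp: frm_def)
  have Bf: "ALL n<4. wa ts1 0 n = wa ts 0 n" using 1(3) J(1) by simp
  have Cf: "ALL t<Suc m. entry_at b L (wa ts1 0) (4 + t * (L + 1)) (Aent jj t)"
  proof (intro allI impI)
   fix t' assume a: "t' < Suc m"
   show "entry_at b L (wa ts1 0) (4 + t' * (L + 1)) (Aent jj t')"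
   proof (cases "t' = m")
    case False
    then have "Suc t' * (L + 1) <= m * (L + 1)" using a by (intro mult_le_mono1) simp
    then have "entry_at b L (wa ts1 0) (4 + t' * (L + 1)) (Aent jj t') = entry_at b L (wa ts' 0) (4 + t' * (L + 1)) (Aent jj t')"
     using 1(3) by (intro entry_at_cong) auto
    then show ?thesis using J(2) a False by simp
   qed (use 1(2) in simp)
  qed
  have D: "(\<forall>t\<ge>Suc m. wa ts1 3 t = wa ts 3 t) & Uof (wa ts1) = Uof (wa ts) - {t. t < Suc m & jj \<in> St t} & cnts (wa ts1) &
   Suc (tm ts1) <= tm ts + 14 * Suc m + 12 * (\<Sum>t\<in>{t \<in> Uof (wa ts). t < Suc m & jj \<in> St t}. card (starts (t mod q))) + 1"
  proof (cases "jj \<in> St m & wa ts' 3 m = 0")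
   case True
   have e: "wa ts1 3 = (wa ts' 3)(m := 1)" "\<forall>x\<le>r. wa ts1 4 x = wa ts' 4 x - dpt m x"
     "\<forall>x\<le>r. wa ts1 5 x = wa ts' 5 x - dmt m x" "tm ts1 <= tm ts' + 17 + 6 * card (starts (m mod q))" using 1(4) True by auto
   have mU: "m \<in> Uof (wa ts')" "m \<in> Uof (wa ts)" using True 6(1) w3 by (auto simp: Uof_def)
   have U1: "Uof (wa ts1) = Uof (wa ts') - {m}" by (auto simp: Uof_def e(1))
   have "cnts (wa ts1)" unfolding cnts_def U1 using J(5) e(2,3) mU(1) by (auto simp: cnts_def sum_diff1_nat)
   moreover have "Uof (wa ts1) = Uof (wa ts) - {t. t < Suc m & jj \<in> St t}" unfolding U1 J(4) using True by (auto simp: less_Suc_eq)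
   moreover have "{t \<in> Uof (wa ts). t < Suc m & jj \<in> St t} = insert m {t \<in> Uof (wa ts). t < m & jj \<in> St t}"
    using mU True by (auto simp: less_Suc_eq)
   moreover have "6 <= 6 * card (starts (m mod q))" using card_starts_pos[of "m mod q"] by simp
   ultimately show ?thesis using e(1,4) J(3,6) 6(4) by auto
  next
   case False
   have e: "wa ts1 3 = wa ts' 3" "wa ts1 4 = wa ts' 4" "wa ts1 5 = wa ts' 5" "tm ts1 <= tm ts' + 12" using 1(4) False by (auto split: if_splits)
   have U1: "Uof (wa ts1) = Uof (wa ts')" by (auto simp: Uof_def e(1))
   have nm: "\<not> (m \<in> Uof (wa ts) & jj \<in> St m)" using False w3 by (auto simp: Uof_def)
   have "cnts (wa ts1)" unfolding cnts_def U1 using J(5) e by (auto simp: cnts_def)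
   moreover have "Uof (wa ts1) = Uof (wa ts) - {t. t < Suc m & jj \<in> St t}" unfolding U1 J(4) using nm by (auto simp: less_Suc_eq)
   moreover have "{t \<in> Uof (wa ts). t < Suc m & jj \<in> St t} = {t \<in> Uof (wa ts). t < m & jj \<in> St t}"
    using nm by (auto simp: less_Suc_eq)
   ultimately show ?thesis using e J(3,6) 6(4) by auto
  qed
  show "vr ts1 19 = m & frm {10, 11, 12, 13, 14, 17, 19, 20} {0, 3, 4, 5} {5} ts ts1 & (ALL n<4. wa ts1 0 n = wa ts 0 n) &
   (ALL t<Suc m. entry_at b L (wa ts1 0) (4 + t * (L + 1)) (Aent jj t)) &
   (\<forall>t\<ge>Suc m. wa ts1 3 t = wa ts 3 t) & Uof (wa ts1) = Uof (wa ts) - {t. t < Suc m & jj \<in> St t} & cnts (wa ts1) &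
   Suc (tm ts1) <= tm ts + 14 * Suc m + 12 * (\<Sum>t\<in>{t \<in> Uof (wa ts). t < Suc m & jj \<in> St t}. card (starts (t mod q))) + 1"
   using A Bf Cf D by blast
 qed
next
 case (7 ts' t)
 have e: "{t \<in> Uof (wa ts). t < p * q & jj \<in> St t} = {t \<in> Uof (wa ts). jj \<in> St t}" by (auto simp: Uof_def)
 have "Uof (wa ts') = Uof (wa ts) - {t. jj \<in> St t}" using 7(3) by (auto simp: Uof_def)
 then show ?case using 7 unfolding e by (intro Q) auto
qed (use env NN sizes v cn in \<open>auto simp: ok2_def frm_def env_def\<close>)

definition bldB :: prog where
 "bldB = L2.frl 19 (Var 2 *! Var 3) (asg2 11 (Var 19 idiv Var 3) ;; asg2 20 (Num 4 +! (Var 9 +! Var 19) *! (Var 8 +! Num 1)) ;;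
   asg2 14 (Var 11 *! Var 3 +! Arr 1 (Var 11 *! Var 3 +! Var 21)) ;; bless 17 1 (Var 19) 1 (Var 14) ;;
   cnd (ev2 (Var 17)) (sto2 0 (Var 20) (Num 1) ;; bsub 5 (Num 0) 1 (Var 14) 1 (Var 19))
    (sto2 0 (Var 20) (Num 0) ;; bsub 5 (Num 0) 1 (Var 19) 1 (Var 14)) ;;
   bto 0 (Var 20 +! Num 1) 5 (Num 0) (Var 8))"

lemma runs_bldB:
 assumes env: "env ts" and st: "stab (wa ts)"
  and v: "vr ts 21 = jj" "jj < r" "vr ts 8 = L" "vr ts 9 = p * q" and PN: "5 + (p * q + q * r) * (L + 1) < N"
  and Q: "!!ts'. frm {11, 14, 17, 19, 20} {0} {5} ts ts' ==> (!!n. n < 4 + p * q * (L + 1) ==> wa ts' 0 n = wa ts 0 n) ==>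
   (!!t. t < q * r ==> entry_at b L (wa ts' 0) (4 + (p * q + t) * (L + 1)) (Bent jj t)) ==>
   tm ts' <= tm ts + 11 * (q * r) + 3 ==> Q ts'"
 shows "L2.run bldB ts Q"
 unfolding bldB_def
proof (rule runs_for[where X = "{11, 14, 17, 19, 20}" and Y = "{0}" and Zs = "{5}" and n = "q * r" and
  J = "%m W Z t. (ALL n<4 + p * q * (L + 1). W 0 n = wa ts 0 n) & (ALL t<m. entry_at b L (W 0) (4 + (p * q + t) * (L + 1)) (Bent jj t)) &
   t <= tm ts + 11 * m + 1"], goal_cases)
 case (6 m ts' t)
 have env': "env ts'" using env_frm[OF env 6(2)] by simp
 define k j where kj: "k = m div r" "j = m mod r"
 have m: "m = k * r + j" "k < q" "j < r" using 6(1) r0 by (auto simp: kj less_mult_imp_div_less)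
 have mN: "m < N" "k < N" using 6(1) sizes m by auto
 define P where "P = 4 + (p * q + m) * (L + 1)"
 have "(p * q + m) * (L + 1) <= (p * q + q * r) * (L + 1)" using 6(1) by (intro mult_le_mono1) simp
 then have PN': "Suc P < N" "P < N" using PN by (auto simp: P_def)
 have v': "vr ts' 21 = jj" "vr ts' 8 = L" "vr ts' 9 = p * q" "wa ts' 1 (k * r + jj) = stt k jj" "wa ts' (Suc 0) (k * r + jj) = stt k jj"
  using 6(2) v st m by (auto simp: frm_def stab_def)
 have sr: "stt k jj < r" using stt_le[of k jj] v by simp
 have idx: "k * r + stt k jj < N" using index_less[OF m(2) sr] sizes by auto
 have zB: "za ts' 1 m = B k j" "za ts' (Suc 0) m = B k j" "za ts' 1 (k * r + stt k jj) = bp k jj" "za ts' (Suc 0) (k * r + stt k jj) = bp k jj"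
  using env' m sr by (auto simp: env_def bp_def)
 have B: "Bent jj m = Fin (int (B k j) - int (bp k jj))" by (simp add: Bent_def kj)
 have ent: "B k j < bp k jj ==> tag (Bent jj m) = 1 & mag (Bent jj m) = bp k jj - B k j"
  "\<not> B k j < bp k jj ==> tag (Bent jj m) = 0 & mag (Bent jj m) = B k j - bp k jj" unfolding B by auto
 have fin: "vr ts'' 19 = m & frm {11, 14, 17, 19, 20} {0} {5} ts ts'' & (ALL n<4 + p * q * (L + 1). wa ts'' 0 n = wa ts 0 n) &
   (ALL t<Suc m. entry_at b L (wa ts'' 0) (4 + (p * q + t) * (L + 1)) (Bent jj t)) & Suc (tm ts'') <= tm ts + 11 * Suc m + 1"
  if f: "frm {11, 14, 17, 20} {0} {5} ts' ts''" and e: "entry_at b L (wa ts'' 0) P (Bent jj m)" and lt: "!!n. n < P ==> wa ts'' 0 n = wa ts' 0 n"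
   and t: "tm ts'' <= tm ts' + 8" for ts''
 proof (intro conjI allI impI)
  show "vr ts'' 19 = m" using f 6(3) by (simp add: frm_def)
  show "frm {11, 14, 17, 19, 20} {0} {5} ts ts''" using frm_trans[OF 6(2) f] by simp
  fix n assume n: "n < 4 + p * q * (L + 1)"
  have "n < P" using n by (simp add: P_def add_mult_distrib)
  then show "wa ts'' 0 n = wa ts 0 n" using lt 6(5) n by simp
 next
  fix t' assume a: "t' < Suc m"
  show "entry_at b L (wa ts'' 0) (4 + (p * q + t') * (L + 1)) (Bent jj t')"
  proof (cases "t' = m")
   case True then show ?thesis using e by (simp add: P_def)
  next
   case False
   then have "Suc (p * q + t') * (L + 1) <= (p * q + m) * (L + 1)" using a by (intro mult_le_mono1) simp
   then have "entry_at b L (wa ts'' 0) (4 + (p * q + t') * (L + 1)) (Bent jj t') = entry_at b L (wa ts' 0) (4 + (p * q + t') * (L + 1)) (Bent jj t')"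
    using lt by (intro entry_at_cong) (auto simp: P_def)
   then show ?thesis using 6(5) a False by simp
  qed
 qed (use t 6(4,5) in simp)
 define K where "K ts'' \<longleftrightarrow> vr ts'' 20 = P & vr ts'' 8 = L & wa ts'' 0 = (wa ts' 0)(P := tag (Bent jj m)) & za ts'' 5 0 = mag (Bent jj m) &
   frm {11, 14, 17, 20} {0} {5} ts' ts'' & tm ts'' <= tm ts' + 7" for ts'' :: store
 let ?C = "cnd (ev2 (Var 17)) (sto2 0 (Var 20) (Num 1) ;; bsub 5 (Num 0) 1 (Var 14) 1 (Var 19))
    (sto2 0 (Var 20) (Num 0) ;; bsub 5 (Num 0) 1 (Var 19) 1 (Var 14))"
 let ?s = "ts'(|vr := (vr ts')(11 := k, 20 := P, 14 := k * r + stt k jj, 17 := (if B k j < bp k jj then 1 else 0)), tm := Suc (Suc (Suc (Suc (tm ts'))))|)"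
 have br: "L2.run ?C ?s K"
 proof (cases "B k j < bp k jj")
  case True
  have le: "B k j <= bp k jj" using True by simp
  show ?thesis
   supply [simp] = ok2_def NN v' mN idx PN' zB 6(3) ent(1)[OF True] True le
   apply (rule runs_cnd', (simp; fail)+)
    apply (rule runs_seq, rule runs_sto', (simp; fail)+)
    apply (rule runs_bsub', (simp; fail)+)
    apply (simp add: K_def frm_def)
   apply simp
   done
 next
  case False
  have le: "bp k jj <= B k j" using False by simp
  show ?thesis
   supply [simp] = ok2_def NN v' mN idx PN' zB 6(3) ent(2)[OF False] False le
   apply (rule runs_cnd', (simp; fail)+)
    apply simp
   apply (rule runs_seq, rule runs_sto', (simp; fail)+)
   apply (rule runs_bsub', (simp; fail)+)
   apply (simp add: K_def frm_def)
   done
 qed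
 have last: "L2.run (bto 0 (Var 20 +! Num 1) 5 (Num 0) (Var 8)) ts'' (%ts''. vr ts'' 19 = m & frm {11, 14, 17, 19, 20} {0} {5} ts ts'' &
   (ALL n<4 + p * q * (L + 1). wa ts'' 0 n = wa ts 0 n) &
   (ALL t<Suc m. entry_at b L (wa ts'' 0) (4 + (p * q + t) * (L + 1)) (Bent jj t)) & Suc (tm ts'') <= tm ts + 11 * Suc m + 1)" if K: "K ts''" for ts''
  apply (rule runs_bto', (use K NN PN' in \<open>simp add: ok2_def K_def; fail\<close>)+)
  apply (rule fin)
    apply (use K in \<open>simp add: K_def frm_def\<close>)
   apply (rule entry_at_upd; use K in \<open>simp add: K_def\<close>)
   apply (use K in \<open>simp add: K_def\<close>)
  using K by (simp add: K_def)
 show ?case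
  supply [simp] = ok2_def envD[OF env'] NN v' mN kj(1)[symmetric] idx PN' zB 6(3)
  apply (rule runs_seq, rule runs_asg', (simp; fail)+)
  apply (rule runs_seq, rule runs_asg'[where v = P], simp, simp add: P_def, rule PN'(2))
  apply (rule runs_seq, rule runs_asg', (simp; fail)+)
  apply (rule runs_seq, rule runs_bless', (simp; fail)+)
  apply (rule runs_seq, rule runs_conseq[OF _ last])
  using br by simp
next
 case (7 ts' t)
 then show ?case by (intro Q) auto
qed (use env NN sizes v in \<open>auto simp: ok2_def frm_def env_def\<close>)

text \<open>Shifted back by \<open>cp i jj\<close>, an entry of the product is the minimum of
  \<open>A i k + B k j\<close> over the \<open>k\<close> alive at the pivot. Merging it keeps the
  lower bound and settles all these pairs in every column.\<close>

lemma MC: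
 assumes "i < p" "j < r" and x: "x = min_plus (MA jj) (MB jj) $$ (i, j)"
 shows "(x = Pinf & (ALL k<q. jj \<notin> S i k)) \<or> (EX z. x = Fin z & (EX k<q. jj \<in> S i k & int (cp i jj) + z = int (A i k + B k j)) &
   (ALL k<q. jj \<in> S i k --> int (cp i jj) + z <= int (A i k + B k j)))"
proof -
 define F where "F k = (if jj \<in> S i k then Fin (int (A i k + B k j) - int (cp i jj)) else Pinf)" for k
 \<comment> \<open>The rounded sum is at least \<open>cp i jj\<close>, so the truncated difference
   is a true one and \<open>bp k jj\<close> cancels.\<close>
 have F: "MA jj $$ (i, k) + MB jj $$ (k, j) = F k" if "k < q" for k
 proof -
  have "int (A i k + bp k jj - cp i jj) = int (A i k + bp k jj) - int (cp i jj)" using cp_le[OF that, of i jj] by (rule of_nat_diff)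
  then show ?thesis using that assms index_div_mod[OF that, of i] index_div_mod[OF assms(2), of k]
   by (auto simp: MA_def MB_def Aent_def Bent_def F_def St_def)
 qed
 have "x = Min (F ` {..<q})"
 proof -
  have "(%k. MA jj $$ (i, k) + MB jj $$ (k, j)) ` {..<q} = F ` {..<q}" using F by (intro image_cong) auto
  then show ?thesis using assms by (simp add: x min_plus_def MA_def MB_def)
 qed
 moreover have ne: "F ` {..<q} ~= {}" using q0 by auto
 ultimately have "x \<in> F ` {..<q}" and le: "!!k. k < q ==> x <= F k" by (auto simp del: Min_in intro: Min_in)
 then obtain k0 where k0: "k0 < q" "x = F k0" by auto
 show ?thesis
 proof (cases "jj \<in> S i k0")
  case True
  then have xz: "x = Fin (int (A i k0 + B k0 j) - int (cp i jj))" using k0 by (simp add: F_def)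
  have "int (cp i jj) + (int (A i k0 + B k0 j) - int (cp i jj)) <= int (A i k + B k j)" if "k < q" "jj \<in> S i k" for k
   using le[OF that(1)] that(2) unfolding xz F_def by simp
  then show ?thesis using xz k0 True by (intro disjI2 exI[of _ "int (A i k0 + B k0 j) - int (cp i jj)"]) auto
 next
  case False
  then have xz: "x = Pinf" using k0 by (simp add: F_def)
  have "jj \<notin> S i k" if "k < q" for k using le[OF that] unfolding xz F_def by (auto split: if_splits)
  then show ?thesis using xz by simp
 qed
qed

text \<open>The emulated program leaves its output correct only modulo \<open>2 ^ w'\<close>, hence
  the reduction of the tag by variable 6. Digits need no extra step: \<open>bfrom\<close> reduces
  them modulo \<open>2 ^ b\<close>, and \<open>b <= w'\<close>.\<close>

definition cmb :: prog where
 "cmb = L2.frl 19 (Var 1 *! Var 3) (asg2 10 (Var 19 idiv Var 3) ;; asg2 20 (Var 19 *! (Var 8 +! Num 1)) ;;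
   asg2 14 (Arr 0 (Var 20) imod Var 6) ;;
   cnd (ev2 (Var 14 =! Num 2)) skp
   (bfrom 5 (Num 0) 0 (Var 20 +! Num 1) (Var 8) ;;
    cnd (ev2 (Var 14)) (bsub 5 (Num 0) 2 (Var 10 *! Var 3 +! Var 21) 5 (Num 0)) (badd 5 (Num 0) 2 (Var 10 *! Var 3 +! Var 21) 5 (Num 0)) ;;
    chmin 3 (Var 19)))"

lemma runs_cmb:
 assumes env: "env ts" and cpt: "cpt (za ts)" and low: "lowC (za ts)"
  and v: "vr ts 21 = jj" "jj < r" "vr ts 8 = L" "vr ts 6 = 2 ^ w'" "b <= w'" and PN: "5 + p * r * (L + 1) < N"
  and out: "!!i j. i < p ==> j < r ==> entry_at b L (%n. wa ts 0 n mod 2 ^ w') ((i * r + j) * (L + 1)) (min_plus (MA jj) (MB jj) $$ (i, j))"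
  and Q: "!!ts'. frm {10, 14, 17, 19, 20} {} {3, 5} ts ts' ==> (!!t. za ts' 3 t <= za ts 3 t) ==> lowC (za ts') ==>
   (!!i k j. i < p ==> k < q ==> j < r ==> jj \<in> S i k ==> za ts' 3 (i * r + j) <= A i k + B k j) ==>
   tm ts' <= tm ts + 13 * (p * r) + 3 ==> Q ts'"
 shows "L2.run cmb ts Q"
 unfolding cmb_def
proof (rule runs_for[where X = "{10, 14, 17, 19, 20}" and Y = "{}" and Zs = "{3, 5}" and n = "p * r" and
  J = "%m W Z t. (ALL t. Z 3 t <= za ts 3 t) & lowC Z &
   (ALL i<p. ALL j<r. i * r + j < m --> (ALL k<q. jj \<in> S i k --> Z 3 (i * r + j) <= A i k + B k j)) & t <= tm ts + 13 * m + 1"], goal_cases)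
 case (6 m ts' t)
 have env': "env ts'" using env_frm[OF env 6(2)] by simp
 define i j where ij: "i = m div r" "j = m mod r"
 have m: "m = i * r + j" "i < p" "j < r" using 6(1) r0 by (auto simp: ij less_mult_imp_div_less)
 have mN: "m < N" "i < N" using 6(1) sizes m by auto
 define P where "P = m * (L + 1)"
 have "m * (L + 1) <= p * r * (L + 1)" using 6(1) by (intro mult_le_mono1) simp
 then have PN': "Suc P < N" "P < N" using PN by (auto simp: P_def)
 have v': "vr ts' 21 = jj" "vr ts' 8 = L" "vr ts' 6 = 2 ^ w'" "wa ts' = wa ts" "za ts' 2 (i * r + jj) = cp i jj"
  using 6(2) v cpt m by (auto simp: frm_def cpt_def)
 have idx: "i * r + jj < N" using index_less[OF m(2) v(2)] sizes by auto
 define x where "x = min_plus (MA jj) (MB jj) $$ (i, j)"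
 have ex: "entry_at b L (%n. wa ts 0 n mod 2 ^ w') P x" using out[OF m(2,3)] by (simp add: P_def x_def m(1)[symmetric])
 have dv: "(2::nat) ^ b dvd 2 ^ w'" using v(5) by (simp add: le_imp_power_dvd)
 have ex': "entry_at b L (%n. wa ts 0 n mod 2 ^ w') P x ==> wa ts 0 P mod 2 ^ w' = tag x" by (simp add: entry_at_def)
 note tg = ex'[OF ex]
 have tgN: "tag x < N" using NN by (auto simp: tag_def split: extended.splits)
 have J: "ALL t. za ts' 3 t <= za ts 3 t" "lowC (za ts')"
  "ALL i<p. ALL j<r. i * r + j < m --> (ALL k<q. jj \<in> S i k --> za ts' 3 (i * r + j) <= A i k + B k j)" "t <= tm ts + 13 * m + 1" using 6(5) by auto
 have step: "vr ts'' 19 = m & frm {10, 14, 17, 19, 20} {} {3, 5} ts ts'' & (ALL t. za ts'' 3 t <= za ts 3 t) & lowC (za ts'') &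
   (ALL i<p. ALL j<r. i * r + j < Suc m --> (ALL k<q. jj \<in> S i k --> za ts'' 3 (i * r + j) <= A i k + B k j)) & Suc (tm ts'') <= tm ts + 13 * Suc m + 1"
  if f: "frm {10, 14, 17, 20} {} {3, 5} ts' ts''" and z: "za ts'' 3 = (za ts' 3)(m := y)" and y: "y <= za ts' 3 m" "cc i j <= y"
   "!!k. k < q ==> jj \<in> S i k ==> y <= A i k + B k j" and t: "tm ts'' <= tm ts' + 10" for ts'' y
 proof (intro conjI)
  show "vr ts'' 19 = m" using f 6(3) by (simp add: frm_def)
  show "frm {10, 14, 17, 19, 20} {} {3, 5} ts ts''" using frm_trans[OF 6(2) f] by simp
  show "ALL t. za ts'' 3 t <= za ts 3 t" using z y(1) J(1) by (metis fun_upd_apply le_trans)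
  show "lowC (za ts'')" unfolding lowC_def z
  proof (intro allI impI)
   fix i' j' assume a: "i' < p" "j' < r"
   show "cc i' j' <= ((za ts' 3)(m := y)) (i' * r + j')"
    using J(2) a y(2) index_eq[OF a(2) m(3), of i' i] m(1) by (auto simp: lowC_def)
  qed
  show "ALL i<p. ALL j<r. i * r + j < Suc m --> (ALL k<q. jj \<in> S i k --> za ts'' 3 (i * r + j) <= A i k + B k j)"
  proof (intro allI impI)
   fix i' j' k' assume a: "i' < p" "j' < r" "i' * r + j' < Suc m" "k' < q" "jj \<in> S i' k'"
   show "za ts'' 3 (i' * r + j') <= A i' k' + B k' j'"
   proof (cases "i' * r + j' = m")
    case True
    then have "i' = i" "j' = j" using index_eq[OF a(2) m(3), of i' i] m(1) by auto
    then show ?thesis using z y(3) a m(1) by simp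
   next
    case False
    then show ?thesis using z J(3) a by simp
   qed
  qed
  show "Suc (tm ts'') <= tm ts + 13 * Suc m + 1" using t J(4) 6(4) by simp
 qed
 have lowm: "cc i j <= za ts' 3 m" using J(2) m by (simp add: lowC_def)
 let ?s = "ts'(|vr := (vr ts')(10 := i, 20 := P, 14 := tag x), tm := Suc (Suc (Suc (tm ts')))|)"
 let ?C = "cnd (ev2 (Var 14 =! Num 2)) skp
   (bfrom 5 (Num 0) 0 (Var 20 +! Num 1) (Var 8) ;;
    cnd (ev2 (Var 14)) (bsub 5 (Num 0) 2 (Var 10 *! Var 3 +! Var 21) 5 (Num 0)) (badd 5 (Num 0) 2 (Var 10 *! Var 3 +! Var 21) 5 (Num 0)) ;;
    chmin 3 (Var 19))"
 let ?post = "%ts''. vr ts'' 19 = m & frm {10, 14, 17, 19, 20} {} {3, 5} ts ts'' & (ALL t. za ts'' 3 t <= za ts 3 t) & lowC (za ts'') &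
   (ALL i<p. ALL j<r. i * r + j < Suc m --> (ALL k<q. jj \<in> S i k --> za ts'' 3 (i * r + j) <= A i k + B k j)) & Suc (tm ts'') <= tm ts + 13 * Suc m + 1"
 have main: "L2.run ?C ?s ?post"
  using MC[OF m(2,3) x_def]
 proof
  assume a': "x = Pinf & (ALL k<q. jj \<notin> S i k)"
  then have a: "x = Pinf" "ALL k<q. jj \<notin> S i k" by auto
  have t2: "tag x = 2" using a by simp
  show ?thesis
   supply [simp] = ok2_def NN t2
   apply (rule runs_cnd', (simp; fail)+)
    apply (rule runs_skp)
    apply (rule step[where y = "za ts' 3 m"])
      apply (simp add: frm_def)
      apply simp
     apply simp
     apply (rule lowm)
    apply (use a in simp)
    apply simp
   apply simp
   done
 next
  assume "EX z. x = Fin z & (EX k<q. jj \<in> S i k & int (cp i jj) + z = int (A i k + B k j)) &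
   (ALL k<q. jj \<in> S i k --> int (cp i jj) + z <= int (A i k + B k j))"
  then obtain z where z: "x = Fin z" "EX k<q. jj \<in> S i k & int (cp i jj) + z = int (A i k + B k j)"
   "ALL k<q. jj \<in> S i k --> int (cp i jj) + z <= int (A i k + B k j)" by blast
  then obtain k where k: "k < q" "jj \<in> S i k" "int (cp i jj) + z = int (A i k + B k j)" by blast
  define y where "y = A i k + B k j"
  have yX: "y <= X" "cp i jj <= X" using AX[OF m(2) k(1) m(3)] cp_le_X[OF m(2) v(2)] by (auto simp: y_def)
  have zy: "z = int y - int (cp i jj)" using k(3) by (simp add: y_def)
  have mg: "mag x < BL" using yX XBL unfolding z(1) zy by auto
  have sm: "(\<Sum>l<L. (wa ts 0 (Suc P + l) mod 2 ^ b) * (2 ^ b) ^ l) = mag x"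
   using entry_at_sum[OF ex] mg dv by (simp add: BL_def mod_mod_cancel)
  have sm': "(\<Sum>l<L. (wa ts 0 (Suc (P + l)) mod 2 ^ b) * (2 ^ b) ^ l) = mag x" using sm by simp
  have yl: "cc i j <= y" "!!k'. k' < q ==> jj \<in> S i k' ==> y <= A i k' + B k' j"
   using cc_le[OF k(1), of i j] z(3) unfolding zy by (auto simp: y_def)
  have ybl: "y < BL" using yX XBL by simp
  show ?thesis
  proof (cases "z < 0")
   case True
   have t1: "tag x = 1" and mx: "mag x = cp i jj - y" and le: "y <= cp i jj" using True unfolding z(1) zy by auto
   have sm'': "(\<Sum>l<L. (wa ts 0 (Suc (P + l)) mod 2 ^ b) * (2 ^ b) ^ l) = cp i jj - y" using sm' mx by simp
   have le': "cp i jj - y <= cp i jj" by simp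
   have yy: "cp i jj - (cp i jj - y) = y" using le by simp
   show ?thesis
    supply [simp] = ok2_def envD[OF env'] NN t1 v' idx PN' mN sm'' yy 6(3)
    apply (rule runs_cnd', (simp; fail)+)
    apply (rule runs_seq, rule runs_bfrom'', (simp; fail)+)
    apply (rule runs_seq, rule runs_cnd', (simp; fail)+)
     apply (rule runs_bsub', (simp; fail)+)
     apply (rule runs_chmin'[where i = m and y = y], (simp; fail)+)
     apply (rule step[where y = "min (za ts' 3 m) y"])
       apply (simp add: frm_def)
       apply simp
      apply simp
      apply (use lowm yl in simp)
     apply (use yl in \<open>simp add: min.coboundedI2\<close>)
     apply simp
    apply simp
    done
  next
   case False
   have t1: "tag x = 0" and mx: "mag x = y - cp i jj" and le: "cp i jj <= y" using False unfolding z(1) zy by auto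
   have sm'': "(\<Sum>l<L. (wa ts 0 (Suc (P + l)) mod 2 ^ b) * (2 ^ b) ^ l) = y - cp i jj" using sm' mx by simp
   have yy: "cp i jj + (y - cp i jj) = y" using le by simp
   show ?thesis
    supply [simp] = ok2_def envD[OF env'] NN t1 v' idx PN' mN sm'' yy ybl 6(3)
    apply (rule runs_cnd', (simp; fail)+)
    apply (rule runs_seq, rule runs_bfrom'', (simp; fail)+)
    apply (rule runs_seq, rule runs_cnd', (simp; fail)+)
    apply (rule runs_badd', (simp; fail)+)
    apply (rule runs_chmin'[where i = m and y = y], (simp; fail)+)
    apply (rule step[where y = "min (za ts' 3 m) y"])
       apply (simp add: frm_def)
      apply simp
      apply simp
     apply (use lowm yl in simp)
     apply (use yl in \<open>simp add: min.coboundedI2\<close>)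
    apply simp
    done
  qed
 qed
 show ?case
  supply [simp] = ok2_def envD[OF env'] NN v' mN ij(1)[symmetric] PN' 6(3) tg tgN
  apply (rule runs_seq, rule runs_asg', (simp; fail)+)
  apply (rule runs_seq, rule runs_asg'[where v = P], simp, simp add: P_def, rule PN'(2))
  apply (rule runs_seq, rule runs_asg', (simp; fail)+)
  apply (rule run_eqI[OF main]; simp)
  done
next
 case (7 ts' t)
 then show ?case using index_less by (intro Q) auto
qed (use env NN sizes v low in \<open>auto simp: ok2_def frm_def env_def\<close>)

end

section \<open>The covering sweep and the whole algorithm\<close>

locale algo3 = algo2 +
 fixes n d' w' :: nat and P :: prog and T :: real
 assumes b_eq: "b = floorlog 2 n" and L_eq: "L = entry_bits d' n + 1" and nN: "n < N"
  and P: "!!jj. jj < r ==> computes_within w' P (encode_instance d' n (MA jj) (MB jj)) (encode_mat d' n (min_plus (MA jj) (MB jj))) T"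
  and w': "24 * 2 ^ w' < (2::nat) ^ w" "2 ^ w' dvd N" "b <= w'"
  and PN: "5 + (p * q + q * r) * (L + 1) < N" "5 + p * r * (L + 1) < N"
begin

text \<open>The header is written again before each call, as an earlier call may have changed any
  cell of array 0.\<close>

definition piv :: "prog => prog" where
 "piv Pr = sto2 0 (Num 0) (Var 0) ;; sto2 0 (Num 1) (Var 1) ;; sto2 0 (Num 2) (Var 2) ;; sto2 0 (Num 3) (Var 3) ;;
   bldA ;; bldB ;; callp 6 Pr ;; cmb"

definition TP :: nat where "TP = 5 * nat \<lceil>T\<rceil> + 14 * (p * q) + 11 * (q * r) + 13 * (p * r) + 14"

lemma runs_piv:
 assumes env: "env ts" and cpt: "cpt (za ts)" and st: "stab (wa ts)" and xt: "xtab (wa ts) (p * q)" and cn: "cnts (wa ts)" and low: "lowC (za ts)"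
  and v: "vr ts 21 = jj" "jj < r" "vr ts 8 = L" "vr ts 9 = p * q" "vr ts 0 = n" "vr ts 6 = 2 ^ w'"
  and Q: "!!ts'. frm {10, 11, 12, 13, 14, 17, 19, 20} {0, 3, 4, 5} {3, 5} ts ts' ==> Uof (wa ts') = Uof (wa ts) - {t. jj \<in> St t} ==>
   cnts (wa ts') ==> lowC (za ts') ==> (!!t. za ts' 3 t <= za ts 3 t) ==>
   (!!i k j. i < p ==> k < q ==> j < r ==> jj \<in> S i k ==> za ts' 3 (i * r + j) <= A i k + B k j) ==>
   tm ts' <= tm ts + TP + 12 * (\<Sum>t\<in>{t \<in> Uof (wa ts). jj \<in> St t}. card (starts (t mod q))) ==> Q ts'"
 shows "L2.run (piv P) ts Q"
proof -
 let ?L = "entry_bits d' n + 2"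
 have L1: "L + 1 = ?L" by (simp add: L_eq)
 define ts0 where "ts0 = ts(|wa := (wa ts)(0 := (wa ts 0)(0 := n, 1 := p, 2 := q, 3 := r)), tm := tm ts + 4|)"
 have f0: "frm {} {0} {} ts ts0" by (auto simp: frm_def ts0_def)
 have i0: "env ts0" "cpt (za ts0)" "stab (wa ts0)" "xtab (wa ts0) (p * q)" "cnts (wa ts0)" "vr ts0 21 = jj" "vr ts0 8 = L" "vr ts0 9 = p * q"
  "Uof (wa ts0) = Uof (wa ts)"
  using env_frm[OF env f0] cpt st xt cn v by (auto simp: ts0_def cpt_def stab_def xtab_def cnts_def Uof_def)
 have PNA: "5 + p * q * (L + 1) < N" using PN(1) by (simp add: add_mult_distrib)
 have main: "L2.run (bldA ;; bldB ;; callp 6 P ;; cmb) ts0 Q"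
 proof (rule runs_seq, rule runs_bldA[OF i0(1-6) v(2) i0(7,8) PNA])
  fix ts1 assume 1: "frm {10, 11, 12, 13, 14, 17, 19, 20} {0, 3, 4, 5} {5} ts0 ts1" "!!n. n < 4 ==> wa ts1 0 n = wa ts0 0 n"
   "!!t. t < p * q ==> entry_at b L (wa ts1 0) (4 + t * (L + 1)) (Aent jj t)" "Uof (wa ts1) = Uof (wa ts0) - {t. jj \<in> St t}"
   "cnts (wa ts1)" "tm ts1 <= tm ts0 + 14 * (p * q) + 12 * (\<Sum>t\<in>{t \<in> Uof (wa ts0). jj \<in> St t}. card (starts (t mod q))) + 3"
  have i1: "env ts1" "stab (wa ts1)" "vr ts1 21 = jj" "vr ts1 8 = L" "vr ts1 9 = p * q"
   using env_frm[OF i0(1) 1(1)] 1(1) i0 by (auto simp: stab_def frm_def)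
  show "L2.run (bldB ;; callp 6 P ;; cmb) ts1 Q"
  proof (rule runs_seq, rule runs_bldB[OF i1(1-3) v(2) i1(4,5) PN(1)])
   fix ts2 assume 2: "frm {11, 14, 17, 19, 20} {0} {5} ts1 ts2" "!!n. n < 4 + p * q * (L + 1) ==> wa ts2 0 n = wa ts1 0 n"
    "!!t. t < q * r ==> entry_at b L (wa ts2 0) (4 + (p * q + t) * (L + 1)) (Bent jj t)" "tm ts2 <= tm ts1 + 11 * (q * r) + 3"
   have Aat: "entry_at b L (wa ts2 0) (4 + t * (L + 1)) (Aent jj t)" if "t < p * q" for t
   proof -
    have "Suc t * (L + 1) <= p * q * (L + 1)" using that by (intro mult_le_mono1) simp
    then show ?thesis using 1(3)[OF that] 2(2) by (subst entry_at_cong[where g = "wa ts1 0"]) auto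
   qed
   have dims: "dim_row (MA jj) = p" "dim_col (MA jj) = q" "dim_row (MB jj) = q" "dim_col (MB jj) = r" by (simp_all add: MA_def MB_def)
   have MAt: "MA jj $$ (t div q, t mod q) = Aent jj t" if "t < p * q" for t
    using that q0 by (simp add: MA_def less_mult_imp_div_less)
   have MBt: "MB jj $$ (t div r, t mod r) = Bent jj t" if "t < q * r" for t
    using that r0 by (simp add: MB_def less_mult_imp_div_less)
   have inp: "ALL i<length (encode_instance d' n (MA jj) (MB jj)). wa ts2 0 i = encode_instance d' n (MA jj) (MB jj) ! i"
    unfolding encode_instance_at dims b_eq[symmetric] L_eq[symmetric] L1[symmetric]
    using Aat 2(2,3) 1(2) by (auto simp: MAt MBt ts0_def)
   have v2: "vr ts2 6 = 2 ^ w'" using 2(1) 1(1) v by (auto simp: frm_def ts0_def)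
   show "L2.run (callp 6 P ;; cmb) ts2 Q"
   proof (rule runs_seq, rule runs_callp[OF P[OF v(2)] v2 w'(1,2)])
    fix i assume "i < length (encode_instance d' n (MA jj) (MB jj))"
    then show "wa ts2 0 i = encode_instance d' n (MA jj) (MB jj) ! i" using inp by simp
   next
    fix ts3 :: store assume 3: "vr ts3 = vr ts2" "!!a. a ~= 0 ==> wa ts3 a = wa ts2 a" "za ts3 = za ts2"
     "!!i. i < length (encode_mat d' n (min_plus (MA jj) (MB jj))) ==> wa ts3 0 i mod 2 ^ w' = encode_mat d' n (min_plus (MA jj) (MB jj)) ! i"
     "tm ts3 = tm ts2 + (5 * nat \<lceil>T\<rceil> + 1)"
    have f2: "frm {10, 11, 12, 13, 14, 17, 19, 20} {0, 3, 4, 5} {5} ts0 ts2" by (rule frm_trans[OF 1(1) 2(1)]) auto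
    have f3': "frm {10, 11, 12, 13, 14, 17, 19, 20} {0, 3, 4, 5} {5} ts0 ts3" using f2 3 by (auto simp: frm_def)
    have f3: "frm {10, 11, 12, 13, 14, 17, 19, 20} {0, 3, 4, 5} {5} ts ts3" using f3' by (auto simp: frm_def ts0_def)
    have i3: "env ts3" "cpt (za ts3)" "lowC (za ts3)" "vr ts3 21 = jj" "vr ts3 8 = L" "vr ts3 6 = 2 ^ w'" "za ts3 3 = za ts 3"
     using env_frm[OF env f3] f3 cpt low v by (auto simp: frm_def cpt_def lowC_def)
    have w3: "wa ts3 a = wa ts1 a" if "a ~= 0" for a using that 3(2)[OF that] 2(1) by (auto simp: frm_def)
    have c3: "Uof (wa ts3) = Uof (wa ts1)" "cnts (wa ts3)" using 1(5) w3 by (auto simp: Uof_def cnts_def)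
    have dims2: "dim_row (min_plus (MA jj) (MB jj)) = p" "dim_col (min_plus (MA jj) (MB jj)) = r" by (simp_all add: min_plus_def dims)
    have "ALL i<length (encode_mat d' n (min_plus (MA jj) (MB jj))). (%i. wa ts3 0 i mod 2 ^ w') (0 + i) = encode_mat d' n (min_plus (MA jj) (MB jj)) ! i"
     using 3(4) by simp
    note oo = encode_mat_at[THEN iffD1, OF this, unfolded dims2]
    have out: "entry_at b L (%i. wa ts3 0 i mod 2 ^ w') ((i * r + j) * (L + 1)) (min_plus (MA jj) (MB jj) $$ (i, j))" if "i < p" "j < r" for i j
     using oo[rule_format, OF index_less[OF that]] index_div_mod[OF that(2), of i] by (simp add: b_eq L_eq)
    show "L2.run cmb ts3 Q"
    proof (rule runs_cmb[OF i3(1-4) v(2) i3(5,6) w'(3) PN(2) out])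
     fix ts4 assume 4: "frm {10, 14, 17, 19, 20} {} {3, 5} ts3 ts4" "!!t. za ts4 3 t <= za ts3 3 t" "lowC (za ts4)"
      "!!i k j. i < p ==> k < q ==> j < r ==> jj \<in> S i k ==> za ts4 3 (i * r + j) <= A i k + B k j" "tm ts4 <= tm ts3 + 13 * (p * r) + 3"
     have w4: "wa ts4 = wa ts3" using 4(1) by (auto simp: frm_def)
     show "Q ts4"
     proof (rule Q)
      show "frm {10, 11, 12, 13, 14, 17, 19, 20} {0, 3, 4, 5} {3, 5} ts ts4"
       by (rule frm_trans[OF frm_mono[OF f3] 4(1)]) auto
      show "Uof (wa ts4) = Uof (wa ts) - {t. jj \<in> St t}" "cnts (wa ts4)" using c3 w4 1(4) i0(9) by auto
      show "za ts4 3 t <= za ts 3 t" for t using 4(2)[of t] i3(7) by simp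
      have "tm ts0 = tm ts + 4" by (simp add: ts0_def)
      then show "tm ts4 <= tm ts + TP + 12 * (\<Sum>t\<in>{t \<in> Uof (wa ts). jj \<in> St t}. card (starts (t mod q)))"
       using 1(6) 2(4) 3(5) 4(5) unfolding i0(9) TP_def by linarith
     qed (use 4 in auto)
    qed
   qed
  qed
 qed
 show ?thesis unfolding piv_def
  supply [simp] = ok2_def envD[OF env] NN v nN sizes
  apply (rule runs_seq, rule runs_sto', (simp; fail)+)
  apply (rule runs_seq, rule runs_sto', (simp; fail)+)
  apply (rule runs_seq, rule runs_sto', (simp; fail)+)
  apply (rule runs_seq, rule runs_sto', (simp; fail)+)
  apply (rule run_eqI[OF main]; simp add: ts0_def fun_eq_iff)
  done
qed

text \<open>Both prefix sums are rebuilt for every column, since a pivot step changes the arrays at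
  earlier columns too. The total of order \<open>r ^ 2\<close> is the size of the output when
  \<open>p = r\<close>.\<close>

definition acc :: prog where
 "acc = asg2 18 (Num 0) ;; asg2 22 (Num 0) ;;
   L2.frl 19 (Var 21 +! Num 1) (asg2 18 (Var 18 +! Arr 4 (Var 19)) ;; asg2 22 (Var 22 +! Arr 5 (Var 19)))"

lemma sum_dpt_le: "U \<subseteq> {..<p * q} ==> (\<Sum>x<k. \<Sum>t\<in>U. dpt t x) <= p * q * r" "U \<subseteq> {..<p * q} ==> (\<Sum>x<k. \<Sum>t\<in>U. dmt t x) <= p * q * r"
proof -
 assume U: "U \<subseteq> {..<p * q}"
 then have cU: "card U <= p * q" using card_mono[of "{..<p * q}" U] by simp
 have *: "(\<Sum>x<k. card {s \<in> starts a. f s = x}) <= r" for a k and f :: "nat => nat"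
 proof -
  have "(\<Sum>x<k. card {s \<in> starts a. f s = x}) <= (\<Sum>x\<le>k. card {s \<in> starts a. f s = x})" by (intro sum_mono2) auto
  also have "\<dots> = card {s \<in> starts a. f s <= k}" by (intro sum_card_eq) (simp add: starts_def)
  also have "\<dots> <= r" by (intro starts_le) auto
  finally show ?thesis .
 qed
 have g: "(\<Sum>x<k. \<Sum>t\<in>U. F t x) <= p * q * r" if "!!t. (\<Sum>x<k. F t x) <= r" for F :: "nat => nat => nat"
 proof -
  have "(\<Sum>x<k. \<Sum>t\<in>U. F t x) = (\<Sum>t\<in>U. \<Sum>x<k. F t x)" by (rule sum.swap)
  also have "\<dots> <= card U * r" using sum_bounded_above[of U "%t. \<Sum>x<k. F t x" r] that by simp
  also have "\<dots> <= p * q * r" using cU by (rule mult_le_mono1)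
  finally show ?thesis .
 qed
 show "(\<Sum>x<k. \<Sum>t\<in>U. dpt t x) <= p * q * r" "(\<Sum>x<k. \<Sum>t\<in>U. dmt t x) <= p * q * r"
  by (rule g; unfold dpt_def dmt_def dp_def dm_def; rule *)+
qed

lemma runs_acc:
 assumes cn: "cnts (wa ts)" and v: "vr ts 21 = jj" "jj < r"
  and Q: "!!ts'. frm {18, 19, 22} {} {} ts ts' ==> vr ts' 18 - vr ts' 22 = card {t \<in> Uof (wa ts). jj \<in> St t} ==>
   tm ts' <= tm ts + 4 * r + 5 ==> Q ts'"
 shows "L2.run acc ts Q"
proof -
 let ?U = "Uof (wa ts)"
 have U: "?U \<subseteq> {..<p * q}" by (auto simp: Uof_def)
 have w45: "wa ts 4 x = (\<Sum>t\<in>?U. dpt t x)" "wa ts 5 x = (\<Sum>t\<in>?U. dmt t x)" if "x <= r" for x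
  using cn that by (auto simp: cnts_def)
 define s4 where "s4 k = (\<Sum>x<k. wa ts 4 x)" for k
 define s5 where "s5 k = (\<Sum>x<k. wa ts 5 x)" for k
 have sN: "s4 k < N" "s5 k < N" if "k <= r" for k
 proof -
  have "s4 k = (\<Sum>x<k. \<Sum>t\<in>?U. dpt t x)" "s5 k = (\<Sum>x<k. \<Sum>t\<in>?U. dmt t x)"
   unfolding s4_def s5_def using that w45 by (auto intro!: sum.cong)
  then show "s4 k < N" "s5 k < N" using sum_dpt_le[OF U, of k] sizes(7) by auto
 qed
 \<comment> \<open>Exchanging the sums reduces the claim to \<open>count_S\<close> for each
   uncovered pair.\<close>
 have cnt: "s4 (Suc jj) - s5 (Suc jj) = card {t \<in> ?U. jj \<in> St t}"
 proof -
  have "s4 (Suc jj) = (\<Sum>x\<le>jj. \<Sum>t\<in>?U. dpt t x)" "s5 (Suc jj) = (\<Sum>x\<le>jj. \<Sum>t\<in>?U. dmt t x)"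
   unfolding s4_def s5_def lessThan_Suc_atMost using v w45 by (auto intro!: sum.cong)
  moreover have "(\<Sum>x\<le>jj. \<Sum>t\<in>?U. dpt t x) = (\<Sum>t\<in>?U. \<Sum>x\<le>jj. dpt t x)" "(\<Sum>x\<le>jj. \<Sum>t\<in>?U. dmt t x) = (\<Sum>t\<in>?U. \<Sum>x\<le>jj. dmt t x)"
   by (rule sum.swap)+
  moreover have "(\<Sum>t\<in>?U. \<Sum>x\<le>jj. dpt t x) = (\<Sum>t\<in>?U. \<Sum>x\<le>jj. dmt t x) + (\<Sum>t\<in>?U. if jj \<in> St t then 1 else 0)"
   unfolding sum.distrib[symmetric] dpt_def dmt_def St_def using count_S[OF v(2)] by (intro sum.cong) auto
  moreover have "(\<Sum>t\<in>?U. if jj \<in> St t then 1 else 0) = card {t \<in> ?U. jj \<in> St t}"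
   by (simp add: sum.If_cases Int_def)
  ultimately show ?thesis by simp
 qed
 have jN: "Suc jj < N" using v sizes(6) by simp
 let ?s = "ts(|vr := (vr ts)(18 := 0, 22 := 0), tm := Suc (Suc (tm ts))|)"
 have main: "L2.run (L2.frl 19 (Var 21 +! Num 1) (asg2 18 (Var 18 +! Arr 4 (Var 19)) ;; asg2 22 (Var 22 +! Arr 5 (Var 19)))) ?s Q"
 proof (rule L2.runs_frl[where n = "Suc jj" and
   I = "%k ts'. frm {18, 19, 22} {} {} ts ts' & vr ts' 19 = k & vr ts' 18 = s4 k & vr ts' 22 = s5 k & tm ts' = tm ts + 4 * k + 3"], goal_cases)
  case (7 k ts')
  then have e: "s4 k + wa ts' 4 k = s4 (Suc k)" "s5 k + wa ts' 5 k = s5 (Suc k)" by (auto simp: s4_def s5_def frm_def)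
  have lt: "s4 (Suc k) < N" "s5 (Suc k) < N" using sN[of "Suc k"] 7(1) v(2) by auto
  have f: "frm {18, 19, 22} {} {} ts (tick (ts'(|vr := (vr ts')(18 := a, 22 := c, 19 := e)|)))" for a c e using 7 by (auto simp: frm_def)
  show ?case
   supply [simp] = ok2_def 7 e lt
   apply (rule runs_seq, rule runs_asg', (simp; fail)+)
   apply (rule runs_asg', (simp; fail)+)
   using 7 by (auto simp: frm_def)
 next
  case (8 ts')
  then show ?case using v(2) cnt by (intro Q) (auto simp: frm_def)
 qed (use v jN in \<open>auto simp: ok2_def frm_def s4_def s5_def\<close>)
 show ?thesis unfolding acc_def
  supply [simp] = ok2_def NN
  apply (rule runs_seq, rule runs_asg', (simp; fail)+)
  apply (rule runs_seq, rule runs_asg', (simp; fail)+)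
  apply (rule run_eqI[OF main]; simp)
  done
qed

definition swp :: "prog => prog" where
 "swp Pr = L2.frl 21 (Var 3) (acc ;; cnd (ev2 ((Var 18 -! Var 22) *! Var 7 <! Var 9)) skp (piv Pr))"

abbreviation cov :: "(nat => nat => nat) => nat set" where "cov W \<equiv> {..<p * q} - Uof W"

text \<open>Amortisation: a pivot step covers at least \<open>p * q / \<rho>\<close> new pairs, so
  \<open>np\<close> steps have covered at least \<open>np * (p * q) / \<rho>\<close> pairs, and
  \<open>np <= \<rho>\<close>. The removal work is charged to the covered pairs, each of which is
  removed once. Columns already passed stay sparse because uncovered pairs only disappear.\<close>

lemma runs_swp:
 assumes env: "env ts" and cpt: "cpt (za ts)" and st: "stab (wa ts)" and xt: "xtab (wa ts) (p * q)" and cn: "cnts (wa ts)" and low: "lowC (za ts)"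
  and U0: "Uof (wa ts) = {..<p * q}" "ALL i<p. ALL k<q. wa ts 3 (i * q + k) = 0"
  and v: "vr ts 8 = L" "vr ts 9 = p * q" "vr ts 0 = n" "vr ts 6 = 2 ^ w'" "vr ts 7 = \<rho>"
  and Q: "!!ts'. frm {10, 11, 12, 13, 14, 17, 18, 19, 20, 21, 22} {0, 3, 4, 5} {3, 5} ts ts' ==> lowC (za ts') ==>
   (!!i k j. i < p ==> k < q ==> j < r ==> wa ts' 3 (i * q + k) ~= 0 ==> za ts' 3 (i * r + j) <= A i k + B k j) ==>
   (!!j. j < r ==> card {t \<in> Uof (wa ts'). j \<in> St t} * \<rho> < p * q) ==>
   tm ts' <= tm ts + r * (4 * r + 9) + \<rho> * TP + 12 * (p * PC) + 2 ==> Q ts'"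
 shows "L2.run (swp P) ts Q"
 unfolding swp_def
proof (rule runs_for[where X = "{10, 11, 12, 13, 14, 17, 18, 19, 20, 21, 22}" and Y = "{0, 3, 4, 5}" and Zs = "{3, 5}" and n = r and
  J = "%m W Z t. cnts W & lowC Z & (ALL i<p. ALL k<q. ALL j<r. W 3 (i * q + k) ~= 0 --> Z 3 (i * r + j) <= A i k + B k j) &
   (ALL j<m. card {t \<in> Uof W. j \<in> St t} * \<rho> < p * q) &
   (EX np. np * (p * q) <= \<rho> * card (cov W) & t <= tm ts + m * (4 * r + 9) + np * TP + 12 * (\<Sum>t\<in>cov W. card (starts (t mod q))) + 1)"], goal_cases)
 case (6 m ts0 t)
 note f0 = 6(2)
 have i0: "env ts0" "cpt (za ts0)" "stab (wa ts0)" "xtab (wa ts0) (p * q)" "vr ts0 8 = L" "vr ts0 9 = p * q" "vr ts0 0 = n" "vr ts0 6 = 2 ^ w'" "vr ts0 7 = \<rho>"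
  using env_frm[OF env f0] cpt st xt v f0 by (auto simp: cpt_def stab_def xtab_def frm_def)
 obtain np where J: "cnts (wa ts0)" "lowC (za ts0)" "!!i k j. i < p ==> k < q ==> j < r ==> wa ts0 3 (i * q + k) ~= 0 ==> za ts0 3 (i * r + j) <= A i k + B k j"
  "!!j. j < m ==> card {t \<in> Uof (wa ts0). j \<in> St t} * \<rho> < p * q" "np * (p * q) <= \<rho> * card (cov (wa ts0))"
  "t <= tm ts + m * (4 * r + 9) + np * TP + 12 * (\<Sum>t\<in>cov (wa ts0). card (starts (t mod q))) + 1" using 6(5) by blast
 show ?case
 proof (rule runs_seq, rule runs_acc[OF J(1) 6(3,1)])
  fix ts1 assume 1: "frm {18, 19, 22} {} {} ts0 ts1" "vr ts1 18 - vr ts1 22 = card {t \<in> Uof (wa ts0). m \<in> St t}" "tm ts1 <= tm ts0 + 4 * r + 5"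
  define c where "c = card {t \<in> Uof (wa ts0). m \<in> St t}"
  have w1: "wa ts1 = wa ts0" "za ts1 = za ts0" using 1(1) by (auto simp: frm_def)
  have f1: "frm {10, 11, 12, 13, 14, 17, 18, 19, 20, 21, 22} {0, 3, 4, 5} {3, 5} ts ts1" by (rule frm_trans[OF f0 1(1)]) auto
  have v1: "vr ts1 21 = m" "vr ts1 8 = L" "vr ts1 9 = p * q" "vr ts1 0 = n" "vr ts1 6 = 2 ^ w'" "vr ts1 7 = \<rho>"
   using 1(1) i0 6(3) by (auto simp: frm_def)
  have e1: "env ts1" using env_frm[OF i0(1) 1(1)] by simp
  show "L2.run (cnd (ev2 ((Var 18 -! Var 22) *! Var 7 <! Var 9)) skp (piv P)) ts1 (%ts''. vr ts'' 21 = m &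
    frm {10, 11, 12, 13, 14, 17, 18, 19, 20, 21, 22} {0, 3, 4, 5} {3, 5} ts ts'' & cnts (wa ts'') & lowC (za ts'') &
    (ALL i<p. ALL k<q. ALL j<r. wa ts'' 3 (i * q + k) ~= 0 --> za ts'' 3 (i * r + j) <= A i k + B k j) &
    (ALL j<Suc m. card {t \<in> Uof (wa ts''). j \<in> St t} * \<rho> < p * q) &
    (EX np. np * (p * q) <= \<rho> * card (cov (wa ts'')) &
     Suc (tm ts'') <= tm ts + Suc m * (4 * r + 9) + np * TP + 12 * (\<Sum>t\<in>cov (wa ts''). card (starts (t mod q))) + 1))"
   (is "L2.run _ _ ?post")
  proof (rule runs_cnd'[where v = "if c * \<rho> < p * q then 1 else 0"])
   assume "(if c * \<rho> < p * q then 1 else 0) ~= (0::nat)"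
   then have lt: "c * \<rho> < p * q" by (auto split: if_splits)
   have "?post (tick (tick ts1))"
    using v1 f1 J lt 6(4) 1(3) by (auto simp: w1 frm_upd c_def less_Suc_eq intro!: exI[of _ np])
   then show "L2.run skp (tick ts1) ?post" by (rule runs_skp)
  next
   assume "(if c * \<rho> < p * q then 1 else 0) = (0::nat)"
   then have ge: "p * q <= c * \<rho>" by (auto split: if_splits)
   have t1: "env (tick ts1)" "cpt (za (tick ts1))" "stab (wa (tick ts1))" "xtab (wa (tick ts1)) (p * q)" "cnts (wa (tick ts1))" "lowC (za (tick ts1))"
    using e1 i0 J w1 by (auto simp: env_def)
   show "L2.run (piv P) (tick ts1) ?post"
   proof (rule runs_piv[OF t1 _ 6(1)])
    fix ts2 assume 2: "frm {10, 11, 12, 13, 14, 17, 19, 20} {0, 3, 4, 5} {3, 5} (tick ts1) ts2" "Uof (wa ts2) = Uof (wa (tick ts1)) - {t. m \<in> St t}"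
     "cnts (wa ts2)" "lowC (za ts2)" "!!t. za ts2 3 t <= za (tick ts1) 3 t"
     "!!i k j. i < p ==> k < q ==> j < r ==> m \<in> S i k ==> za ts2 3 (i * r + j) <= A i k + B k j"
     "tm ts2 <= tm (tick ts1) + TP + 12 * (\<Sum>t\<in>{t \<in> Uof (wa (tick ts1)). m \<in> St t}. card (starts (t mod q)))"
    let ?D = "{t \<in> Uof (wa ts0). m \<in> St t}"
    have U2: "Uof (wa ts2) = Uof (wa ts0) - {t. m \<in> St t}" using 2(2) by (simp add: w1)
    have C2: "cov (wa ts2) = cov (wa ts0) \<union> ?D" "cov (wa ts0) \<inter> ?D = {}" unfolding U2 by (auto simp: Uof_def)
    have card2: "card (cov (wa ts2)) = card (cov (wa ts0)) + c" unfolding C2(1) c_def using C2(2) by (intro card_Un_disjoint) auto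
    have sum2: "(\<Sum>t\<in>cov (wa ts2). card (starts (t mod q))) = (\<Sum>t\<in>cov (wa ts0). card (starts (t mod q))) + (\<Sum>t\<in>?D. card (starts (t mod q)))"
     unfolding C2(1) using C2(2) by (intro sum.union_disjoint) auto
    have z2: "za ts2 3 t <= za ts0 3 t" for t using 2(5)[of t] by (simp add: w1)
    show "?post ts2"
    proof (intro conjI)
     show "vr ts2 21 = m" using 2(1) v1 by (auto simp: frm_def)
     show "frm {10, 11, 12, 13, 14, 17, 18, 19, 20, 21, 22} {0, 3, 4, 5} {3, 5} ts ts2"
      using f1 2(1) by (auto simp: frm_def)
     show "ALL i<p. ALL k<q. ALL j<r. wa ts2 3 (i * q + k) ~= 0 --> za ts2 3 (i * r + j) <= A i k + B k j"
     proof (intro allI impI)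
      fix i k j assume a: "i < p" "k < q" "j < r" "wa ts2 3 (i * q + k) ~= 0"
      then have "i * q + k \<in> cov (wa ts2)" using index_less[OF a(1,2)] by (auto simp: Uof_def)
      then have "i * q + k \<in> cov (wa ts0) \<or> m \<in> S i k" unfolding C2(1) using index_div_mod[OF a(2), of i] by (auto simp: St_def)
      then show "za ts2 3 (i * r + j) <= A i k + B k j"
      proof
       assume "i * q + k \<in> cov (wa ts0)"
       then have "za ts0 3 (i * r + j) <= A i k + B k j" using a by (intro J(3)) (auto simp: Uof_def)
       then show ?thesis using z2 le_trans by blast
      qed (use 2(6) a in auto)
     qed
     show "ALL j<Suc m. card {t \<in> Uof (wa ts2). j \<in> St t} * \<rho> < p * q"
     proof (intro allI impI)
      fix j assume j: "j < Suc m"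
      show "card {t \<in> Uof (wa ts2). j \<in> St t} * \<rho> < p * q"
      proof (cases "j = m")
       case True
       have "{t \<in> Uof (wa ts2). j \<in> St t} = {}" unfolding True U2 by auto
       then have c0: "card {t \<in> Uof (wa ts2). j \<in> St t} = 0" by (simp only: card.empty)
       show ?thesis unfolding c0 using p0 q0 by simp
      next
       case False
       have "card {t \<in> Uof (wa ts2). j \<in> St t} <= card {t \<in> Uof (wa ts0). j \<in> St t}" unfolding U2 by (intro card_mono) auto
       then have "card {t \<in> Uof (wa ts2). j \<in> St t} * \<rho> <= card {t \<in> Uof (wa ts0). j \<in> St t} * \<rho>" by (rule mult_le_mono1)
       also have "\<dots> < p * q" using J(4)[of j] j False by simp
       finally show ?thesis .
      qed
     qed
     show "EX np. np * (p * q) <= \<rho> * card (cov (wa ts2)) &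
      Suc (tm ts2) <= tm ts + Suc m * (4 * r + 9) + np * TP + 12 * (\<Sum>t\<in>cov (wa ts2). card (starts (t mod q))) + 1"
     proof (rule exI[of _ "Suc np"], intro conjI)
      show "Suc np * (p * q) <= \<rho> * card (cov (wa ts2))" unfolding card2 using J(5) ge by (simp add: algebra_simps)
      have e: "Suc m * (4 * r + 9) = m * (4 * r + 9) + (4 * r + 9)" "Suc np * TP = np * TP + TP" by simp_all
      define x1 x2 x3 x4 where x: "x1 = m * (4 * r + 9)" "x2 = np * TP" "x3 = (\<Sum>t\<in>cov (wa ts0). card (starts (t mod q)))" "x4 = (\<Sum>t\<in>?D. card (starts (t mod q)))"
      have "tm ts2 <= Suc (tm ts1) + TP + 12 * (\<Sum>t\<in>?D. card (starts (t mod q)))" using 2(7) by (simp add: w1)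
      then show "Suc (tm ts2) <= tm ts + Suc m * (4 * r + 9) + Suc np * TP + 12 * (\<Sum>t\<in>cov (wa ts2). card (starts (t mod q))) + 1"
       using 1(3) J(6) 6(4) unfolding sum2 e x[symmetric] by (simp add: add_mult_distrib2)
     qed
    qed (use 2 in auto)
   qed (use v1 in auto)
  qed (use 1(2) v1 in \<open>auto simp: ok2_def c_def\<close>)
 qed
next
 case (7 ts' t)
 then obtain np where np: "np * (p * q) <= \<rho> * card (cov (wa ts'))"
  "t <= tm ts + r * (4 * r + 9) + np * TP + 12 * (\<Sum>t\<in>cov (wa ts'). card (starts (t mod q))) + 1" by blast
 have "card (cov (wa ts')) <= p * q" using card_mono[of "{..<p * q}" "cov (wa ts')"] by simp
 then have "np * (p * q) <= \<rho> * (p * q)" using np(1) mult_le_mono2 le_trans by blast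
 then have "np <= \<rho>" using p0 q0 by simp
 then have a: "np * TP <= \<rho> * TP" by (rule mult_le_mono1)
 have "(\<Sum>t\<in>cov (wa ts'). card (starts (t mod q))) <= (\<Sum>t<p * q. card (starts (t mod q)))" by (intro sum_mono2) auto
 then have "(\<Sum>t\<in>cov (wa ts'). card (starts (t mod q))) <= p * PC" by (simp add: PC_def sum_mod[where f = "%k. card (starts k)"])
 then have "tm ts' <= tm ts + r * (4 * r + 9) + \<rho> * TP + 12 * (p * PC) + 2" using np(2) a 7(2) by linarith
 then show ?case using 7 by (intro Q) auto
qed (use env NN sizes v low cn U0 p0 q0 in \<open>auto simp: ok2_def frm_def env_def Uof_def intro!: exI[of _ 0]\<close>)

definition core :: "prog => prog" where "core Pr = scan ;; cpr ;; ini ;; xxp ;; swp Pr ;; enm"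

text \<open>\<open>u\<close> counts the triples left to enumerate. An optimal \<open>k\<close> for
  \<open>(i, j)\<close> is alive there; if its pair is covered, some pivot product has merged the
  sum, otherwise the enumeration does.\<close>

lemma runs_core:
 assumes env: "env ts" and v: "vr ts 8 = L" "vr ts 9 = p * q" "vr ts 0 = n" "vr ts 6 = 2 ^ w'" "vr ts 7 = \<rho>" "0 < \<rho>"
  and Q: "!!ts' u. frm {10, 11, 12, 13, 14, 15, 16, 17, 18, 19, 20, 21, 22} {0, 1, 2, 3, 4, 5, 6} {2, 3, 5} ts ts' ==>
   (!!i j. i < p ==> j < r ==> za ts' 3 (i * r + j) = cc i j) ==> u * \<rho> <= p * q * r ==>
   tm ts' <= tm ts + (6 * floorlog 2 r + 61) * (p * PC) + 12 * (q * r) + 14 * (p * r) + 3 * (p * q) + 12 * p +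
    r * (4 * r + 13) + \<rho> * TP + 6 * u + 29 ==> Q ts'"
 shows "L2.run (core P) ts Q"
 unfolding core_def
proof (rule runs_seq, rule runs_scan[OF env])
 let ?F = "frm {10, 11, 12, 13, 14, 15, 16, 17, 18, 19, 20, 21, 22} {0, 1, 2, 3, 4, 5, 6} {2, 3, 5} ts"
 have fr: "env ts' & vr ts' 8 = L & vr ts' 9 = p * q & vr ts' 0 = n & vr ts' 6 = 2 ^ w' & vr ts' 7 = \<rho>" if "?F ts'" for ts'
  using env_frm[OF env that] that v by (auto simp: frm_def)
 fix ts1 assume 1: "frm {11, 12, 17, 19} {1, 2} {5} ts ts1" "stab (wa ts1)" "tm ts1 <= tm ts + 12 * (q * r) + 3"
 have f1: "?F ts1" by (rule frm_mono[OF 1(1)]) auto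
 show "L2.run (cpr ;; ini ;; xxp ;; swp P ;; enm) ts1 Q"
 proof (rule runs_seq, rule runs_cpr[OF fr[OF f1, THEN conjunct1] 1(2)])
  fix ts2 assume 2: "frm {10, 11, 12, 13, 17} {} {2, 5} ts1 ts2" "!!i j. i < p ==> j < r ==> za ts2 2 (i * r + j) = cp i j"
   "tm ts2 <= tm ts1 + p * (11 * r + 14 * PC + 12) + 3"
  have f2: "?F ts2" by (rule frm_trans[OF f1 2(1)]) auto
  have i2: "stab (wa ts2)" "cpt (za ts2)" using 2 1(2) by (auto simp: cpt_def stab_def frm_def)
  show "L2.run (ini ;; xxp ;; swp P ;; enm) ts2 Q"
  proof (rule runs_seq, rule runs_ini[OF fr[OF f2, THEN conjunct1]])
   fix ts3 assume 3: "frm {19} {3, 4, 5} {3} ts2 ts3" "!!t. t < p * q ==> wa ts3 3 t = 0" "!!x. x <= r ==> wa ts3 4 x = 0 & wa ts3 5 x = 0"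
    "!!t. t < p * r ==> za ts3 3 t = X" "tm ts3 <= tm ts2 + 3 * (p * q) + 4 * r + 3 * (p * r) + 15"
   have f3: "?F ts3" by (rule frm_trans[OF f2 3(1)]) auto
   have i3: "cpt (za ts3)" "stab (wa ts3)" using 3(1) i2 by (auto simp: cpt_def stab_def frm_def)
   show "L2.run (xxp ;; swp P ;; enm) ts3 Q"
   proof (rule runs_seq, rule runs_xxp[OF fr[OF f3, THEN conjunct1] i3 3(3)])
    fix ts4 assume 4: "frm {10, 11, 12, 13, 14, 15, 16, 17, 19} {4, 5, 6} {5} ts3 ts4" "xtab (wa ts4) (p * q)"
     "!!x. x <= r ==> wa ts4 4 x = (\<Sum>t<p * q. dpt t x)" "!!x. x <= r ==> wa ts4 5 x = (\<Sum>t<p * q. dmt t x)"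
     "tm ts4 <= tm ts3 + (6 * floorlog 2 r + 20) * (p * PC) + 3"
    have f4: "?F ts4" by (rule frm_trans[OF f3 4(1)]) auto
    have U4: "Uof (wa ts4) = {..<p * q}" using 4(1) 3(2) by (auto simp: Uof_def frm_def)
    have W4: "ALL i<p. ALL k<q. wa ts4 3 (i * q + k) = 0" using 4(1) 3(2) index_less by (auto simp: frm_def)
    have z4: "za ts4 3 = za ts3 3" using 4(1) by (auto simp: frm_def)
    have low4: "lowC (za ts4)"
     unfolding lowC_def z4
    proof (intro allI impI)
     fix i j assume ij: "i < p" "j < r"
     show "cc i j <= za ts3 3 (i * r + j)" using 3(4)[OF index_less[OF ij]] cc_le[OF q0, of i j] AX[OF ij(1) q0 ij(2)] by simp
    qed
    have i4: "cpt (za ts4)" "stab (wa ts4)" "cnts (wa ts4)" using 4 i3 U4 by (auto simp: cpt_def stab_def frm_def cnts_def)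
    note v4 = fr[OF f4]
    show "L2.run (swp P ;; enm) ts4 Q"
    proof (rule runs_seq, rule runs_swp[OF v4[THEN conjunct1] i4(1,2) 4(2) i4(3) low4 U4 W4])
     fix ts5 assume 5: "frm {10, 11, 12, 13, 14, 17, 18, 19, 20, 21, 22} {0, 3, 4, 5} {3, 5} ts4 ts5" "lowC (za ts5)"
      "!!i k j. i < p ==> k < q ==> j < r ==> wa ts5 3 (i * q + k) ~= 0 ==> za ts5 3 (i * r + j) <= A i k + B k j"
      "!!j. j < r ==> card {t \<in> Uof (wa ts5). j \<in> St t} * \<rho> < p * q"
      "tm ts5 <= tm ts4 + r * (4 * r + 9) + \<rho> * TP + 12 * (p * PC) + 2"
     have f5: "?F ts5" by (rule frm_trans[OF f4 5(1)]) auto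
     have i5: "stab (wa ts5)" "xtab (wa ts5) (p * q)" using 5(1) 4(2) i4 by (auto simp: xtab_def stab_def frm_def)
     show "L2.run enm ts5 Q"
     proof (rule runs_enm[OF fr[OF f5, THEN conjunct1] i5 5(2)])
      fix ts6 assume 6: "frm {10, 11, 12, 13, 14, 17, 19} {} {3, 5} ts5 ts6" "!!t. za ts6 3 t <= za ts5 3 t" "lowC (za ts6)"
       "!!i k j. i < p ==> k < q ==> wa ts5 3 (i * q + k) = 0 ==> j \<in> S i k ==> za ts6 3 (i * r + j) <= A i k + B k j"
       "tm ts6 <= tm ts5 + 15 * (p * PC) + 6 * (\<Sum>t\<in>{t \<in> {..<p * q}. wa ts5 3 t = 0}. card (St t)) + 3"
      let ?U = "Uof (wa ts5)"
      define u where "u = (\<Sum>t\<in>?U. card (St t))"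
      \<comment> \<open>Counting the remaining triples by columns instead of pairs brings in the
        sparsity of each column.\<close>
      have "u = (\<Sum>j<r. card {t \<in> ?U. j \<in> St t})"
      proof -
       have "card (St t) = (\<Sum>j<r. if j \<in> St t then 1 else 0)" for t
       proof -
        have "St t = {j. j < r & j \<in> St t}" by (auto simp: St_def S_def)
        then show ?thesis by (simp add: sum.If_cases Int_def)
       qed
       then have "u = (\<Sum>t\<in>?U. \<Sum>j<r. if j \<in> St t then 1 else 0)" by (simp add: u_def)
       also have "\<dots> = (\<Sum>j<r. \<Sum>t\<in>?U. if j \<in> St t then 1 else 0)" by (rule sum.swap)
       also have "\<dots> = (\<Sum>j<r. card {t \<in> ?U. j \<in> St t})" by (simp add: sum.If_cases Int_def)
       finally show ?thesis .
      qed
      then have "u * \<rho> = (\<Sum>j<r. card {t \<in> ?U. j \<in> St t} * \<rho>)" by (simp add: sum_distrib_right)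
      also have "\<dots> <= (\<Sum>j<r. p * q)" by (intro sum_mono) (use 5(4) less_imp_le in auto)
      finally have u: "u * \<rho> <= p * q * r" by (simp add: mult.commute)
      show "Q ts6"
      proof (rule Q[OF _ _ u])
       show "?F ts6" by (rule frm_trans[OF f5 6(1)]) auto
       show "za ts6 3 (i * r + j) = cc i j" if ij: "i < p" "j < r" for i j
       proof (rule antisym)
        obtain k where k: "k < q" "cc i j = A i k + B k j" using cc_ex by blast
        show "za ts6 3 (i * r + j) <= cc i j"
        proof (cases "wa ts5 3 (i * q + k) = 0")
         case True
         then show ?thesis using 6(4)[OF ij(1) k(1) True cc_S[OF k(1) ij(2) k(2)]] k by simp
        next
         case False
         then show ?thesis using 5(3)[OF ij(1) k(1) ij(2) False] 6(2)[of "i * r + j"] k by simp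
        qed
        show "cc i j <= za ts6 3 (i * r + j)" using 6(3) ij by (simp add: lowC_def)
       qed
       have e: "p * (11 * r + 14 * PC + 12) = 11 * (p * r) + 14 * (p * PC) + 12 * p"
        "r * (4 * r + 13) = r * (4 * r + 9) + 4 * r"
        "(6 * floorlog 2 r + 61) * (p * PC) = (6 * floorlog 2 r + 20) * (p * PC) + 41 * (p * PC)" by (simp_all add: add_mult_distrib add_mult_distrib2)
       have "{t \<in> {..<p * q}. wa ts5 3 t = 0} = ?U" by (simp add: Uof_def)
       then have "tm ts6 <= tm ts5 + 15 * (p * PC) + 6 * u + 3" using 6(5) by (simp add: u_def)
       then show "tm ts6 <= tm ts + (6 * floorlog 2 r + 61) * (p * PC) + 12 * (q * r) + 14 * (p * r) + 3 * (p * q) + 12 * p +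
        r * (4 * r + 13) + \<rho> * TP + 6 * u + 29"
        using 1(3) 2(3) 3(5) 4(5) 5(5) unfolding e by linarith
      qed
     qed
    qed (use v4 in auto)
   qed
  qed
 qed
qed

end

section \<open>Complete programs\<close>

lemma outcome_WhileFalse: "regs s r = 0 ==> Q 1 s ==> outcome w (WhileNZ r P) s Q"
 unfolding outcome_def using exec.WhileFalse by blast

lemma outcome_WhileTrue:
 assumes "regs s r ~= 0" "outcome w P s (%t s'. outcome w (WhileNZ r P) s' (%u. Q (1 + t + u)))"
 shows "outcome w (WhileNZ r P) s Q"
 using assms unfolding outcome_def by (meson exec.WhileTrue)

lemma binop_word_shift:
 "x < 2 ^ w ==> binop_word w Shr x 1 = x div 2"
 "k < w ==> binop_word w Shl 1 k = 2 ^ k"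
proof -
 have *: "nat (int z mod 2 ^ w) = z" if "z < 2 ^ w" for z :: nat
  using that by (metis nat_int of_nat_numeral of_nat_power zmod_int mod_less)
 show "x < 2 ^ w ==> binop_word w Shr x 1 = x div 2"
  using *[of "x div 2"] by (simp add: binop_word_def drop_bit_eq_div)
 show "k < w ==> binop_word w Shl 1 k = 2 ^ k"
  using *[of "2 ^ k"] by (simp add: binop_word_def push_bit_eq_mult)
qed

lemma floorlog_0 [simp]: "floorlog 2 0 = 0" by (simp add: floorlog_def)

lemma log_loop:
 "regs s 7 = n ==> n < 2 ^ w ==> regs s 13 = 1 ==> regs s 42 = a ==> a + floorlog 2 n < 2 ^ w ==>
  outcome w (WhileNZ 7 (Op Shr 7 7 13 ;; Op Add 42 42 13)) s
   (%t s'. t <= 3 * floorlog 2 n + 1 & mem s' = mem s & regs s' 13 = 1 & regs s' 42 = a + floorlog 2 n)"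
proof (induction n arbitrary: s a rule: less_induct)
 case (less n)
 show ?case
 proof (cases "n = 0")
  case True
  then show ?thesis using less.prems by (intro outcome_WhileFalse) auto
 next
  case False
  then have lg: "floorlog 2 n = Suc (floorlog 2 (n div 2))" by (simp add: floorlog_half)
  define s' where "s' = s(|regs := (regs s)(7 := n div 2, 42 := a + 1)|)"
  have "outcome w (WhileNZ 7 (Op Shr 7 7 13 ;; Op Add 42 42 13)) s'
   (%t s''. t <= 3 * floorlog 2 (n div 2) + 1 & mem s'' = mem s' & regs s'' 13 = 1 & regs s'' 42 = (a + 1) + floorlog 2 (n div 2))"
   using less.prems False lg by (intro less.IH) (auto simp: s'_def)
  then have "outcome w (WhileNZ 7 (Op Shr 7 7 13 ;; Op Add 42 42 13)) s'
   (%u s''. 3 + u <= 3 * floorlog 2 n + 1 & mem s'' = mem s & regs s'' 13 = 1 & regs s'' 42 = a + floorlog 2 n)"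
   by (rule outcome_mono) (auto simp: lg s'_def)
  moreover have "binop_word w Shr n (Suc 0) = n div 2" "binop_word w Add a (Suc 0) = a + 1"
   using less.prems binop_word_shift(1)[of n w] binop_word_simps(1)[of a 1 w] lg by auto
  ultimately show ?thesis using less.prems False
   by (intro outcome_WhileTrue) (auto simp: outcome_Seq s'_def numeral_eq_Suc)
 qed
qed

text \<open>Runs on raw registers, before \<open>N\<close> exists. Repeated halving of
  \<open>n\<close> leaves the bit length \<open>b\<close> in register 42, which is word variable 14;
  register 0 is word variable 0 and receives the base \<open>2 ^ b\<close>, register 1 receives
  \<open>N = 2 ^ (m * b)\<close>.\<close>

definition pre :: "nat => prog" where
 "pre m = Const 4 0 ;; Load 7 4 ;; Const 42 0 ;; Const 13 1 ;; WhileNZ 7 (Op Shr 7 7 13 ;; Op Add 42 42 13) ;;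
   Const 4 m ;; Op Mul 4 4 42 ;; Op Shl 1 13 4 ;; Op Shl 0 13 42"

lemma pre_outcome:
 assumes "mem s 0 = n" "n < 2 ^ w" "b = floorlog 2 n" "m * b < w" "b < w" "m < 2 ^ w" "1 < w"
 shows "outcome w (pre m) s (%t s'. t <= 3 * b + 9 & mem s' = mem s & regs s' 1 = 2 ^ (m * b) & regs s' 0 = 2 ^ b & regs s' 42 = b)"
proof -
 have lt: "x < 2 ^ w" if "x < w" for x :: nat using that less_exp[of w] by (rule less_trans)
 have w0: "0 < w" using assms(7) by simp
 have mb: "binop_word w Mul m b = m * b" using lt[OF assms(4)] by (simp add: binop_word_simps)
 have one: "(Suc 0) mod 2 ^ w = Suc 0" using assms(7) by simp
 have sh: "binop_word w Shl (Suc 0) (m * b) = 2 ^ (m * b)" "binop_word w Shl (Suc 0) b = 2 ^ b" using binop_word_shift(2) assms by auto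
 let ?s = "s(|regs := (regs s)(4 := 0, 7 := n, 42 := 0, 13 := Suc 0)|)"
 have "outcome w (WhileNZ 7 (Op Shr 7 7 13 ;; Op Add 42 42 13)) ?s
   (%t s'. t <= 3 * floorlog 2 n + 1 & mem s' = mem ?s & regs s' 13 = 1 & regs s' 42 = 0 + floorlog 2 n)"
  by (rule log_loop) (use assms lt in auto)
 then show ?thesis
  unfolding pre_def by (auto simp: outcome_Seq one assms(1) w0 elim!: outcome_mono) (auto simp: assms(3)[symmetric] assms(6) mb sh)
qed

text \<open>Moves input word \<open>i\<close> to cell \<open>24 * i\<close>, starting with the last
  word: targets are never below their sources, so no unread word is lost. Register 57 is word
  variable 19, the input length.\<close>

definition itl :: prog where
 "itl = Op Mod 4 57 1 ;; Const 7 24 ;; Const 10 1 ;;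
   WhileNZ 4 (Op Sub 4 4 10 ;; Load 13 4 ;; Op Mul 16 4 7 ;; Store 16 13)"

lemma itl_loop:
 "regs s 4 = k ==> regs s 7 = 24 ==> regs s 10 = 1 ==> 24 * k < 2 ^ w ==>
  outcome w (WhileNZ 4 (Op Sub 4 4 10 ;; Load 13 4 ;; Op Mul 16 4 7 ;; Store 16 13)) s
   (%t s'. t <= 5 * k + 1 & (ALL i<k. mem s' (24 * i) = mem s i) & (\<forall>a\<ge>24 * k. mem s' a = mem s a) &
    (ALL r. r \<notin> {4, 13, 16} --> regs s' r = regs s r))"
proof (induction k arbitrary: s)
 case 0
 then show ?case by (intro outcome_WhileFalse) auto
next
 case (Suc k)
 define s' where "s' = s(|regs := (regs s)(4 := k, 13 := mem s k, 16 := k * 24), mem := (mem s)(k * 24 := mem s k)|)"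
 have "outcome w (WhileNZ 4 (Op Sub 4 4 10 ;; Load 13 4 ;; Op Mul 16 4 7 ;; Store 16 13)) s'
   (%t s''. t <= 5 * k + 1 & (ALL i<k. mem s'' (24 * i) = mem s' i) & (\<forall>a\<ge>24 * k. mem s'' a = mem s' a) &
    (ALL r. r \<notin> {4, 13, 16} --> regs s'' r = regs s' r))"
  using Suc.prems by (intro Suc.IH) (auto simp: s'_def)
 then have "outcome w (WhileNZ 4 (Op Sub 4 4 10 ;; Load 13 4 ;; Op Mul 16 4 7 ;; Store 16 13)) s'
   (%u s''. 5 + u <= 5 * Suc k + 1 & (ALL i<Suc k. mem s'' (24 * i) = mem s i) & (\<forall>a\<ge>24 * Suc k. mem s'' a = mem s a) &
    (ALL r. r \<notin> {4, 13, 16} --> regs s'' r = regs s r))"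
  by (rule outcome_mono) (auto simp: s'_def less_Suc_eq)
 moreover have "binop_word w Sub (Suc k) (Suc 0) = k" "binop_word w Mul k 24 = k * 24"
  using Suc.prems binop_word_simps(2)[of 1 "Suc k" w] binop_word_simps(3)[of k 24 w] by auto
 moreover have "s(|regs := (regs s)(4 := k, 13 := mem s k, 16 := k * 24), mem := (mem s)(k * 24 := mem s k)|) = s'" by (simp add: s'_def)
 ultimately show ?case using Suc.prems by (intro outcome_WhileTrue) (auto simp: outcome_Seq numeral_eq_Suc)
qed

lemma itl_outcome:
 assumes "regs s 57 mod regs s 1 = k" "regs s 57 < 2 ^ w" "24 * k < 2 ^ w" "24 < (2::nat) ^ w" "0 < w"
 shows "outcome w itl s (%t s'. t <= 5 * k + 4 & (ALL i<k. mem s' (24 * i) = mem s i) & (ALL r. r \<notin> {4, 7, 10, 13, 16} --> regs s' r = regs s r))"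
proof -
 have c: "binop_word w Mod (regs s 57) (regs s (Suc 0)) = k" using assms by (simp add: binop_word_simps)
 let ?s = "s(|regs := (regs s)(4 := k, 7 := 24, 10 := Suc 0)|)"
 have "outcome w (WhileNZ 4 (Op Sub 4 4 10 ;; Load 13 4 ;; Op Mul 16 4 7 ;; Store 16 13)) ?s
   (%t s'. t <= 5 * k + 1 & (ALL i<k. mem s' (24 * i) = mem ?s i) & (\<forall>a\<ge>24 * k. mem s' a = mem ?s a) &
    (ALL r. r \<notin> {4, 13, 16} --> regs s' r = regs ?s r))"
  by (rule itl_loop) (use assms in auto)
 moreover have "(Suc 0) mod 2 ^ w = Suc 0" using assms(5) by simp
 ultimately show ?thesis unfolding itl_def
  by (auto simp: outcome_Seq c assms(4,5) elim!: outcome_mono)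
qed

text \<open>The opposite move, upwards for the same reason. Register 87 is word variable 29, which
  is variable 19 of the upper level. Words are reduced modulo \<open>N\<close> because that is how
  the abstract store reads them.\<close>

definition epi :: prog where
 "epi = Op Mod 19 87 1 ;; Const 4 0 ;; Const 7 24 ;; Const 10 1 ;; Op Less 13 4 19 ;;
   WhileNZ 13 (Op Mul 16 4 7 ;; Load 16 16 ;; Op Mod 16 16 1 ;; Store 4 16 ;; Op Add 4 4 10 ;; Op Less 13 4 19)"

lemma epi_loop:
 "c = k - i ==> regs s 4 = i ==> regs s 7 = 24 ==> regs s 10 = 1 ==> regs s 19 = k ==> regs s 13 = (if i < k then 1 else 0) ==>
  24 * k < 2 ^ w ==> bounded_ram w s ==> 0 < w ==>
  outcome w (WhileNZ 13 (Op Mul 16 4 7 ;; Load 16 16 ;; Op Mod 16 16 1 ;; Store 4 16 ;; Op Add 4 4 10 ;; Op Less 13 4 19)) s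
   (%t s'. t <= 7 * c + 1 & (ALL j<i. mem s' j = mem s j) & (ALL j. i <= j --> j < k --> mem s' j = mem s (24 * j) mod regs s 1))"
proof (induction c arbitrary: s i)
 case 0
 then show ?case by (intro outcome_WhileFalse) auto
next
 case (Suc c)
 let ?W = "WhileNZ 13 (Op Mul 16 4 7 ;; Load 16 16 ;; Op Mod 16 16 1 ;; Store 4 16 ;; Op Add 4 4 10 ;; Op Less 13 4 19)"
 have ik: "i < k" using Suc.prems(1) by simp
 define v where "v = mem s (i * 24) mod regs s 1"
 define s' where "s' = s(|regs := (regs s)(16 := v, 4 := Suc i, 13 := if Suc i < k then Suc 0 else 0), mem := (mem s)(i := v)|)"
 have bd: "mem s a < 2 ^ w" "regs s a < 2 ^ w" for a using Suc.prems(8) by (auto simp: bounded_ram_def)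
 have iw: "i * 24 < 2 ^ w" "Suc i < 2 ^ w" "(1::nat) < 2 ^ w" using ik Suc.prems(7) by auto
 have vb: "v < 2 ^ w" using bd(1)[of "i * 24"] mod_less_eq_dividend[of "mem s (i * 24)" "regs s 1"] le_less_trans unfolding v_def by blast
 have bs': "bounded_ram w s'" using bd vb iw by (auto simp: s'_def bounded_ram_def)
 have "outcome w ?W s' (%t s''. t <= 7 * c + 1 & (ALL j<Suc i. mem s'' j = mem s' j) & (ALL j. Suc i <= j --> j < k --> mem s'' j = mem s' (24 * j) mod regs s' 1))"
  using Suc.prems bs' by (intro Suc.IH) (auto simp: s'_def)
 then have "outcome w ?W s' (%t s''. 7 + t <= 7 * Suc c + 1 & (ALL j<i. mem s'' j = mem s j) & (ALL j. i <= j --> j < k --> mem s'' j = mem s (24 * j) mod regs s 1))"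
 proof (rule outcome_mono)
  fix t s'' assume a: "t <= 7 * c + 1 & (ALL j<Suc i. mem s'' j = mem s' j) & (ALL j. Suc i <= j --> j < k --> mem s'' j = mem s' (24 * j) mod regs s' 1)"
  have "mem s'' j = mem s (24 * j) mod regs s 1" if "i <= j" "j < k" for j
  proof (cases "j = i")
   case True
   then show ?thesis using a by (simp add: s'_def v_def mult.commute)
  next
   case False
   then have "mem s'' j = mem s' (24 * j) mod regs s' 1" using a that by simp
   then show ?thesis using False that by (simp add: s'_def)
  qed
  then show "7 + t <= 7 * Suc c + 1 & (ALL j<i. mem s'' j = mem s j) & (ALL j. i <= j --> j < k --> mem s'' j = mem s (24 * j) mod regs s 1)"
   using a by (auto simp: s'_def)
 qed
 moreover have "binop_word w Mul i 24 = i * 24" "binop_word w Mod (mem s (i * 24)) (regs s (Suc 0)) = v" "binop_word w Add i (Suc 0) = Suc i"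
  "binop_word w Less (Suc i) k = (if Suc i < k then Suc 0 else 0)"
  using iw bd Suc.prems(9) binop_word_simps(1)[of i 1 w] by (auto simp: binop_word_simps v_def)
 moreover have "s(|regs := (regs s)(16 := v, 4 := Suc i, 13 := if Suc i < k then Suc 0 else 0), mem := (mem s)(i := v)|) = s'" by (simp add: s'_def)
 ultimately show ?case using Suc.prems ik
  by (intro outcome_WhileTrue) (auto simp: outcome_Seq numeral_eq_Suc ram_upd_swap)
qed

lemma epi_outcome:
 assumes "regs s 87 mod regs s 1 = k" "24 * k < 2 ^ w" "24 < (2::nat) ^ w" "bounded_ram w s" "0 < w"
 shows "outcome w epi s (%t s'. t <= 7 * k + 6 & (ALL i<k. mem s' i = mem s (24 * i) mod regs s 1))"
proof -
 have bd: "mem s a < 2 ^ w" "regs s a < 2 ^ w" for a using assms(4) by (auto simp: bounded_ram_def)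
 have c: "binop_word w Mod (regs s 87) (regs s (Suc 0)) = k" "binop_word w Less 0 k = (if 0 < k then Suc 0 else 0)"
  using assms bd by (simp_all add: binop_word_simps)
 let ?s = "s(|regs := (regs s)(19 := k, 4 := 0, 7 := 24, 10 := Suc 0, 13 := if 0 < k then Suc 0 else 0)|)"
 have one: "(Suc 0) mod 2 ^ w = Suc 0" using assms(5) by simp
 have one': "Suc 0 < 2 ^ w" using assms(3) by linarith
 have "outcome w (WhileNZ 13 (Op Mul 16 4 7 ;; Load 16 16 ;; Op Mod 16 16 1 ;; Store 4 16 ;; Op Add 4 4 10 ;; Op Less 13 4 19)) ?s
   (%t s'. t <= 7 * (k - 0) + 1 & (ALL j<0. mem s' j = mem ?s j) & (ALL j. 0 <= j --> j < k --> mem s' j = mem ?s (24 * j) mod regs ?s 1))"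
  by (rule epi_loop[OF refl]) (use assms bd one' in \<open>auto simp: bounded_ram_def\<close>)
 then show ?thesis unfolding epi_def
  by (auto simp: outcome_Seq c one assms(3,5) elim!: outcome_mono)
qed

context bigm
begin

text \<open>Unrolled, since the exponent is a fixed parameter of the program and only the base
  depends on the instance.\<close>

primrec powp :: "nat => nat => nat => prog" where
 "powp x d 0 = Const (3 * x) d"
| "powp x d (Suc k) = powp x d k ;; asg1 x (Var x *! Var 14)"

lemma runs_powp:
 assumes "x ~= 14" "vr sg 14 = b'" "!!j. j <= k ==> d * b' ^ j < N"
  "Q (sg(|vr := (vr sg)(x := d * b' ^ k), tm := tm sg + Suc k|))"
 shows "L1.run (powp x d k) sg Q"
 using assms(3,4)
proof (induction k arbitrary: Q)
 case 0
 show ?case unfolding powp.simps by (rule runs_setc) (use 0(1)[of 0] 0(2) in \<open>simp_all only: power_0 mult_1_right le_refl add_Suc_right add_0_right\<close>)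
next
 case (Suc k)
 show ?case unfolding powp.simps
 proof (rule runs_seq, rule Suc.IH)
  show "L1.run (asg1 x (Var x *! Var 14)) (sg(|vr := (vr sg)(x := d * b' ^ k), tm := tm sg + Suc k|)) Q"
   by (rule L1.runs_asg) (use assms(1,2) Suc.prems(1)[of "Suc k"] Suc.prems(2) in \<open>simp_all add: ok1_def sz1_def ac_simps fun_upd_def cong: if_cong\<close>)
 qed (use Suc.prems in auto)
qed

lemma runs_asg1':
 assumes "ok1 e" "eval sg e = v" "v < N" "Q (sg(|vr := (vr sg)(x := v), tm := Suc (tm sg)|))"
 shows "L1.run (asg1 x e) sg Q"
 by (rule L1.runs_asg) (use assms in auto)

lemma ok1_iff: "ok1 e \<longleftrightarrow> okx 24 e & deg e <= 8 & esz e < 190"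
 by (simp add: ok1_def sz1_def)

text \<open>Runs before the input is spread out, when the header cells 0 to 3 are the first elements
  of arrays 0 to 3. Word variables 10 to 19 turn into variables 0 to 9 of the upper level. Word
  variable 1 receives the number of digits that the long integers use.\<close>

definition rd :: "nat => nat => prog" where
 "rd d d' = asg1 10 (Arr 0 (Num 0)) ;; asg1 11 (Arr 1 (Num 0)) ;; asg1 12 (Arr 2 (Num 0)) ;; asg1 13 (Arr 3 (Num 0)) ;;
   powp 15 d d ;; asg1 15 (Var 15 +! Num 1) ;; powp 18 d' d' ;; asg1 18 (Var 18 +! Num 1) ;; asg1 1 (Var 18) ;;
   asg1 19 (Num 4 +! (Var 11 *! Var 12 +! Var 12 *! Var 13) *! (Var 15 +! Num 1))"

lemma runs_rd:
 assumes "wa sg 0 0 = n" "wa sg 1 0 = p" "wa sg 2 0 = q" "wa sg 3 0 = r" "vr sg 14 = b'" "0 < b'"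
  and lt: "n < N" "p < N" "q < N" "r < N" "d * b' ^ d + 1 < N" "d' * b' ^ d' + 1 < N" "4 + (p * q + q * r) * (d * b' ^ d + 2) < N"
  and Q: "!!sg'. vr sg' 10 = n ==> vr sg' 11 = p ==> vr sg' 12 = q ==> vr sg' 13 = r ==> vr sg' 14 = b' ==> vr sg' 15 = d * b' ^ d + 1 ==>
   vr sg' 18 = d' * b' ^ d' + 1 ==> vr sg' 1 = d' * b' ^ d' + 1 ==> vr sg' 19 = 4 + (p * q + q * r) * (d * b' ^ d + 2) ==>
   vr sg' 0 = vr sg 0 ==> wa sg' = wa sg ==> tm sg' = tm sg + d + d' + 10 ==> Q sg'"
 shows "L1.run (rd d d') sg Q"
proof -
 have pw: "e * b' ^ j < N" if "e * b' ^ e + 1 < N" "j <= e" for e j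
 proof -
  have "e * b' ^ j <= e * b' ^ e" using that assms(6) by (intro mult_le_mono2 power_increasing) auto
  also have "\<dots> < N" using that by simp
  finally show ?thesis .
 qed
 have s: "wa sg (Suc 0) 0 = p" using assms by simp
 show ?thesis unfolding rd_def
  supply [simp] = ok1_iff assms(1-5) s lt(1-4) lt(5,6)[simplified]
  apply (rule runs_seq, rule runs_asg1', (simp; fail)+)
  apply simp
  apply (rule runs_seq, rule runs_asg1', (simp; fail)+)
  apply simp
  apply (rule runs_seq, rule runs_asg1', (simp; fail)+)
  apply simp
  apply (rule runs_seq, rule runs_asg1', (simp; fail)+)
  apply simp
  apply (rule runs_seq, rule runs_powp, (simp; fail), (simp; fail), erule pw[OF lt(5)])
  apply simp
  apply (rule runs_seq, rule runs_asg1', (simp; fail)+)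
  apply simp
  apply (rule runs_seq, rule runs_powp, (simp; fail), (simp; fail), erule pw[OF lt(6)])
  apply simp
  apply (rule runs_seq, rule runs_asg1', (simp; fail)+)
  apply simp
  apply (rule runs_seq, rule runs_asg1', (simp; fail)+)
  apply simp
  apply (rule runs_asg1'[where v = "4 + (p * q + q * r) * (d * b' ^ d + 2)"])
    apply simp
   apply simp
   apply (rule lt(7))
  by (rule Q) simp_all
qed

end

lemma tag_less: "tag x < 3" by (simp add: tag_def split: extended.splits)

lemma encode_mat_less: "x \<in> set (encode_mat d n A) ==> x < 2 ^ floorlog 2 n \<or> x < 3"
 unfolding encode_mat_eq encode_entry_eq by (auto simp: tag_less simp del: upt_Suc)

lemma dec_mono: "u <= v ==> dec h u <= dec h v"
 by (auto simp: dec_def)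

lemma dec_enc_add:
 assumes "x = Pinf \<or> (EX z. x = Fin z & \<bar>z\<bar> < 2 ^ h)" "y = Pinf \<or> (EX z. y = Fin z & \<bar>z\<bar> < 2 ^ h)"
 shows "dec h (enc h x + enc h y) = x + y"
 using assms
proof (elim disjE exE conjE)
 fix z1 z2 assume z: "x = Fin z1" "\<bar>z1\<bar> < 2 ^ h" "y = Fin z2" "\<bar>z2\<bar> < 2 ^ h"
 have "0 <= 2 ^ h + z1" "0 <= 2 ^ h + z2" using z by linarith+
 then have e: "int (enc h x + enc h y) = 2 ^ (h + 1) + z1 + z2" using z by (simp add: enc_def)
 then have "int (enc h x + enc h y) < int (2 ^ (h + 2))" using z by simp
 then have "enc h x + enc h y < 2 ^ (h + 2)" using of_nat_less_iff by blast
 then show ?thesis using e z by (simp add: dec_def)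
qed (auto simp: dec_def enc_def)

text \<open>\<open>dec h\<close> is monotone and inverts sums of codes, so it maps a minimum of
  coded sums to the minimum of the sums.\<close>

lemma dec_Min:
 fixes q :: nat
 assumes "0 < q" "!!k. k < q ==> f k = Pinf \<or> (EX z. f k = Fin z & \<bar>z\<bar> < 2 ^ h)" "!!k. k < q ==> g k = Pinf \<or> (EX z. g k = Fin z & \<bar>z\<bar> < 2 ^ h)"
 shows "dec h (Min ((%k. enc h (f k) + enc h (g k)) ` {..<q})) = Min ((%k. f k + g k) ` {..<q})"
proof -
 let ?F = "%k. enc h (f k) + enc h (g k)"
 have "Min (?F ` {..<q}) \<in> ?F ` {..<q}" using assms(1) by (intro Min_in) auto
 then obtain k0 where k0: "k0 < q" "Min (?F ` {..<q}) = ?F k0" by auto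
 have d: "dec h (?F k) = f k + g k" if "k < q" for k using assms(2,3)[OF that] by (rule dec_enc_add)
 have "f k0 + g k0 <= f k + g k" if "k < q" for k
 proof -
  have "?F k0 <= ?F k" unfolding k0(2)[symmetric] using that by (intro Min_le) auto
  then show ?thesis using dec_mono d[OF that] d[OF k0(1)] by metis
 qed
 then have "Min ((%k. f k + g k) ` {..<q}) = f k0 + g k0" using k0(1) by (intro Min_eqI) auto
 then show ?thesis using k0 d by simp
qed

section \<open>Running a core program on an encoded instance\<close>

locale inst = bigm +
 fixes n d d' m p q r L1 h :: nat and A B :: matrix
 assumes n1: "1 <= n" and b_eq: "b = floorlog 2 n" and L_eq: "L = entry_bits d' n + 1" and N_eq: "N = 2 ^ (m * b)" and mw: "m * b < w" "m < 2 ^ w"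
  and A: "A \<in> carrier_mat p q" and B: "B \<in> carrier_mat q r" and pqr: "0 < p" "0 < q" "0 < r"
  and vA: "valid_entries d n A" and vB: "valid_entries d n B" and L1_eq: "L1 = entry_bits d n + 1" and h_eq: "h = b * L1"
  and L1L: "L1 <= L" and hB: "2 ^ (h + 4) < BL" and nN: "n < N" and hN: "h + 4 < N"
  and sz: "5 + (p * q + q * r) * (L1 + 1) < N" "5 + p * r * (L1 + 1) < N"
begin

text \<open>\<open>2 ^ b < 2 ^ (m * b)\<close> forces \<open>m * b > b\<close>, from which the
  bounds on the word length follow.\<close>

lemma b0: "0 < b" "b < 2 ^ b" "2 ^ b < N" "b < w" "1 < w"
proof -
 show b: "0 < b" using n1 by (simp add: b_eq floorlog_def)
 show "b < 2 ^ b" by (rule less_exp)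
 show b1: "2 ^ b < N" using bN by simp
 have "(2::nat) ^ b < 2 ^ (m * b)" using b1 N_eq by simp
 then have "b < m * b" using power_less_imp_less_exp[of "2::nat" b "m * b"] by simp
 then show "b < w" "1 < w" using mw(1) b by linarith+
qed

lemma sizes: "p < N" "q < N" "r < N" "p * q < N" "q * r < N" "p * r < N" "L1 < N"
proof -
 have a: "p * q + q * r < N" "p * r < N"
 proof -
  have le: "p * q + q * r <= (p * q + q * r) * (L1 + 1)" "p * r <= p * r * (L1 + 1)" by simp_all
  show "p * q + q * r < N" "p * r < N"
   by (rule le_less_trans[OF le(1) le_less_trans[OF le_add2 sz(1)]], rule le_less_trans[OF le(2) le_less_trans[OF le_add2 sz(2)]])
 qed
 then show "p * q < N" "q * r < N" "p * r < N" by simp_all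
 have "p * 1 <= p * q" "1 * q <= p * q" "1 * r <= q * r" using pqr by (intro mult_le_mono; simp)+
 then show "p < N" "q < N" "r < N" using a(1) by linarith+
 show "L1 < N" using L1L LN by simp
qed

lemma entries:
 "i < p ==> k < q ==> A $$ (i, k) = Pinf \<or> (EX z. A $$ (i, k) = Fin z & \<bar>z\<bar> < 2 ^ h)"
 "k < q ==> j < r ==> B $$ (k, j) = Pinf \<or> (EX z. B $$ (k, j) = Fin z & \<bar>z\<bar> < 2 ^ h)"
proof -
 have "entry_bits d n <= h" using b0(1) by (cases b) (simp_all add: h_eq L1_eq)
 then have le: "(2::int) ^ entry_bits d n <= 2 ^ h" by (intro power_increasing) auto
 have *: "x = Pinf \<or> (EX z. x = Fin z & \<bar>z\<bar> < 2 ^ h)" if "valid_entries d n Y" "x \<in> elements_mat Y" for x Y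
  using that le unfolding valid_entries_def by (meson order_less_le_trans)
 show "i < p ==> k < q ==> A $$ (i, k) = Pinf \<or> (EX z. A $$ (i, k) = Fin z & \<bar>z\<bar> < 2 ^ h)"
  using *[OF vA] elements_matI[OF A] by blast
 show "k < q ==> j < r ==> B $$ (k, j) = Pinf \<or> (EX z. B $$ (k, j) = Fin z & \<bar>z\<bar> < 2 ^ h)"
  using *[OF vB] elements_matI[OF B] by blast
qed

definition ready :: "store => bool" where
 "ready ts \<longleftrightarrow> vr ts 0 = n & vr ts 1 = p & vr ts 2 = q & vr ts 3 = r & vr ts 4 = b & vr ts 5 = L1 & vr ts 8 = L &
   za ts 4 0 = 0 & za ts 4 3 = 2 ^ (h + 2) & za ts 4 4 = 2 ^ (h + 4) & za ts 4 5 = 2 ^ (h + 1) &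
   (ALL t<p * q. za ts 0 t = enc h (A $$ (t div q, t mod q))) & (ALL t<q * r. za ts 1 t = enc h (B $$ (t div r, t mod r)))"

definition ended :: "store => bool" where
 "ended ts \<longleftrightarrow> vr ts 1 = p & vr ts 3 = r & vr ts 5 = L1 & za ts 4 0 = 0 & za ts 4 3 = 2 ^ (h + 2) & za ts 4 5 = 2 ^ (h + 1) &
   (ALL t<p * r. za ts 3 t = Min ((%k. enc h (A $$ (t div r, k)) + enc h (B $$ (k, t mod r))) ` {..<q}))"

definition body :: "prog => prog" where
 "body C = cst ;; rdm 0 (Num 0) (Var 1 *! Var 2) ;; rdm 1 (Var 1 *! Var 2) (Var 2 *! Var 3) ;; C ;;
   wrm (Var 1 *! Var 3) ;; asg2 19 (Var 1 *! Var 3 *! (Var 5 +! Num 1))"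

lemma runs_output:
 assumes 4: "ended ts4" and Q: "!!ts'. vr ts' 19 = p * r * (L1 + 1) ==>
   (!!t. t < p * r ==> entry_at b L1 (wa ts' 0) (t * (L1 + 1)) (min_plus A B $$ (t div r, t mod r))) ==>
   tm ts' <= tm ts4 + 11 * (p * r) + 4 ==> Q ts'"
 shows "L2.run (wrm (Var 1 *! Var 3) ;; asg2 19 (Var 1 *! Var 3 *! (Var 5 +! Num 1))) ts4 Q"
proof (rule runs_seq, rule runs_wrm[where ?L1.0 = L1 and n = "p * r" and h = h], goal_cases)
 case (10 ts5)
 have v5: "vr ts5 (Suc 0) = p" "vr ts5 3 = r" "vr ts5 5 = L1" using 10(1) 4 by (auto simp: frm_def ended_def)
 have lt: "p * r * (L1 + 1) < N" using sz(2) by simp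
 have out: "entry_at b L1 (wa ts5 0) (t * (L1 + 1)) (min_plus A B $$ (t div r, t mod r))" if t: "t < p * r" for t
 proof -
  have ij: "t div r < p" "t mod r < r" using t pqr by (auto simp: less_mult_imp_div_less)
  have "dec h (za ts4 3 t) = min_plus A B $$ (t div r, t mod r)"
   using 4 t ij A B dec_Min[OF pqr(2), of "%k. A $$ (t div r, k)" h "%k. B $$ (k, t mod r)"] entries
   by (auto simp: ended_def min_plus_def)
  then show ?thesis using 10(2)[OF t] by simp
 qed
 show ?case
  by (rule runs_asg'[where v = "p * r * (L1 + 1)"]) (use v5 lt out 10(3) in \<open>auto simp: ok2_def intro!: Q\<close>)
qed (use 4 L1L sizes sz in \<open>auto simp: ok2_def ended_def frm_def\<close>)

lemma runs_body:
 assumes core: "!!ts. ready ts ==> L2.run C ts (%ts'. ended ts' & tm ts' <= tm ts + Tc)"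
  and v: "vr ts 0 = n" "vr ts 1 = p" "vr ts 2 = q" "vr ts 3 = r" "vr ts 4 = b" "vr ts 5 = L1" "vr ts 8 = L"
  and aA: "!!t. t < p * q ==> entry_at b L1 (wa ts 0) (4 + t * (L1 + 1)) (A $$ (t div q, t mod q))"
  and aB: "!!t. t < q * r ==> entry_at b L1 (wa ts 0) (4 + (p * q + t) * (L1 + 1)) (B $$ (t div r, t mod r))"
 shows "L2.run (body C) ts (%ts'. vr ts' 19 = p * r * (L1 + 1) &
   (ALL t<p * r. entry_at b L1 (wa ts' 0) (t * (L1 + 1)) (min_plus A B $$ (t div r, t mod r))) &
   tm ts' <= tm ts + (9 * h + 8 * (p * q) + 8 * (q * r) + 11 * (p * r) + Tc + 70))" (is "L2.run _ _ ?post")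
 unfolding body_def
proof (rule runs_seq, rule runs_cst[where h = h, OF b0(1)])
 show "vr ts 4 * vr ts 5 = h" using v by (simp add: h_eq)
 fix ts1 assume 1: "frm {20} {7} {4} ts ts1" "za ts1 4 0 = 0" "za ts1 4 2 = 2 ^ h" "za ts1 4 3 = 2 ^ (h + 2)" "za ts1 4 4 = 2 ^ (h + 4)"
   "za ts1 4 5 = 2 ^ (h + 1)" "tm ts1 <= tm ts + 9 * h + 60"
 have v1: "vr ts1 0 = n" "vr ts1 1 = p" "vr ts1 2 = q" "vr ts1 3 = r" "vr ts1 4 = b" "vr ts1 5 = L1" "vr ts1 8 = L" "wa ts1 0 = wa ts 0"
  using 1(1) v by (auto simp: frm_def)
 show "L2.run (rdm 0 (Num 0) (Var 1 *! Var 2) ;; rdm 1 (Var 1 *! Var 2) (Var 2 *! Var 3) ;; C ;;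
   wrm (Var 1 *! Var 3) ;; asg2 19 (Var 1 *! Var 3 *! (Var 5 +! Num 1))) ts1 ?post"
 proof (rule runs_seq, rule runs_rdm[where ?L1.0 = L1 and n = "p * q" and m = 0 and h = h and x = "%t. A $$ (t div q, t mod q)"], goal_cases)
  case (19 ts2)
  have v2: "vr ts2 0 = n" "vr ts2 1 = p" "vr ts2 2 = q" "vr ts2 3 = r" "vr ts2 4 = b" "vr ts2 5 = L1" "vr ts2 8 = L" "wa ts2 0 = wa ts 0" "za ts2 4 = za ts1 4"
   using 19(1) v1 by (auto simp: frm_def)
  have t2: "tm ts2 <= tm ts1 + 8 * (p * q) + 3" and z2: "!!t. t < p * q ==> za ts2 0 t = enc h (A $$ (t div q, t mod q))" using 19(2,3) by auto
  show ?case
  proof (rule runs_seq, rule runs_rdm[where ?L1.0 = L1 and n = "q * r" and m = "p * q" and h = h and x = "%t. B $$ (t div r, t mod r)"], goal_cases)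
   case (19 ts3)
   have v3: "vr ts3 0 = n" "vr ts3 1 = p" "vr ts3 2 = q" "vr ts3 3 = r" "vr ts3 4 = b" "vr ts3 5 = L1" "vr ts3 8 = L" "za ts3 4 = za ts1 4" "za ts3 0 = za ts2 0"
    using 19(1) v2 by (auto simp: frm_def)
   have rdy: "ready ts3" unfolding ready_def using v3 1 19(2) z2 by simp
   have t3: "tm ts3 <= tm ts + 9 * h + 8 * (p * q) + 8 * (q * r) + 66"
    using 1(7) 19(3) t2 by linarith
   show ?case
    by (rule runs_seq, rule runs_conseq[OF core[OF rdy]], rule runs_output) (use t3 in auto)
  qed (use v2 1 L1L sizes sz aB entries hB pqr in \<open>auto simp: ok2_def frm_def h_eq less_mult_imp_div_less\<close>)
 qed (use v1 1 L1L sizes sz aA entries hB pqr in \<open>auto simp: ok2_def frm_def h_eq less_mult_imp_div_less add_mult_distrib\<close>)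
qed (use hN hB in auto)

text \<open>None of these programs mentions \<open>w\<close>, \<open>N\<close>, \<open>b\<close> or
  \<open>L\<close>, so outside their locales they are constants without instance parameters: one
  program serves all \<open>n\<close>.\<close>

definition wrp :: "nat => nat => nat => prog => prog" where
 "wrp m1 e e' C = pre m1 ;; rd e e' ;; itl ;; body C ;; epi"

lemma wrp_computes:
 assumes core: "!!ts. ready ts ==> L2.run C ts (%ts'. ended ts' & tm ts' <= tm ts + Tc)"
 shows "computes_within w (wrp m d d' C) (encode_instance d n A B) (encode_mat d n (min_plus A B))
  (real (3 * b + 200 * (d + d' + 10) + 12 * ((p * q + q * r + p * r) * (L1 + 1)) +
    U2 * (9 * h + 8 * (p * q) + 8 * (q * r) + 11 * (p * r) + Tc + 70) + 39))"
 unfolding computes_within_def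
proof (intro conjI allI impI)
 let ?xs = "encode_instance d n A B" and ?ys = "encode_mat d n (min_plus A B)"
 let ?len = "4 + (p * q + q * r) * (L1 + 1)"
 have dims: "dim_row A = p" "dim_col A = q" "dim_row B = q" "dim_col B = r" "dim_row (min_plus A B) = p" "dim_col (min_plus A B) = r"
  using A B by (auto simp: min_plus_def)
 have len: "length ?xs = ?len" by (simp add: length_encode_instance dims L1_eq)
 have Nw: "x < 2 ^ w" if "x < N" for x using small_less[OF that] .
 have lt: "x < N" if "x \<in> set ?xs" for x
  using that sizes nN encode_mat_less[of x d n A] encode_mat_less[of x d n B] b0 N unfolding encode_instance_def b_eq dims by auto
 show "\<forall>x\<in>set ?xs. x < 2 ^ w" using lt Nw by blast
 have lenN: "?len < N" using sz(1) by simp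
 show "length ?xs <= 2 ^ w" unfolding len using Nw[OF lenN] by simp
 fix s :: ram assume s: "(ALL r. regs s r < 2 ^ w) & (ALL a. mem s a < 2 ^ w) & (ALL i<length ?xs. mem s i = ?xs ! i)"
 then have bs: "bounded_ram w s" by (simp add: bounded_ram_def)
 have at: "ALL i<length ?xs. mem s i = ?xs ! i" using s by simp
 have mN: "mem s i < N" if "i < ?len" for i
 proof -
  have i: "i < length ?xs" using that len by simp
  then show ?thesis using at lt[OF nth_mem[OF i]] by simp
 qed
 note hd = at[unfolded encode_instance_at dims L1_eq[symmetric] b_eq[symmetric]]
 have e2: "entry_bits d n + 2 = L1 + 1" "entry_bits d n + 1 = L1" by (simp_all add: L1_eq)
 have h0: "mem s 0 = n" "mem s 1 = p" "mem s 2 = q" "mem s 3 = r" using hd by auto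
 have hA: "!!t. t < p * q ==> entry_at b L1 (mem s) (4 + t * (L1 + 1)) (A $$ (t div q, t mod q))"
  and hB': "!!t. t < q * r ==> entry_at b L1 (mem s) (4 + (p * q + t) * (L1 + 1)) (B $$ (t div r, t mod r))" using hd unfolding e2 by auto
 obtain t1 s1 where 1: "exec w (pre m) s t1 s1" "t1 <= 3 * b + 9" "mem s1 = mem s" "regs s1 1 = N" "regs s1 0 = 2 ^ b" "regs s1 42 = b"
  using pre_outcome[OF h0(1) Nw[OF nN] b_eq mw(1) b0(4) mw(2) b0(5)] by (auto simp: outcome_def N_eq)
 \<comment> \<open>\<open>R1\<close> ignores long integers, so any value serves for
   \<open>za\<close>; the clock starts at 0.\<close>
 define sg1 where "sg1 = (|vr = %x. regs s1 (3 * x) mod N, wa = %a i. if a < 24 then mem s1 (24 * i + a) mod N else 0, za = %_ _. 0, tm = 0|)"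
 have R1: "R1 s1 sg1" using exec_bounded_ram[OF 1(1) bs] 1(4) by (simp add: R1_def sg1_def)
 have m4: "mem s 0 mod N = n" "mem s (Suc 0) mod N = p" "mem s 2 mod N = q" "mem s 3 mod N = r" using h0 sizes nN by auto
 have m4': "mem s (Suc (Suc 0)) mod N = q" "mem s (Suc (Suc (Suc 0))) mod N = r" using m4(3,4) by (simp_all add: numeral_2_eq_2 numeral_3_eq_3)
 have bb: "b < N" by (rule less_trans[OF b0(2,3)])
 define post where "post sg' \<longleftrightarrow> vr sg' 10 = n & vr sg' 11 = p & vr sg' 12 = q & vr sg' 13 = r & vr sg' 14 = b & vr sg' 15 = L1 &
   vr sg' 18 = L & vr sg' 1 = L & vr sg' 19 = ?len & vr sg' 0 = 2 ^ b & wa sg' = wa sg1 & tm sg' = d + d' + 10" for sg' :: store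
 have w1: "wa sg1 0 0 = n" "wa sg1 1 0 = p" "wa sg1 2 0 = q" "wa sg1 3 0 = r" "vr sg1 14 = b" "vr sg1 0 = 2 ^ b" "tm sg1 = 0"
  using m4 m4' 1(3,5,6) bb b0(3) by (simp_all add: sg1_def)
 have ll: "d * b ^ d + 1 = L1" "d' * b ^ d' + 1 = L" "d * b ^ d + 2 = L1 + 1" by (simp_all add: L1_eq L_eq entry_bits_def b_eq)
 have "L1.run (rd d d') sg1 post"
  by (rule runs_rd[OF w1(1-5) b0(1) nN sizes(1-3), where d = d and d' = d', unfolded ll, OF sizes(7) LN lenN])
   (use w1(6,7) in \<open>auto simp: post_def\<close>)
 then obtain t2 s2 sg2 where 2: "exec w (rd d d') s1 t2 s2" "R1 s2 sg2" "t2 + sz1 * tm sg1 <= sz1 * tm sg2" "post sg2"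
  using R1 unfolding runs_def by blast
 have t2: "t2 <= 200 * (d + d' + 10)" using 2(3,4) by (simp add: sg1_def post_def sz1_def)
 have b2: "bounded_ram w s2" "regs s2 1 = N" using 2(2) by (auto simp: R1_def)
 have r2: "regs s2 (3 * x) mod N = vr sg2 x" for x using 2(2) by (simp add: R1_def)
 \<comment> \<open>The store determines cells only modulo \<open>N\<close>; this suffices because
   the input words are below \<open>N\<close>.\<close>
 have m2: "mem s2 i mod N = mem s i mod N" for i
 proof -
  have "wa sg2 (i mod 24) (i div 24) = wa sg1 (i mod 24) (i div 24)" using 2(4) by (simp add: post_def)
  then show ?thesis using 2(2) by (simp add: R1_def sg1_def 1(3))
 qed
 have l2: "regs s2 57 mod regs s2 1 = ?len" using r2[of 19] 2(4) b2(2) by (simp add: post_def)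
 have w24: "24 * x < 2 ^ w" if "x < N" for x
 proof -
  have "24 * x < N * N" using that N by (intro mult_strict_mono) auto
  also have "N * N <= 2 ^ w" using N_pow_le[of 2] by (simp add: power2_eq_square)
  finally show ?thesis .
 qed
 have "24 < N" using N by simp
 then have c24: "24 < (2::nat) ^ w" using Nw by blast
 have w0: "0 < w" using b0 by simp
 obtain t3 s3 where 3: "exec w itl s2 t3 s3" "t3 <= 5 * ?len + 4" "!!i. i < ?len ==> mem s3 (24 * i) = mem s2 i"
  "!!r. r \<notin> {4, 7, 10, 13, 16} ==> regs s3 r = regs s2 r"
  using itl_outcome[OF l2 _ w24[OF lenN] c24 w0] b2(1) unfolding outcome_def bounded_ram_def by blast
 have b3: "bounded_ram w s3" by (rule exec_bounded_ram[OF 3(1) b2(1)])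
 have r3: "regs s3 (3 * x) = regs s2 (3 * x)" for x by (rule 3(4)) (simp, presburger)
 have r31: "regs s3 1 = N" using 3(4)[of 1] b2 by simp
 define sg3 where "sg3 = (|vr = %x. regs s3 (3 * x) mod N, wa = %a i. if a < 24 then mem s3 (24 * i + a) mod N else 0, za = %_ _. 0, tm = 0|)"
 define ts3 where "ts3 = (|vr = %x. vr sg3 (x + 10), wa = %a. wa sg3 (2 * a), za = %a. big (wa sg3 (2 * a + 1)), tm = 0|)"
 have v3: "vr sg3 x = vr sg2 x" for x by (simp add: sg3_def r3 r2)
 have R2: "R2 s3 ts3" unfolding R2_def
  using b3 r31 v3[of 0] v3[of 1] 2(4) by (intro exI[of _ sg3]) (auto simp: R1_def PR_def ts3_def sg3_def post_def)
 have v: "vr ts3 0 = n" "vr ts3 1 = p" "vr ts3 2 = q" "vr ts3 3 = r" "vr ts3 4 = b" "vr ts3 5 = L1" "vr ts3 8 = L"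
  using 2(4) by (auto simp: ts3_def v3 post_def)
 have w3: "wa ts3 0 i = mem s i" if "i < ?len" for i
  using 3(3)[OF that] m2[of i] mN[OF that] by (simp add: ts3_def sg3_def)
 have aA: "entry_at b L1 (wa ts3 0) (4 + t * (L1 + 1)) (A $$ (t div q, t mod q))" if t: "t < p * q" for t
 proof -
  have "Suc t * (L1 + 1) <= (p * q + q * r) * (L1 + 1)" using t by (intro mult_le_mono1) simp
  then have "entry_at b L1 (wa ts3 0) (4 + t * (L1 + 1)) (A $$ (t div q, t mod q)) = entry_at b L1 (mem s) (4 + t * (L1 + 1)) (A $$ (t div q, t mod q))"
   by (intro entry_at_cong w3) simp
  then show ?thesis using hA[OF t] by simp
 qed
 have aB: "entry_at b L1 (wa ts3 0) (4 + (p * q + t) * (L1 + 1)) (B $$ (t div r, t mod r))" if t: "t < q * r" for t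
 proof -
  have "Suc (p * q + t) * (L1 + 1) <= (p * q + q * r) * (L1 + 1)" using t by (intro mult_le_mono1) simp
  then have "entry_at b L1 (wa ts3 0) (4 + (p * q + t) * (L1 + 1)) (B $$ (t div r, t mod r)) = entry_at b L1 (mem s) (4 + (p * q + t) * (L1 + 1)) (B $$ (t div r, t mod r))"
   by (intro entry_at_cong w3) simp
  then show ?thesis using hB'[OF t] by simp
 qed
 let ?T = "9 * h + 8 * (p * q) + 8 * (q * r) + 11 * (p * r) + Tc + 70"
 obtain t4 s4 ts4 where 4: "exec w (body C) s3 t4 s4" "R2 s4 ts4" "t4 + U2 * tm ts3 <= U2 * tm ts4" "vr ts4 19 = p * r * (L1 + 1)"
   "!!t. t < p * r ==> entry_at b L1 (wa ts4 0) (t * (L1 + 1)) (min_plus A B $$ (t div r, t mod r))" "tm ts4 <= tm ts3 + ?T"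
  using runs_body[OF core v aA aB] R2 unfolding runs_def by blast
 have t4: "t4 <= U2 * ?T"
 proof -
  have "t4 <= U2 * tm ts4" using 4(3) by (simp add: ts3_def)
  also have "\<dots> <= U2 * ?T" using 4(6) by (intro mult_le_mono2) (simp add: ts3_def)
  finally show ?thesis .
 qed
 obtain sg4 where sg4: "R1 s4 sg4" "PR sg4 ts4" using 4(2) by (auto simp: R2_def)
 have olen: "regs s4 87 mod regs s4 1 = p * r * (L1 + 1)" using sg4 4(4) by (simp add: R1_def PR_def)
 have oN: "p * r * (L1 + 1) < N" using sz(2) by simp
 have b4: "bounded_ram w s4" "regs s4 1 = N" using sg4 by (auto simp: R1_def)
 obtain t5 s5 where 5: "exec w epi s4 t5 s5" "t5 <= 7 * (p * r * (L1 + 1)) + 6" "!!i. i < p * r * (L1 + 1) ==> mem s5 i = mem s4 (24 * i) mod N"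
  using epi_outcome[OF olen w24[OF oN] c24 b4(1) w0] unfolding outcome_def b4(2) by blast
 have m5: "mem s5 i = wa ts4 0 i" if "i < p * r * (L1 + 1)" for i using 5(3)[OF that] sg4 by (simp add: R1_def PR_def)
 have "entry_at b L1 (mem s5) (0 + t * (L1 + 1)) (min_plus A B $$ (t div r, t mod r))" if t: "t < p * r" for t
 proof -
  have "Suc t * (L1 + 1) <= p * r * (L1 + 1)" using t by (intro mult_le_mono1) simp
  then have "entry_at b L1 (mem s5) (t * (L1 + 1)) (min_plus A B $$ (t div r, t mod r)) = entry_at b L1 (wa ts4 0) (t * (L1 + 1)) (min_plus A B $$ (t div r, t mod r))"
   by (intro entry_at_cong m5) simp
  then show ?thesis using 4(5)[OF t] by simp
 qed
 then have "ALL i<length ?ys. mem s5 (0 + i) = ?ys ! i" unfolding encode_mat_at dims e2 b_eq[symmetric] by blast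
 then have ys: "ALL i<length ?ys. mem s5 i = ?ys ! i" by simp
 have ex: "exec w (wrp m d d' C) s (t1 + (t2 + (t3 + (t4 + t5)))) s5" unfolding wrp_def
  by (intro exec.Seq[OF 1(1)] exec.Seq[OF 2(1)] exec.Seq[OF 3(1)] exec.Seq[OF 4(1) 5(1)])
 define Y1 Y2 Y3 where Y_def: "Y1 = (p * q + q * r) * (L1 + 1)" "Y2 = p * r * (L1 + 1)" "Y3 = U2 * ?T"
 have e: "12 * ((p * q + q * r + p * r) * (L1 + 1)) = 12 * ((p * q + q * r) * (L1 + 1)) + 12 * (p * r * (L1 + 1))" by (simp add: add_mult_distrib)
 have "t1 + (t2 + (t3 + (t4 + t5))) <= 3 * b + 200 * (d + d' + 10) + 12 * ((p * q + q * r + p * r) * (L1 + 1)) + U2 * ?T + 39"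
  unfolding e using 1(2) t2 3(2) t4 5(2) unfolding Y_def[symmetric] by (simp add: add_mult_distrib2)
 then have "real (t1 + (t2 + (t3 + (t4 + t5)))) <= real (3 * b + 200 * (d + d' + 10) + 12 * ((p * q + q * r + p * r) * (L1 + 1)) + U2 * ?T + 39)"
  by (rule of_nat_mono)
 with ex ys show "\<exists>t s'. exec w (wrp m d d' C) s t s' &
   real t <= real (3 * b + 200 * (d + d' + 10) + 12 * ((p * q + q * r + p * r) * (L1 + 1)) + U2 * ?T + 39) & (ALL i<length ?ys. mem s' i = ?ys ! i)"
  by blast
qed

end

lemma runs_seqI:
 assumes "runs w U R P sg \<Phi>" "!!sg'. \<Phi> sg' ==> runs w U R P' sg' Q"
 shows "runs w U R (Seq P P') sg Q"
 by (rule runs_seq, rule runs_conseq[OF assms(1)], rule assms(2))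

context bigm
begin

text \<open>The floor of \<open>(b - 1) * s\<close> for the rational \<open>s\<close> given by
  variables 23 and 24. As \<open>n\<close> lies between \<open>2 ^ (b - 1)\<close> and
  \<open>2 ^ b\<close>, two to this power is \<open>n powr s\<close> up to a constant
  factor.\<close>

definition dex :: aexp where "dex = ((Var 4 -! Num 1) *! Var 23) idiv Var 24"

text \<open>The numerators \<open>pp\<close> for \<open>\<Delta>\<close> and \<open>p2\<close> for
  \<open>\<rho>\<close> share the denominator \<open>qq\<close>, and \<open>c * b\<close> is the
  word length of the emulated program. The constants enter through \<open>setc2\<close>, because
  literals in expressions are limited to values below 128.\<close>

definition mcore :: "nat => nat => nat => nat => prog => prog" where
 "mcore pp p2 qq c Pr = setc2 23 pp ;; setc2 24 qq ;; bpow 1 dex ;; setc2 23 p2 ;; wpow 7 dex ;; setc2 23 c ;;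
   wpow 6 (Var 4 *! Var 23) ;; asg2 9 (Var 1 *! Var 2) ;; algo3.core Pr"

lemma runs_setc2_frm: "k < N ==> L2.run (setc2 x k) ts (%ts'. frm {x} {} {} ts ts' & vr ts' x = k & tm ts' = Suc (tm ts))"
 by (rule runs_setc2) (auto simp: frm_def)

lemma runs_mcore_setup:
 assumes b0: "0 < b" and v: "vr ts 1 = p" "vr ts 2 = q" "vr ts 4 = b" and c: "pp < N" "p2 < N" "qq < N" "c < N"
  and \<delta>: "\<delta> = ((b - 1) * pp) div qq" "\<delta> < N" "2 ^ \<delta> < BL" and \<delta>2: "\<delta>2 = ((b - 1) * p2) div qq" "\<delta>2 < N" "2 ^ \<delta>2 < N"
  and w': "c * b < N" "2 ^ (c * b) < N" and pq: "p * q < N"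
  and Q: "!!ts'. frm {6, 7, 9, 20, 23, 24} {7} {4} ts ts' ==> za ts' 4 = (za ts 4)(1 := 2 ^ \<delta>) ==> vr ts' 7 = 2 ^ \<delta>2 ==>
   vr ts' 6 = 2 ^ (c * b) ==> vr ts' 9 = p * q ==> tm ts' <= tm ts + 3 * \<delta> + 3 * \<delta>2 + 3 * (c * b) + 40 ==> L2.run (algo3.core Pr) ts' Q"
 shows "L2.run (mcore pp p2 qq c Pr) ts Q"
 unfolding mcore_def
proof (rule runs_seqI[OF runs_setc2_frm[OF c(1)]])
 fix ts1 assume 1: "frm {23} {} {} ts ts1 & vr ts1 23 = pp & tm ts1 = Suc (tm ts)"
 show "L2.run (setc2 24 qq ;; bpow 1 dex ;; setc2 23 p2 ;; wpow 7 dex ;; setc2 23 c ;;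
   wpow 6 (Var 4 *! Var 23) ;; asg2 9 (Var 1 *! Var 2) ;; algo3.core Pr) ts1 Q"
 proof (rule runs_seqI[OF runs_setc2_frm[OF c(3)]])
  fix ts2 assume 2: "frm {24} {} {} ts1 ts2 & vr ts2 24 = qq & tm ts2 = Suc (tm ts1)"
  have v2: "vr ts2 1 = p" "vr ts2 2 = q" "vr ts2 4 = b" "vr ts2 23 = pp" "vr ts2 24 = qq" "frm {6, 7, 9, 20, 23, 24} {7} {4} ts ts2" "za ts2 = za ts"
   using 1 2 v by (auto simp: frm_def)
  show "L2.run (bpow 1 dex ;; setc2 23 p2 ;; wpow 7 dex ;; setc2 23 c ;;
   wpow 6 (Var 4 *! Var 23) ;; asg2 9 (Var 1 *! Var 2) ;; algo3.core Pr) ts2 Q"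
  proof (rule runs_seq, rule runs_bpow[where m = \<delta>, OF b0])
   fix ts' assume "frm {20} {7} {4} ts2 ts'"
   then show "eval ts' dex = \<delta>" using v2 by (simp add: frm_def dex_def \<delta>(1))
  next
   fix ts3 assume 3: "frm {20} {7} {4} ts2 ts3" "za ts3 4 = (za ts2 4)(1 := 2 ^ \<delta>)" "tm ts3 <= tm ts2 + 3 * \<delta> + 10"
   show "L2.run (setc2 23 p2 ;; wpow 7 dex ;; setc2 23 c ;; wpow 6 (Var 4 *! Var 23) ;; asg2 9 (Var 1 *! Var 2) ;; algo3.core Pr) ts3 Q"
   proof (rule runs_seqI[OF runs_setc2_frm[OF c(2)]])
    fix ts4 assume 4: "frm {23} {} {} ts3 ts4 & vr ts4 23 = p2 & tm ts4 = Suc (tm ts3)"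
    have v4: "vr ts4 1 = p" "vr ts4 2 = q" "vr ts4 4 = b" "vr ts4 23 = p2" "vr ts4 24 = qq" "frm {6, 7, 9, 20, 23, 24} {7} {4} ts ts4" "za ts4 4 = (za ts 4)(1 := 2 ^ \<delta>)"
     using 3(1,2) 4 v2 by (auto simp: frm_def)
    show "L2.run (wpow 7 dex ;; setc2 23 c ;; wpow 6 (Var 4 *! Var 23) ;; asg2 9 (Var 1 *! Var 2) ;; algo3.core Pr) ts4 Q"
    proof (rule runs_seq, rule runs_wpow[where m = \<delta>2])
     fix ts' assume "frm {20, 7} {} {} ts4 ts'"
     then show "eval ts' dex = \<delta>2" using v4 by (simp add: frm_def dex_def \<delta>2(1))
    next
     fix ts5 assume 5: "frm {20, 7} {} {} ts4 ts5" "vr ts5 7 = 2 ^ \<delta>2" "tm ts5 <= tm ts4 + 3 * \<delta>2 + 10"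
     show "L2.run (setc2 23 c ;; wpow 6 (Var 4 *! Var 23) ;; asg2 9 (Var 1 *! Var 2) ;; algo3.core Pr) ts5 Q"
     proof (rule runs_seqI[OF runs_setc2_frm[OF c(4)]])
      fix ts6 assume 6: "frm {23} {} {} ts5 ts6 & vr ts6 23 = c & tm ts6 = Suc (tm ts5)"
      have v6: "vr ts6 1 = p" "vr ts6 2 = q" "vr ts6 4 = b" "vr ts6 23 = c" "vr ts6 7 = 2 ^ \<delta>2" "frm {6, 7, 9, 20, 23, 24} {7} {4} ts ts6" "za ts6 4 = (za ts 4)(1 := 2 ^ \<delta>)"
       using 5(1,2) 6 v4 by (auto simp: frm_def)
      show "L2.run (wpow 6 (Var 4 *! Var 23) ;; asg2 9 (Var 1 *! Var 2) ;; algo3.core Pr) ts6 Q"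
      proof (rule runs_seq, rule runs_wpow[where m = "c * b"])
       fix ts' assume "frm {20, 6} {} {} ts6 ts'"
       then show "eval ts' (Var 4 *! Var 23) = c * b" using v6 by (simp add: frm_def)
      next
       fix ts7 assume 7: "frm {20, 6} {} {} ts6 ts7" "vr ts7 6 = 2 ^ (c * b)" "tm ts7 <= tm ts6 + 3 * (c * b) + 10"
       have v7: "vr ts7 1 = p" "vr ts7 2 = q" "vr ts7 7 = 2 ^ \<delta>2" "frm {6, 7, 9, 20, 23, 24} {7} {4} ts ts7" "za ts7 4 = (za ts 4)(1 := 2 ^ \<delta>)"
        using 7(1,2) v6 by (auto simp: frm_def)
       have t7: "tm ts7 + 1 <= tm ts + 3 * \<delta> + 3 * \<delta>2 + 3 * (c * b) + 40" using 1 2 3(3) 4 5(3) 6 7(3) by linarith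
       show "L2.run (asg2 9 (Var 1 *! Var 2) ;; algo3.core Pr) ts7 Q"
       proof (rule runs_seq, rule runs_asg'[where v = "p * q"])
        show "L2.run (algo3.core Pr) (ts7(|vr := (vr ts7)(9 := p * q), tm := Suc (tm ts7)|)) Q"
         by (rule Q) (use v7 7(2) t7 in \<open>auto simp: frm_def\<close>)
       qed (use v7 pq in \<open>auto simp: ok2_def\<close>)
      qed (use w' in \<open>auto simp: ok2_def\<close>)
     qed
    qed (use \<delta>2 in \<open>auto simp: ok2_def dex_def\<close>)
   qed
  qed (use \<delta> in \<open>auto simp: ok2_def dex_def\<close>)
 qed
qed

end

lemma enc_mono:
 assumes "x = Pinf \<or> (EX z. x = Fin z & \<bar>z\<bar> < 2 ^ h)" "y = Pinf \<or> (EX z. y = Fin z & \<bar>z\<bar> < 2 ^ h)" "x <= y"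
 shows "enc h x <= enc h y" "enc h y <= 2 ^ (h + 2)"
proof -
 have *: "nat (2 ^ h + z) <= 2 ^ (h + 2)" if "\<bar>z\<bar> < 2 ^ h" for z
 proof -
  have "2 ^ h + z <= int (2 ^ (h + 2))" using that by simp
  then show ?thesis by linarith
 qed
 show "enc h x <= enc h y" "enc h y <= 2 ^ (h + 2)" using assms * by (auto simp: enc_def)
qed

context inst
begin

lemma runs_brt_core:
 assumes "ready ts"
 shows "L2.run brt ts (%ts'. ended ts' & tm ts' <= tm ts + (p * r * (7 * q + 10) + 3))"
proof (rule runs_brt[where p = p and q = q and r = r and A = "%i k. enc h (A $$ (i, k))" and B = "%k j. enc h (B $$ (k, j))" and X = "2 ^ (h + 4)"])
 fix i k j assume a: "i < p" "k < q" "j < r"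
 have "enc h (A $$ (i, k)) <= 2 ^ (h + 2)" "enc h (B $$ (k, j)) <= 2 ^ (h + 2)"
  using enc_mono(2)[OF entries(1)[OF a(1,2)] entries(1)[OF a(1,2)]] enc_mono(2)[OF entries(2)[OF a(2,3)] entries(2)[OF a(2,3)]] by auto
 moreover have "(2::nat) ^ (h + 2) + 2 ^ (h + 2) <= 2 ^ (h + 4)" by (simp add: power_add)
 ultimately show "enc h (A $$ (i, k)) + enc h (B $$ (k, j)) <= 2 ^ (h + 4)" by linarith
next
 fix ts' assume "frm {10, 11, 12, 17, 19} {} {3, 5} ts ts'"
  "!!t. t < p * r ==> za ts' 3 t = Min ((%k. enc h (A $$ (t div r, k)) + enc h (B $$ (k, t mod r))) ` {..<q})"
  "tm ts' <= tm ts + p * r * (7 * q + 10) + 3"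
 then show "ended ts' & tm ts' <= tm ts + (p * r * (7 * q + 10) + 3)"
  using assms by (auto simp: ended_def ready_def frm_def)
qed (use assms sizes pqr hB in \<open>auto simp: ready_def\<close>)

text \<open>Instantiates the algorithm with the codes of \<open>A\<close> and \<open>B\<close>,
  \<open>\<Delta> = 2 ^ \<delta>\<close>, \<open>\<rho> = 2 ^ \<delta>2\<close> and
  \<open>X = 2 ^ (h + 4)\<close>, an upper bound for the sum of two codes. \<open>R k\<close> is the
  range of row \<open>k\<close>, with the code of infinity exempted.\<close>

lemma runs_mcore:
 fixes R :: "nat => nat"
 assumes mono: "!!k j j'. k < q ==> j <= j' ==> j' < r ==> B $$ (k, j) <= B $$ (k, j')"
  and c: "pp < N" "p2 < N" "qq < N" "c < N"
  and \<delta>: "\<delta> = ((b - 1) * pp) div qq" "\<delta> < N" and \<delta>2: "\<delta>2 = ((b - 1) * p2) div qq" "\<delta>2 < N" "2 ^ \<delta>2 < N"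
  and w': "c * b < N" "2 ^ (c * b) < N" "b <= c * b" "c <= m" and pqrN: "p * q * r < N" "Suc r < N"
  and PN: "5 + (p * q + q * r) * (L + 1) < N" "5 + p * r * (L + 1) < N"
  and XD: "2 ^ (h + 4) + 2 ^ \<delta> < BL" and eb: "h + 3 <= entry_bits d' n" "\<delta> <= entry_bits d' n"
  and P: "!!M1 M2. M1 \<in> carrier_mat p q ==> M2 \<in> carrier_mat q r ==> valid_entries d' n M1 ==> valid_entries d' n M2 ==>
   (!!x. x \<in> elements_mat M1 ==> x = Pinf \<or> (EX z. x = Fin z & 0 <= z & z < 2 ^ \<delta>)) ==>
   computes_within (c * b) P (encode_instance d' n M1 M2) (encode_mat d' n (min_plus M1 M2)) T"
  and R: "!!k j. k < q ==> j < r ==> enc h (B $$ (k, j)) <= enc h (B $$ (k, 0)) + R k \<or> enc h (B $$ (k, j)) = 2 ^ (h + 2)"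
  and rdy: "ready ts"
 shows "L2.run (mcore pp p2 qq c P) ts (%ts'. ended ts' & tm ts' <= tm ts +
   (3 * \<delta> + 3 * \<delta>2 + 3 * (c * b) + 69 + (6 * floorlog 2 r + 61) * (p * (\<Sum>k<q. R k div 2 ^ \<delta> + 2)) + 12 * (q * r) + 14 * (p * r) + 3 * (p * q) +
   12 * p + r * (4 * r + 13) + 2 ^ \<delta>2 * (5 * nat \<lceil>T\<rceil> + 14 * (p * q) + 11 * (q * r) + 13 * (p * r) + 14) + 6 * (p * q * r div 2 ^ \<delta>2)))"
proof -
 define A' where "A' = (%i k. enc h (A $$ (i, k)))"
 define B' where "B' = (%k j. enc h (B $$ (k, j)))"
 define \<Delta> :: nat where "\<Delta> = 2 ^ \<delta>"
 define X :: nat where "X = 2 ^ (h + 4)"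
 have leA: "A' i k <= 2 ^ (h + 2)" if "i < p" "k < q" for i k
  unfolding A'_def using enc_mono(2)[OF entries(1)[OF that] entries(1)[OF that]] by simp
 have leB: "B' k j <= 2 ^ (h + 2)" if "k < q" "j < r" for k j
  unfolding B'_def using enc_mono(2)[OF entries(2)[OF that] entries(2)[OF that]] by simp
 have D0: "0 < \<Delta>" by (simp add: \<Delta>_def)
 have monoB: "B' k j <= B' k j'" if "k < q" "j <= j'" "j' < r" for k j j'
  unfolding B'_def using that by (intro enc_mono(1) entries(2) mono) auto
 have AX: "A' i k + B' k j <= X" if a: "i < p" "k < q" "j < r" for i k j
 proof -
  have "(2::nat) ^ (h + 2) + 2 ^ (h + 2) <= X" by (simp add: X_def power_add)
  then show ?thesis using leA[OF a(1,2)] leB[OF a(2,3)] by linarith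
 qed
 have XB: "X + \<Delta> < BL" using XD by (simp add: X_def \<Delta>_def)
 interpret G: algo2 w N b L A' B' p q r \<Delta> X
  by unfold_locales (use D0 pqr monoB sizes pqrN AX XB in auto)
 have lt2: "(2::int) ^ (h + 2) < 2 ^ entry_bits d' n" using eb(1) by (intro power_strict_increasing) auto
 have MAe: "x = Pinf \<or> (EX z. x = Fin z & 0 <= z & z < 2 ^ \<delta>)" if x: "x \<in> elements_mat (G.MA jj)" for x jj
 proof -
  obtain i k where ik: "i < p" "k < q" "x = G.Aent jj (i * q + k)" using elements_matD[OF x] by (auto simp: G.MA_def)
  have lt: "int (A' i k + G.bp k jj - G.cp i jj) < 2 ^ \<delta>" if "jj \<in> G.S i k"
  proof -
   have "int (A' i k + G.bp k jj - G.cp i jj) < int \<Delta>"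
    using that D0 unfolding of_nat_less_iff by (auto simp: G.S_def)
   also have "int \<Delta> = 2 ^ \<delta>" by (simp add: \<Delta>_def)
   finally show ?thesis .
  qed
  have x': "x = (if jj \<in> G.S i k then Fin (int (A' i k + G.bp k jj - G.cp i jj)) else Pinf)"
   using ik index_div_mod[OF ik(2), of i] by (simp add: G.Aent_def G.St_def)
  show ?thesis
  proof (cases "jj \<in> G.S i k")
   case True
   then have "x = Fin (int (A' i k + G.bp k jj - G.cp i jj))" using x' by simp
   then show ?thesis using lt[OF True] of_nat_0_le_iff by blast
  qed (use x' in simp)
 qed
 have MBe: "EX z. x = Fin z & \<bar>z\<bar> < 2 ^ entry_bits d' n" if jj: "jj < r" and x: "x \<in> elements_mat (G.MB jj)" for x jj
 proof -
  obtain k j where kj: "k < q" "j < r" "x = G.Bent jj (k * r + j)" using elements_matD[OF x] by (auto simp: G.MB_def)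
  have le: "B' k j <= 2 ^ (h + 2)" "G.bp k jj <= 2 ^ (h + 2)"
   using leB[OF kj(1,2)] G.bp_le[OF kj(1) jj] leB[OF kj(1) jj] by auto
  have i2: "(2::int) ^ (h + 2) = int (2 ^ (h + 2))" by simp
  have "int (B' k j) <= 2 ^ (h + 2)" "int (G.bp k jj) <= 2 ^ (h + 2)" unfolding i2 using le by (simp_all only: of_nat_le_iff)
  then have "\<bar>int (B' k j) - int (G.bp k jj)\<bar> < 2 ^ entry_bits d' n" using lt2 by linarith
  then show ?thesis using kj index_div_mod[OF kj(2), of k] by (auto simp: G.Bent_def)
 qed
 have le\<delta>: "(2::int) ^ \<delta> <= 2 ^ entry_bits d' n" using eb(2) by (intro power_increasing) auto
 have PP: "computes_within (c * b) P (encode_instance d' n (G.MA jj) (G.MB jj)) (encode_mat d' n (min_plus (G.MA jj) (G.MB jj))) T" if jj: "jj < r" for jj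
 proof (rule P)
  show "G.MA jj \<in> carrier_mat p q" "G.MB jj \<in> carrier_mat q r" by (simp_all add: G.MA_def G.MB_def)
  show "valid_entries d' n (G.MA jj)" unfolding valid_entries_def
  proof
   fix x assume "x \<in> elements_mat (G.MA jj)"
   from MAe[OF this] show "x = Pinf \<or> (EX z. x = Fin z & \<bar>z\<bar> < 2 ^ entry_bits d' n)"
   proof (elim disjE exE conjE)
    fix z assume z: "x = Fin z" "0 <= z" "z < 2 ^ \<delta>"
    then have "\<bar>z\<bar> < 2 ^ entry_bits d' n" using le\<delta> by linarith
    then show ?thesis using z by blast
   qed simp
  qed
  show "valid_entries d' n (G.MB jj)" unfolding valid_entries_def using MBe[OF jj] by blast
 qed (rule MAe)
 have w24: "24 * 2 ^ (c * b) < (2::nat) ^ w"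
 proof -
  have "24 * 2 ^ (c * b) < N * N" using w'(2) N by (intro mult_strict_mono) auto
  also have "N * N <= 2 ^ w" using N_pow_le[of 2] by (simp add: power2_eq_square)
  finally show ?thesis .
 qed
 have dv: "2 ^ (c * b) dvd N" unfolding N_eq using w'(4) by (intro le_imp_power_dvd) simp
 interpret H: algo3 w N b L A' B' p q r \<Delta> X n d' "c * b" P T
  by unfold_locales (use b_eq L_eq nN PP w24 dv w'(3) PN in auto)
 let ?PC0 = "\<Sum>k<q. R k div 2 ^ \<delta> + 2"
 \<comment> \<open>The code \<open>2 ^ (h + 2)\<close> of infinity is the exceptional value
   \<open>c\<close> of \<open>card_starts\<close>.\<close>
 have PC: "G.PC <= ?PC0" unfolding G.PC_def
 proof (intro sum_mono)
  fix k assume "k \<in> {..<q}"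
  then show "card (G.starts k) <= R k div 2 ^ \<delta> + 2"
   using G.card_starts[of k "R k" "2 ^ (h + 2)"] R by (auto simp: B'_def \<Delta>_def)
 qed
 have r: "vr ts 1 = p" "vr ts 2 = q" "vr ts 3 = r" "vr ts 4 = b" "vr ts 0 = n" "vr ts 8 = L" "vr ts 5 = L1" using rdy by (auto simp: ready_def)
 have dB: "2 ^ \<delta> < BL" using XD by simp
 show ?thesis
 proof (rule runs_mcore_setup[OF b0(1) r(1,2,4) c \<delta> dB \<delta>2 w'(1,2) sizes(4)])
  fix ts1 assume 1: "frm {6, 7, 9, 20, 23, 24} {7} {4} ts ts1" "za ts1 4 = (za ts 4)(1 := 2 ^ \<delta>)" "vr ts1 7 = 2 ^ \<delta>2"
   "vr ts1 6 = 2 ^ (c * b)" "vr ts1 9 = p * q" "tm ts1 <= tm ts + 3 * \<delta> + 3 * \<delta>2 + 3 * (c * b) + 40"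
  have v1: "vr ts1 1 = p" "vr ts1 3 = r" "vr ts1 0 = n" "vr ts1 8 = L" "vr ts1 5 = L1" "vr ts1 2 = q" "za ts1 0 = za ts 0" "za ts1 1 = za ts 1"
   using 1(1) r by (auto simp: frm_def)
  have zA: "za ts 0 (i * q + k) = A' i k" if "i < p" "k < q" for i k
   using rdy index_less[OF that] index_div_mod[OF that(2), of i] by (auto simp: ready_def A'_def)
  have zB: "za ts 1 (k * r + j) = B' k j" if "k < q" "j < r" for k j
   using rdy index_less[OF that] index_div_mod[OF that(2), of k] by (auto simp: ready_def B'_def)
  have env: "G.env ts1" unfolding G.env_def using v1 zA zB rdy 1(2) by (auto simp: ready_def X_def \<Delta>_def)
  show "L2.run (algo3.core P) ts1 (%ts'. ended ts' & tm ts' <= tm ts +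
   (3 * \<delta> + 3 * \<delta>2 + 3 * (c * b) + 69 + (6 * floorlog 2 r + 61) * (p * ?PC0) + 12 * (q * r) + 14 * (p * r) + 3 * (p * q) +
   12 * p + r * (4 * r + 13) + 2 ^ \<delta>2 * (5 * nat \<lceil>T\<rceil> + 14 * (p * q) + 11 * (q * r) + 13 * (p * r) + 14) + 6 * (p * q * r div 2 ^ \<delta>2)))"
  proof (rule H.runs_core[OF env v1(4) 1(5) v1(3) 1(4,3)])
   show "(0::nat) < 2 ^ \<delta>2" by simp
   fix ts2 u assume 2: "frm {10, 11, 12, 13, 14, 15, 16, 17, 18, 19, 20, 21, 22} {0, 1, 2, 3, 4, 5, 6} {2, 3, 5} ts1 ts2"
    "!!i j. i < p ==> j < r ==> za ts2 3 (i * r + j) = G.cc i j" "u * 2 ^ \<delta>2 <= p * q * r"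
    "tm ts2 <= tm ts1 + (6 * floorlog 2 r + 61) * (p * G.PC) + 12 * (q * r) + 14 * (p * r) + 3 * (p * q) + 12 * p +
     r * (4 * r + 13) + 2 ^ \<delta>2 * H.TP + 6 * u + 29"
   have u: "u <= p * q * r div 2 ^ \<delta>2" using div_le_mono[OF 2(3), of "2 ^ \<delta>2"] by simp
   have pc: "(6 * floorlog 2 r + 61) * (p * G.PC) <= (6 * floorlog 2 r + 61) * (p * ?PC0)" using PC by (intro mult_le_mono2)
   have e: "ended ts2" unfolding ended_def
   proof (intro conjI allI impI)
    fix t assume t: "t < p * r"
    have "t div r < p" "t mod r < r" using t pqr by (auto simp: less_mult_imp_div_less)
    then have "za ts2 3 (t div r * r + t mod r) = G.cc (t div r) (t mod r)" by (rule 2(2))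
    then have "za ts2 3 t = Min ((%k. A' (t div r) k + B' k (t mod r)) ` {..<q})" unfolding G.cc_def by simp
    then show "za ts2 3 t = Min ((%k. enc h (A $$ (t div r, k)) + enc h (B $$ (k, t mod r))) ` {..<q})"
     by (simp add: A'_def B'_def)
   qed (use 2(1) v1 1(2) rdy in \<open>auto simp: frm_def ready_def\<close>)
   define y1 y2 y3 where y: "y1 = (6 * floorlog 2 r + 61) * (p * ?PC0)" "y2 = r * (4 * r + 13)"
    "y3 = 2 ^ \<delta>2 * (5 * nat \<lceil>T\<rceil> + 14 * (p * q) + 11 * (q * r) + 13 * (p * r) + 14)"
   have "tm ts2 <= tm ts + (3 * \<delta> + 3 * \<delta>2 + 3 * (c * b) + 69 + y1 + 12 * (q * r) + 14 * (p * r) + 3 * (p * q) +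
    12 * p + y2 + y3 + 6 * (p * q * r div 2 ^ \<delta>2))"
    using 2(4) 1(6) u pc unfolding H.TP_def y[symmetric] by linarith
   then show "ended ts2 & tm ts2 <= tm ts +
    (3 * \<delta> + 3 * \<delta>2 + 3 * (c * b) + 69 + (6 * floorlog 2 r + 61) * (p * ?PC0) + 12 * (q * r) + 14 * (p * r) + 3 * (p * q) +
    12 * p + r * (4 * r + 13) + 2 ^ \<delta>2 * (5 * nat \<lceil>T\<rceil> + 14 * (p * q) + 11 * (q * r) + 13 * (p * r) + 14) + 6 * (p * q * r div 2 ^ \<delta>2))"
    using e unfolding y by blast
  qed
 qed
qed

end

section \<open>Exponents\<close>

lemma floorlog_pow: "1 <= n ==> 2 ^ (floorlog 2 n - 1) <= n" "n < 2 ^ floorlog 2 n" "1 <= n ==> 1 <= floorlog 2 n"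
proof -
 show "1 <= n ==> 2 ^ (floorlog 2 n - 1) <= n" using floorlog_bounds[of n 2] by auto
 show "n < 2 ^ floorlog 2 n" using floorlog_bounds[of n 2] by (cases "n = 0") auto
 show "1 <= n ==> 1 <= floorlog 2 n" by (simp add: floorlog_def)
qed

lemma polylog_bound:
 assumes "0 < \<delta>"
 shows "\<exists>K\<ge>1. \<forall>n\<ge>1. real (floorlog 2 n) ^ k <= K * real n powr \<delta>"
proof -
 \<comment> \<open>The \<open>k\<close>-th power of a bound of order \<open>n powr a\<close> must
   stay within \<open>n powr \<delta>\<close>; adding 1 to \<open>k\<close> avoids a division by
   zero.\<close>
 define a where "a = \<delta> / (real k + 1)"
 have a: "0 < a" using assms by (simp add: a_def)
 define C where "C = 1 + 1 / (a * ln 2)"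
 have C: "1 <= C" using a by (simp add: C_def)
 have "real (floorlog 2 n) ^ k <= C ^ k * real n powr \<delta>" if n: "n \<ge> 1" for n
 proof -
  have x: "1 <= real n" using n by simp
  have "2 ^ (floorlog 2 n - 1) <= real n" using floorlog_pow(1)[OF n] by (simp add: numeral_power_le_of_nat_cancel_iff)
  then have "ln (2 ^ (floorlog 2 n - 1)) <= ln (real n)" by (subst ln_le_cancel_iff) (use x in auto)
  then have "real (floorlog 2 n - 1) * ln 2 <= ln (real n)" by (simp add: ln_realpow)
  also have "\<dots> <= real n powr a / a" by (rule ln_powr_bound[OF x a])
  finally have "real (floorlog 2 n - 1) <= real n powr a / (a * ln 2)" using a by (simp add: field_simps)
  moreover have "1 <= real n powr a" using x a by (simp add: ge_one_powr_ge_zero)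
  ultimately have "real (floorlog 2 n) <= C * real n powr a" using floorlog_pow(3)[OF n] by (simp add: C_def algebra_simps of_nat_diff)
  then have "real (floorlog 2 n) ^ k <= (C * real n powr a) ^ k" by (intro power_mono) auto
  also have "\<dots> = C ^ k * real n powr (a * real k)" using x by (simp add: power_mult_distrib powr_powr flip: powr_realpow)
  also have "\<dots> <= C ^ k * real n powr \<delta>"
  proof (intro mult_left_mono powr_mono)
   show "a * real k <= \<delta>" using assms by (simp add: a_def field_simps)
  qed (use C x in auto)
  finally show ?thesis .
 qed
 moreover have "1 <= C ^ k" using C by (rule one_le_power)
 ultimately show ?thesis by blast
qed

text \<open>The floor in \<open>\<delta>\<close> costs a factor 2, and replacing \<open>n\<close> by
  the power of two below it costs a factor \<open>2 powr s\<close>.\<close>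

lemma power_two_bounds:
 fixes n pp qq :: nat
 assumes n: "1 <= n" and q: "0 < qq" and \<delta>: "\<delta> = ((floorlog 2 n - 1) * pp) div qq" and s: "s = real pp / real qq"
 shows "2 ^ \<delta> <= real n powr s" "real n powr s <= (2 * 2 powr s) * 2 ^ \<delta>"
proof -
 define b where "b = floorlog 2 n - 1"
 have b: "2 ^ b <= real n" "real n <= 2 * 2 ^ b"
 proof -
  show "2 ^ b <= real n" using floorlog_pow(1)[OF n] by (simp add: b_def numeral_power_le_of_nat_cancel_iff)
  have "n < 2 ^ Suc b" using floorlog_pow(2)[of n] floorlog_pow(3)[OF n] by (simp add: b_def)
  then have "real n < 2 ^ Suc b" by (simp add: of_nat_less_numeral_power_cancel_iff del: power_Suc)
  then show "real n <= 2 * 2 ^ b" by simp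
 qed
 have s0: "0 <= s" by (simp add: s)
 have e: "real b * s = real (b * pp) / real qq" by (simp add: s)
 have "b * pp = qq * \<delta> + b * pp mod qq" unfolding \<delta> b_def[symmetric] by simp
 then have mm: "real (b * pp) = real qq * real \<delta> + real (b * pp mod qq)" by (metis of_nat_add of_nat_mult)
 have ml: "real (b * pp mod qq) <= real qq" using q by (simp add: less_imp_le)
 have d: "real \<delta> <= real b * s" unfolding e mm using q by (simp add: field_simps)
 have d2: "real b * s <= real \<delta> + 1" unfolding e mm using q ml by (simp add: field_simps)
 have p: "(2 ^ b) powr s = 2 powr (real b * s)" by (simp add: powr_powr flip: powr_realpow)
 have "2 ^ \<delta> = 2 powr real \<delta>" by (simp add: powr_realpow)
 also have "\<dots> <= 2 powr (real b * s)" using d by (intro powr_mono) auto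
 also have "\<dots> <= real n powr s" unfolding p[symmetric] using b s0 by (intro powr_mono2) auto
 finally show "2 ^ \<delta> <= real n powr s" .
 have "real n powr s <= (2 * 2 ^ b) powr s" using b s0 n by (intro powr_mono2) auto
 also have "\<dots> = 2 powr s * 2 powr (real b * s)" by (simp add: powr_mult p)
 also have "\<dots> <= 2 powr s * 2 powr (real \<delta> + 1)" using d2 by (intro mult_left_mono powr_mono) auto
 also have "\<dots> = (2 * 2 powr s) * 2 ^ \<delta>" by (simp add: powr_add powr_realpow)
 finally show "real n powr s <= (2 * 2 powr s) * 2 ^ \<delta>" .
qed

lemma rational_below:
 assumes "0 < qq" "1 / real qq <= \<epsilon>" "0 <= x"
 shows "x - \<epsilon> <= real (nat \<lfloor>x * real qq\<rfloor>) / real qq" "real (nat \<lfloor>x * real qq\<rfloor>) / real qq <= x"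
proof -
 have 0: "0 <= x * real qq" using assms by simp
 have r: "real (nat \<lfloor>x * real qq\<rfloor>) = of_int \<lfloor>x * real qq\<rfloor>" using 0 by simp
 have "(x * real qq - 1) / real qq <= real (nat \<lfloor>x * real qq\<rfloor>) / real qq"
  unfolding r using assms by (intro divide_right_mono) linarith+
 then show "x - \<epsilon> <= real (nat \<lfloor>x * real qq\<rfloor>) / real qq" using assms by (simp add: diff_divide_distrib)
 have "real (nat \<lfloor>x * real qq\<rfloor>) <= x * real qq" unfolding r by (rule of_int_floor_le)
 then show "real (nat \<lfloor>x * real qq\<rfloor>) / real qq <= x" using assms by (simp add: field_simps)
qed

lemma computes_within_mono: "computes_within w P xs ys T ==> T <= T' ==> computes_within w P xs ys T'"
 unfolding computes_within_def by (meson order_trans)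

text \<open>\<open>K * y\<close> stands for every polylogarithmic factor, \<open>W\<close> for the
  matrix sizes and \<open>T\<close> for the core. No term contains more than two polylogarithmic
  factors, hence the squares.\<close>

lemma total_bound:
 fixes K y W T b l h u PQ D :: real
 assumes "1 <= K" "1 <= y" "1 <= W" "0 <= T" "0 <= D" "b <= K * y" "l <= K * y" "h <= K * y" "u <= K * y" "PQ <= 3 * W" "0 <= PQ" "0 <= l" "0 <= u" "0 <= h"
 shows "3 * b + 200 * D + 12 * (PQ * l) + u * (9 * h + 11 * PQ + T + 70) + 39 <= (200 * D + 200) * K ^ 2 * y ^ 2 * (W + T)"
proof -
 define k where "k = K * y"
 have k: "1 <= k" unfolding k_def using mult_mono[of 1 K 1 y] assms by simp
 define Z where "Z = k ^ 2 * (W + T)"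
 have WT: "1 <= W + T" using assms by simp
 have kk: "k <= k ^ 2" using k by (simp add: power2_eq_square)
 have Z1: "k ^ 2 <= Z" unfolding Z_def using WT by (metis mult_left_mono mult.right_neutral zero_le_power2)
 have Z2: "k * W <= Z" "k * T <= Z"
 proof -
  have "k * W <= k ^ 2 * (W + T)" "k * T <= k ^ 2 * (W + T)" using kk assms k by (auto intro!: mult_mono)
  then show "k * W <= Z" "k * T <= Z" by (simp_all add: Z_def)
 qed
 have a: "PQ * l <= 3 * Z" using mult_mono[of PQ "3 * W" l k] assms k Z2 by (simp add: k_def ac_simps)
 have "u * (9 * h + 11 * PQ + T + 70) <= k * (9 * k + 33 * W + T + 70)"
  using assms k by (intro mult_mono) (auto simp: k_def)
 also have "\<dots> = 9 * k ^ 2 + 33 * (k * W) + k * T + 70 * k" by (simp add: algebra_simps power2_eq_square)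
 also have "\<dots> <= 113 * Z" using Z1 Z2 kk by linarith
 finally have c: "u * (9 * h + 11 * PQ + T + 70) <= 113 * Z" .
 have one: "1 <= Z" using k kk Z1 by linarith
 have D: "200 * D <= 200 * D * Z" using one assms by (simp add: mult_le_cancel_left1)
 have "3 * b <= 3 * Z" using assms(6) kk Z1 by (simp add: k_def)
 then have "3 * b + 200 * D + 12 * (PQ * l) + u * (9 * h + 11 * PQ + T + 70) + 39 <= 3 * Z + 200 * D * Z + 36 * Z + 113 * Z + 39 * Z"
  using a c D one by linarith
 also have "\<dots> <= (200 * D + 200) * Z" using one by (simp add: algebra_simps)
 also have "\<dots> = (200 * D + 200) * K ^ 2 * y ^ 2 * (W + T)" by (simp add: Z_def k_def power_mult_distrib)
 finally show ?thesis .
qed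

text \<open>Block lengths are bounded by a fixed power of \<open>2 ^ b\<close>, so a constant
  \<open>m\<close> makes all addresses smaller than \<open>N = 2 ^ (m * b)\<close>.\<close>

lemma entry_bits_pow: "1 <= b ==> d * b ^ d + 2 <= (2 ^ b) ^ (2 * d + 2)" for b d :: nat
proof -
 assume b: "1 <= b"
 have 1: "d <= 2 ^ (b * d)"
 proof -
  have "d <= 2 ^ d" using less_exp[of d] by simp
  also have "\<dots> <= 2 ^ (b * d)" using b by (intro power_increasing) auto
  finally show ?thesis .
 qed
 have "b ^ d <= (2 ^ b) ^ d" using less_exp[of b] by (intro power_mono) auto
 then have "d * b ^ d <= 2 ^ (b * d) * (2 ^ b) ^ d" using 1 by (intro mult_mono) auto
 also have "\<dots> = (2 ^ b) ^ (2 * d)" by (simp add: power_mult mult_2 power_add)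
 finally have 2: "d * b ^ d <= (2 ^ b) ^ (2 * d)" .
 have "2 ^ 1 <= (2::nat) ^ b" using b by (intro power_increasing) auto
 then have 4: "2 * 2 <= (2 ^ b) * (2 ^ b :: nat)" by (intro mult_mono) auto
 have p: "1 <= (2 ^ b :: nat) ^ (2 * d)" by simp
 have "d * b ^ d + 2 <= (2 ^ b) ^ (2 * d) * 4" using 2 p by linarith
 also have "\<dots> <= (2 ^ b) ^ (2 * d) * (2 ^ b * 2 ^ b)" using 4 by (intro mult_le_mono2) simp
 also have "\<dots> = (2 ^ b) ^ (2 * d + 2)" by (simp add: power_add power2_eq_square)
 finally show ?thesis .
qed

text \<open>The origin of \<open>d'\<close>: the codes of input entries need about
  \<open>b * (d * b ^ d + 1)\<close> bits, 5 more accommodate \<open>X\<close> and sums, and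
  \<open>k * b\<close> bounds the exponent of \<open>\<Delta>\<close>.\<close>

lemma entry_bits_gap:
 fixes b d k :: nat
 assumes "1 <= b" "d' = d + 6 + k"
 shows "b * (d * b ^ d + 1) + 5 + k * b <= d' * b ^ d'"
proof -
 have "b * (d * b ^ d + 1) + 5 + k * b <= d * b ^ (d + 1) + 6 * b + k * b" using assms(1) by (simp add: algebra_simps)
 also have "\<dots> <= d * b ^ (d + 1) + 6 * b ^ (d + 1) + k * b ^ (d + 1)" using assms(1) by (intro add_mono mult_le_mono2) auto
 also have "\<dots> = d' * b ^ (d + 1)" by (simp add: assms(2) algebra_simps)
 also have "\<dots> <= d' * b ^ d'" using assms by (intro mult_le_mono2 power_increasing) auto
 finally show ?thesis .
qed

text \<open>Distributes the total range over the rows and restates it for codes. A row that starts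
  with infinity contributes 0, since by monotonicity it has no finite entry.\<close>

lemma total_range_rows:
 assumes B: "B \<in> carrier_mat q r" and q: "0 < q" "0 < r" and mono: "monotone_mat B"
  and ent: "!!k j. k < q ==> j < r ==> B $$ (k, j) = Pinf \<or> (EX z. B $$ (k, j) = Fin z & \<bar>z\<bar> < 2 ^ h)"
 obtains R :: "nat => nat" where "!!k j. k < q ==> j < r ==> enc h (B $$ (k, j)) <= enc h (B $$ (k, 0)) + R k \<or> enc h (B $$ (k, j)) = 2 ^ (h + 2)"
  "int (\<Sum>k<q. R k) = total_range B"
proof -
 have dims: "dim_row B = q" "dim_col B = r" using B by auto
 define S where "S k = {z. EX j<r. B $$ (k, j) = Fin z}" for k
 have fin: "finite (S k)" for k
 proof -
  have "S k \<subseteq> (%j. case B $$ (k, j) of Fin z => z | _ => 0) ` {..<r}" by (force simp: S_def)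
  then show ?thesis using finite_surj by blast
 qed
 define t where "t k = (case B $$ (k, 0) of Fin b => Max (S k) - b + 1 | _ => 0)" for k
 have t0: "0 <= t k" for k
 proof (cases "B $$ (k, 0)")
  case (Fin b)
  then have "b \<in> S k" using q by (auto simp: S_def)
  then have "b <= Max (S k)" using fin by simp
  then show ?thesis using Fin by (simp add: t_def)
 qed (simp_all add: t_def)
 show ?thesis
 proof (rule that[of "%k. nat (t k)"])
  have "int (\<Sum>k<q. nat (t k)) = (\<Sum>k<q. t k)" using t0 by simp
  also have "\<dots> = total_range B" unfolding total_range_def t_def S_def dims by simp
  finally show "int (\<Sum>k<q. nat (t k)) = total_range B" .
 next
  fix k j assume kj: "k < q" "j < r"
  show "enc h (B $$ (k, j)) <= enc h (B $$ (k, 0)) + nat (t k) \<or> enc h (B $$ (k, j)) = 2 ^ (h + 2)"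
  proof (cases "B $$ (k, j) = Pinf")
   case True
   then show ?thesis by (simp add: enc_def)
  next
   case False
   then obtain z where z: "B $$ (k, j) = Fin z" using ent[OF kj] by blast
   have "B $$ (k, 0) <= B $$ (k, j)" using mono kj B q by (auto simp: monotone_mat_def)
   then obtain b where b: "B $$ (k, 0) = Fin b" "b <= z" using z ent[OF kj(1) q(2)] by auto
   have "z \<in> S k" using z kj by (auto simp: S_def)
   then have "z <= Max (S k)" using fin by simp
   then have "z - b <= t k" using b by (simp add: t_def)
   then have "nat (2 ^ h + z) <= nat (2 ^ h + b) + nat (t k)" by linarith
   then show ?thesis using z b by (simp add: enc_def)
  qed
 qed
qed

lemma real_div_le: "0 < c ==> real (a div c) <= real a / real c" for a c :: nat
 by (simp add: pos_le_divide_eq flip: of_nat_mult)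

text \<open>Everything is compared with powers of \<open>y = 2 ^ b\<close>, which exceeds
  \<open>n\<close>, so that a constant \<open>m\<close> puts all sizes below
  \<open>N = y ^ m\<close>. The factor 10 in the word length provides
  \<open>N ^ 10 <= 2 ^ w\<close>.\<close>

lemma inst_setup:
 fixes n d d' k m kb :: nat
 assumes n: "1 <= n" and \<beta>: "0 <= \<beta>" "\<beta> <= real kb" and q: "q = nat \<lfloor>real n powr \<beta>\<rfloor>" and d': "d' = d + 6 + k" and m: "kb + 2 * d' + 12 <= m"
  and A: "A \<in> carrier_mat n q" "B \<in> carrier_mat q n" "valid_entries d n A" "valid_entries d n B" and b: "b = floorlog 2 n"
 shows "inst (10 * m * b) (2 ^ (m * b)) b (entry_bits d' n + 1) n d d' m n q n (entry_bits d n + 1) (b * (entry_bits d n + 1)) A B"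
  "5 + (n * q + q * n) * (entry_bits d' n + 2) < 2 ^ (m * b)" "5 + n * n * (entry_bits d' n + 2) < 2 ^ (m * b)"
  "n * q * n < 2 ^ (m * b)" "Suc n < 2 ^ (m * b)"
proof -
 define N :: nat where "N = 2 ^ (m * b)"
 define y :: nat where "y = 2 ^ b"
 define L where "L = entry_bits d' n + 1"
 have b1: "1 <= b" using floorlog_pow(3)[OF n] b by simp
 have y2: "2 <= y" unfolding y_def using b1 power_increasing[of 1 b "2::nat"] by simp
 have ny: "n < y" using floorlog_pow(2)[of n] by (simp add: y_def b)
 have Ny: "N = y ^ m" by (simp add: N_def y_def mult.commute flip: power_mult)
 have pw: "x < N" if "x < y ^ j" "j <= m" for x j
  unfolding Ny using that power_increasing[of j m y] y2 by linarith
 have y8: "8 <= y ^ 3" using power_mono[OF y2, of 3] by simp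
 have eL: "L + 1 <= y ^ (2 * d' + 2)" using entry_bits_pow[OF b1, of d'] by (simp add: L_def entry_bits_def b y_def)
 have q1: "1 <= q" "q <= y ^ kb"
 proof -
  show "1 <= q" unfolding q by (rule floor_powr_bounds(1)[OF n \<beta>(1)])
  have "real q <= real n powr \<beta>" unfolding q by (rule floor_powr_bounds(2)[OF n \<beta>(1)])
  also have "\<dots> <= real n powr real kb" using \<beta> n by (intro powr_mono) auto
  also have "\<dots> = real (n ^ kb)" using n by (simp add: powr_realpow)
  also have "\<dots> <= real (y ^ kb)" using ny by (intro of_nat_mono power_mono) auto
  finally show "q <= y ^ kb" by simp
 qed
 have nq: "n * q <= y ^ (kb + 1)" using mult_le_mono[of n y q "y ^ kb"] ny q1 by simp
 have big: "5 + 2 * Y < y ^ 3 * Y" if "1 <= Y" for Y :: nat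
 proof -
  have "8 * Y <= y ^ 3 * Y" using y8 by (rule mult_le_mono1)
  then show ?thesis using that by linarith
 qed
 have s1: "5 + (n * q + q * n) * (L + 1) < N"
 proof (rule pw[of _ "kb + 2 * d' + 6"])
  have "n * q * (L + 1) <= y ^ (kb + 1) * y ^ (2 * d' + 2)" using nq eL by (rule mult_le_mono)
  then have "(n * q + q * n) * (L + 1) <= 2 * (y ^ (kb + 1) * y ^ (2 * d' + 2))" by (simp add: algebra_simps)
  moreover have "1 <= y ^ (kb + 1) * y ^ (2 * d' + 2)" using y2 by simp
  ultimately have "5 + (n * q + q * n) * (L + 1) < y ^ 3 * (y ^ (kb + 1) * y ^ (2 * d' + 2))" using big by (meson add_left_mono le_less_trans)
  also have "\<dots> = y ^ (kb + 2 * d' + 6)" by (simp only: power_add[symmetric] mult.assoc[symmetric]) (simp add: algebra_simps)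
  finally show "5 + (n * q + q * n) * (L + 1) < y ^ (kb + 2 * d' + 6)" .
 qed (use m in simp)
 have s2: "5 + n * n * (L + 1) < N"
 proof (rule pw[of _ "2 * d' + 7"])
  have "n * n <= y ^ 2" unfolding power2_eq_square using ny by (intro mult_le_mono) auto
  then have "n * n * (L + 1) <= y ^ 2 * y ^ (2 * d' + 2)" using eL by (rule mult_le_mono)
  moreover have "1 <= y ^ 2 * y ^ (2 * d' + 2)" using y2 by simp
  ultimately have "5 + n * n * (L + 1) < y ^ 3 * (y ^ 2 * y ^ (2 * d' + 2))" using big[of "y ^ 2 * y ^ (2 * d' + 2)"] by linarith
  also have "\<dots> = y ^ (2 * d' + 7)" by (simp only: power_add[symmetric] mult.assoc[symmetric]) (simp add: algebra_simps)
  finally show "5 + n * n * (L + 1) < y ^ (2 * d' + 7)" .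
 qed (use m in simp)
 have s3: "n * q * n < N"
 proof (rule pw[of _ "kb + 3"])
  have "n * q * n <= y ^ (kb + 1) * y" using nq ny by (intro mult_le_mono) auto
  also have "\<dots> = y ^ (kb + 2)" by simp
  also have "\<dots> < y ^ (kb + 3)" using y2 by (intro power_strict_increasing) auto
  finally show "n * q * n < y ^ (kb + 3)" .
 qed (use m in simp)
 have yN: "y ^ 3 <= N" "y ^ 7 <= N" unfolding Ny using y2 m by (auto intro!: power_increasing)
 have y23: "y ^ 2 < y ^ 3" using y2 by (intro power_strict_increasing) auto
 have yy: "2 * y <= y ^ 2" using y2 by (simp add: power2_eq_square)
 have s4: "Suc n < N" using ny yy y23 yN y2 by linarith
 have "128 <= y ^ 7" using power_mono[OF y2, of 7] by simp
 then have N128: "128 <= N" using yN by linarith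
 have LN: "L < N"
 proof (rule pw[of _ "2 * d' + 2"])
  show "L < y ^ (2 * d' + 2)" using eL by simp
 qed (use m in simp)
 have gap: "b * (entry_bits d n + 1) + 5 <= entry_bits d' n" using entry_bits_gap[OF b1 d'] by (simp add: entry_bits_def b)
 have eh: "entry_bits d n <= b * (entry_bits d n + 1)" using b1 by (cases b) auto
 have bL: "L <= b * L" using b1 by simp
 have m1: "1 <= m" using m by simp
 have mb: "1 <= m * b" using m1 b1 by simp
 have le10: "m <= 10 * m * b" using b1 by (cases b) auto
 interpret K: bigm "10 * m * b" N b L
 proof unfold_locales
  show "128 <= N" by fact
  show "24 < N" using N128 by simp
  show "N ^ 10 <= 2 ^ (10 * m * b)" by (simp add: N_def mult_ac flip: power_mult)
  show "2 * 2 ^ b < N" using yy y23 yN by (simp add: y_def)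
  show "L < N" by fact
 qed (simp_all add: L_def)
 have hB: "2 ^ (b * (entry_bits d n + 1) + 4) < K.BL"
 proof -
  have "(2::nat) ^ (b * (entry_bits d n + 1) + 4) < 2 ^ (b * L)" using gap bL by (intro power_strict_increasing) (auto simp: L_def)
  then show ?thesis by (simp add: K.BL_def power_mult)
 qed
 have szz: "5 + (n * q + q * n) * (entry_bits d n + 1 + 1) < N" "5 + n * n * (entry_bits d n + 1 + 1) < N"
 proof -
  have l: "entry_bits d n + 1 + 1 <= L + 1" using eh gap by (simp add: L_def)
  show "5 + (n * q + q * n) * (entry_bits d n + 1 + 1) < N" using s1 mult_le_mono2[OF l, of "n * q + q * n"] by linarith
  show "5 + n * n * (entry_bits d n + 1 + 1) < N" using s2 mult_le_mono2[OF l, of "n * n"] by linarith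
 qed
 have "inst (10 * m * b) N b L n d d' m n q n (entry_bits d n + 1) (b * (entry_bits d n + 1)) A B"
 proof unfold_locales
  show "1 <= n" by fact
  show "b = floorlog 2 n" by fact
  show "L = entry_bits d' n + 1" by (simp add: L_def)
  show "N = 2 ^ (m * b)" by (simp add: N_def)
  show "m * b < 10 * m * b" using mb by simp
  show "m < 2 ^ (10 * m * b)" using le10 less_exp[of "10 * m * b"] by linarith
  show "A \<in> carrier_mat n q" "B \<in> carrier_mat q n" by fact+
  show "0 < n" "0 < q" using n q1 by auto
  show "valid_entries d n A" "valid_entries d n B" by fact+
  show "entry_bits d n + 1 <= L" using eh gap by (simp add: L_def)
  show "2 ^ (b * (entry_bits d n + 1) + 4) < K.BL" by fact
  show "n < N" using s4 by simp
  show "b * (entry_bits d n + 1) + 4 < N" using gap LN by (simp add: L_def)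
  show "5 + (n * q + q * n) * (entry_bits d n + 1 + 1) < N" "5 + n * n * (entry_bits d n + 1 + 1) < N" by fact+
 qed auto
 then show "inst (10 * m * b) (2 ^ (m * b)) b (entry_bits d' n + 1) n d d' m n q n (entry_bits d n + 1) (b * (entry_bits d n + 1)) A B"
  by (simp only: N_def L_def)
 have "entry_bits d' n + 2 = L + 1" by (simp add: L_def)
 then show "5 + (n * q + q * n) * (entry_bits d' n + 2) < 2 ^ (m * b)" "5 + n * n * (entry_bits d' n + 2) < 2 ^ (m * b)"
  using s1 s2 by (simp_all only: N_def)
 show "n * q * n < 2 ^ (m * b)" "Suc n < 2 ^ (m * b)" using s3 s4 by (simp_all only: N_def)
qed

lemma polylogs:
 assumes "0 < \<delta>"
 shows "\<exists>K\<ge>1. \<forall>n\<ge>1. real (floorlog 2 n) <= K * real n powr \<delta> & real (entry_bits d n + 2) <= K * real n powr \<delta> &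
  real (floorlog 2 n * (entry_bits d n + 1)) <= K * real n powr \<delta> & real (200 * (12 * (entry_bits d' n + 1) + 12)) <= K * real n powr \<delta> &
  real (6 * floorlog 2 n + 61) <= K * real n powr \<delta>"
proof -
 obtain K0 where K0: "1 <= K0" "!!n. n \<ge> 1 ==> real (floorlog 2 n) ^ (d + d' + 1) <= K0 * real n powr \<delta>"
  using polylog_bound[OF assms] by blast
 \<comment> \<open>Crude coefficients that cover the five estimates below at once.\<close>
 define M where "M = 5000 + 3000 * d' + d"
 define K where "K = real M * K0"
 have "1 * 1 <= real M * K0" using K0 by (intro mult_mono) (auto simp: M_def)
 then have "1 <= K" by (simp add: K_def)
 moreover have "real (floorlog 2 n) <= K * real n powr \<delta> & real (entry_bits d n + 2) <= K * real n powr \<delta> &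
  real (floorlog 2 n * (entry_bits d n + 1)) <= K * real n powr \<delta> & real (200 * (12 * (entry_bits d' n + 1) + 12)) <= K * real n powr \<delta> &
  real (6 * floorlog 2 n + 61) <= K * real n powr \<delta>" if n: "n \<ge> 1" for n
 proof -
  define b where "b = floorlog 2 n"
  define X where "X = b ^ (d + d' + 1)"
  have b: "1 <= b" using floorlog_pow(3)[OF n] by (simp add: b_def)
  have pw: "b ^ j <= X" if "j <= d + d' + 1" for j unfolding X_def using that b by (intro power_increasing) auto
  have X1: "1 <= X" using pw[of 0] by simp
  have Xb: "b <= X" using pw[of 1] by simp
  have d1: "d * b ^ d <= d * X" "d' * b ^ d' <= d' * X" "d * b ^ (d + 1) <= d * X" by (rule mult_le_mono2, rule pw, simp)+
  have up: "real a <= K * real n powr \<delta>" if "a <= M * X" for a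
  proof -
   have "real a <= real M * real X" using that by (simp flip: of_nat_mult)
   also have "\<dots> <= real M * (K0 * real n powr \<delta>)" using K0(2)[OF n] by (intro mult_left_mono) (auto simp: X_def b_def)
   finally show ?thesis by (simp add: K_def)
  qed
  have MX: "M * X = 5000 * X + 3000 * (d' * X) + d * X" by (simp add: M_def algebra_simps)
  have 1: "b <= M * X" using Xb unfolding MX by linarith
  have 2: "d * b ^ d + 2 <= M * X" using X1 d1 unfolding MX by linarith
  have 3: "b * (d * b ^ d + 1) <= M * X"
  proof -
   have "b * (d * b ^ d + 1) = d * b ^ (d + 1) + b" by (simp add: algebra_simps)
   then show ?thesis using Xb d1 unfolding MX by linarith
  qed
  have 4: "200 * (12 * (d' * b ^ d' + 1) + 12) <= M * X"
  proof -
   have "200 * (12 * (d' * b ^ d' + 1) + 12) = 2400 * (d' * b ^ d') + 4800" by simp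
   then show ?thesis using X1 d1 unfolding MX by linarith
  qed
  have 5: "6 * b + 61 <= M * X" using X1 Xb unfolding MX by linarith
  show ?thesis unfolding entry_bits_def b_def[symmetric] using up[OF 1] up[OF 2] up[OF 3] up[OF 4] up[OF 5] by blast
 qed
 ultimately show ?thesis by blast
qed

lemma wrp_time:
 fixes n :: nat
 assumes I: "inst w N b (entry_bits d' n + 1) n d d' m n q n (entry_bits d n + 1) (b * (entry_bits d n + 1)) A B"
  and core: "!!ts. inst.ready b (entry_bits d' n + 1) n n q n (entry_bits d n + 1) (b * (entry_bits d n + 1)) A B ts ==>
   runs w (bigm.U2 (entry_bits d' n + 1)) (bigm.R2 w N b (entry_bits d' n + 1)) C ts
    (%ts'. inst.ended n q n (entry_bits d n + 1) (b * (entry_bits d n + 1)) A B ts' & tm ts' <= tm ts + Tc)"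
  and K: "1 <= K" "1 <= y" "real b <= K * y" "real (entry_bits d n + 2) <= K * y" "real (b * (entry_bits d n + 1)) <= K * y"
   "real (200 * (12 * (entry_bits d' n + 1) + 12)) <= K * y"
  and W: "1 <= W" "real (n * q + q * n + n * n) <= 3 * W"
 shows "computes_within w (inst.wrp m d d' C) (encode_instance d n A B) (encode_mat d n (min_plus A B))
  ((200 * real (d + d' + 10) + 200) * K ^ 2 * y ^ 2 * (W + real Tc))"
proof -
 interpret inst w N b "entry_bits d' n + 1" n d d' m n q n "entry_bits d n + 1" "b * (entry_bits d n + 1)" A B by (rule I)
 let ?h = "b * (entry_bits d n + 1)"
 let ?PQ = "n * q + q * n + n * n"
 have U: "U2 = 200 * (12 * (entry_bits d' n + 1) + 12)" unfolding U2_def sz1_def by (rule refl)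
 have "computes_within w (wrp m d d' C) (encode_instance d n A B) (encode_mat d n (min_plus A B))
   (real (3 * b + 200 * (d + d' + 10) + 12 * (?PQ * (entry_bits d n + 1 + 1)) +
    U2 * (9 * ?h + 8 * (n * q) + 8 * (q * n) + 11 * (n * n) + Tc + 70) + 39))"
  by (rule wrp_computes) (rule core)
 then show ?thesis
 proof (rule computes_within_mono)
  have e2: "entry_bits d n + 1 + 1 = entry_bits d n + 2" by simp
  have "9 * ?h + 8 * (n * q) + 8 * (q * n) + 11 * (n * n) + Tc + 70 <= 9 * ?h + 11 * ?PQ + Tc + 70" by simp
  then have "3 * b + 200 * (d + d' + 10) + 12 * (?PQ * (entry_bits d n + 1 + 1)) + U2 * (9 * ?h + 8 * (n * q) + 8 * (q * n) + 11 * (n * n) + Tc + 70) + 39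
   <= 3 * b + 200 * (d + d' + 10) + 12 * (?PQ * (entry_bits d n + 2)) + U2 * (9 * ?h + 11 * ?PQ + Tc + 70) + 39"
   unfolding e2 by (intro add_right_mono add_left_mono) (rule mult_le_mono2)
  then have "real (3 * b + 200 * (d + d' + 10) + 12 * (?PQ * (entry_bits d n + 1 + 1)) + U2 * (9 * ?h + 8 * (n * q) + 8 * (q * n) + 11 * (n * n) + Tc + 70) + 39)
   <= real (3 * b + 200 * (d + d' + 10) + 12 * (?PQ * (entry_bits d n + 2)) + U2 * (9 * ?h + 11 * ?PQ + Tc + 70) + 39)"
   by (rule of_nat_mono)
  also have "\<dots> = 3 * real b + 200 * real (d + d' + 10) + 12 * (real ?PQ * real (entry_bits d n + 2)) + real U2 * (9 * real ?h + 11 * real ?PQ + real Tc + 70) + 39"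
   by (simp only: of_nat_add of_nat_mult of_nat_numeral)
  also have "\<dots> <= (200 * real (d + d' + 10) + 200) * K ^ 2 * y ^ 2 * (W + real Tc)"
   by (rule total_bound) (use K W in \<open>simp_all only: U of_nat_0_le_iff\<close>)
  finally show "real (3 * b + 200 * (d + d' + 10) + 12 * (?PQ * (entry_bits d n + 1 + 1)) + U2 * (9 * ?h + 8 * (n * q) + 8 * (q * n) + 11 * (n * n) + Tc + 70) + 39)
   <= (200 * real (d + d' + 10) + 200) * K ^ 2 * y ^ 2 * (W + real Tc)" .
 qed
qed

section \<open>Bounds on the two exponents\<close>

lemma brute_force_exponent:
 assumes \<beta>: "0 <= \<beta>"
 shows "bounded_product_in_time 1 \<beta> 1 \<theta> (2 + \<beta>)"
 unfolding bounded_product_in_time_def soft_O_time_def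
proof (intro allI impI)
 fix d :: nat and \<epsilon> :: real assume \<epsilon>: "0 < \<epsilon>"
 define d' where "d' = d + 6 + 0"
 define kb where "kb = nat \<lceil>\<beta>\<rceil>"
 have kb: "\<beta> <= real kb" unfolding kb_def by (rule real_nat_ceiling_ge)
 define m where "m = kb + 2 * d' + 12"
 have e2: "0 < \<epsilon> / 2" using \<epsilon> by simp
 obtain K where K: "1 <= K" "!!n. n \<ge> 1 ==> real (floorlog 2 n) <= K * real n powr (\<epsilon> / 2) & real (entry_bits d n + 2) <= K * real n powr (\<epsilon> / 2) &
  real (floorlog 2 n * (entry_bits d n + 1)) <= K * real n powr (\<epsilon> / 2) & real (200 * (12 * (entry_bits d' n + 1) + 12)) <= K * real n powr (\<epsilon> / 2) &
  real (6 * floorlog 2 n + 61) <= K * real n powr (\<epsilon> / 2)" using polylogs[OF e2, of d d'] by blast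
 define KK where "KK = (200 * real (d + d' + 10) + 200) * K ^ 2 * 21"
 show "\<exists>P c K. \<forall>n\<ge>1. \<forall>(xs, ys)\<in>min_plus_problem 1 \<beta> 1
   (%n A B. \<forall>x\<in>elements_mat A. x = Pinf \<or> (EX z. x = Fin z & \<bar>real_of_int z\<bar> <= real n powr \<theta>)) d n.
   computes_within (c * floorlog 2 n) P xs ys (K * real n powr (2 + \<beta> + \<epsilon>))"
 proof (rule exI[of _ "inst.wrp m d d' bigm.brt"], rule exI[of _ "10 * m"], rule exI[of _ KK], intro allI impI ballI, clarify)
  fix n :: nat and xs ys assume n: "1 <= n"
   and "(xs, ys) \<in> min_plus_problem 1 \<beta> 1 (%n A B. \<forall>x\<in>elements_mat A. x = Pinf \<or> (EX z. x = Fin z & \<bar>real_of_int z\<bar> <= real n powr \<theta>)) d n"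
  then obtain A B where AB: "xs = encode_instance d n A B" "ys = encode_mat d n (min_plus A B)" "A \<in> carrier_mat n (nat \<lfloor>real n powr \<beta>\<rfloor>)"
   "B \<in> carrier_mat (nat \<lfloor>real n powr \<beta>\<rfloor>) n" "valid_entries d n A" "valid_entries d n B"
   by (auto simp: min_plus_problem_def)
  define q where "q = nat \<lfloor>real n powr \<beta>\<rfloor>"
  define b where "b = floorlog 2 n"
  note I = inst_setup(1)[OF n \<beta> kb q_def d'_def _ AB(3,4)[folded q_def] AB(5,6) b_def, of m]
  have I': "inst (10 * m * b) (2 ^ (m * b)) b (entry_bits d' n + 1) n d d' m n q n (entry_bits d n + 1) (b * (entry_bits d n + 1)) A B"
   by (rule I) (simp add: m_def)
  let ?y = "real n powr (\<epsilon> / 2)" and ?W = "real n powr (2 + \<beta>)"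
  have x1: "1 <= real n" using n by simp
  have y1: "1 <= ?y" "1 <= ?W" using x1 \<epsilon> \<beta> by (auto intro!: ge_one_powr_ge_zero)
  have qW: "real q <= real n powr \<beta>" unfolding q_def by (rule floor_powr_bounds(2)[OF n \<beta>])
  have nn: "real (n * n) = real n powr 2" using n by (simp add: powr_realpow[of _ 2, simplified] power2_eq_square)
  have nnW: "real (n * n) <= ?W" unfolding nn using x1 \<beta> by (intro powr_mono) auto
  have nnq: "real (n * n * q) <= ?W"
   unfolding of_nat_mult[of "n * n"] nn powr_add using qW by (intro mult_left_mono) auto
  have nq: "real (n * q) <= ?W"
  proof -
   have "n * q * 1 <= n * q * n" using n by (intro mult_le_mono2)
   then have "n * q <= n * n * q" by (simp add: ac_simps)
   then show ?thesis using nnq by (meson of_nat_mono order_trans)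
  qed
  have PQ: "real (n * q + q * n + n * n) <= 3 * ?W" using nq nnW by (simp add: mult.commute)
  define Tc where "Tc = n * n * (7 * q + 10) + 3"
  have Tc: "real Tc <= 20 * ?W"
  proof -
   have "real Tc = 7 * real (n * n * q) + 10 * real (n * n) + 3" by (simp add: Tc_def algebra_simps)
   then show ?thesis using nnq nnW y1 by linarith
  qed
  have "computes_within (10 * m * b) (inst.wrp m d d' bigm.brt) xs ys ((200 * real (d + d' + 10) + 200) * K ^ 2 * ?y ^ 2 * (?W + real Tc))"
   unfolding AB(1,2)
   by (rule wrp_time[OF I']) (use K(1) K(2)[OF n] y1 PQ inst.runs_brt_core[OF I'] in \<open>auto simp: Tc_def b_def simp del: of_nat_add of_nat_mult\<close>)
  then show "computes_within (10 * m * floorlog 2 n) (inst.wrp m d d' bigm.brt) xs ys (KK * real n powr (2 + \<beta> + \<epsilon>))"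
   unfolding b_def
  proof (rule computes_within_mono)
   have "(200 * real (d + d' + 10) + 200) * K ^ 2 * ?y ^ 2 * (?W + real Tc) <= (200 * real (d + d' + 10) + 200) * K ^ 2 * ?y ^ 2 * (21 * ?W)"
    using Tc by (intro mult_left_mono) auto
   also have "\<dots> = KK * (?y ^ 2 * ?W)" by (simp add: KK_def)
   also have "?y ^ 2 * ?W = real n powr (2 + \<beta> + \<epsilon>)" by (simp add: power2_eq_square powr_add[symmetric] algebra_simps)
   finally show "(200 * real (d + d' + 10) + 200) * K ^ 2 * ?y ^ 2 * (?W + real Tc) <= KK * real n powr (2 + \<beta> + \<epsilon>)" .
  qed
 qed
qed

lemma soft_O_time_mono:
 assumes "soft_O_time prob e" "e <= e'"
 shows "soft_O_time prob e'"
 unfolding soft_O_time_def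
proof (intro allI impI)
 fix \<epsilon> :: real assume "0 < \<epsilon>"
 then obtain P c K where P: "!!n xs ys. n \<ge> 1 ==> (xs, ys) \<in> prob n ==> computes_within (c * floorlog 2 n) P xs ys (K * real n powr (e + \<epsilon>))"
  using assms(1) unfolding soft_O_time_def by fast
 have "K * real n powr (e + \<epsilon>) <= \<bar>K\<bar> * real n powr (e' + \<epsilon>)" if "n \<ge> 1" for n
  using that assms(2) by (intro mult_mono powr_mono) auto
 then show "\<exists>P c K. \<forall>n\<ge>1. \<forall>(xs, ys)\<in>prob n. computes_within (c * floorlog 2 n) P xs ys (K * real n powr (e' + \<epsilon>))"
  using P computes_within_mono by (intro exI[of _ P] exI[of _ c] exI[of _ "\<bar>K\<bar>"]) blast
qed

text \<open>Lets an infimum of feasible exponents be approached from above, whether or not it is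
  attained.\<close>

lemma soft_O_time_closed:
 assumes "!!x. 0 < x ==> soft_O_time prob (e + x)"
 shows "soft_O_time prob e"
 unfolding soft_O_time_def
proof (intro allI impI)
 fix \<epsilon> :: real assume "0 < \<epsilon>"
 then have h: "0 < \<epsilon> / 2" by simp
 have eq: "e + \<epsilon> / 2 + \<epsilon> / 2 = e + \<epsilon>" by simp
 have "\<exists>P c K. \<forall>n\<ge>1. \<forall>(xs, ys)\<in>prob n. computes_within (c * floorlog 2 n) P xs ys (K * real n powr (e + \<epsilon> / 2 + \<epsilon> / 2))"
  using assms[OF h] h unfolding soft_O_time_def by blast
 then show "\<exists>P c K. \<forall>n\<ge>1. \<forall>(xs, ys)\<in>prob n. computes_within (c * floorlog 2 n) P xs ys (K * real n powr (e + \<epsilon>))"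
  unfolding eq .
qed

text \<open>The exponents that compete are \<open>1 + \<beta> + \<eta> - \<theta>\<close> for the
  pieces, \<open>sg + e\<close> for the pivot products and \<open>2 + \<beta> - sg\<close> for the
  enumeration; the last two agree for \<open>sg = (2 + \<beta> - e) / 2\<close>.\<close>

lemma monotone_product_upper:
 assumes \<beta>: "0 <= \<beta>" and \<theta>: "0 <= \<theta>" "\<theta> <= \<eta>" and bp: "bounded_product_in_time 1 \<beta> 1 \<theta> e"
  and e: "1 + \<beta> <= e" "2 <= e" "e <= 2 + \<beta>"
 shows "monotone_product_in_time 1 \<beta> 1 \<eta> (max (1 + \<beta> + \<eta> - \<theta>) (1 / 2 * (2 + \<beta> + e)))"
 unfolding monotone_product_in_time_def soft_O_time_def
proof (intro allI impI)
 fix d :: nat and C \<epsilon> :: real assume \<epsilon>: "0 < \<epsilon>"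
 \<comment> \<open>Four factors \<open>n powr x\<close> will accumulate: one for the rational
   exponents and the slack of the given program, one for the polylogarithm inside the core, and two
   for those of the surrounding program.\<close>
 define x where "x = \<epsilon> / 4"
 have x: "0 < x" using \<epsilon> by (simp add: x_def)
 define F where "F = max (1 + \<beta> + \<eta> - \<theta>) (1 / 2 * (2 + \<beta> + e))"
 have F: "1 + \<beta> + \<eta> - \<theta> <= F" "1 / 2 * (2 + \<beta> + e) <= F" "1 + \<beta> <= F" "2 <= F"
 proof -
  have "1 + \<beta> <= 1 + \<beta> + \<eta> - \<theta>" "2 <= 1 / 2 * (2 + \<beta> + e)" using \<theta> e \<beta> by simp_all
  then show "1 + \<beta> + \<eta> - \<theta> <= F" "1 / 2 * (2 + \<beta> + e) <= F" "1 + \<beta> <= F" "2 <= F" unfolding F_def by linarith+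
 qed
 define sg where "sg = (2 + \<beta> - e) / 2"
 have sg: "0 <= sg" using e by (simp add: sg_def)
 define k where "k = nat \<lceil>\<theta>\<rceil>"
 define kb where "kb = nat \<lceil>\<beta>\<rceil>"
 have kb: "\<beta> <= real kb" unfolding kb_def by (rule real_nat_ceiling_ge)
 have k: "\<theta> <= real k" unfolding k_def by (rule real_nat_ceiling_ge)
 define d' where "d' = d + 6 + k"
 \<comment> \<open>A denominator fine enough that rounding an exponent down loses at most
   \<open>x\<close>.\<close>
 define qq where "qq = nat \<lceil>1 / x\<rceil>"
 have "1 / x <= real qq" unfolding qq_def by (rule real_nat_ceiling_ge)
 moreover have "0 < 1 / x" using x by simp
 ultimately have rq: "0 < real qq" by linarith
 then have qq: "0 < qq" by simp
 have qx: "1 / real qq <= x" using \<open>1 / x <= real qq\<close> x rq by (simp add: field_simps)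
 define pp where "pp = nat \<lfloor>\<theta> * real qq\<rfloor>"
 define p2 where "p2 = nat \<lfloor>sg * real qq\<rfloor>"
 define s where "s = real pp / real qq"
 define s2 where "s2 = real p2 / real qq"
 have s: "\<theta> - x <= s" "s <= \<theta>" "sg - x <= s2" "s2 <= sg"
  using rational_below[OF qq qx \<theta>(1)] rational_below[OF qq qx sg] by (auto simp: s_def s2_def pp_def p2_def)
 have ppk: "pp <= k * qq"
 proof -
  have "real pp = s * real qq" using rq by (simp add: s_def)
  also have "\<dots> <= real k * real qq" using s k rq by (intro mult_right_mono) auto
  finally show ?thesis by (simp flip: of_nat_mult)
 qed
 obtain P c K where P: "!!n xs ys. n \<ge> 1 ==> (xs, ys) \<in> min_plus_problem 1 \<beta> 1
   (%n A B. \<forall>x\<in>elements_mat A. x = Pinf \<or> (EX z. x = Fin z & \<bar>real_of_int z\<bar> <= real n powr \<theta>)) d' n ==>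
   computes_within (c * floorlog 2 n) P xs ys (K * real n powr (e + x))"
  using bp x unfolding bounded_product_in_time_def soft_O_time_def by fast
 \<comment> \<open>The first summands meet \<open>inst_setup\<close>; the bracket puts the program
   constants and the powers \<open>2 ^ \<delta>2\<close> and \<open>2 ^ (c * b)\<close> below
   \<open>N\<close>.\<close>
 define m where "m = kb + 2 * d' + 12 + (pp + p2 + qq + c + 2)"
 obtain Kp where Kp: "1 <= Kp" "!!n. n \<ge> 1 ==> real (floorlog 2 n) <= Kp * real n powr x & real (entry_bits d n + 2) <= Kp * real n powr x &
  real (floorlog 2 n * (entry_bits d n + 1)) <= Kp * real n powr x & real (200 * (12 * (entry_bits d' n + 1) + 12)) <= Kp * real n powr x &
  real (6 * floorlog 2 n + 61) <= Kp * real n powr x" using polylogs[OF x, of d d'] by blast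
 define c1 where "c1 = 2 * 2 powr \<theta>"
 define c2 where "c2 = 2 * 2 powr sg"
 have c12: "0 <= c1" "0 <= c2" by (simp_all add: c1_def c2_def)
 define a1 where "a1 = real (3 * pp + 3 * p2 + 3 * c + 69)"
 define KT where "KT = a1 + (\<bar>C\<bar> * c1 + 2) + 60 + (5 * \<bar>K\<bar> + 60) + 6 * c2"
 have a1: "0 <= a1" by (simp add: a1_def)
 have KT: "0 <= KT" using a1 c12 by (simp add: KT_def)
 define KK where "KK = (200 * real (d + d' + 10) + 200) * Kp ^ 2 * (1 + KT * Kp)"
 show "\<exists>P c K. \<forall>n\<ge>1. \<forall>(xs, ys)\<in>min_plus_problem 1 \<beta> 1
   (%n A B. monotone_mat B & real_of_int (total_range B) <= C * real n powr (\<beta> + \<eta>)) d n.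
   computes_within (c * floorlog 2 n) P xs ys (K * real n powr (max (1 + \<beta> + \<eta> - \<theta>) (1 / 2 * (2 + \<beta> + e)) + \<epsilon>))"
  unfolding F_def[symmetric]
 proof (rule exI[of _ "inst.wrp m d d' (bigm.mcore pp p2 qq c P)"], rule exI[of _ "10 * m"], rule exI[of _ KK], intro allI impI ballI, clarify)
  fix n :: nat and xs ys assume n: "1 <= n"
   and "(xs, ys) \<in> min_plus_problem 1 \<beta> 1 (%n A B. monotone_mat B & real_of_int (total_range B) <= C * real n powr (\<beta> + \<eta>)) d n"
  then obtain A B where AB: "xs = encode_instance d n A B" "ys = encode_mat d n (min_plus A B)" "A \<in> carrier_mat n (nat \<lfloor>real n powr \<beta>\<rfloor>)"
   "B \<in> carrier_mat (nat \<lfloor>real n powr \<beta>\<rfloor>) n" "valid_entries d n A" "valid_entries d n B" "monotone_mat B"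
   "real_of_int (total_range B) <= C * real n powr (\<beta> + \<eta>)"
   by (auto simp: min_plus_problem_def)
  define q where "q = nat \<lfloor>real n powr \<beta>\<rfloor>"
  define b where "b = floorlog 2 n"
  define L where "L = entry_bits d' n + 1"
  define h where "h = b * (entry_bits d n + 1)"
  define N :: nat where "N = 2 ^ (m * b)"
  have mm: "kb + 2 * d' + 12 <= m" by (simp add: m_def)
  note I0 = inst_setup[OF n \<beta> kb q_def d'_def mm AB(3,4)[folded q_def] AB(5,6) b_def]
  have I: "inst (10 * m * b) N b L n d d' m n q n (entry_bits d n + 1) h A B" using I0(1) by (simp only: N_def L_def h_def)
  interpret I: inst "10 * m * b" N b L n d d' m n q n "entry_bits d n + 1" h A B by (rule I)
  have b1: "1 <= b" using I.b0 by simp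
  define \<delta> where "\<delta> = ((b - 1) * pp) div qq"
  define \<delta>2 where "\<delta>2 = ((b - 1) * p2) div qq"
  have smallN: "a < N" if "a < 2 ^ (b * j)" "j <= m" for a j
  proof -
   have "(2::nat) ^ (b * j) <= N" unfolding N_def using that(2) by (intro power_increasing) (auto simp: mult.commute)
   then show ?thesis using that(1) by simp
  qed
  have self: "j < 2 ^ (b * j)" for j
  proof -
   have "j < 2 ^ j" by (rule less_exp)
   also have "(2::nat) ^ j <= 2 ^ (b * j)" using b1 by (intro power_increasing) auto
   finally show ?thesis .
  qed
  have cN: "pp < N" "p2 < N" "qq < N" "c < N" by (rule smallN[OF self]; simp add: m_def)+
  have dle: "((b - 1) * j) div qq <= b * j" for j
  proof -
   have "((b - 1) * j) div qq <= (b - 1) * j" by (rule div_le_dividend)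
   also have "\<dots> <= b * j" by (intro mult_le_mono1) simp
   finally show ?thesis .
  qed
  have dN: "\<delta> < N" "\<delta>2 < N" "c * b < N"
  proof -
   have "b * pp < 2 ^ (b * pp)" "b * p2 < 2 ^ (b * p2)" "c * b < 2 ^ (b * c)" using less_exp by (simp_all add: mult.commute)
   then have 1: "\<delta> < 2 ^ (b * pp)" "\<delta>2 < 2 ^ (b * p2)" "c * b < 2 ^ (b * c)" using dle[of pp] dle[of p2] unfolding \<delta>_def \<delta>2_def by linarith+
   show "\<delta> < N" "\<delta>2 < N" "c * b < N" by (rule smallN[OF 1(1)], simp add: m_def, rule smallN[OF 1(2)], simp add: m_def, rule smallN[OF 1(3)], simp add: m_def)
  qed
  have big2: "2 ^ a < N" if "a <= b * j" "j < m" for a j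
  proof -
   have "b * j < b * m" using that b1 by simp
   with that(1) have "a < b * m" by (rule le_less_trans)
   then have "a < m * b" by (simp add: mult.commute)
   then show ?thesis unfolding N_def by (intro power_strict_increasing) auto
  qed
  have d2N: "2 ^ \<delta>2 < N" "2 ^ (c * b) < N"
   using big2[OF dle[of p2]] big2[of "c * b" c] by (auto simp: \<delta>2_def m_def mult.commute)
  have dk: "\<delta> <= b * k"
  proof -
   have "(b - 1) * pp <= b * (k * qq)" using ppk by (intro mult_le_mono) auto
   then have "\<delta> <= (b * (k * qq)) div qq" unfolding \<delta>_def by (rule div_le_mono)
   also have "b * (k * qq) div qq = b * k" using qq by (simp add: mult.assoc[symmetric])
   finally show ?thesis .
  qed
  have gap: "h + 5 + \<delta> <= entry_bits d' n"
   using entry_bits_gap[OF b1 d'_def] dk by (simp add: h_def entry_bits_def b_def mult.commute)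
  have XD: "2 ^ (h + 4) + 2 ^ \<delta> < I.BL"
  proof -
   have "(2::nat) ^ (h + 4) <= 2 ^ (h + 4 + \<delta>)" "(2::nat) ^ \<delta> <= 2 ^ (h + 4 + \<delta>)" by (intro power_increasing; simp)+
   moreover have "(2::nat) ^ (h + 5 + \<delta>) = 2 ^ (h + 4 + \<delta>) + 2 ^ (h + 4 + \<delta>)" by (simp add: power_add)
   ultimately have "2 ^ (h + 4) + 2 ^ \<delta> <= (2::nat) ^ (h + 5 + \<delta>)" by linarith
   also have "\<dots> < 2 ^ (b * L)"
   proof (intro power_strict_increasing)
    have "L <= b * L" using b1 by simp
    then show "h + 5 + \<delta> < b * L" using gap by (simp add: L_def)
   qed simp
   finally show ?thesis by (simp add: I.BL_def power_mult)
  qed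
  let ?X = "real n"
  have X1: "1 <= ?X" using n by simp
  have pb: "2 ^ \<delta> <= ?X powr s" "?X powr s <= (2 * 2 powr s) * 2 ^ \<delta>"
   using power_two_bounds[OF n qq, of \<delta> pp s] by (auto simp: \<delta>_def b_def s_def)
  have pb2: "2 ^ \<delta>2 <= ?X powr s2" "?X powr s2 <= (2 * 2 powr s2) * 2 ^ \<delta>2"
   using power_two_bounds[OF n qq, of \<delta>2 p2 s2] by (auto simp: \<delta>2_def b_def s2_def)
  define T where "T = K * ?X powr (e + x)"
  have PM: "computes_within (c * b) P (encode_instance d' n M1 M2) (encode_mat d' n (min_plus M1 M2)) T"
   if M: "M1 \<in> carrier_mat n q" "M2 \<in> carrier_mat q n" "valid_entries d' n M1" "valid_entries d' n M2"
    and sm: "!!x. x \<in> elements_mat M1 ==> x = Pinf \<or> (EX z. x = Fin z & 0 <= z & z < 2 ^ \<delta>)" for M1 M2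
   unfolding b_def T_def
  proof (rule P[OF n])
   \<comment> \<open>Here it matters that \<open>s\<close> approximates \<open>\<theta>\<close> from
     below: entries below \<open>2 ^ \<delta>\<close> must obey the bound
     \<open>n powr \<theta>\<close>.\<close>
   have bd: "x = Pinf \<or> (EX z. x = Fin z & \<bar>real_of_int z\<bar> <= ?X powr \<theta>)" if "x \<in> elements_mat M1" for x
   proof -
    have "\<bar>real_of_int z\<bar> <= ?X powr \<theta>" if "0 <= z" "z < 2 ^ \<delta>" for z
    proof -
     have "real_of_int z <= real_of_int (2 ^ \<delta>)" using that by (intro of_int_le_iff[THEN iffD2]) simp
     also have "\<dots> <= ?X powr s" using pb(1) by simp
     also have "\<dots> <= ?X powr \<theta>" using s(2) X1 by (intro powr_mono) auto
     finally show ?thesis using that by simp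
    qed
    then show ?thesis using sm[OF that] by blast
   qed
   show "(encode_instance d' n M1 M2, encode_mat d' n (min_plus M1 M2)) \<in> min_plus_problem 1 \<beta> 1
    (%n A B. \<forall>x\<in>elements_mat A. x = Pinf \<or> (EX z. x = Fin z & \<bar>real_of_int z\<bar> <= real n powr \<theta>)) d' n"
    unfolding min_plus_problem_def using M bd by (auto simp: q_def)
  qed
  \<comment> \<open>Any admissible instance shows \<open>c\<close> to be nonzero, since its first
    word \<open>n >= 1\<close> has to fit into \<open>c * b\<close> bits.\<close>
  have bc: "b <= c * b"
  proof -
   let ?M1 = "mat n q (%_. Pinf) :: matrix" and ?M2 = "mat q n (%_. Pinf) :: matrix"
   have el: "y = Pinf" if "y \<in> elements_mat ?M1 \<or> y \<in> elements_mat ?M2" for y using that by (auto dest!: elements_matD)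
   have "computes_within (c * b) P (encode_instance d' n ?M1 ?M2) (encode_mat d' n (min_plus ?M1 ?M2)) T"
    by (rule PM) (use el in \<open>auto simp: valid_entries_def\<close>)
   then have "n < 2 ^ (c * b)" by (auto simp: computes_within_def encode_instance_def)
   then have "c ~= 0" using n by (cases "c = 0") auto
   then show ?thesis by (cases c) auto
  qed
  obtain R :: "nat => nat" where R: "!!k j. k < q ==> j < n ==> enc h (B $$ (k, j)) <= enc h (B $$ (k, 0)) + R k \<or> enc h (B $$ (k, j)) = 2 ^ (h + 2)"
   "int (\<Sum>k<q. R k) = total_range B"
   using total_range_rows[OF I.B I.pqr(2,3) AB(7) I.entries(2)] by blast
  have mono: "B $$ (k, j) <= B $$ (k, j')" if "k < q" "j <= j'" "j' < n" for k j j'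
   using AB(7) I.B that unfolding monotone_mat_def by (metis carrier_matD le_less_trans)
  define PC where "PC = (\<Sum>k<q. R k div 2 ^ \<delta> + 2)"
  define Tc where "Tc = 3 * \<delta> + 3 * \<delta>2 + 3 * (c * b) + 69 + (6 * floorlog 2 n + 61) * (n * PC) + 12 * (q * n) + 14 * (n * n) + 3 * (n * q) +
   12 * n + n * (4 * n + 13) + 2 ^ \<delta>2 * (5 * nat \<lceil>T\<rceil> + 14 * (n * q) + 11 * (q * n) + 13 * (n * n) + 14) + 6 * (n * q * n div 2 ^ \<delta>2)"
  have cm: "c <= m" by (simp add: m_def)
  have L2: "entry_bits d' n + 2 = L + 1" by (simp add: L_def)
  note sz = I0(2-5)[folded N_def, unfolded L2]
  have eb: "h + 3 <= entry_bits d' n" "\<delta> <= entry_bits d' n" using gap by auto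
  have run: "I.L2.run (bigm.mcore pp p2 qq c P) ts (%ts'. I.ended ts' & tm ts' <= tm ts + Tc)" if "I.ready ts" for ts
   unfolding Tc_def PC_def
   by (rule I.runs_mcore[OF mono cN \<delta>_def dN(1) \<delta>2_def dN(2) d2N(1) dN(3) d2N(2) bc cm sz(3,4,1,2) XD eb PM R(1) that])
  define z where "z = ?X powr x"
  define V where "V = ?X powr F"
  have zV: "1 <= z" "1 <= V" using X1 x F by (auto simp: z_def V_def intro!: ge_one_powr_ge_zero)
  have qW: "real q <= ?X powr \<beta>" unfolding q_def by (rule floor_powr_bounds(2)[OF n \<beta>])
  have nn: "real (n * n) = ?X powr 2" using n by (simp add: powr_realpow[of _ 2, simplified] power2_eq_square)
  have nq: "real (n * q) <= ?X powr (1 + \<beta>)" unfolding powr_add using qW X1 by (simp add: mult_left_mono)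
  have nqn: "real (n * q * n) <= ?X powr (2 + \<beta>)"
  proof -
   have "real (n * q * n) = real (n * n) * real q" by simp
   also have "\<dots> <= ?X powr 2 * ?X powr \<beta>" unfolding nn using qW by (intro mult_left_mono) auto
   finally show ?thesis by (simp add: powr_add)
  qed
  have up: "?X powr a <= V" if "a <= F" for a unfolding V_def using that X1 by (rule powr_mono)
  have upz: "?X powr a <= V * z" if "a <= F + x" for a
   unfolding V_def z_def powr_add[symmetric] using that X1 by (rule powr_mono)
  have nnV: "real (n * n) <= V" unfolding nn by (rule up[OF F(4)])
  have nqV: "real (n * q) <= V" using nq up[OF F(3)] by linarith
  have nV: "real n <= V"
  proof -
   have "n * 1 <= n * n" using n by (intro mult_le_mono2)
   then have "real n <= real (n * n)" by (simp del: of_nat_mult)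
   then show ?thesis using nnV by linarith
  qed
  have PQ: "real (n * q + q * n + n * n) <= 3 * V" using nqV nnV by (simp add: mult.commute)
  note Kn = Kp(2)[OF n, folded z_def b_def]
  have r1: "real (3 * \<delta> + 3 * \<delta>2 + 3 * (c * b) + 69) <= a1 * (Kp * z)"
  proof -
   have "3 * \<delta> + 3 * \<delta>2 + 3 * (c * b) + 69 <= (3 * pp + 3 * p2 + 3 * c + 69) * b"
    using dle[of pp] dle[of p2] b1 unfolding \<delta>_def[symmetric] \<delta>2_def[symmetric] by (simp add: algebra_simps)
   then have "real (3 * \<delta> + 3 * \<delta>2 + 3 * (c * b) + 69) <= real ((3 * pp + 3 * p2 + 3 * c + 69) * b)" by (rule of_nat_mono)
   also have "\<dots> = a1 * real b" by (simp add: a1_def)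
   also have "\<dots> <= a1 * (Kp * z)" using Kn a1 by (intro mult_left_mono) auto
   finally show ?thesis .
  qed
  \<comment> \<open>The pieces number at most the total range divided by
    \<open>2 ^ \<delta>\<close>, plus two per row; the latter are absorbed since
    \<open>1 + \<beta> <= F\<close>.\<close>
  have r2: "real ((6 * floorlog 2 n + 61) * (n * PC)) <= (Kp * z) * ((\<bar>C\<bar> * c1 + 2) * (V * z))"
  proof -
   have D: "0 < (2::real) ^ \<delta>" by simp
   have "?X powr s <= c1 * 2 ^ \<delta>"
   proof -
    have "(2 * 2 powr s) * 2 ^ \<delta> <= c1 * 2 ^ \<delta>" unfolding c1_def using s(2) by (intro mult_right_mono mult_left_mono powr_mono) auto
    then show ?thesis using pb(2) by linarith
   qed
   then have inv: "1 / 2 ^ \<delta> <= c1 * ?X powr (- s)" using X1 by (simp add: powr_minus field_simps)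
   have "real PC = (\<Sum>k<q. real (R k div 2 ^ \<delta>)) + 2 * real q" by (simp add: PC_def sum.distrib)
   also have "\<dots> <= (\<Sum>k<q. real (R k) / 2 ^ \<delta>) + 2 * real q"
    using real_div_le[of "2 ^ \<delta>"] by (intro add_mono sum_mono) auto
   also have "\<dots> = real (\<Sum>k<q. R k) * (1 / 2 ^ \<delta>) + 2 * real q" by (simp add: sum_divide_distrib)
   also have "\<dots> <= (\<bar>C\<bar> * ?X powr (\<beta> + \<eta>)) * (c1 * ?X powr (- s)) + 2 * real q"
   proof (intro add_mono mult_mono)
    have "real (\<Sum>k<q. R k) = real_of_int (total_range B)" using R(2) by (metis of_int_of_nat_eq)
    also have "\<dots> <= C * ?X powr (\<beta> + \<eta>)" by (rule AB(8))
    also have "\<dots> <= \<bar>C\<bar> * ?X powr (\<beta> + \<eta>)" by (intro mult_right_mono) auto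
    finally show "real (\<Sum>k<q. R k) <= \<bar>C\<bar> * ?X powr (\<beta> + \<eta>)" .
   qed (use inv in auto)
   finally have PCb: "real PC <= (\<bar>C\<bar> * ?X powr (\<beta> + \<eta>)) * (c1 * ?X powr (- s)) + 2 * real q" .
   have "real (n * PC) <= ?X * ((\<bar>C\<bar> * ?X powr (\<beta> + \<eta>)) * (c1 * ?X powr (- s)) + 2 * real q)"
    unfolding of_nat_mult using PCb by (intro mult_left_mono) auto
   also have "\<dots> = \<bar>C\<bar> * c1 * (?X powr 1 * ?X powr (\<beta> + \<eta>) * ?X powr (- s)) + 2 * real (n * q)" using X1 by (simp add: algebra_simps)
   also have "?X powr 1 * ?X powr (\<beta> + \<eta>) * ?X powr (- s) = ?X powr (1 + (\<beta> + \<eta>) + - s)" by (simp only: powr_add)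
   also have "\<bar>C\<bar> * c1 * (?X powr (1 + (\<beta> + \<eta>) + - s)) + 2 * real (n * q) <= \<bar>C\<bar> * c1 * (V * z) + 2 * (V * z)"
   proof (intro add_mono mult_left_mono)
    show "?X powr (1 + (\<beta> + \<eta>) + - s) <= V * z" by (rule upz) (use s(1) F(1) in linarith)
    have "V * 1 <= V * z" using zV by (intro mult_left_mono) auto
    then show "real (n * q) <= V * z" using nqV by linarith
   qed (use c12 in auto)
   finally have "real (n * PC) <= (\<bar>C\<bar> * c1 + 2) * (V * z)" by (simp add: algebra_simps)
   then show ?thesis unfolding of_nat_mult[of "6 * floorlog 2 n + 61"] using Kn zV Kp(1) by (intro mult_mono) (auto simp: b_def)
  qed
  have r3: "real (12 * (q * n) + 14 * (n * n) + 3 * (n * q) + 12 * n + n * (4 * n + 13)) <= 60 * V"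
  proof -
   have "real (12 * (q * n) + 14 * (n * n) + 3 * (n * q) + 12 * n + n * (4 * n + 13)) = 15 * real (n * q) + 18 * real (n * n) + 25 * real n"
    by (simp add: algebra_simps)
   then show ?thesis using nqV nnV nV zV by linarith
  qed
  \<comment> \<open>\<open>sg + e = (2 + \<beta> + e) / 2 <= F\<close>; the lower bounds on
    \<open>e\<close> let \<open>?E\<close> dominate the matrix sizes.\<close>
  have r4: "real (2 ^ \<delta>2 * (5 * nat \<lceil>T\<rceil> + 14 * (n * q) + 11 * (q * n) + 13 * (n * n) + 14)) <= (5 * \<bar>K\<bar> + 60) * (V * z)"
  proof -
   let ?E = "?X powr (e + x)"
   have E: "real (n * q) <= ?E" "real (n * n) <= ?E" "1 <= ?E"
   proof -
    have "?X powr (1 + \<beta>) <= ?E" by (rule powr_mono) (use e x X1 in linarith)+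
    moreover have "?X powr 2 <= ?E" by (rule powr_mono) (use e x X1 in linarith)+
    ultimately show "real (n * q) <= ?E" "real (n * n) <= ?E" using nq nn by linarith+
    show "1 <= ?E" using X1 e x by (auto intro!: ge_one_powr_ge_zero)
   qed
   have "T <= \<bar>K\<bar> * ?E" unfolding T_def by (intro mult_right_mono) auto
   moreover have "0 <= \<bar>K\<bar> * ?E" by simp
   ultimately have "real (nat \<lceil>T\<rceil>) <= \<bar>K\<bar> * ?E + 1" by linarith
   moreover have "real (5 * nat \<lceil>T\<rceil> + 14 * (n * q) + 11 * (q * n) + 13 * (n * n) + 14) = 5 * real (nat \<lceil>T\<rceil>) + 25 * real (n * q) + 13 * real (n * n) + 14"
    by simp
   ultimately have inner: "real (5 * nat \<lceil>T\<rceil> + 14 * (n * q) + 11 * (q * n) + 13 * (n * n) + 14) <= 5 * (\<bar>K\<bar> * ?E) + 60 * ?E" using E by linarith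
   have p: "real (2 ^ \<delta>2) <= ?X powr sg"
   proof -
    have "?X powr s2 <= ?X powr sg" using s(4) X1 by (intro powr_mono) auto
    then show ?thesis using pb2(1) by simp
   qed
   have "real (2 ^ \<delta>2 * (5 * nat \<lceil>T\<rceil> + 14 * (n * q) + 11 * (q * n) + 13 * (n * n) + 14)) <= ?X powr sg * (5 * (\<bar>K\<bar> * ?E) + 60 * ?E)"
    unfolding of_nat_mult[of "2 ^ \<delta>2"] using p inner by (intro mult_mono) auto
   also have "\<dots> = (5 * \<bar>K\<bar> + 60) * ?X powr (sg + (e + x))" unfolding powr_add[of _ sg] by (simp add: algebra_simps)
   also have "\<dots> <= (5 * \<bar>K\<bar> + 60) * (V * z)"
    using F(2) by (intro mult_left_mono upz) (auto simp: sg_def field_simps)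
   finally show ?thesis .
  qed
  \<comment> \<open>\<open>2 + \<beta> - sg\<close> is again \<open>(2 + \<beta> + e) / 2\<close>;
    here \<open>s2\<close> must not be too small, which costs the factor \<open>z\<close>.\<close>
  have r5: "real (6 * (n * q * n div 2 ^ \<delta>2)) <= 6 * c2 * (V * z)"
  proof -
   have "?X powr s2 <= c2 * 2 ^ \<delta>2"
   proof -
    have "(2 * 2 powr s2) * 2 ^ \<delta>2 <= c2 * 2 ^ \<delta>2" unfolding c2_def using s(4) by (intro mult_right_mono mult_left_mono powr_mono) auto
    then show ?thesis using pb2(2) by linarith
   qed
   then have inv: "1 / 2 ^ \<delta>2 <= c2 * ?X powr (- s2)" using X1 by (simp add: powr_minus field_simps)
   have "real (n * q * n div 2 ^ \<delta>2) <= real (n * q * n) * (1 / 2 ^ \<delta>2)" using real_div_le[of "2 ^ \<delta>2" "n * q * n"] by simp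
   also have "\<dots> <= ?X powr (2 + \<beta>) * (c2 * ?X powr (- s2))" using nqn inv by (intro mult_mono) auto
   also have "\<dots> = c2 * ?X powr (2 + \<beta> + - s2)" unfolding powr_add[of _ "2 + \<beta>"] by simp
   also have "\<dots> <= c2 * (V * z)" using F(2) s(3) c12 by (intro mult_left_mono upz) (auto simp: sg_def field_simps)
   finally show ?thesis by simp
  qed
  define Q where "Q = Kp * (V * z * z)"
  have Vz: "V <= V * z" "V * z <= V * z * z" using zV by auto
  have Q: "Kp * z <= Q" "V <= Q" "V * z <= Q" "Kp * z * (V * z) <= Q"
  proof -
   have z1: "z <= V * z * z" using mult_mono[of 1 V z "z * z"] zV by (simp add: mult.assoc)
   then show "Kp * z <= Q" unfolding Q_def using Kp(1) by (intro mult_left_mono) auto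
   have "1 * (V * z * z) <= Q" unfolding Q_def using Kp(1) zV by (intro mult_right_mono) auto
   then show "V <= Q" "V * z <= Q" using Vz by linarith+
   show "Kp * z * (V * z) <= Q" by (simp add: Q_def ac_simps)
  qed
  have Tcb: "real Tc <= KT * Q"
  proof -
   have "real Tc = real (3 * \<delta> + 3 * \<delta>2 + 3 * (c * b) + 69) + real ((6 * floorlog 2 n + 61) * (n * PC)) +
    real (12 * (q * n) + 14 * (n * n) + 3 * (n * q) + 12 * n + n * (4 * n + 13)) +
    real (2 ^ \<delta>2 * (5 * nat \<lceil>T\<rceil> + 14 * (n * q) + 11 * (q * n) + 13 * (n * n) + 14)) + real (6 * (n * q * n div 2 ^ \<delta>2))"
    unfolding Tc_def of_nat_add by simp
   also have "\<dots> <= a1 * (Kp * z) + (Kp * z) * ((\<bar>C\<bar> * c1 + 2) * (V * z)) + 60 * V + (5 * \<bar>K\<bar> + 60) * (V * z) + 6 * c2 * (V * z)"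
    by (intro add_mono r1 r2 r3 r4 r5)
   also have "\<dots> = a1 * (Kp * z) + (\<bar>C\<bar> * c1 + 2) * (Kp * z * (V * z)) + 60 * V + (5 * \<bar>K\<bar> + 60) * (V * z) + 6 * c2 * (V * z)" by (simp add: ac_simps)
   also have "\<dots> <= a1 * Q + (\<bar>C\<bar> * c1 + 2) * Q + 60 * Q + (5 * \<bar>K\<bar> + 60) * Q + 6 * c2 * Q"
    using Q a1 c12 by (intro add_mono mult_left_mono) auto
   also have "\<dots> = KT * Q" by (simp add: KT_def algebra_simps)
   finally show ?thesis .
  qed
  have "computes_within (10 * m * b) (inst.wrp m d d' (bigm.mcore pp p2 qq c P)) xs ys ((200 * real (d + d' + 10) + 200) * Kp ^ 2 * z ^ 2 * (V + real Tc))"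
   unfolding AB(1,2)
  proof (rule wrp_time[OF I[unfolded L_def h_def]])
   fix ts assume "inst.ready b (entry_bits d' n + 1) n n q n (entry_bits d n + 1) (b * (entry_bits d n + 1)) A B ts"
   then show "runs (10 * m * b) (bigm.U2 (entry_bits d' n + 1)) (bigm.R2 (10 * m * b) N b (entry_bits d' n + 1)) (bigm.mcore pp p2 qq c P) ts
    (%ts'. inst.ended n q n (entry_bits d n + 1) (b * (entry_bits d n + 1)) A B ts' & tm ts' <= tm ts + Tc)"
    using run[of ts] by (simp only: L_def h_def)
  qed (use Kp(1) Kn zV PQ in \<open>simp_all only:\<close>)
  then show "computes_within (10 * m * floorlog 2 n) (inst.wrp m d d' (bigm.mcore pp p2 qq c P)) xs ys (KK * real n powr (F + \<epsilon>))"
   unfolding b_def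
  proof (rule computes_within_mono)
   have VQ: "V + real Tc <= (1 + KT * Kp) * (V * z * z)"
    using Tcb Vz by (simp add: Q_def algebra_simps)
   have "(200 * real (d + d' + 10) + 200) * Kp ^ 2 * z ^ 2 * (V + real Tc) <= (200 * real (d + d' + 10) + 200) * Kp ^ 2 * z ^ 2 * ((1 + KT * Kp) * (V * z * z))"
    using VQ by (intro mult_left_mono) auto
   also have "\<dots> = KK * (V * (z * z * z * z))" by (simp add: KK_def power2_eq_square ac_simps)
   also have "V * (z * z * z * z) = real n powr (F + \<epsilon>)"
    unfolding V_def z_def powr_add[symmetric] by (simp add: x_def)
   finally show "(200 * real (d + d' + 10) + 200) * Kp ^ 2 * z ^ 2 * (V + real Tc) <= KK * real n powr (F + \<epsilon>)" .
  qed
 qed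
qed

text \<open>Supplies the lower bound that makes \<open>m_exp\<close> a genuine infimum: every run
  takes at least one step.\<close>

lemma monotone_product_exponent_nonneg:
 assumes \<beta>: "0 <= \<beta>" and mp: "monotone_product_in_time 1 \<beta> 1 \<eta> e"
 shows "0 <= e"
proof (rule field_le_epsilon)
 fix x :: real assume x: "0 < x"
 obtain P c K where P: "!!n xs ys. n \<ge> 1 ==> (xs, ys) \<in> min_plus_problem 1 \<beta> 1
   (%n A B. monotone_mat B & real_of_int (total_range B) <= 0 * real n powr (\<beta> + \<eta>)) 0 n ==>
   computes_within (c * floorlog 2 n) P xs ys (K * real n powr (e + x))"
  using mp x unfolding monotone_product_in_time_def soft_O_time_def by fast
 show "0 <= e + x"
 proof (rule powr_le_imp_exponent_le[where K = K])
  fix n :: nat assume n: "n \<ge> 2"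
  let ?q = "nat \<lfloor>real n powr \<beta>\<rfloor>"
  let ?A = "mat n ?q (%_. Pinf) :: matrix" and ?B = "mat ?q n (%_. Pinf) :: matrix"
  \<comment> \<open>Rows starting with infinity count 0, so the all-infinite matrix is admissible
    even for the constant 0.\<close>
  have tr: "total_range ?B = 0" using n by (simp add: total_range_def)
  have "(encode_instance 0 n ?A ?B, encode_mat 0 n (min_plus ?A ?B)) \<in> min_plus_problem 1 \<beta> 1
   (%n A B. monotone_mat B & real_of_int (total_range B) <= 0 * real n powr (\<beta> + \<eta>)) 0 n"
   unfolding min_plus_problem_def
   by (rule CollectI, rule exI[of _ ?A], rule exI[of _ ?B])
    (use tr in \<open>auto simp: valid_entries_def monotone_mat_def dest!: elements_matD\<close>)
  then have cw: "computes_within (c * floorlog 2 n) P (encode_instance 0 n ?A ?B) (encode_mat 0 n (min_plus ?A ?B)) (K * real n powr (e + x))"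
   using n by (intro P) auto
  define xs where "xs = encode_instance 0 n ?A ?B"
  let ?s = "(|regs = %_. 0, mem = %i. if i < length xs then xs ! i else 0|)"
  obtain t s' where t: "exec (c * floorlog 2 n) P ?s t s'" "real t <= K * real n powr (e + x)"
   using cw[folded xs_def] unfolding computes_within_def by (auto dest!: spec[of _ ?s])
  have "1 <= t" using t(1) by (induction rule: exec.induct) auto
  then show "real n powr 0 <= K * real n powr (e + x)" using t(2) n by simp
 qed
qed

theorem theorem3p1:
  fixes \<beta> \<eta> :: real
  assumes "\<beta> \<ge> 0" and "\<eta> \<ge> 0"
  shows "(\<forall>\<theta>\<in>{0..\<eta>}. monotone_product_in_time 1 \<beta> 1 \<eta>
            (max (1 + \<beta> + \<eta> - \<theta>) (1 / 2 * (2 + \<beta> + g_exp 1 \<beta> 1 \<theta>)))) \<and>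
         m_exp 1 \<beta> 1 \<eta> \<le>
            (INF \<theta>\<in>{0..\<eta>}. max (1 + \<beta> + \<eta> - \<theta>) (1 / 2 * (2 + \<beta> + g_exp 1 \<beta> 1 \<theta>)))"
proof -
 have main: "monotone_product_in_time 1 \<beta> 1 \<eta> (max (1 + \<beta> + \<eta> - \<theta>) (1 / 2 * (2 + \<beta> + g_exp 1 \<beta> 1 \<theta>)))"
  if \<theta>: "0 <= \<theta>" "\<theta> <= \<eta>" for \<theta>
  unfolding monotone_product_in_time_def
 proof (rule allI, rule allI, rule soft_O_time_closed)
  fix d :: nat and C x :: real assume x: "0 < x"
  define g where "g = g_exp 1 \<beta> 1 \<theta>"
  have bf: "bounded_product_in_time 1 \<beta> 1 \<theta> (2 + \<beta>)" by (rule brute_force_exponent[OF assms(1)])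
  \<comment> \<open>The infimum itself is not known here to be feasible, so a feasible
    \<open>e\<close> slightly above it is used; brute force shows that the set is non-empty.\<close>
  have "\<exists>e\<in>{e. bounded_product_in_time 1 \<beta> 1 \<theta> e}. e < g + x"
   unfolding g_def g_exp_def by (rule cInf_lessD) (use bf x in \<open>auto simp: g_exp_def\<close>)
  then obtain e where e: "bounded_product_in_time 1 \<beta> 1 \<theta> e" "e < g + x" by auto
  \<comment> \<open>Capped by the brute force exponent, so that the exponent of
    \<open>\<rho>\<close> is non-negative.\<close>
  define e' where "e' = min e (2 + \<beta>)"
  have e': "bounded_product_in_time 1 \<beta> 1 \<theta> e'" using e(1) bf by (simp add: e'_def min_def)
  have "monotone_product_in_time 1 \<beta> 1 \<eta> (max (1 + \<beta> + \<eta> - \<theta>) (1 / 2 * (2 + \<beta> + e')))"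
   by (rule monotone_product_upper[OF assms(1) \<theta> e' bounded_product_exponent_lower[OF e' assms(1)]]) (simp add: e'_def)
  then have "soft_O_time (min_plus_problem 1 \<beta> 1 (%n A B. monotone_mat B & real_of_int (total_range B) <= C * real n powr (\<beta> + \<eta>)) d)
    (max (1 + \<beta> + \<eta> - \<theta>) (1 / 2 * (2 + \<beta> + e')))" by (simp add: monotone_product_in_time_def)
  then show "soft_O_time (min_plus_problem 1 \<beta> 1 (%n A B. monotone_mat B & real_of_int (total_range B) <= C * real n powr (\<beta> + \<eta>)) d)
    (max (1 + \<beta> + \<eta> - \<theta>) (1 / 2 * (2 + \<beta> + g_exp 1 \<beta> 1 \<theta>)) + x)"
   unfolding g_def[symmetric]
  proof (rule soft_O_time_mono)
   define G1 E1 where GE: "G1 = 1 / 2 * (2 + \<beta> + g)" "E1 = 1 / 2 * (2 + \<beta> + e')"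
   have "e' <= g + x" using e(2) by (simp add: e'_def)
   then have "E1 <= G1 + x" using x by (simp add: GE field_simps)
   moreover have "G1 <= max (1 + \<beta> + \<eta> - \<theta>) G1" "1 + \<beta> + \<eta> - \<theta> <= max (1 + \<beta> + \<eta> - \<theta>) G1" by simp_all
   ultimately have "E1 <= max (1 + \<beta> + \<eta> - \<theta>) G1 + x" "1 + \<beta> + \<eta> - \<theta> <= max (1 + \<beta> + \<eta> - \<theta>) G1 + x" using x by linarith+
   then show "max (1 + \<beta> + \<eta> - \<theta>) (1 / 2 * (2 + \<beta> + e')) <= max (1 + \<beta> + \<eta> - \<theta>) (1 / 2 * (2 + \<beta> + g)) + x"
    unfolding GE[symmetric] by (intro max.boundedI)
  qed
 qed
 have bdd: "bdd_below {e. monotone_product_in_time 1 \<beta> 1 \<eta> e}"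
  by (rule bdd_belowI[of _ 0]) (use monotone_product_exponent_nonneg[OF assms(1)] in auto)
 have "m_exp 1 \<beta> 1 \<eta> <= (INF \<theta>\<in>{0..\<eta>}. max (1 + \<beta> + \<eta> - \<theta>) (1 / 2 * (2 + \<beta> + g_exp 1 \<beta> 1 \<theta>)))"
 proof (rule cINF_greatest)
  show "{0..\<eta>} ~= {}" using assms(2) by simp
  fix \<theta> assume "\<theta> \<in> {0..\<eta>}"
  then show "m_exp 1 \<beta> 1 \<eta> <= max (1 + \<beta> + \<eta> - \<theta>) (1 / 2 * (2 + \<beta> + g_exp 1 \<beta> 1 \<theta>))"
   unfolding m_exp_def using main by (intro cInf_lower[OF _ bdd]) auto
 qed
 then show ?thesis using main by auto
qed

end
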